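(* Consider the decision problem \textsc{Token Sliding in Split Graphs}: given a split graph $G$ and an integer $k$, answer YES if and only if the $k$-TS reconfiguration graph $TS_k(G)$ is connected. This problem is co-NP-hard, and it is co-$W[2]$-hard when parameterized by $k$ (the size of the independent sets).
   Context: A graph $G=(V,E)$ is a split graph if $V$ can be partitioned into $V_1,V_2$ such that $V_1$ induces a clique and $V_2$ induces an independent set (edges between $V_1$ and $V_2$ are arbitrary). A $k$-independent set is an independent set of size exactly $k$. The $k$-TS (token sliding) reconfiguration graph $TS_k(G)$ has as vertices the $k$-independent sets of $G$, and two $k$-independent sets $I,J$ are adjacent if $I\setminus J=\{v\}$, $J\setminus I=\{u\}$ and $uv$ is an edge of $G$ (a token is slid along an edge). *)

theory Defs
  imports
    "HOL-Computational_Algebra.Polynomial"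
    "Graph_Theory.Digraph_Component"
begin

section \<open>Multitape Turing machines\<close>

text \<open>
  Cells contain 0, 1 or blank (\<^term>\<open>None\<close>); tapes are infinite in both directions.  The working
  states are \<open>0, \<dots>, num_states - 1\<close>, the start state is \<open>0\<close>, and every \<open>q \<ge> num_states\<close> is a halting
  state, so only finitely many values of the transition function matter.
\<close>

type_synonym symbol = "bool option"

datatype direction = MoveLeft | Stay | MoveRight

record tm =
  num_tapes :: nat
  num_states :: nat
  delta :: "nat \<Rightarrow> symbol list \<Rightarrow> nat \<times> (symbol \<times> direction) list"

definition wf_tm :: "tm \<Rightarrow> bool" where
  "wf_tm M \<longleftrightarrow> 0 < num_states M \<and>
     (\<forall>q < num_states M. \<forall>ss. length ss = num_tapes M \<longrightarrow>
        fst (delta M q ss) \<le> num_states M \<and> length (snd (delta M q ss)) = num_tapes M)"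

type_synonym tape = "(int \<Rightarrow> symbol) \<times> int"  \<comment> \<open>contents and head position\<close>

type_synonym config = "nat \<times> tape list"

fun move :: "direction \<Rightarrow> int \<Rightarrow> int" where
  "move MoveLeft h = h - 1"
| "move Stay h = h"
| "move MoveRight h = h + 1"

fun act :: "symbol \<times> direction \<Rightarrow> tape \<Rightarrow> tape" where
  "act (s, d) (c, h) = (c(h := s), move d h)"

fun step :: "tm \<Rightarrow> config \<Rightarrow> config" where
  "step M (q, ts) =
     (if q < num_states M
      then (let (q', as) = delta M q (map (\<lambda>(c, h). c h) ts) in (q', map2 act as ts))
      else (q, ts))"

definition string_tape :: "bool list \<Rightarrow> tape" where
  "string_tape x = ((\<lambda>i. if 0 \<le> i \<and> nat i < length x then Some (x ! nat i) else None), 0)"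

definition init_config :: "tm \<Rightarrow> bool list list \<Rightarrow> config" where
  "init_config M xs =
     (0, map (\<lambda>i. string_tape (if i < length xs then xs ! i else [])) [0..<num_tapes M])"

definition holds_string :: "tape \<Rightarrow> bool list \<Rightarrow> bool" where
  "holds_string t y \<longleftrightarrow>
     (\<forall>i < length y. fst t (int i) = Some (y ! i)) \<and> fst t (int (length y)) = None"

text \<open>
  Several strings are passed on separate tapes: started with \<open>xs ! i\<close> on tape \<open>i\<close>, the machine halts
  after at most \<open>T\<close> steps with \<open>ys ! i\<close> on tape \<open>i\<close>.
\<close>

definition computes_within :: "tm \<Rightarrow> bool list list \<Rightarrow> bool list list \<Rightarrow> nat \<Rightarrow> bool" where
  "computes_within M xs ys T \<longleftrightarrow>
     length xs \<le> num_tapes M \<and> length ys \<le> num_tapes M \<and>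
     (\<exists>n \<le> T. \<exists>q ts. (step M ^^ n) (init_config M xs) = (q, ts) \<and> num_states M \<le> q \<and>
        (\<forall>i < length ys. holds_string (ts ! i) (ys ! i)))"


section \<open>Polynomial-time reductions and co-NP-hardness\<close>

type_synonym language = "bool list set"

definition polytime :: "(bool list \<Rightarrow> bool list) \<Rightarrow> bool" where
  "polytime f \<longleftrightarrow> (\<exists>M (p :: nat poly). wf_tm M \<and>
     (\<forall>x. computes_within M [x] [f x] (poly p (length x))))"

definition polytime_relation :: "(bool list \<Rightarrow> bool list \<Rightarrow> bool) \<Rightarrow> bool" where
  "polytime_relation R \<longleftrightarrow> (\<exists>M (p :: nat poly). wf_tm M \<and>
     (\<forall>x u. computes_within M [x, u] [[R x u]] (poly p (length x + length u))))"

definition NP :: "language set" where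
  "NP = {L. \<exists>R (p :: nat poly). polytime_relation R \<and>
     (\<forall>x. x \<in> L \<longleftrightarrow> (\<exists>u. length u \<le> poly p (length x) \<and> R x u))}"

definition coNP :: "language set" where
  "coNP = {L. - L \<in> NP}"

text \<open>
  A decision problem is given by its yes-instances and its no-instances.  The two sets need not
  cover all strings (a problem may only be posed on strings encoding, say, split graphs), and a
  reduction has to produce instances of the target problem.
\<close>

type_synonym 'i problem = "'i set \<times> 'i set"

definition reduction :: "('i \<Rightarrow> 'j) \<Rightarrow> 'i set \<Rightarrow> 'j problem \<Rightarrow> bool" where
  "reduction f A P \<longleftrightarrow> (\<forall>x. (x \<in> A \<longrightarrow> f x \<in> fst P) \<and> (x \<notin> A \<longrightarrow> f x \<in> snd P))"

definition poly_reducible :: "language \<Rightarrow> bool list problem \<Rightarrow> bool" where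
  "poly_reducible L P \<longleftrightarrow> (\<exists>f. polytime f \<and> reduction f L P)"

definition coNP_hard :: "bool list problem \<Rightarrow> bool" where
  "coNP_hard P \<longleftrightarrow> (\<forall>L \<in> coNP. poly_reducible L P)"


section \<open>Parameterized reductions\<close>

type_synonym param_instance = "bool list \<times> nat"

definition unary :: "nat \<Rightarrow> bool list" where
  "unary n = replicate n True"

definition computable :: "(nat \<Rightarrow> nat) \<Rightarrow> bool" where
  "computable h \<longleftrightarrow> (\<exists>M. wf_tm M \<and> (\<forall>n. \<exists>T. computes_within M [unary n] [unary (h n)] T))"

definition fpt_time :: "(param_instance \<Rightarrow> param_instance) \<Rightarrow> bool" where
  "fpt_time f \<longleftrightarrow> (\<exists>M h (p :: nat poly). wf_tm M \<and> computable h \<and>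
     (\<forall>x k. computes_within M [x, unary k] [fst (f (x, k)), unary (snd (f (x, k)))]
              (h k * poly p (length x))))"

definition fpt_reducible :: "param_instance set \<Rightarrow> param_instance problem \<Rightarrow> bool" where
  "fpt_reducible A P \<longleftrightarrow> (\<exists>f g. fpt_time f \<and> computable g \<and>
     (\<forall>x k. snd (f (x, k)) \<le> g k) \<and> reduction f A P)"


section \<open>Boolean circuits and the W-hierarchy\<close>

text \<open>
  A circuit is a directed acyclic graph of gates listed in topological order; the predecessors of a
  gate are given by their positions, and the last gate is the output.
\<close>

datatype gate = Input | Not nat | And "nat list" | Or "nat list"

type_synonym circuit = "gate list"

fun preds :: "gate \<Rightarrow> nat list" where
  "preds Input = []"
| "preds (Not j) = [j]"
| "preds (And js) = js"
| "preds (Or js) = js"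

definition circuit :: "circuit \<Rightarrow> bool" where
  "circuit C \<longleftrightarrow> C \<noteq> [] \<and>
     (\<forall>i < length C. distinct (preds (C ! i)) \<and> (\<forall>j \<in> set (preds (C ! i)). j < i) \<and>
        (C ! i \<noteq> Input \<longrightarrow> preds (C ! i) \<noteq> []))"

text \<open>A path from an input gate to the output gate.\<close>

definition io_path :: "circuit \<Rightarrow> nat list \<Rightarrow> bool" where
  "io_path C p \<longleftrightarrow> p \<noteq> [] \<and> (\<forall>i \<in> set p. i < length C) \<and>
     C ! hd p = Input \<and> last p = length C - 1 \<and>
     (\<forall>i. Suc i < length p \<longrightarrow> p ! i \<in> set (preds (C ! (p ! Suc i))))"

definition depth_le :: "circuit \<Rightarrow> nat \<Rightarrow> bool" where
  "depth_le C d \<longleftrightarrow> (\<forall>p. io_path C p \<longrightarrow> length p - 1 \<le> d)"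

text \<open>A gate is large if its in-degree exceeds 2.\<close>

definition weft_le :: "circuit \<Rightarrow> nat \<Rightarrow> bool" where
  "weft_le C t \<longleftrightarrow>
     (\<forall>p. io_path C p \<longrightarrow> length (filter (\<lambda>i. 2 < length (preds (C ! i))) p) \<le> t)"

text \<open>
  The values of all gates under an assignment.  On a circuit, \<open>v\<close> is determined by its restriction to
  the input gates, which is arbitrary.
\<close>

definition valuation :: "circuit \<Rightarrow> (nat \<Rightarrow> bool) \<Rightarrow> bool" where
  "valuation C v \<longleftrightarrow> (\<forall>i < length C. case C ! i of
       Input \<Rightarrow> True
     | Not j \<Rightarrow> v i = (\<not> v j)
     | And js \<Rightarrow> v i = (\<forall>j \<in> set js. v j)
     | Or js \<Rightarrow> v i = (\<exists>j \<in> set js. v j))"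

definition weighted_sat :: "circuit \<Rightarrow> nat \<Rightarrow> bool" where
  "weighted_sat C k \<longleftrightarrow> (\<exists>v. valuation C v \<and> v (length C - 1) \<and>
     card {i. i < length C \<and> C ! i = Input \<and> v i} = k)"

definition enc_nat :: "nat \<Rightarrow> bool list" where
  "enc_nat n = replicate n True @ [False]"

definition enc_list :: "('a \<Rightarrow> bool list) \<Rightarrow> 'a list \<Rightarrow> bool list" where
  "enc_list e xs = concat (map (\<lambda>x. True # e x) xs) @ [False]"

fun enc_gate :: "gate \<Rightarrow> bool list" where
  "enc_gate Input = [False, False]"
| "enc_gate (Not j) = [False, True] @ enc_nat j"
| "enc_gate (And js) = [True, False] @ enc_list enc_nat js"
| "enc_gate (Or js) = [True, True] @ enc_list enc_nat js"

definition enc_circuit :: "circuit \<Rightarrow> bool list" where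
  "enc_circuit C = enc_list enc_gate C"

text \<open>Weighted circuit satisfiability for circuits of weft at most \<open>t\<close> and depth at most \<open>d\<close>.\<close>

definition WCS :: "nat \<Rightarrow> nat \<Rightarrow> param_instance problem" where
  "WCS t d =
    ({(enc_circuit C, k) | C k. circuit C \<and> weft_le C t \<and> depth_le C d \<and> weighted_sat C k},
     {(enc_circuit C, k) | C k. circuit C \<and> weft_le C t \<and> depth_le C d \<and> \<not> weighted_sat C k})"

definition W :: "nat \<Rightarrow> param_instance set set" where
  "W t = {A. \<exists>d. fpt_reducible A (WCS t d)}"

definition coW :: "nat \<Rightarrow> param_instance set set" where
  "coW t = {A. - A \<in> W t}"

definition coW_hard :: "nat \<Rightarrow> param_instance problem \<Rightarrow> bool" where
  "coW_hard t P \<longleftrightarrow> (\<forall>A \<in> coW t. fpt_reducible A P)"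


section \<open>Token sliding in split graphs\<close>

text \<open>Finite simple graphs are rendered as finite loop-free symmetric digraphs (\<^term>\<open>pair_graph\<close>).\<close>

definition indep_set :: "'a pair_pre_digraph \<Rightarrow> 'a set \<Rightarrow> bool" where
  "indep_set G I \<longleftrightarrow> I \<subseteq> pverts G \<and> (\<forall>u \<in> I. \<forall>v \<in> I. (u, v) \<notin> parcs G)"

definition clique :: "'a pair_pre_digraph \<Rightarrow> 'a set \<Rightarrow> bool" where
  "clique G K \<longleftrightarrow> K \<subseteq> pverts G \<and> (\<forall>u \<in> K. \<forall>v \<in> K. u \<noteq> v \<longrightarrow> (u, v) \<in> parcs G)"

definition split_graph :: "'a pair_pre_digraph \<Rightarrow> bool" where
  "split_graph G \<longleftrightarrow> pair_graph G \<and>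
     (\<exists>V1 V2. V1 \<union> V2 = pverts G \<and> V1 \<inter> V2 = {} \<and> clique G V1 \<and> indep_set G V2)"

definition k_indep_sets :: "nat \<Rightarrow> 'a pair_pre_digraph \<Rightarrow> 'a set set" where
  "k_indep_sets k G = {I. indep_set G I \<and> card I = k}"

definition TS :: "nat \<Rightarrow> 'a pair_pre_digraph \<Rightarrow> 'a set pair_pre_digraph" where
  "TS k G = \<lparr> pverts = k_indep_sets k G,
     parcs = {(I, J). I \<in> k_indep_sets k G \<and> J \<in> k_indep_sets k G \<and>
                (\<exists>u v. I - J = {v} \<and> J - I = {u} \<and> (u, v) \<in> parcs G)} \<rparr>"

text \<open>
  The adjacency matrix of a graph with vertices \<open>0, \<dots>, n - 1\<close>, preceded by \<open>n\<close> in unary.  Together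
  with such a graph, \<open>k\<close> is written in unary as well (values \<open>k > n\<close> are trivial).
\<close>

definition enc_graph :: "nat \<Rightarrow> nat pair_pre_digraph \<Rightarrow> bool list" where
  "enc_graph n G =
     enc_nat n @ concat (map (\<lambda>i. map (\<lambda>j. (i, j) \<in> parcs G) [0..<n]) [0..<n])"

definition token_sliding_split :: "bool list problem" where
  "token_sliding_split =
    ({enc_nat k @ enc_graph n G | k n G.
        split_graph G \<and> pverts G = {..<n} \<and> Digraph_Component.connected (with_proj (TS k G))},
     {enc_nat k @ enc_graph n G | k n G.
        split_graph G \<and> pverts G = {..<n} \<and> \<not> Digraph_Component.connected (with_proj (TS k G))})"

definition param_token_sliding_split :: "param_instance problem" where
  "param_token_sliding_split =
    ({(enc_graph n G, k) | n G k.
        split_graph G \<and> pverts G = {..<n} \<and> Digraph_Component.connected (with_proj (TS k G))},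
     {(enc_graph n G, k) | n G k.
        split_graph G \<and> pverts G = {..<n} \<and> \<not> Digraph_Component.connected (with_proj (TS k G))})"

end

theory Submission
  imports Defs
begin

text \<open>
  Everything is reduced to a constraint satisfaction problem with binary constraints and
  clauses, whose number of variables becomes the parameter, and from there to hitting set.
  A hitting set instance becomes a split graph whose independent side consists of the elements
  and one extra vertex \<open>w\<close>, and whose clique has a vertex \<open>(z, u)\<close> for every set \<open>z\<close> and element
  \<open>u\<close>, adjacent to \<open>w\<close>, to \<open>u\<close> and to the elements of \<open>z\<close>. A hitting set together with \<open>w\<close> is a
  frozen configuration; conversely, a set \<open>z\<close> missed by the current tokens lets the token on \<open>w\<close>
  or \<open>u\<close> slide along \<open>(z, u)\<close>, so that without a hitting set the reconfiguration graph is connected.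

  An accepting computation of a verifier is guessed by choosing, for every time step, the local
  state, the head positions and the times of the previous visits to the scanned cells, which can
  be checked pairwise. A weft 2 circuit is evaluated by guessing the gaps between consecutive
  true inputs: each variable carries a tuple of gaps, each of which decides the inputs inside it, and
  all variables carry a common strategy for the existential gates above the large gates, while the
  strategies for the universal gates are the clauses. The number of
  variables stays bounded in the parameter because a gate with no large gate below it depends on
  boundedly many inputs.

  The reductions are written as terms of a small language with bounded recursion, which is compiled
  to Turing machines; polynomial running time then holds for every term.
\<close>

section \<open>Structured Turing machines\<close>

text \<open>The obstacle is the shape of a clause: one variable has to satisfy it by its value
  alone. Whatever has to be established about the unknown inputs must therefore fit into a single
  value. This is why a variable of the circuit problem carries \<open>2 ^ d\<close> gaps instead of
  one: a gate of depth at most \<open>d\<close> without large gates depends on at most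
  \<open>2 ^ d\<close> inputs, and the \<open>(k + 1) ^ 2 ^ d\<close> variables run through all
  tuples of gap numbers, so that one of them holds the combination in question. Gaps are preferred
  to the true inputs themselves because a gap also certifies that an input is false. Strategies are
  limited in a similar way: for fixed depth they form a set of polynomial size only if they never
  record one reply for each input of a large gate.

  The clique has a vertex for every pair of a set and an element because a missed set alone only
  lets the token on \<open>w\<close> leave; the pair with \<open>u\<close> also gives that token a
  way down to \<open>u\<close>.

  Solvable constraints make the graph disconnected, so both statements start from complements: a
  verifier for \<open>- L\<close>, and circuits for \<open>- B\<close>.\<close>

inductive halts :: "tm \<Rightarrow> config \<Rightarrow> nat \<Rightarrow> tape list \<Rightarrow> bool" for N where
  halts_now: "halts N (num_states N, ts) 0 ts"
| halts_step: "q < num_states N \<Longrightarrow> halts N (step N (q, ts)) t ts' \<Longrightarrow> halts N (q, ts) (Suc t) ts'"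

definition read_fun :: "symbol list \<Rightarrow> nat \<Rightarrow> symbol" where
  "read_fun ss i = (if i < length ss then ss ! i else None)"

definition reads :: "nat \<Rightarrow> (nat \<Rightarrow> tape) \<Rightarrow> nat \<Rightarrow> symbol" where
  "reads m \<tau> i = (if i < m then fst (\<tau> i) (snd (\<tau> i)) else None)"

definition machine :: "nat \<Rightarrow> tm \<Rightarrow> bool" where
  "machine m N \<longleftrightarrow> wf_tm N \<and> num_tapes N = m"

text \<open>Tape families are total functions of which the first \<open>m\<close> values are run, so
  that single tapes can be changed by function update. \<open>T\<close> is only an upper bound,
  which allows one uniform bound for all rounds of a loop.\<close>

definition runs :: "nat \<Rightarrow> tm \<Rightarrow> (nat \<Rightarrow> tape) \<Rightarrow> nat \<Rightarrow> (nat \<Rightarrow> tape) \<Rightarrow> bool" where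
  "runs m N \<tau> T \<tau>' \<longleftrightarrow> (\<exists>t \<le> T. halts N (0, map \<tau> [0..<m]) t (map \<tau>' [0..<m]))"

lemma runs_mono: "runs m N \<tau> T \<tau>' \<Longrightarrow> T \<le> T' \<Longrightarrow> runs m N \<tau> T' \<tau>'"
  unfolding runs_def using le_trans by blast

lemma runs_cong: "runs m N \<tau> T \<tau>' \<Longrightarrow> (\<And>i. i < m \<Longrightarrow> \<tau>' i = \<tau>'' i) \<Longrightarrow> runs m N \<tau> T \<tau>''"
  unfolding runs_def by (metis (no_types, lifting) atLeastLessThan_iff map_cong set_upt)

lemma map_read: "map (\<lambda>(c, h). c h) (map \<tau> [0..<m]) = map (reads m \<tau>) [0..<m]"
  by (auto simp: reads_def split: prod.splits)

lemma read_fun_map: "read_fun (map (reads m \<tau>) [0..<m]) = reads m \<tau>"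
  by (auto simp: read_fun_def reads_def fun_eq_iff)

lemma map2_act: "map2 act (map f [0..<m]) (map \<tau> [0..<m]) = map (\<lambda>i. act (f i) (\<tau> i)) [0..<m]"
  by (rule nth_equalityI) auto

definition basic :: "nat \<Rightarrow> (nat \<Rightarrow> (nat \<Rightarrow> symbol) \<Rightarrow> symbol \<times> direction) \<Rightarrow> tm" where
  "basic m g = \<lparr>num_tapes = m, num_states = 1,
     delta = (\<lambda>q ss. (1, map (\<lambda>i. g i (read_fun ss)) [0..<m]))\<rparr>"

text \<open>The halting state \<open>num_states N1\<close> of the first machine is, after the shift,
  the start state of the second one, so the handover costs no step. This is why \<open>halts\<close>
  insists on the halting state \<open>num_states N\<close> itself.\<close>

definition seq :: "tm \<Rightarrow> tm \<Rightarrow> tm" where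
  "seq N1 N2 = \<lparr>num_tapes = num_tapes N1, num_states = num_states N1 + num_states N2,
     delta = (\<lambda>q ss. if q < num_states N1 then delta N1 q ss
       else apfst ((+) (num_states N1)) (delta N2 (q - num_states N1) ss))\<rparr>"

text \<open>State 0 is the test and leaves the tapes alone; the states of the body are shifted by
  one, and halting of the body leads back to the test.\<close>

definition loop :: "((nat \<Rightarrow> symbol) \<Rightarrow> bool) \<Rightarrow> tm \<Rightarrow> tm" where
  "loop b N = \<lparr>num_tapes = num_tapes N, num_states = Suc (num_states N),
     delta = (\<lambda>q ss. case q of
         0 \<Rightarrow> (if b (read_fun ss) then 1 else Suc (num_states N), map (\<lambda>s. (s, Stay)) ss)
       | Suc q \<Rightarrow> apfst (\<lambda>q'. if q' < num_states N then Suc q' else 0) (delta N q ss))\<rparr>"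

lemma machine_basic [simp]: "machine m (basic m g)"
  by (auto simp: machine_def wf_tm_def basic_def)

lemma machine_seq [simp]: "machine m N1 \<Longrightarrow> machine m N2 \<Longrightarrow> machine m (seq N1 N2)"
  by (auto simp: machine_def wf_tm_def seq_def trans_le_add1)

lemma machine_loop [simp]: "machine m N \<Longrightarrow> machine m (loop b N)"
  by (auto simp: machine_def wf_tm_def loop_def split: nat.splits)

lemma runs_basic: "runs m (basic m g) \<tau> 1 (\<lambda>i. act (g i (reads m \<tau>)) (\<tau> i))"
proof -
  have "step (basic m g) (0, map \<tau> [0..<m])
      = (num_states (basic m g), map (\<lambda>i. act (g i (reads m \<tau>)) (\<tau> i)) [0..<m])"
    by (simp del: map_map add: basic_def map_read read_fun_map map2_act)
  then have "halts (basic m g) (0, map \<tau> [0..<m]) (Suc 0)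
      (map (\<lambda>i. act (g i (reads m \<tau>)) (\<tau> i)) [0..<m])"
    using halts_step[of 0 "basic m g"] halts_now[of "basic m g"] by (simp add: basic_def)
  then show ?thesis unfolding runs_def by auto
qed

lemma halts_seq2:
  "halts N2 c t ts' \<Longrightarrow> halts (seq N1 N2) (num_states N1 + fst c, snd c) t ts'"
proof (induction rule: halts.induct)
  case (halts_now ts)
  show ?case using halts.halts_now[of "seq N1 N2" ts] by (simp add: seq_def)
next
  case (halts_step q ts t ts')
  have "step (seq N1 N2) (num_states N1 + q, ts)
      = (num_states N1 + fst (step N2 (q, ts)), snd (step N2 (q, ts)))"
    using halts_step.hyps(1) by (simp add: seq_def Let_def split: prod.splits)
  then show ?case using halts_step by (auto intro!: halts.halts_step simp: seq_def)
qed

lemma halts_seq1: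
  "halts N1 c t ts' \<Longrightarrow> halts N2 (0, ts') u ts'' \<Longrightarrow> halts (seq N1 N2) c (t + u) ts''"
proof (induction rule: halts.induct)
  case (halts_now ts)
  then show ?case using halts_seq2[of N2 "(0, ts)"] by simp
next
  case (halts_step q ts t ts')
  have "step (seq N1 N2) (q, ts) = step N1 (q, ts)"
    using halts_step.hyps(1) by (simp add: seq_def)
  then show ?case using halts_step by (auto intro!: halts.halts_step simp: seq_def)
qed

lemma runs_seq:
  assumes "runs m N1 \<tau> T1 \<tau>'" "runs m N2 \<tau>' T2 \<tau>''"
  shows "runs m (seq N1 N2) \<tau> (T1 + T2) \<tau>''"
  using assms unfolding runs_def by (meson add_mono halts_seq1)

lemma map2_act_stay: "map2 act (map ((\<lambda>s. (s, Stay)) \<circ> (\<lambda>(c, h). c h)) ts) ts = ts"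
  by (rule nth_equalityI) (auto split: prod.splits)

lemma halts_loop:
  "halts N c t ts' \<Longrightarrow> halts (loop b N) (0, ts') u ts'' \<Longrightarrow>
   halts (loop b N) (if fst c < num_states N then Suc (fst c) else 0, snd c) (t + u) ts''"
proof (induction rule: halts.induct)
  case (halts_step q ts t ts')
  have "step (loop b N) (Suc q, ts) = (if fst (step N (q, ts)) < num_states N
      then Suc (fst (step N (q, ts))) else 0, snd (step N (q, ts)))"
    using halts_step.hyps(1) by (simp add: loop_def Let_def split: prod.splits)
  then show ?case using halts_step by (auto intro!: halts.halts_step simp: loop_def)
qed simp

lemma step_loop: "step (loop b N) (0, map \<tau> [0..<m])
    = (if b (reads m \<tau>) then 1 else Suc (num_states N), map \<tau> [0..<m])"
proof -
  let ?ts = "map \<tau> [0..<m]"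
  have "read_fun (map (\<lambda>(c, h). c h) ?ts) = reads m \<tau>"
    by (metis map_read read_fun_map)
  then show ?thesis by (simp del: map_map add: loop_def) (metis map2_act_stay map_map)
qed

lemma runs_loop_False:
  assumes "\<not> b (reads m \<tau>)"
  shows "runs m (loop b N) \<tau> 1 \<tau>"
proof -
  have "halts (loop b N) (0, map \<tau> [0..<m]) (Suc 0) (map \<tau> [0..<m])"
  proof (rule halts_step)
    show "halts (loop b N) (step (loop b N) (0, map \<tau> [0..<m])) 0 (map \<tau> [0..<m])"
      using assms halts_now[of "loop b N"] by (simp only: step_loop) (simp add: loop_def)
  qed (simp add: loop_def)
  then show ?thesis unfolding runs_def by auto
qed

lemma runs_loop_True:
  assumes "machine m N" "b (reads m \<tau>)" "runs m N \<tau> T1 \<tau>'" "runs m (loop b N) \<tau>' T2 \<tau>''"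
  shows "runs m (loop b N) \<tau> (Suc (T1 + T2)) \<tau>''"
proof -
  obtain t u where t: "t \<le> T1" "halts N (0, map \<tau> [0..<m]) t (map \<tau>' [0..<m])"
    and u: "u \<le> T2" "halts (loop b N) (0, map \<tau>' [0..<m]) u (map \<tau>'' [0..<m])"
    using assms unfolding runs_def by blast
  have "0 < num_states N" using assms(1) by (simp add: machine_def wf_tm_def)
  then have "halts (loop b N) (1, map \<tau> [0..<m]) (t + u) (map \<tau>'' [0..<m])"
    using halts_loop[OF t(2) u(2)] by simp
  then have "halts (loop b N) (0, map \<tau> [0..<m]) (Suc (t + u)) (map \<tau>'' [0..<m])"
    using assms(2) by (intro halts_step) (simp_all only: step_loop, simp_all add: loop_def)
  then show ?thesis unfolding runs_def using t(1) u(1) by (meson Suc_le_mono add_mono)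
qed

text \<open>All loops are analysed by naming the tapes \<open>s i\<close> before round
  \<open>i\<close>. A round costs its body and one test, and the last summand is the failing
  test.\<close>

lemma runs_loop_iter:
  assumes "machine m N"
    and "\<And>i. i < n \<Longrightarrow> b (reads m (s i))" "\<And>i. i < n \<Longrightarrow> runs m N (s i) T (s (Suc i))"
    and "\<not> b (reads m (s n))"
  shows "runs m (loop b N) (s 0) (n * Suc T + 1) (s n)"
  using assms(2-)
proof (induction n arbitrary: s)
  case 0
  then show ?case using runs_loop_False by simp
next
  case (Suc n)
  have "runs m (loop b N) (s (Suc 0)) (n * Suc T + 1) (s (Suc n))"
    using Suc.IH[of "\<lambda>i. s (Suc i)"] Suc.prems by simp
  moreover have "b (reads m (s 0))" "runs m N (s 0) T (s (Suc 0))" using Suc.prems by auto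
  ultimately have "runs m (loop b N) (s 0) (Suc (T + (n * Suc T + 1))) (s (Suc n))"
    using runs_loop_True[OF assms(1)] by blast
  then show ?case by (rule runs_mono) simp
qed

definition mover :: "nat \<Rightarrow> (nat \<Rightarrow> (nat \<Rightarrow> symbol) \<Rightarrow> direction) \<Rightarrow> tm" where
  "mover m f = basic m (\<lambda>i \<sigma>. (\<sigma> i, f i \<sigma>))"

lemma machine_mover [simp]: "machine m (mover m f)"
  by (simp add: mover_def)

lemma runs_mover:
  assumes "\<And>i. i < m \<Longrightarrow> \<tau>' i = (fst (\<tau> i), move (f i (reads m \<tau>)) (snd (\<tau> i)))"
  shows "runs m (mover m f) \<tau> 1 \<tau>'"
  unfolding mover_def
proof (rule runs_cong[OF runs_basic])
  fix i assume "i < m"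
  then show "act (reads m \<tau> i, f i (reads m \<tau>)) (\<tau> i) = \<tau>' i"
    using assms[of i] by (cases "\<tau> i") (simp add: reads_def)
qed


section \<open>Polynomially bounded functions\<close>

text \<open>The base \<open>n + 2\<close> is at least 2, so constants, sums and compositions can be
  absorbed into the exponent. Monotonicity is included because bounds are applied to enlarged
  arguments.\<close>

definition poly_bounded :: "(nat \<Rightarrow> nat) \<Rightarrow> bool" where
  "poly_bounded g \<longleftrightarrow> mono g \<and> (\<exists>c. \<forall>n. g n \<le> (n + 2) ^ c)"

lemma poly_bounded_mono: "poly_bounded g \<Longrightarrow> a \<le> b \<Longrightarrow> g a \<le> g b"
  by (simp add: poly_bounded_def monoD)

lemma poly_bounded_const: "poly_bounded (\<lambda>_. c)"
proof -
  have "c \<le> (n + 2) ^ c" for n :: nat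
    using less_exp[of c] power_mono[of 2 "n + 2" c] by linarith
  then show ?thesis unfolding poly_bounded_def mono_def by blast
qed

lemma poly_bounded_id: "poly_bounded (\<lambda>n. n)"
  unfolding poly_bounded_def mono_def by (auto intro!: exI[of _ 1])

lemma poly_bounded_mult:
  assumes "poly_bounded f" "poly_bounded g"
  shows "poly_bounded (\<lambda>n. f n * g n)"
proof -
  obtain c d where "\<And>n. f n \<le> (n + 2) ^ c" "\<And>n. g n \<le> (n + 2) ^ d"
    using assms unfolding poly_bounded_def by blast
  then have "f n * g n \<le> (n + 2) ^ (c + d)" for n
    by (simp add: power_add mult_mono del: add_2_eq_Suc')
  moreover have "mono (\<lambda>n. f n * g n)"
    using assms[THEN poly_bounded_mono] by (auto intro!: monoI mult_mono)
  ultimately show ?thesis unfolding poly_bounded_def by blast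
qed

lemma poly_bounded_add:
  assumes "poly_bounded f" "poly_bounded g"
  shows "poly_bounded (\<lambda>n. f n + g n)"
proof -
  obtain c d where c: "\<And>n. f n \<le> (n + 2) ^ c" and d: "\<And>n. g n \<le> (n + 2) ^ d"
    using assms unfolding poly_bounded_def by blast
  have "f n + g n \<le> (n + 2) ^ Suc (c + d)" for n
  proof -
    have "(n + 2) ^ c \<le> (n + 2) ^ (c + d)" "(n + 2) ^ d \<le> (n + 2) ^ (c + d)"
      by (simp_all add: power_increasing del: add_2_eq_Suc')
    then have "f n + g n \<le> 2 * (n + 2) ^ (c + d)" using c[of n] d[of n] by linarith
    also have "\<dots> \<le> (n + 2) * (n + 2) ^ (c + d)" by (intro mult_right_mono) auto
    finally show ?thesis by simp
  qed
  moreover have "mono (\<lambda>n. f n + g n)"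
    using assms[THEN poly_bounded_mono] by (auto intro!: monoI add_mono)
  ultimately show ?thesis unfolding poly_bounded_def by blast
qed

lemma poly_bounded_compose:
  assumes "poly_bounded f" "poly_bounded g"
  shows "poly_bounded (\<lambda>n. f (g n))"
proof -
  obtain c d where c: "\<And>n. f n \<le> (n + 2) ^ c" and d: "\<And>n. g n \<le> (n + 2) ^ d"
    using assms unfolding poly_bounded_def by blast
  have "f (g n) \<le> (n + 2) ^ ((d + 2) * c)" for n
  proof -
    have "1 \<le> (n + 2) ^ d" by simp
    then have "g n + 2 \<le> 4 * (n + 2) ^ d" using d[of n] by linarith
    also have "\<dots> \<le> (n + 2) ^ 2 * (n + 2) ^ d"
      using power_mono[of 2 "n + 2" 2] by (intro mult_right_mono) auto
    finally have "g n + 2 \<le> (n + 2) ^ (d + 2)" by (simp only: power_add mult.commute)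
    then have "(g n + 2) ^ c \<le> ((n + 2) ^ (d + 2)) ^ c" by (rule power_mono) simp
    then show ?thesis using c[of "g n"] by (simp only: power_mult)
  qed
  moreover have "mono (\<lambda>n. f (g n))" using assms[THEN poly_bounded_mono] by (auto intro!: monoI)
  ultimately show ?thesis unfolding poly_bounded_def by blast
qed


section \<open>Register machines\<close>

type_synonym inp = "bool list \<times> bool list"

definition component :: "bool \<Rightarrow> inp \<Rightarrow> bool list" where
  "component w X = (if w then snd X else fst X)"

definition marker :: "int \<Rightarrow> symbol" where
  "marker i = (if i = 0 then Some True else None)"

locale layout =
  fixes m b :: nat
begin

text \<open>
  Tapes below \<open>b\<close> are left alone, tapes \<open>b\<close> and \<open>b + 1\<close> hold the two input strings, and a register is
  a tape whose cell 0 is marked; its value is the head position.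
\<close>

definition lay :: "(nat \<Rightarrow> tape) \<Rightarrow> inp \<Rightarrow> (bool \<Rightarrow> int) \<Rightarrow> (nat \<Rightarrow> nat) \<Rightarrow> nat \<Rightarrow> tape" where
  "lay J X h \<rho> i = (if i < b then J i
     else if i = b then (fst (string_tape (fst X)), h False)
     else if i = Suc b then (fst (string_tape (snd X)), h True)
     else (marker, int (\<rho> (i - b - 2))))"

abbreviation "reg r \<equiv> b + 2 + r"

abbreviation "intape w \<equiv> (if w then Suc b else b)"

section \<open>Programs on unary registers and on the two input heads\<close>

definition incr :: "nat \<Rightarrow> tm" where
  "incr r = mover m (\<lambda>i \<sigma>. if i = reg r then MoveRight else Stay)"

text \<open>On the marked cell the head stays, which makes the arithmetic truncated like subtraction
  on \<open>nat\<close>.\<close>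

definition decr :: "nat \<Rightarrow> tm" where
  "decr r = mover m (\<lambda>i \<sigma>. if i = reg r \<and> \<sigma> i = None then MoveLeft else Stay)"

definition nop :: tm where
  "nop = mover m (\<lambda>i \<sigma>. Stay)"

definition while_pos :: "nat \<Rightarrow> tm \<Rightarrow> tm" where
  "while_pos r N = loop (\<lambda>\<sigma>. \<sigma> (reg r) = None) N"

definition clear :: "nat \<Rightarrow> tm" where
  "clear r = while_pos r (decr r)"

definition transfer :: "nat \<Rightarrow> nat \<Rightarrow> tm" where
  "transfer r s = while_pos r (seq (decr r) (incr s))"

text \<open>The value of a register is read off by counting it down. Copying therefore produces two
  duplicates and moves one of them back.\<close>

definition copy :: "nat \<Rightarrow> nat \<Rightarrow> nat \<Rightarrow> tm" where
  "copy r s u = seq (while_pos r (seq (decr r) (seq (incr s) (incr u)))) (transfer u r)"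

definition subtract :: "nat \<Rightarrow> nat \<Rightarrow> tm" where
  "subtract r s = while_pos r (seq (decr r) (decr s))"

definition decr_both_if :: "nat \<Rightarrow> nat \<Rightarrow> tm" where
  "decr_both_if r s = mover m (\<lambda>i \<sigma>. if i = reg r \<and> \<sigma> (reg r) = None then MoveLeft
     else if i = reg s \<and> \<sigma> (reg r) = None then MoveRight else Stay)"

text \<open>Realises the truncation in \<open>TRec\<close>: each unit of \<open>r\<close> moves one
  unit from \<open>c\<close> to \<open>s\<close> while \<open>c\<close> is positive, and what is
  left in \<open>c\<close> is discarded.\<close>

definition transfer_min :: "nat \<Rightarrow> nat \<Rightarrow> nat \<Rightarrow> tm" where
  "transfer_min r c s = seq (while_pos r (seq (decr r) (decr_both_if c s))) (clear c)"

definition head_move :: "bool \<Rightarrow> direction \<Rightarrow> tm" where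
  "head_move w dir = mover m (\<lambda>i \<sigma>. if i = intape w then dir else Stay)"

definition rewind :: "bool \<Rightarrow> nat \<Rightarrow> tm" where
  "rewind w r = while_pos r (seq (decr r) (head_move w MoveLeft))"

text \<open>Register \<open>d\<close> is used up as a counter while the head walks to the position;
  \<open>Suc d\<close> records the distance for the way back. At the position \<open>d\<close> is 0,
  so a single conditional move turns it into the bit.\<close>

definition fetch_bit :: "bool \<Rightarrow> nat \<Rightarrow> tm" where
  "fetch_bit w d = seq (while_pos d (seq (decr d) (seq (incr (Suc d)) (head_move w MoveRight))))
     (seq (mover m (\<lambda>i \<sigma>. if i = reg d \<and> \<sigma> (intape w) = Some True then MoveRight else Stay))
       (rewind w (Suc d)))"

definition measure_length :: "bool \<Rightarrow> nat \<Rightarrow> tm" where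
  "measure_length w d = seq (loop (\<lambda>\<sigma>. \<sigma> (intape w) \<noteq> None)
       (seq (incr d) (seq (incr (Suc d)) (head_move w MoveRight))))
     (rewind w (Suc d))"

lemma machines [simp]:
  "machine m (incr r)" "machine m (decr r)" "machine m nop"
  "machine m N \<Longrightarrow> machine m (while_pos r N)"
  "machine m (clear r)" "machine m (transfer r s)" "machine m (copy r s u)"
  "machine m (subtract r s)" "machine m (transfer_min r c s)" "machine m (head_move w dir)"
  "machine m (decr_both_if r s)"
  "machine m (rewind w r)" "machine m (fetch_bit w d)" "machine m (measure_length w d)"
  by (simp_all add: incr_def decr_def nop_def while_pos_def clear_def transfer_def copy_def
      subtract_def transfer_min_def head_move_def rewind_def fetch_bit_def measure_length_def
      decr_both_if_def)

section \<open>Effect and running time of the register programs\<close>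

lemma reads_reg: "reg r < m \<Longrightarrow> reads m (lay J X h \<rho>) (reg r) = (if \<rho> r = 0 then Some True else None)"
  by (simp add: reads_def lay_def marker_def)

lemma reads_in: "reg 0 \<le> m \<Longrightarrow>
    reads m (lay J X h \<rho>) (intape w) = fst (string_tape (component w X)) (h w)"
  by (simp add: reads_def lay_def component_def)

lemma runs_incr: "reg r < m \<Longrightarrow> runs m (incr r) (lay J X h \<rho>) 1 (lay J X h (\<rho>(r := Suc (\<rho> r))))"
  unfolding incr_def by (rule runs_mover) (auto simp: lay_def)

lemma runs_nop: "runs m nop (lay J X h \<rho>) 1 (lay J X h \<rho>)"
  unfolding nop_def by (rule runs_mover) (auto simp: lay_def)

lemma runs_decr: "reg r < m \<Longrightarrow> runs m (decr r) (lay J X h \<rho>) 1 (lay J X h (\<rho>(r := \<rho> r - 1)))"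
  unfolding decr_def by (rule runs_mover) (auto simp: lay_def reads_def marker_def)

lemma runs_head_move: "reg 0 \<le> m \<Longrightarrow>
    runs m (head_move w dir) (lay J X h \<rho>) 1 (lay J X (h(w := move dir (h w))) \<rho>)"
  unfolding head_move_def by (rule runs_mover) (auto simp: lay_def)

lemma runs_decr_both_if: "reg r < m \<Longrightarrow> reg s < m \<Longrightarrow> r \<noteq> s \<Longrightarrow>
    runs m (decr_both_if r s) (lay J X h \<rho>) 1
      (lay J X h (if \<rho> r = 0 then \<rho> else \<rho>(r := \<rho> r - 1, s := Suc (\<rho> s))))"
  unfolding decr_both_if_def by (rule runs_mover) (auto simp: lay_def reads_def marker_def)

lemma runs_while_pos:
  assumes "reg r < m" "machine m N"
    and "\<And>i. i < n \<Longrightarrow> \<rho> i r \<noteq> 0" "\<rho> n r = 0"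
    and "\<And>i. i < n \<Longrightarrow> runs m N (lay J X (h i) (\<rho> i)) T (lay J X (h (Suc i)) (\<rho> (Suc i)))"
  shows "runs m (while_pos r N) (lay J X (h 0) (\<rho> 0)) (n * Suc T + 1) (lay J X (h n) (\<rho> n))"
  unfolding while_pos_def
  by (rule runs_loop_iter[where s = "\<lambda>i. lay J X (h i) (\<rho> i)"])
    (use assms in \<open>auto simp: reads_reg simp del: add_2_eq_Suc'\<close>)

lemma runs_clear:
  assumes "reg r < m"
  shows "runs m (clear r) (lay J X h \<rho>) (2 * \<rho> r + 1) (lay J X h (\<rho>(r := 0)))"
proof -
  let ?\<rho> = "\<lambda>i. \<rho>(r := \<rho> r - i)"
  have "runs m (clear r) (lay J X h (?\<rho> 0)) (\<rho> r * Suc 1 + 1) (lay J X h (?\<rho> (\<rho> r)))"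
    unfolding clear_def
  proof (rule runs_while_pos[where h = "\<lambda>_. h" and \<rho> = ?\<rho>, OF assms])
    fix i
    show "runs m (decr r) (lay J X h (?\<rho> i)) 1 (lay J X h (?\<rho> (Suc i)))"
      using runs_decr[OF assms, of J X h "?\<rho> i"] by simp
  qed simp_all
  then show ?thesis by (auto elim!: runs_mono)
qed

lemma runs_transfer:
  assumes "reg r < m" "reg s < m" "r \<noteq> s"
  shows "runs m (transfer r s) (lay J X h \<rho>) (3 * \<rho> r + 1) (lay J X h (\<rho>(r := 0, s := \<rho> s + \<rho> r)))"
proof -
  let ?\<rho> = "\<lambda>i. \<rho>(r := \<rho> r - i, s := \<rho> s + i)"
  have "runs m (transfer r s) (lay J X h (?\<rho> 0)) (\<rho> r * Suc (1 + 1) + 1) (lay J X h (?\<rho> (\<rho> r)))"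
    unfolding transfer_def
  proof (rule runs_while_pos[where h = "\<lambda>_. h" and \<rho> = ?\<rho>, OF assms(1)])
    fix i
    show "runs m (seq (decr r) (incr s)) (lay J X h (?\<rho> i)) (1 + 1) (lay J X h (?\<rho> (Suc i)))"
      using runs_seq[OF runs_decr[OF assms(1), of J X h "?\<rho> i"] runs_incr[OF assms(2)]] assms(3)
      by (simp add: fun_upd_twist)
  qed (use assms in simp_all)
  then show ?thesis using assms by (auto elim!: runs_mono)
qed

lemma runs_copy:
  assumes "reg r < m" "reg s < m" "reg u < m" "r \<noteq> s" "r \<noteq> u" "s \<noteq> u" "\<rho> u = 0" "\<rho> s = 0"
  shows "runs m (copy r s u) (lay J X h \<rho>) (7 * \<rho> r + 2) (lay J X h (\<rho>(s := \<rho> r)))"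
proof -
  let ?\<rho> = "\<lambda>i. \<rho>(r := \<rho> r - i, s := i, u := i)"
  have "runs m (while_pos r (seq (decr r) (seq (incr s) (incr u)))) (lay J X h (?\<rho> 0))
      (\<rho> r * Suc (1 + (1 + 1)) + 1) (lay J X h (?\<rho> (\<rho> r)))"
  proof (rule runs_while_pos[where h = "\<lambda>_. h" and \<rho> = ?\<rho>, OF assms(1)])
    fix i
    have "(((?\<rho> i)(r := ?\<rho> i r - 1))(s := Suc i))(u := Suc i) = ?\<rho> (Suc i)"
      using assms by (auto simp: fun_eq_iff)
    then show "runs m (seq (decr r) (seq (incr s) (incr u))) (lay J X h (?\<rho> i)) (1 + (1 + 1))
        (lay J X h (?\<rho> (Suc i)))"
      using runs_seq[OF runs_decr[OF assms(1), of J X h "?\<rho> i"]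
          runs_seq[OF runs_incr[OF assms(2)] runs_incr[OF assms(3)]]] assms(4-6)
      by simp
  qed (use assms in simp_all)
  then have "runs m (copy r s u) (lay J X h (?\<rho> 0)) (\<rho> r * Suc (1 + (1 + 1)) + 1 + (3 * \<rho> r + 1))
    (lay J X h ((?\<rho> (\<rho> r))(u := 0, r := \<rho> r)))"
    unfolding copy_def using runs_transfer[of u r J X h "?\<rho> (\<rho> r)"] assms
    by (intro runs_seq) simp_all
  moreover have "?\<rho> 0 = \<rho>" using assms by (auto simp: fun_eq_iff)
  moreover have "(?\<rho> (\<rho> r))(u := 0, r := \<rho> r) = \<rho>(s := \<rho> r)" using assms by (auto simp: fun_eq_iff)
  ultimately show ?thesis by (simp add: mult.commute)
qed

lemma runs_subtract:
  assumes "reg r < m" "reg s < m" "r \<noteq> s"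
  shows "runs m (subtract r s) (lay J X h \<rho>) (3 * \<rho> r + 1) (lay J X h (\<rho>(r := 0, s := \<rho> s - \<rho> r)))"
proof -
  let ?\<rho> = "\<lambda>i. \<rho>(r := \<rho> r - i, s := \<rho> s - i)"
  have "runs m (subtract r s) (lay J X h (?\<rho> 0)) (\<rho> r * Suc (1 + 1) + 1) (lay J X h (?\<rho> (\<rho> r)))"
    unfolding subtract_def
  proof (rule runs_while_pos[where h = "\<lambda>_. h" and \<rho> = ?\<rho>, OF assms(1)])
    fix i
    show "runs m (seq (decr r) (decr s)) (lay J X h (?\<rho> i)) (1 + 1) (lay J X h (?\<rho> (Suc i)))"
      using runs_seq[OF runs_decr[OF assms(1), of J X h "?\<rho> i"] runs_decr[OF assms(2)]] assms(3)
      by (simp add: fun_upd_twist)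
  qed (use assms in simp_all)
  then show ?thesis using assms by (auto elim!: runs_mono)
qed

lemma runs_transfer_min:
  assumes "reg r < m" "reg c < m" "reg s < m" "r \<noteq> s" "r \<noteq> c" "s \<noteq> c" "\<rho> s = 0"
  shows "runs m (transfer_min r c s) (lay J X h \<rho>) (3 * \<rho> r + 2 * \<rho> c + 2)
    (lay J X h (\<rho>(r := 0, c := 0, s := min (\<rho> c) (\<rho> r))))"
proof -
  let ?\<rho> = "\<lambda>i. \<rho>(r := \<rho> r - i, c := \<rho> c - i, s := min (\<rho> c) i)"
  have "runs m (while_pos r (seq (decr r) (decr_both_if c s))) (lay J X h (?\<rho> 0))
      (\<rho> r * Suc (1 + 1) + 1) (lay J X h (?\<rho> (\<rho> r)))"
  proof (rule runs_while_pos[where h = "\<lambda>_. h" and \<rho> = ?\<rho>, OF assms(1)])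
    fix i
    let ?\<rho>' = "(?\<rho> i)(r := ?\<rho> i r - 1)"
    have "(if ?\<rho>' c = 0 then ?\<rho>' else ?\<rho>'(c := ?\<rho>' c - 1, s := Suc (?\<rho>' s))) = ?\<rho> (Suc i)"
      using assms by (auto simp: fun_eq_iff)
    then show "runs m (seq (decr r) (decr_both_if c s)) (lay J X h (?\<rho> i)) (1 + 1)
        (lay J X h (?\<rho> (Suc i)))"
      using runs_seq[OF runs_decr[OF assms(1), of J X h "?\<rho> i"]
          runs_decr_both_if[OF assms(2,3), of J X h ?\<rho>']] assms by simp
  qed (use assms in simp_all)
  then have "runs m (transfer_min r c s) (lay J X h (?\<rho> 0))
      (\<rho> r * Suc (1 + 1) + 1 + (2 * (\<rho> c - \<rho> r) + 1)) (lay J X h ((?\<rho> (\<rho> r))(c := 0)))"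
    unfolding transfer_min_def using runs_clear[of c J X h "?\<rho> (\<rho> r)"] assms
    by (intro runs_seq) simp_all
  moreover have "?\<rho> 0 = \<rho>" using assms by (auto simp: fun_eq_iff)
  moreover have "(?\<rho> (\<rho> r))(c := 0) = \<rho>(r := 0, c := 0, s := min (\<rho> c) (\<rho> r))"
    using assms by (auto simp: fun_eq_iff)
  ultimately show ?thesis by (simp add: runs_mono mult.commute)
qed

lemma runs_rewind:
  assumes "reg r < m"
  shows "runs m (rewind w r) (lay J X h \<rho>) (3 * \<rho> r + 1)
    (lay J X (h(w := h w - int (\<rho> r))) (\<rho>(r := 0)))"
proof -
  let ?\<rho> = "\<lambda>i. \<rho>(r := \<rho> r - i)" and ?h = "\<lambda>i. h(w := h w - int i)"
  have "runs m (rewind w r) (lay J X (?h 0) (?\<rho> 0)) (\<rho> r * Suc (1 + 1) + 1)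
      (lay J X (?h (\<rho> r)) (?\<rho> (\<rho> r)))"
    unfolding rewind_def
  proof (rule runs_while_pos[where h = ?h and \<rho> = ?\<rho>, OF assms(1)])
    fix i
    have "(?h i)(w := move MoveLeft (?h i w)) = ?h (Suc i)" by (auto simp: fun_eq_iff)
    then show "runs m (seq (decr r) (head_move w MoveLeft)) (lay J X (?h i) (?\<rho> i)) (1 + 1)
        (lay J X (?h (Suc i)) (?\<rho> (Suc i)))"
      using runs_seq[OF runs_decr[OF assms(1), of J X "?h i" "?\<rho> i"]
          runs_head_move[of w MoveLeft J X "?h i"]] assms by simp
  qed (use assms in simp_all)
  then show ?thesis by (auto elim!: runs_mono)
qed

lemma string_tape_bit:
  "fst (string_tape x) (int i) = Some True \<longleftrightarrow> i < length x \<and> x ! i"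
  by (simp add: string_tape_def)

lemma runs_fetch_bit:
  assumes "reg (Suc d) < m" "\<rho> (Suc d) = 0" "h w = 0"
  shows "runs m (fetch_bit w d) (lay J X h \<rho>) (7 * \<rho> d + 3)
    (lay J X h (\<rho>(d := of_bool (\<rho> d < length (component w X) \<and> component w X ! \<rho> d))))"
proof -
  let ?\<rho> = "\<lambda>i. \<rho>(d := \<rho> d - i, Suc d := i)" and ?h = "\<lambda>i. h(w := int i)"
  let ?n = "\<rho> d" and ?bit = "of_bool (\<rho> d < length (component w X) \<and> component w X ! \<rho> d) :: nat"
  have d: "reg d < m" using assms(1) by simp
  have "runs m (while_pos d (seq (decr d) (seq (incr (Suc d)) (head_move w MoveRight))))
      (lay J X (?h 0) (?\<rho> 0)) (?n * Suc (1 + (1 + 1)) + 1) (lay J X (?h ?n) (?\<rho> ?n))"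
  proof (rule runs_while_pos[where h = ?h and \<rho> = ?\<rho>, OF d])
    fix i
    have "(?h i)(w := move MoveRight (?h i w)) = ?h (Suc i)" by (auto simp: fun_eq_iff)
    moreover have "((?\<rho> i)(d := ?\<rho> i d - 1))(Suc d := Suc i) = ?\<rho> (Suc i)"
      by (auto simp: fun_eq_iff)
    ultimately show "runs m (seq (decr d) (seq (incr (Suc d)) (head_move w MoveRight)))
        (lay J X (?h i) (?\<rho> i)) (1 + (1 + 1)) (lay J X (?h (Suc i)) (?\<rho> (Suc i)))"
      using runs_seq[OF runs_decr[OF d, of J X "?h i" "?\<rho> i"]
          runs_seq[OF runs_incr[OF assms(1)] runs_head_move[of w MoveRight J X "?h i"]]] assms(1)
      by simp
  qed simp_all
  moreover have "runs m (mover m (\<lambda>i \<sigma>. if i = reg d \<and> \<sigma> (intape w) = Some True then MoveRight else Stay))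
      (lay J X (?h ?n) (?\<rho> ?n)) 1 (lay J X (?h ?n) ((?\<rho> ?n)(d := ?bit)))"
  proof (rule runs_mover)
    fix i assume "i < m"
    have "reads m (lay J X (?h ?n) (?\<rho> ?n)) (intape w) = Some True \<longleftrightarrow>
        \<rho> d < length (component w X) \<and> component w X ! \<rho> d"
      using assms(1) by (subst reads_in) (simp_all add: string_tape_bit)
    then show "lay J X (?h ?n) ((?\<rho> ?n)(d := ?bit)) i
        = (fst (lay J X (?h ?n) (?\<rho> ?n) i),
           move (if i = reg d \<and> reads m (lay J X (?h ?n) (?\<rho> ?n)) (intape w) = Some True
                 then MoveRight else Stay) (snd (lay J X (?h ?n) (?\<rho> ?n) i)))"
      by (auto simp: lay_def)
  qed
  moreover have "runs m (rewind w (Suc d)) (lay J X (?h ?n) ((?\<rho> ?n)(d := ?bit))) (3 * ?n + 1)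
      (lay J X ((?h ?n)(w := 0)) ((?\<rho> ?n)(d := ?bit, Suc d := 0)))"
    using runs_rewind[OF assms(1), of w J X "?h ?n" "(?\<rho> ?n)(d := ?bit)"] by simp
  ultimately have "runs m (fetch_bit w d) (lay J X (?h 0) (?\<rho> 0))
      (?n * Suc (1 + (1 + 1)) + 1 + (1 + (3 * ?n + 1)))
      (lay J X ((?h ?n)(w := 0)) ((?\<rho> ?n)(d := ?bit, Suc d := 0)))"
    unfolding fetch_bit_def by (intro runs_seq)
  moreover have "?\<rho> 0 = \<rho>" "(?\<rho> ?n)(d := ?bit, Suc d := 0) = \<rho>(d := ?bit)" "?h 0 = h"
    "(?h ?n)(w := 0) = h" using assms by (auto simp: fun_eq_iff)
  ultimately have "runs m (fetch_bit w d) (lay J X h \<rho>) (?n * Suc (1 + (1 + 1)) + 1 + (1 + (3 * ?n + 1)))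
      (lay J X h (\<rho>(d := ?bit)))" by (simp only:)
  then show ?thesis by (rule runs_mono) simp
qed

lemma runs_measure_length:
  assumes "reg (Suc d) < m" "\<rho> (Suc d) = 0" "\<rho> d = 0" "h w = 0"
  shows "runs m (measure_length w d) (lay J X h \<rho>) (7 * length (component w X) + 2)
    (lay J X h (\<rho>(d := length (component w X))))"
proof -
  let ?\<rho> = "\<lambda>i. \<rho>(d := i, Suc d := i)" and ?h = "\<lambda>i. h(w := int i)"
  let ?n = "length (component w X)"
  have d: "reg d < m" "reg 0 \<le> m" using assms(1) by simp_all
  have "runs m (loop (\<lambda>\<sigma>. \<sigma> (intape w) \<noteq> None)
       (seq (incr d) (seq (incr (Suc d)) (head_move w MoveRight))))
      (lay J X (?h 0) (?\<rho> 0)) (?n * Suc (1 + (1 + 1)) + 1) (lay J X (?h ?n) (?\<rho> ?n))"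
  proof (rule runs_loop_iter[where s = "\<lambda>i. lay J X (?h i) (?\<rho> i)"])
    fix i
    have "(?h i)(w := move MoveRight (?h i w)) = ?h (Suc i)" by (auto simp: fun_eq_iff)
    moreover have "((?\<rho> i)(d := Suc i))(Suc d := Suc i) = ?\<rho> (Suc i)"
      by (auto simp: fun_eq_iff)
    ultimately show "runs m (seq (incr d) (seq (incr (Suc d)) (head_move w MoveRight)))
        (lay J X (?h i) (?\<rho> i)) (1 + (1 + 1)) (lay J X (?h (Suc i)) (?\<rho> (Suc i)))"
      using runs_seq[OF runs_incr[OF d(1), of J X "?h i" "?\<rho> i"]
          runs_seq[OF runs_incr[OF assms(1)] runs_head_move[of w MoveRight J X "?h i"]]] assms(1)
      by simp
  qed (simp_all only: reads_in[OF d(2)], simp_all add: string_tape_def)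
  moreover have "runs m (rewind w (Suc d)) (lay J X (?h ?n) (?\<rho> ?n)) (3 * ?n + 1)
      (lay J X ((?h ?n)(w := 0)) ((?\<rho> ?n)(Suc d := 0)))"
    using runs_rewind[OF assms(1), of w J X "?h ?n" "?\<rho> ?n"] by simp
  ultimately have "runs m (measure_length w d) (lay J X (?h 0) (?\<rho> 0))
      (?n * Suc (1 + (1 + 1)) + 1 + (3 * ?n + 1))
      (lay J X ((?h ?n)(w := 0)) ((?\<rho> ?n)(Suc d := 0)))"
    unfolding measure_length_def by (intro runs_seq)
  moreover have "?\<rho> 0 = \<rho>" "(?\<rho> ?n)(Suc d := 0) = \<rho>(d := ?n)" "?h 0 = h"
    "(?h ?n)(w := 0) = h" using assms by (auto simp: fun_eq_iff)
  ultimately show ?thesis by (simp add: mult.commute)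
qed

end


section \<open>Bounded-recursive terms\<close>

text \<open>
  Terms denote functions of the two input strings and of an environment of numbers (de Bruijn
  indices).  Recursion is truncated at an explicit bound, so all values stay polynomial in the input.
\<close>

datatype trm =
    TVar nat | TZero | TOne | TAdd trm trm | TSub trm trm | TBit bool trm | TLen bool
  | TSum trm trm | TRec trm trm trm | TLet trm trm

fun ev :: "inp \<Rightarrow> (nat \<Rightarrow> nat) \<Rightarrow> trm \<Rightarrow> nat" where
  "ev X e (TVar k) = e k"
| "ev X e TZero = 0"
| "ev X e TOne = 1"
| "ev X e (TAdd s t) = ev X e s + ev X e t"
| "ev X e (TSub s t) = ev X e s - ev X e t"
| "ev X e (TBit w t) = of_bool (ev X e t < length (component w X) \<and> component w X ! ev X e t)"
| "ev X e (TLen w) = length (component w X)"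
| "ev X e (TSum n f) = (\<Sum>i<ev X e n. ev X (case_nat i e) f)"
| "ev X e (TRec c n s) =
     rec_nat 0 (\<lambda>i a. min (ev X e c) (ev X (case_nat i (case_nat a e)) s)) (ev X e n)"
| "ev X e (TLet a f) = ev X (case_nat (ev X e a) e) f"

definition bounded_by :: "nat \<Rightarrow> inp \<Rightarrow> (nat \<Rightarrow> nat) \<Rightarrow> bool" where
  "bounded_by S X e \<longleftrightarrow> length (fst X) \<le> S \<and> length (snd X) \<le> S \<and> (\<forall>k. e k \<le> S)"

lemma bounded_by_case_nat: "bounded_by S X e \<Longrightarrow> S \<le> S' \<Longrightarrow> i \<le> S' \<Longrightarrow> bounded_by S' X (case_nat i e)"
  unfolding bounded_by_def by (auto split: nat.splits intro: le_trans)

lemma length_component: "bounded_by S X e \<Longrightarrow> length (component w X) \<le> S"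
  unfolding bounded_by_def component_def by auto

lemma rec_min_le: "rec_nat 0 (\<lambda>i a. min c (f i a)) n \<le> (c :: nat)"
  by (cases n) auto

lemmas poly_bounded_intros =
  poly_bounded_const poly_bounded_id poly_bounded_add poly_bounded_mult

text \<open>A recursion is bounded by its bound term whatever its body does; without the truncation
  iterated squaring would be expressible. For sums and \<open>TLet\<close> the bound of the body is
  taken at \<open>S + g S\<close>, because the bound variable joins the environment.\<close>

lemma ev_bounded:
  "\<exists>g. poly_bounded g \<and> (\<forall>X S e. bounded_by S X e \<longrightarrow> ev X e t \<le> g S)"
proof (induction t)
  case (TVar k)
  then show ?case by (intro exI[of _ "\<lambda>n. n"]) (auto simp: poly_bounded_id bounded_by_def)
next
  case (TAdd s t)
  then obtain g h where "poly_bounded g" "poly_bounded h"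
    "\<And>X S e. bounded_by S X e \<Longrightarrow> ev X e s \<le> g S" "\<And>X S e. bounded_by S X e \<Longrightarrow> ev X e t \<le> h S"
    by blast
  then show ?case by (intro exI[of _ "\<lambda>n. g n + h n"]) (auto intro: poly_bounded_add add_mono)
next
  case (TSub s t)
  then obtain g where "poly_bounded g" "\<And>X S e. bounded_by S X e \<Longrightarrow> ev X e s \<le> g S"
    by blast
  then show ?case by (intro exI[of _ g]) (auto intro: le_trans[OF diff_le_self])
next
  case (TLen w)
  then show ?case by (intro exI[of _ "\<lambda>n. n"]) (auto simp: poly_bounded_id length_component)
next
  case (TSum n f)
  then obtain g h where gh: "poly_bounded g" "poly_bounded h"
    "\<And>X S e. bounded_by S X e \<Longrightarrow> ev X e n \<le> g S" "\<And>X S e. bounded_by S X e \<Longrightarrow> ev X e f \<le> h S"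
    by blast
  show ?case
  proof (intro exI[of _ "\<lambda>S. g S * h (S + g S)"] conjI allI impI)
    show "poly_bounded (\<lambda>S. g S * h (S + g S))"
      by (intro poly_bounded_intros poly_bounded_compose[OF gh(2)] gh)
    fix X S e assume b: "bounded_by S X e"
    have "ev X (case_nat i e) f \<le> h (S + g S)" if "i < ev X e n" for i
      using that gh(3)[OF b] by (intro gh(4) bounded_by_case_nat[OF b]) auto
    then have "ev X e (TSum n f) \<le> ev X e n * h (S + g S)"
      using sum_bounded_above[of "{..<ev X e n}" "\<lambda>i. ev X (case_nat i e) f"] by simp
    also have "\<dots> \<le> g S * h (S + g S)" using gh(3)[OF b] by simp
    finally show "ev X e (TSum n f) \<le> g S * h (S + g S)" .
  qed
next
  case (TRec c n s)
  then obtain g where "poly_bounded g" "\<And>X S e. bounded_by S X e \<Longrightarrow> ev X e c \<le> g S"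
    by blast
  then show ?case by (intro exI[of _ g]) (auto intro: le_trans[OF rec_min_le])
next
  case (TLet a f)
  then obtain g h where gh: "poly_bounded g" "poly_bounded h"
    "\<And>X S e. bounded_by S X e \<Longrightarrow> ev X e a \<le> g S" "\<And>X S e. bounded_by S X e \<Longrightarrow> ev X e f \<le> h S"
    by blast
  show ?case
  proof (intro exI[of _ "\<lambda>S. h (S + g S)"] conjI allI impI)
    show "poly_bounded (\<lambda>S. h (S + g S))"
      by (intro poly_bounded_intros poly_bounded_compose[OF gh(2)] gh)
    fix X S e assume b: "bounded_by S X e"
    show "ev X e (TLet a f) \<le> h (S + g S)"
      using gh(3)[OF b] by (simp, intro gh(4) bounded_by_case_nat[OF b]) auto
  qed
qed (auto intro!: exI[of _ "\<lambda>_. 1"] simp: poly_bounded_const)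

text \<open>An upper bound for the number of registers used from \<open>d\<close> on. The additive
  constants pay for the result, the loop counters and the scratch registers of the programs
  above.\<close>

fun width :: "trm \<Rightarrow> nat" where
  "width (TAdd s t) = width s + width t + 2"
| "width (TSub s t) = width s + width t + 2"
| "width (TBit w t) = width t + 2"
| "width (TSum n f) = width n + width f + 4"
| "width (TRec c n s) = width c + width n + width s + 6"
| "width (TLet a f) = width a + width f + 2"
| "width _ = 2"

section \<open>Compilation of terms\<close>

context layout
begin

definition env :: "nat list \<Rightarrow> (nat \<Rightarrow> nat) \<Rightarrow> nat \<Rightarrow> nat" where
  "env vs \<rho> k = (if k < length vs then \<rho> (vs ! k) else 0)"

text \<open>\<open>comp vs d t\<close> puts the value of \<open>t\<close> into register \<open>d\<close>; variable \<open>k\<close> lives in register \<open>vs ! k\<close>.\<close>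

fun comp :: "nat list \<Rightarrow> nat \<Rightarrow> trm \<Rightarrow> tm" where
  "comp vs d (TVar k) = (if k < length vs then copy (vs ! k) d (Suc d) else nop)"
| "comp vs d TZero = nop"
| "comp vs d TOne = incr d"
| "comp vs d (TAdd s t) = seq (comp vs d s) (seq (comp vs (Suc d) t) (transfer (Suc d) d))"
| "comp vs d (TSub s t) = seq (comp vs d s) (seq (comp vs (Suc d) t) (subtract (Suc d) d))"
| "comp vs d (TBit w t) = seq (comp vs d t) (fetch_bit w d)"
| "comp vs d (TLen w) = measure_length w d"
| "comp vs d (TSum n f) = seq (comp vs (d + 1) n)
     (seq (while_pos (d + 1) (seq (decr (d + 1)) (seq (comp ((d + 2) # vs) (d + 3) f)
        (seq (transfer (d + 3) d) (incr (d + 2))))))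
      (clear (d + 2)))"
| "comp vs d (TRec c n s) = seq (comp vs (d + 1) n)
     (seq (while_pos (d + 1) (seq (decr (d + 1)) (seq (comp ((d + 2) # d # vs) (d + 3) s)
        (seq (comp vs (d + 4) c) (seq (clear d) (seq (transfer_min (d + 3) (d + 4) d)
          (incr (d + 2))))))))
      (clear (d + 2)))"
| "comp vs d (TLet a f) = seq (comp vs d a) (seq (comp (d # vs) (Suc d) f)
     (seq (clear d) (transfer (Suc d) d)))"

lemma machine_comp [simp]: "machine m (comp vs d t)"
  by (induction t arbitrary: vs d) simp_all

lemma env_upd: "\<forall>v \<in> set vs. v < d \<Longrightarrow> d \<le> r \<Longrightarrow> env vs (\<rho>(r := x)) = env vs \<rho>"
  unfolding env_def by (force simp: fun_eq_iff dest: nth_mem)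

lemma env_Cons: "env (r # vs) \<rho> = case_nat (\<rho> r) (env vs \<rho>)"
  unfolding env_def by (auto simp: fun_eq_iff split: nat.splits)

text \<open>The contract of compiled code: variables live below \<open>d\<close>, everything from
  \<open>d\<close> on is 0, and the input heads rest on cell 0. Afterwards only register
  \<open>d\<close> has changed. Since scratch registers are returned to 0, the code of subterms can
  be nested.\<close>

definition computed_in :: "trm \<Rightarrow> (nat \<Rightarrow> nat) \<Rightarrow> bool" where
  "computed_in t g \<longleftrightarrow> (\<forall>X S vs d \<rho> J. bounded_by S X (env vs \<rho>) \<longrightarrow> (\<forall>v \<in> set vs. v < d) \<longrightarrow>
     (\<forall>r \<ge> d. \<rho> r = 0) \<longrightarrow> reg (d + width t) \<le> m \<longrightarrow>
     runs m (comp vs d t) (lay J X (\<lambda>_. 0) \<rho>) (g S)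
       (lay J X (\<lambda>_. 0) (\<rho>(d := ev X (env vs \<rho>) t))))"

lemma computed_inD:
  assumes "computed_in t g" "bounded_by S X (env vs \<rho>)" "\<forall>v \<in> set vs. v < d" "\<forall>r \<ge> d. \<rho> r = 0"
    "reg (d + width t) \<le> m" "env vs \<rho> = e"
  shows "runs m (comp vs d t) (lay J X (\<lambda>_. 0) \<rho>) (g S) (lay J X (\<lambda>_. 0) (\<rho>(d := ev X e t)))"
  using assms unfolding computed_in_def by blast

lemma upd_zero: "\<rho> r = 0 \<Longrightarrow> \<rho>(r := 0) = (\<rho> :: nat \<Rightarrow> nat)"
  by auto

lemma comp_sum:
  assumes n: "computed_in n gn" "\<And>X S e. bounded_by S X e \<Longrightarrow> ev X e n \<le> hn S"
    and f: "computed_in f gf" "\<And>X S e. bounded_by S X e \<Longrightarrow> ev X e f \<le> hf S"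
    and p: "poly_bounded gn" "poly_bounded hn" "poly_bounded gf" "poly_bounded hf"
  shows "computed_in (TSum n f) (\<lambda>S. gn S + ((hn S * Suc (1 + (gf (S + hn S) +
    ((3 * hf (S + hn S) + 1) + 1))) + 1) + (2 * hn S + 1)))"
  unfolding computed_in_def
proof (intro allI impI)
  fix X S vs d \<rho> J
  assume b: "bounded_by S X (env vs \<rho>)" and vs: "\<forall>v \<in> set vs. v < d" and z: "\<forall>r \<ge> d. \<rho> r = 0"
    and w: "reg (d + width (TSum n f)) \<le> m"
  let ?e = "env vs \<rho>" and ?S = "S + hn S"
  let ?N = "ev X ?e n" and ?F = "\<lambda>i. ev X (case_nat i ?e) f"
  let ?lay = "\<lambda>\<rho>. lay J X (\<lambda>_. 0) \<rho>"
  have N: "?N \<le> hn S" using n(2)[OF b] .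
  \<comment> \<open>The loop invariant: \<open>d\<close> holds the partial sum, \<open>d + 1\<close>
    the number of remaining rounds, and \<open>d + 2\<close> the index, which is also the register
    of the bound variable.\<close>
  let ?\<rho> = "\<lambda>i. \<rho>(d := (\<Sum>k<i. ?F k), d + 1 := ?N - i, d + 2 := i)"
  have 1: "runs m (comp vs (d + 1) n) (?lay \<rho>) (gn S) (?lay (?\<rho> 0))"
  proof -
    have "runs m (comp vs (d + 1) n) (?lay \<rho>) (gn S) (?lay (\<rho>(d + 1 := ?N)))"
      using vs z w by (intro computed_inD[OF n(1) b]) auto
    moreover have "\<rho>(d + 1 := ?N) = ?\<rho> 0" using z by (auto simp: fun_eq_iff)
    ultimately show ?thesis by simp
  qed
  have 2: "runs m (while_pos (d + 1) (seq (decr (d + 1)) (seq (comp ((d + 2) # vs) (d + 3) f)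
        (seq (transfer (d + 3) d) (incr (d + 2)))))) (?lay (?\<rho> 0))
      (?N * Suc (1 + (gf ?S + ((3 * hf ?S + 1) + 1))) + 1) (?lay (?\<rho> ?N))"
  proof (rule runs_while_pos[where h = "\<lambda>_ _. 0" and \<rho> = ?\<rho>])
    fix i assume i: "i < ?N"
    let ?\<rho>1 = "(?\<rho> i)(d + 1 := ?\<rho> i (d + 1) - 1)"
    have e: "env ((d + 2) # vs) ?\<rho>1 = case_nat i ?e"
      unfolding env_Cons using vs by (simp add: env_upd)
    have bi: "bounded_by ?S X (case_nat i ?e)"
      using i N by (intro bounded_by_case_nat[OF b]) auto
    have "runs m (decr (d + 1)) (?lay (?\<rho> i)) 1 (?lay ?\<rho>1)"
      using w by (intro runs_decr) simp
    moreover have "runs m (comp ((d + 2) # vs) (d + 3) f) (?lay ?\<rho>1) (gf ?S) (?lay (?\<rho>1(d + 3 := ?F i)))"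
      using vs z w by (intro computed_inD[OF f(1)]) (auto simp only: e bi, auto)
    moreover have "runs m (transfer (d + 3) d) (?lay (?\<rho>1(d + 3 := ?F i))) (3 * hf ?S + 1)
        (?lay ((?\<rho>1(d + 3 := ?F i))(d + 3 := 0, d := (\<Sum>k<i. ?F k) + ?F i)))"
      using runs_transfer[of "d + 3" d J X "\<lambda>_. 0" "?\<rho>1(d + 3 := ?F i)"] w f(2)[OF bi]
      by (auto elim!: runs_mono)
    moreover have "runs m (incr (d + 2)) (?lay ((?\<rho>1(d + 3 := ?F i))(d + 3 := 0, d := (\<Sum>k<i. ?F k) + ?F i)))
        1 (?lay (?\<rho> (Suc i)))"
    proof -
      have "((?\<rho>1(d + 3 := ?F i))(d + 3 := 0, d := (\<Sum>k<i. ?F k) + ?F i))(d + 2 := Suc i) = ?\<rho> (Suc i)"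
        using z by (auto simp: fun_eq_iff)
      then show ?thesis
        using runs_incr[of "d + 2" J X "\<lambda>_. 0"
            "(?\<rho>1(d + 3 := ?F i))(d + 3 := 0, d := (\<Sum>k<i. ?F k) + ?F i)"] w by simp
    qed
    ultimately show "runs m (seq (decr (d + 1)) (seq (comp ((d + 2) # vs) (d + 3) f)
        (seq (transfer (d + 3) d) (incr (d + 2))))) (?lay (?\<rho> i))
        (1 + (gf ?S + ((3 * hf ?S + 1) + 1))) (?lay (?\<rho> (Suc i)))"
      by (intro runs_seq)
  qed (use w in simp_all)
  have 3: "runs m (clear (d + 2)) (?lay (?\<rho> ?N)) (2 * hn S + 1)
      (?lay (\<rho>(d := ev X ?e (TSum n f))))"
  proof -
    have "(?\<rho> ?N)(d + 2 := 0) = \<rho>(d := ev X ?e (TSum n f))" using z by (auto simp: fun_eq_iff)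
    then show ?thesis using runs_clear[of "d + 2" J X "\<lambda>_. 0" "?\<rho> ?N"] w N
      by (auto elim!: runs_mono)
  qed
  have "runs m (comp vs d (TSum n f)) (?lay \<rho>)
      (gn S + ((?N * Suc (1 + (gf ?S + ((3 * hf ?S + 1) + 1))) + 1) + (2 * hn S + 1)))
      (?lay (\<rho>(d := ev X ?e (TSum n f))))"
    unfolding comp.simps by (rule runs_seq[OF 1 runs_seq[OF 2 3]])
  then show "runs m (comp vs d (TSum n f)) (?lay \<rho>)
      (gn S + ((hn S * Suc (1 + (gf ?S + ((3 * hf ?S + 1) + 1))) + 1) + (2 * hn S + 1)))
      (?lay (\<rho>(d := ev X ?e (TSum n f))))"
    by (rule runs_mono) (intro add_mono mult_right_mono N order.refl, simp)
qed

lemma comp_rec: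
  assumes n: "computed_in n gn" "\<And>X S e. bounded_by S X e \<Longrightarrow> ev X e n \<le> hn S"
    and f: "computed_in f gf" "\<And>X S e. bounded_by S X e \<Longrightarrow> ev X e f \<le> hf S"
    and c: "computed_in c gc" "\<And>X S e. bounded_by S X e \<Longrightarrow> ev X e c \<le> hc S"
    and p: "poly_bounded gn" "poly_bounded hn" "poly_bounded gf" "poly_bounded hf"
  shows "computed_in (TRec c n f) (\<lambda>S. gn S + ((hn S * Suc (1 + (gf (S + hn S + hc S) +
    (gc S + ((2 * hc S + 1) + ((3 * hf (S + hn S + hc S) + 2 * hc S + 2) + 1))))) + 1)
    + (2 * hn S + 1)))"
  unfolding computed_in_def
proof (intro allI impI)
  fix X S vs d \<rho> J
  assume b: "bounded_by S X (env vs \<rho>)" and vs: "\<forall>v \<in> set vs. v < d" and z: "\<forall>r \<ge> d. \<rho> r = 0"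
    and w: "reg (d + width (TRec c n f)) \<le> m"
  let ?e = "env vs \<rho>" and ?S = "S + hn S + hc S"
  let ?N = "ev X ?e n" and ?C = "ev X ?e c" and ?F = "\<lambda>i a. ev X (case_nat i (case_nat a ?e)) f"
  let ?A = "\<lambda>i. rec_nat 0 (\<lambda>i a. min ?C (?F i a)) i"
  let ?lay = "\<lambda>\<rho>. lay J X (\<lambda>_. 0) \<rho>"
  have N: "?N \<le> hn S" using n(2)[OF b] .
  have C: "?C \<le> hc S" using c(2)[OF b] .
  have A: "?A i \<le> hc S" for i using rec_min_le C by (rule le_trans)
  \<comment> \<open>As for sums, except that \<open>d\<close> holds the current value of the
    recursion and is a second bound variable. The bound \<open>c\<close> is evaluated afresh in
    every round, since \<open>transfer_min\<close> consumes it.\<close>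
  let ?\<rho> = "\<lambda>i. \<rho>(d := ?A i, d + 1 := ?N - i, d + 2 := i)"
  let ?T = "1 + (gf ?S + (gc S + ((2 * hc S + 1) + ((3 * hf ?S + 2 * hc S + 2) + 1))))"
  have 1: "runs m (comp vs (d + 1) n) (?lay \<rho>) (gn S) (?lay (?\<rho> 0))"
  proof -
    have "runs m (comp vs (d + 1) n) (?lay \<rho>) (gn S) (?lay (\<rho>(d + 1 := ?N)))"
      using vs z w by (intro computed_inD[OF n(1) b]) auto
    moreover have "\<rho>(d + 1 := ?N) = ?\<rho> 0" using z by (auto simp: fun_eq_iff)
    ultimately show ?thesis by simp
  qed
  have 2: "runs m (while_pos (d + 1) (seq (decr (d + 1)) (seq (comp ((d + 2) # d # vs) (d + 3) f)
        (seq (comp vs (d + 4) c) (seq (clear d) (seq (transfer_min (d + 3) (d + 4) d)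
          (incr (d + 2)))))))) (?lay (?\<rho> 0)) (?N * Suc ?T + 1) (?lay (?\<rho> ?N))"
  proof (rule runs_while_pos[where h = "\<lambda>_ _. 0" and \<rho> = ?\<rho>])
    fix i assume i: "i < ?N"
    let ?\<rho>1 = "(?\<rho> i)(d + 1 := ?\<rho> i (d + 1) - 1)"
    let ?V = "?F i (?A i)"
    let ?\<rho>2 = "?\<rho>1(d + 3 := ?V)"
    let ?\<rho>3 = "?\<rho>2(d + 4 := ?C)"
    let ?\<rho>4 = "?\<rho>3(d := 0)"
    let ?\<rho>5 = "?\<rho>4(d + 3 := 0, d + 4 := 0, d := min ?C ?V)"
    have e: "env ((d + 2) # d # vs) ?\<rho>1 = case_nat i (case_nat (?A i) ?e)"
      unfolding env_Cons using vs by (simp add: env_upd)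
    have bi: "bounded_by ?S X (case_nat i (case_nat (?A i) ?e))"
      using i N A[of i] by (intro bounded_by_case_nat[of ?S] bounded_by_case_nat[OF b]) auto
    have e2: "env vs ?\<rho>2 = ?e" using vs by (simp add: env_upd)
    have "runs m (decr (d + 1)) (?lay (?\<rho> i)) 1 (?lay ?\<rho>1)"
      using w by (intro runs_decr) simp
    moreover have "runs m (comp ((d + 2) # d # vs) (d + 3) f) (?lay ?\<rho>1) (gf ?S) (?lay ?\<rho>2)"
      using vs z w by (intro computed_inD[OF f(1)]) (auto simp only: e bi, auto)
    moreover have "runs m (comp vs (d + 4) c) (?lay ?\<rho>2) (gc S) (?lay ?\<rho>3)"
      using vs z w by (intro computed_inD[OF c(1)]) (auto simp only: e2 b, auto)
    moreover have "runs m (clear d) (?lay ?\<rho>3) (2 * hc S + 1) (?lay ?\<rho>4)"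
      using runs_clear[of d J X "\<lambda>_. 0" ?\<rho>3] w A[of i] by (auto elim!: runs_mono)
    moreover have "runs m (transfer_min (d + 3) (d + 4) d) (?lay ?\<rho>4) (3 * hf ?S + 2 * hc S + 2)
        (?lay ?\<rho>5)"
    proof -
      have "?\<rho>4 (d + 3) \<le> hf ?S" "?\<rho>4 (d + 4) \<le> hc S" using f(2)[OF bi] C by simp_all
      then have T: "3 * ?\<rho>4 (d + 3) + 2 * ?\<rho>4 (d + 4) + 2 \<le> 3 * hf ?S + 2 * hc S + 2" by linarith
      have "runs m (transfer_min (d + 3) (d + 4) d) (?lay ?\<rho>4)
          (3 * ?\<rho>4 (d + 3) + 2 * ?\<rho>4 (d + 4) + 2)
          (?lay (?\<rho>4(d + 3 := 0, d + 4 := 0, d := min (?\<rho>4 (d + 4)) (?\<rho>4 (d + 3)))))"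
        using w by (intro runs_transfer_min) simp_all
      then show ?thesis using T by (auto elim!: runs_mono)
    qed
    moreover have "runs m (incr (d + 2)) (?lay ?\<rho>5) 1 (?lay (?\<rho> (Suc i)))"
    proof -
      have "?\<rho>5(d + 2 := Suc (?\<rho>5 (d + 2))) = ?\<rho> (Suc i)" using z by (auto simp: fun_eq_iff)
      then show ?thesis using runs_incr[of "d + 2" J X "\<lambda>_. 0" ?\<rho>5] w by simp
    qed
    ultimately show "runs m (seq (decr (d + 1)) (seq (comp ((d + 2) # d # vs) (d + 3) f)
        (seq (comp vs (d + 4) c) (seq (clear d) (seq (transfer_min (d + 3) (d + 4) d)
          (incr (d + 2))))))) (?lay (?\<rho> i)) ?T (?lay (?\<rho> (Suc i)))"
      by (intro runs_seq)
  qed (use w in simp_all)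
  have 3: "runs m (clear (d + 2)) (?lay (?\<rho> ?N)) (2 * hn S + 1)
      (?lay (\<rho>(d := ev X ?e (TRec c n f))))"
  proof -
    have "(?\<rho> ?N)(d + 2 := 0) = \<rho>(d := ev X ?e (TRec c n f))" using z by (auto simp: fun_eq_iff)
    then show ?thesis using runs_clear[of "d + 2" J X "\<lambda>_. 0" "?\<rho> ?N"] w N
      by (auto elim!: runs_mono)
  qed
  have "runs m (comp vs d (TRec c n f)) (?lay \<rho>)
      (gn S + ((?N * Suc ?T + 1) + (2 * hn S + 1))) (?lay (\<rho>(d := ev X ?e (TRec c n f))))"
    unfolding comp.simps by (rule runs_seq[OF 1 runs_seq[OF 2 3]])
  then show "runs m (comp vs d (TRec c n f)) (?lay \<rho>)
      (gn S + ((hn S * Suc ?T + 1) + (2 * hn S + 1))) (?lay (\<rho>(d := ev X ?e (TRec c n f))))"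
    by (rule runs_mono) (intro add_mono mult_right_mono N order.refl, simp)
qed

lemma comp_binary:
  assumes s: "computed_in s gs" and t: "computed_in t gt"
    and "\<And>X S e. bounded_by S X e \<Longrightarrow> ev X e t \<le> ht S"
  shows "computed_in (TAdd s t) (\<lambda>S. gs S + (gt S + (3 * ht S + 1)))"
    and "computed_in (TSub s t) (\<lambda>S. gs S + (gt S + (3 * ht S + 1)))"
proof -
  have "runs m (comp vs d (TAdd s t)) (lay J X (\<lambda>_. 0) \<rho>) (gs S + (gt S + (3 * ht S + 1)))
        (lay J X (\<lambda>_. 0) (\<rho>(d := ev X (env vs \<rho>) (TAdd s t)))) \<and>
      runs m (comp vs d (TSub s t)) (lay J X (\<lambda>_. 0) \<rho>) (gs S + (gt S + (3 * ht S + 1)))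
        (lay J X (\<lambda>_. 0) (\<rho>(d := ev X (env vs \<rho>) (TSub s t))))"
    if b: "bounded_by S X (env vs \<rho>)" and vs: "\<forall>v \<in> set vs. v < d" and z: "\<forall>r \<ge> d. \<rho> r = 0"
      and w: "reg (d + (width s + width t + 2)) \<le> m" for X S vs d \<rho> J
  proof -
    let ?e = "env vs \<rho>" and ?lay = "\<lambda>\<rho>. lay J X (\<lambda>_. 0) \<rho>"
    let ?\<rho>1 = "\<rho>(d := ev X ?e s)"
    let ?\<rho>2 = "?\<rho>1(Suc d := ev X ?e t)"
    have e: "env vs ?\<rho>1 = ?e" using vs by (simp add: env_upd)
    have 1: "runs m (comp vs d s) (?lay \<rho>) (gs S) (?lay ?\<rho>1)"
      using vs z w by (intro computed_inD[OF s b]) auto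
    have 2: "runs m (comp vs (Suc d) t) (?lay ?\<rho>1) (gt S) (?lay ?\<rho>2)"
      using vs z w by (intro computed_inD[OF t]) (auto simp only: e b, auto)
    have T: "3 * ?\<rho>2 (Suc d) + 1 \<le> 3 * ht S + 1" using assms(3)[OF b] by simp
    have "?\<rho>2(Suc d := 0, d := ?\<rho>2 d + ?\<rho>2 (Suc d)) = \<rho>(d := ev X ?e (TAdd s t))"
      using z by (auto simp: fun_eq_iff)
    then have 3: "runs m (transfer (Suc d) d) (?lay ?\<rho>2) (3 * ht S + 1)
        (?lay (\<rho>(d := ev X ?e (TAdd s t))))"
      using runs_mono[OF runs_transfer[of "Suc d" d J X "\<lambda>_. 0" ?\<rho>2] T] w by simp
    have "?\<rho>2(Suc d := 0, d := ?\<rho>2 d - ?\<rho>2 (Suc d)) = \<rho>(d := ev X ?e (TSub s t))"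
      using z by (auto simp: fun_eq_iff)
    then have 4: "runs m (subtract (Suc d) d) (?lay ?\<rho>2) (3 * ht S + 1)
        (?lay (\<rho>(d := ev X ?e (TSub s t))))"
      using runs_mono[OF runs_subtract[of "Suc d" d J X "\<lambda>_. 0" ?\<rho>2] T] w by simp
    show ?thesis unfolding comp.simps by (intro conjI runs_seq[OF 1] runs_seq[OF 2] 3 4)
  qed
  then show "computed_in (TAdd s t) (\<lambda>S. gs S + (gt S + (3 * ht S + 1)))"
    "computed_in (TSub s t) (\<lambda>S. gs S + (gt S + (3 * ht S + 1)))"
    unfolding computed_in_def width.simps by blast+
qed

lemma comp_let:
  assumes s: "computed_in s gs" and t: "computed_in t gt"
    and hs: "\<And>X S e. bounded_by S X e \<Longrightarrow> ev X e s \<le> hs S"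
    and ht: "\<And>X S e. bounded_by S X e \<Longrightarrow> ev X e t \<le> ht S"
  shows "computed_in (TLet s t)
    (\<lambda>S. gs S + (gt (S + hs S) + ((2 * hs S + 1) + (3 * ht (S + hs S) + 1))))"
  unfolding computed_in_def
proof (intro allI impI)
  fix X S vs d \<rho> J
  assume b: "bounded_by S X (env vs \<rho>)" and vs: "\<forall>v \<in> set vs. v < d" and z: "\<forall>r \<ge> d. \<rho> r = 0"
    and w: "reg (d + width (TLet s t)) \<le> m"
  let ?e = "env vs \<rho>" and ?lay = "\<lambda>\<rho>. lay J X (\<lambda>_. 0) \<rho>" and ?S = "S + hs S"
  let ?\<rho>1 = "\<rho>(d := ev X ?e s)"
  let ?e1 = "case_nat (ev X ?e s) ?e"
  let ?\<rho>2 = "?\<rho>1(Suc d := ev X ?e1 t)"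
  have e: "env (d # vs) ?\<rho>1 = ?e1" unfolding env_Cons using vs by (simp add: env_upd)
  have b1: "bounded_by ?S X ?e1" using hs[OF b] by (intro bounded_by_case_nat[OF b]) auto
  have 1: "runs m (comp vs d s) (?lay \<rho>) (gs S) (?lay ?\<rho>1)"
    using vs z w by (intro computed_inD[OF s b]) auto
  have 2: "runs m (comp (d # vs) (Suc d) t) (?lay ?\<rho>1) (gt ?S) (?lay ?\<rho>2)"
    using vs z w by (intro computed_inD[OF t]) (auto simp only: e b1, auto)
  have 3: "runs m (clear d) (?lay ?\<rho>2) (2 * hs S + 1) (?lay (?\<rho>2(d := 0)))"
    using runs_clear[of d J X "\<lambda>_. 0" ?\<rho>2] w hs[OF b] by (auto elim!: runs_mono)
  have "?\<rho>2(d := 0, Suc d := 0, d := ev X ?e1 t) = \<rho>(d := ev X ?e (TLet s t))"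
    using z by (auto simp: fun_eq_iff)
  then have 4: "runs m (transfer (Suc d) d) (?lay (?\<rho>2(d := 0))) (3 * ht ?S + 1)
      (?lay (\<rho>(d := ev X ?e (TLet s t))))"
    using runs_mono[OF runs_transfer[of "Suc d" d J X "\<lambda>_. 0" "?\<rho>2(d := 0)"], of "3 * ht ?S + 1"]
      w ht[OF b1] by simp
  show "runs m (comp vs d (TLet s t)) (?lay \<rho>)
      (gs S + (gt ?S + ((2 * hs S + 1) + (3 * ht ?S + 1)))) (?lay (\<rho>(d := ev X ?e (TLet s t))))"
    unfolding comp.simps by (rule runs_seq[OF 1 runs_seq[OF 2 runs_seq[OF 3 4]]])
qed

lemma comp_var: "computed_in (TVar k) (\<lambda>S. 7 * S + 2)"
  unfolding computed_in_def
proof (intro allI impI)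
  fix X S vs d \<rho> J
  assume b: "bounded_by S X (env vs \<rho>)" and vs: "\<forall>v \<in> set vs. v < d" and z: "\<forall>r \<ge> d. \<rho> r = 0"
    and w: "reg (d + width (TVar k)) \<le> m"
  show "runs m (comp vs d (TVar k)) (lay J X (\<lambda>_. 0) \<rho>) (7 * S + 2)
      (lay J X (\<lambda>_. 0) (\<rho>(d := ev X (env vs \<rho>) (TVar k))))"
  proof (cases "k < length vs")
    case True
    then have k: "vs ! k < d" using vs by simp
    have "\<rho> (vs ! k) \<le> S" using b True unfolding bounded_by_def env_def by metis
    then show ?thesis
      using True runs_copy[of "vs ! k" d "Suc d" \<rho> J X "\<lambda>_. 0"] k z w
      by (auto simp: env_def elim!: runs_mono)
  next
    case False
    then have "\<rho>(d := ev X (env vs \<rho>) (TVar k)) = \<rho>" using z by (auto simp: env_def)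
    then show ?thesis using runs_mono[OF runs_nop[of J X "\<lambda>_. 0" \<rho>], of "7 * S + 2"] False by simp
  qed
qed

lemma comp_correct: "\<exists>g. poly_bounded g \<and> computed_in t g"
proof (induction t)
  case (TVar k)
  have "poly_bounded (\<lambda>S. 7 * S + 2)" by (intro poly_bounded_intros)
  then show ?case using comp_var by blast
next
  case TZero
  have "computed_in TZero (\<lambda>_. 1)"
    unfolding computed_in_def using runs_nop by (simp add: upd_zero)
  then show ?case using poly_bounded_const by blast
next
  case TOne
  have "computed_in TOne (\<lambda>_. 1)" unfolding computed_in_def
  proof (intro allI impI)
    fix X S vs d J and \<rho> :: "nat \<Rightarrow> nat"
    assume z: "\<forall>r \<ge> d. \<rho> r = 0" and w: "reg (d + width TOne) \<le> m"
    then show "runs m (comp vs d TOne) (lay J X (\<lambda>_. 0) \<rho>) 1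
        (lay J X (\<lambda>_. 0) (\<rho>(d := ev X (env vs \<rho>) TOne)))"
      using runs_incr[of d J X "\<lambda>_. 0" \<rho>] by simp
  qed
  then show ?case using poly_bounded_const by blast
next
  case (TAdd s t)
  then obtain gs gt where g: "poly_bounded gs" "computed_in s gs" "poly_bounded gt" "computed_in t gt"
    by blast
  obtain h where h: "poly_bounded h" "\<And>X S e. bounded_by S X e \<Longrightarrow> ev X e t \<le> h S"
    using ev_bounded[of t] by blast
  have "poly_bounded (\<lambda>S. gs S + (gt S + (3 * h S + 1)))" by (intro poly_bounded_intros g h)
  moreover have "computed_in (TAdd s t) (\<lambda>S. gs S + (gt S + (3 * h S + 1)))"
    by (rule comp_binary(1)[OF g(2,4)]) (rule h(2))
  ultimately show ?case by blast
next
  case (TSub s t)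
  then obtain gs gt where g: "poly_bounded gs" "computed_in s gs" "poly_bounded gt" "computed_in t gt"
    by blast
  obtain h where h: "poly_bounded h" "\<And>X S e. bounded_by S X e \<Longrightarrow> ev X e t \<le> h S"
    using ev_bounded[of t] by blast
  have "poly_bounded (\<lambda>S. gs S + (gt S + (3 * h S + 1)))" by (intro poly_bounded_intros g h)
  moreover have "computed_in (TSub s t) (\<lambda>S. gs S + (gt S + (3 * h S + 1)))"
    by (rule comp_binary(2)[OF g(2,4)]) (rule h(2))
  ultimately show ?case by blast
next
  case (TBit w t)
  then obtain g where g: "poly_bounded g" "computed_in t g" by blast
  obtain h where h: "poly_bounded h" "\<And>X S e. bounded_by S X e \<Longrightarrow> ev X e t \<le> h S"
    using ev_bounded[of t] by blast
  have "computed_in (TBit w t) (\<lambda>S. g S + (7 * h S + 3))"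
    unfolding computed_in_def
  proof (intro allI impI)
    fix X S vs d \<rho> J
    assume b: "bounded_by S X (env vs \<rho>)" and vs: "\<forall>v \<in> set vs. v < d" and z: "\<forall>r \<ge> d. \<rho> r = 0"
      and w: "reg (d + width (TBit w t)) \<le> m"
    let ?e = "env vs \<rho>" and ?lay = "\<lambda>\<rho>. lay J X (\<lambda>_. 0) \<rho>"
    let ?\<rho>1 = "\<rho>(d := ev X ?e t)"
    have 1: "runs m (comp vs d t) (?lay \<rho>) (g S) (?lay ?\<rho>1)"
      using vs z w by (intro computed_inD[OF g(2) b]) auto
    have "?\<rho>1(d := of_bool (?\<rho>1 d < length (component w X) \<and> component w X ! ?\<rho>1 d))
        = \<rho>(d := ev X ?e (TBit w t))" by simp
    then have 2: "runs m (fetch_bit w d) (?lay ?\<rho>1) (7 * h S + 3) (?lay (\<rho>(d := ev X ?e (TBit w t))))"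
      using runs_mono[OF runs_fetch_bit[of d ?\<rho>1 "\<lambda>_. 0" w J X], of "7 * h S + 3"]
        w z h(2)[OF b] by simp
    show "runs m (comp vs d (TBit w t)) (?lay \<rho>) (g S + (7 * h S + 3))
        (?lay (\<rho>(d := ev X ?e (TBit w t))))"
      unfolding comp.simps by (rule runs_seq[OF 1 2])
  qed
  moreover have "poly_bounded (\<lambda>S. g S + (7 * h S + 3))" by (intro poly_bounded_intros g h)
  ultimately show ?case by blast
next
  case (TLen w)
  have "computed_in (TLen w) (\<lambda>S. 7 * S + 2)"
    unfolding computed_in_def
  proof (intro allI impI)
    fix X S vs d \<rho> J
    assume b: "bounded_by S X (env vs \<rho>)" and z: "\<forall>r \<ge> d. \<rho> r = 0"
      and w: "reg (d + width (TLen w)) \<le> m"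
    show "runs m (comp vs d (TLen w)) (lay J X (\<lambda>_. 0) \<rho>) (7 * S + 2)
        (lay J X (\<lambda>_. 0) (\<rho>(d := ev X (env vs \<rho>) (TLen w))))"
      using runs_mono[OF runs_measure_length[of d \<rho> "\<lambda>_. 0" w J X], of "7 * S + 2"]
        w z length_component[OF b, of w] by simp
  qed
  moreover have "poly_bounded (\<lambda>S. 7 * S + 2)" by (intro poly_bounded_intros)
  ultimately show ?case by blast
next
  case (TSum n f)
  then obtain gn gf where g: "poly_bounded gn" "computed_in n gn" "poly_bounded gf" "computed_in f gf"
    by blast
  obtain hn where hn: "poly_bounded hn" "\<And>X S e. bounded_by S X e \<Longrightarrow> ev X e n \<le> hn S"
    using ev_bounded[of n] by blast
  obtain hf where hf: "poly_bounded hf" "\<And>X S e. bounded_by S X e \<Longrightarrow> ev X e f \<le> hf S"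
    using ev_bounded[of f] by blast
  have "poly_bounded (\<lambda>S. gn S + ((hn S * (1 + (1 + (gf (S + hn S) +
    ((3 * hf (S + hn S) + 1) + 1)))) + 1) + (2 * hn S + 1)))"
    by (intro poly_bounded_intros poly_bounded_compose[OF g(3)] poly_bounded_compose[OF hf(1)] g hn)
  then show ?case using comp_sum[OF g(2) hn(2) g(4) hf(2) g(1) hn(1) g(3) hf(1)]
    unfolding Suc_eq_plus1_left by blast
next
  case (TRec c n f)
  then obtain gc gn gf where g: "poly_bounded gn" "computed_in n gn" "poly_bounded gf" "computed_in f gf"
    "poly_bounded gc" "computed_in c gc"
    by blast
  obtain hn where hn: "poly_bounded hn" "\<And>X S e. bounded_by S X e \<Longrightarrow> ev X e n \<le> hn S"
    using ev_bounded[of n] by blast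
  obtain hf where hf: "poly_bounded hf" "\<And>X S e. bounded_by S X e \<Longrightarrow> ev X e f \<le> hf S"
    using ev_bounded[of f] by blast
  obtain hc where hc: "poly_bounded hc" "\<And>X S e. bounded_by S X e \<Longrightarrow> ev X e c \<le> hc S"
    using ev_bounded[of c] by blast
  have "poly_bounded (\<lambda>S. gn S + ((hn S * (1 + (1 + (gf (S + hn S + hc S) +
    (gc S + ((2 * hc S + 1) + ((3 * hf (S + hn S + hc S) + 2 * hc S + 2) + 1)))))) + 1)
    + (2 * hn S + 1)))"
    by (intro poly_bounded_intros poly_bounded_compose[OF g(3)] poly_bounded_compose[OF hf(1)] g hn hc)
  moreover have "computed_in (TRec c n f) (\<lambda>S. gn S + ((hn S * Suc (1 + (gf (S + hn S + hc S) +
    (gc S + ((2 * hc S + 1) + ((3 * hf (S + hn S + hc S) + 2 * hc S + 2) + 1))))) + 1)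
    + (2 * hn S + 1)))"
    by (rule comp_rec[OF g(2) _ g(4) _ g(6) _ g(1) hn(1) g(3) hf(1)])
      (rule hn(2) hf(2) hc(2), assumption)+
  ultimately show ?case unfolding Suc_eq_plus1_left by blast
next
  case (TLet s t)
  then obtain gs gt where g: "poly_bounded gs" "computed_in s gs" "poly_bounded gt" "computed_in t gt"
    by blast
  obtain hs where hs: "poly_bounded hs" "\<And>X S e. bounded_by S X e \<Longrightarrow> ev X e s \<le> hs S"
    using ev_bounded[of s] by blast
  obtain ht where ht: "poly_bounded ht" "\<And>X S e. bounded_by S X e \<Longrightarrow> ev X e t \<le> ht S"
    using ev_bounded[of t] by blast
  have "poly_bounded (\<lambda>S. gs S + (gt (S + hs S) + ((2 * hs S + 1) + (3 * ht (S + hs S) + 1))))"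
    by (intro poly_bounded_intros poly_bounded_compose[OF g(3)] poly_bounded_compose[OF ht(1)] g hs)
  moreover have "computed_in (TLet s t)
      (\<lambda>S. gs S + (gt (S + hs S) + ((2 * hs S + 1) + (3 * ht (S + hs S) + 1))))"
    by (rule comp_let[OF g(2,4)]) (rule hs(2) ht(2), assumption)+
  ultimately show ?case by blast
qed

end


section \<open>Composing a machine with a term-defined string function\<close>

text \<open>A string is given by a term for its length and a term for its bits, whose variable 0 is
  the position. Each bit is computed from the inputs, so no intermediate string has to be
  stored.\<close>

definition string_of :: "trm \<Rightarrow> trm \<Rightarrow> inp \<Rightarrow> bool list" where
  "string_of tn tb X = map (\<lambda>i. ev X (case_nat i (\<lambda>_. 0)) tb \<noteq> 0) [0..<ev X (\<lambda>_. 0) tn]"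

definition put :: "nat \<Rightarrow> nat \<Rightarrow> ((nat \<Rightarrow> symbol) \<Rightarrow> symbol) \<Rightarrow> direction \<Rightarrow> tm" where
  "put m o1 f dir = basic m (\<lambda>i \<sigma>. if i = o1 then (f \<sigma>, dir) else (\<sigma> i, Stay))"

lemma machine_put [simp]: "machine m (put m o1 f dir)"
  by (simp add: put_def)

lemma runs_put:
  "runs m (put m o1 f dir) \<tau> 1 (\<tau>(o1 := act (f (reads m \<tau>), dir) (\<tau> o1)))"
  unfolding put_def
proof (rule runs_cong[OF runs_basic])
  fix i assume "i < m"
  then show "act (if i = o1 then (f (reads m \<tau>), dir) else (reads m \<tau> i, Stay)) (\<tau> i)
      = (\<tau>(o1 := act (f (reads m \<tau>), dir) (\<tau> o1))) i"
    by (cases "\<tau> i") (auto simp: reads_def)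
qed

context layout
begin

lemma lay_upd: "o1 < b \<Longrightarrow> (lay J X h \<rho>)(o1 := t) = lay (J(o1 := t)) X h \<rho>"
  by (auto simp: fun_eq_iff lay_def)

text \<open>The closing blank is written explicitly because the tape may still carry symbols of an
  earlier machine. A blank under the head of a register means that its value is positive, hence the
  test in \<open>put\<close>.\<close>

definition emit :: "nat \<Rightarrow> trm \<Rightarrow> trm \<Rightarrow> tm" where
  "emit o1 tn tb = seq (comp [] 0 tn) (seq
     (while_pos 0 (seq (decr 0) (seq (comp [1] 2 tb)
        (seq (put m o1 (\<lambda>\<sigma>. Some (\<sigma> (reg 2) = None)) MoveRight) (seq (clear 2) (incr 1))))))
     (seq (clear 1) (put m o1 (\<lambda>\<sigma>. None) Stay)))"

lemma machine_emit [simp]: "machine m (emit o1 tn tb)"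
  by (simp add: emit_def)

lemma runs_emit:
  assumes "reg (3 + width tn + width tb) \<le> m"
  shows "\<exists>g. poly_bounded g \<and> (\<forall>X S J c o1. o1 < b \<longrightarrow> J o1 = (c, 0) \<longrightarrow> bounded_by S X (\<lambda>_. 0) \<longrightarrow>
    (\<exists>t. holds_string t (string_of tn tb X) \<and>
       runs m (emit o1 tn tb) (lay J X (\<lambda>_. 0) (\<lambda>_. 0)) (g S)
         (lay (J(o1 := t)) X (\<lambda>_. 0) (\<lambda>_. 0))))"
proof -
  obtain gl where gl: "poly_bounded gl" "computed_in tn gl" using comp_correct by blast
  obtain gb where gb: "poly_bounded gb" "computed_in tb gb" using comp_correct by blast
  obtain hl where hl: "poly_bounded hl" "\<And>X S e. bounded_by S X e \<Longrightarrow> ev X e tn \<le> hl S"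
    using ev_bounded[of tn] by blast
  obtain hb where hb: "poly_bounded hb" "\<And>X S e. bounded_by S X e \<Longrightarrow> ev X e tb \<le> hb S"
    using ev_bounded[of tb] by blast
  define T where "T = (\<lambda>S. 1 + (gb (S + hl S) + (1 + ((2 * hb (S + hl S) + 1) + 1))))"
  define g where "g = (\<lambda>S. gl S + ((hl S * (1 + T S) + 1) + ((2 * hl S + 1) + 1)))"
  have "poly_bounded g"
    unfolding g_def T_def
    by (intro poly_bounded_intros poly_bounded_compose[OF gb(1)] poly_bounded_compose[OF hb(1)] gl hl)
  moreover have "\<exists>t. holds_string t (string_of tn tb X) \<and>
       runs m (emit o1 tn tb) (lay J X (\<lambda>_. 0) (\<lambda>_. 0)) (g S)
         (lay (J(o1 := t)) X (\<lambda>_. 0) (\<lambda>_. 0))"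
    if o: "o1 < b" and J: "J o1 = (c, 0)" and bd: "bounded_by S X (\<lambda>_. 0)" for X S J c o1
  proof -
    let ?N = "ev X (\<lambda>_. 0) tn" and ?B = "\<lambda>i. ev X (case_nat i (\<lambda>_. 0)) tb"
    have N: "?N \<le> hl S" using hl(2)[OF bd] .
    let ?t = "\<lambda>i. ((\<lambda>p. if 0 \<le> p \<and> nat p < i then Some (?B (nat p) \<noteq> 0) else c p), int i)"
    let ?\<rho> = "\<lambda>i. (\<lambda>_ :: nat. 0 :: nat)(0 := ?N - i, 1 := i)"
    let ?lay = "\<lambda>i. lay (J(o1 := ?t i)) X (\<lambda>_. 0) (?\<rho> i)"
    have J0: "J(o1 := ?t 0) = J" using J by (auto simp: fun_eq_iff)
    have 1: "runs m (comp [] 0 tn) (lay J X (\<lambda>_. 0) (\<lambda>_. 0)) (gl S) (?lay 0)"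
    proof -
      have e: "env [] \<rho> = (\<lambda>_. 0)" for \<rho> by (simp add: env_def fun_eq_iff)
      have "runs m (comp [] 0 tn) (lay J X (\<lambda>_. 0) (\<lambda>_. 0)) (gl S)
          (lay J X (\<lambda>_. 0) ((\<lambda>_. 0)(0 := ?N)))"
        using bd assms by (intro computed_inD[OF gl(2)]) (simp_all add: e)
      moreover have eq: "(\<lambda>_. 0)(0 := ?N) = ?\<rho> 0" by (simp add: fun_eq_iff)
      ultimately show ?thesis unfolding J0 by (simp only: eq)
    qed
    have 2: "runs m (while_pos 0 (seq (decr 0) (seq (comp [1] 2 tb)
        (seq (put m o1 (\<lambda>\<sigma>. Some (\<sigma> (reg 2) = None)) MoveRight) (seq (clear 2) (incr 1))))))
        (?lay 0) (?N * Suc (T S) + 1) (?lay ?N)"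
      unfolding while_pos_def
    proof (rule runs_loop_iter[where s = ?lay])
      fix i assume i: "i < ?N"
      then show "reads m (?lay i) (reg 0) = None" using assms by (subst reads_reg) simp_all
      let ?\<rho>1 = "(?\<rho> i)(0 := ?\<rho> i 0 - 1)"
      let ?\<rho>2 = "?\<rho>1(2 := ?B i)"
      let ?J = "J(o1 := ?t i)"
      have e: "env [1] ?\<rho>1 = case_nat i (\<lambda>_. 0)"
        unfolding env_Cons by (auto simp: env_def fun_eq_iff split: nat.splits)
      have bi: "bounded_by (S + hl S) X (case_nat i (\<lambda>_. 0))"
        using i N by (intro bounded_by_case_nat[OF bd]) auto
      have a: "runs m (decr 0) (?lay i) 1 (lay ?J X (\<lambda>_. 0) ?\<rho>1)"
        using assms by (intro runs_decr) simp
      have b': "runs m (comp [1] 2 tb) (lay ?J X (\<lambda>_. 0) ?\<rho>1) (gb (S + hl S))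
          (lay ?J X (\<lambda>_. 0) ?\<rho>2)"
        using assms by (intro computed_inD[OF gb(2)]) (auto simp only: e bi, auto)
      have c': "runs m (put m o1 (\<lambda>\<sigma>. Some (\<sigma> (reg 2) = None)) MoveRight)
          (lay ?J X (\<lambda>_. 0) ?\<rho>2) 1 (lay (J(o1 := ?t (Suc i))) X (\<lambda>_. 0) ?\<rho>2)"
      proof -
        let ?\<tau> = "lay ?J X (\<lambda>_. 0) ?\<rho>2"
        have "reads m ?\<tau> (reg 2) = None \<longleftrightarrow> ?B i \<noteq> 0"
          using assms by (subst reads_reg) simp_all
        moreover have "?\<tau> o1 = ?t i" using o by (simp add: lay_def)
        ultimately have "act (Some (reads m ?\<tau> (reg 2) = None), MoveRight) (?\<tau> o1) = ?t (Suc i)"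
          by (auto simp: fun_eq_iff)
        then have "?\<tau>(o1 := act (Some (reads m ?\<tau> (reg 2) = None), MoveRight) (?\<tau> o1))
            = lay (J(o1 := ?t (Suc i))) X (\<lambda>_. 0) ?\<rho>2"
          using o by (simp only: lay_upd fun_upd_upd)
        then show ?thesis using runs_put[of m o1 "\<lambda>\<sigma>. Some (\<sigma> (reg 2) = None)" MoveRight ?\<tau>] by simp
      qed
      have d: "runs m (clear 2) (lay (J(o1 := ?t (Suc i))) X (\<lambda>_. 0) ?\<rho>2) (2 * hb (S + hl S) + 1)
          (lay (J(o1 := ?t (Suc i))) X (\<lambda>_. 0) (?\<rho>2(2 := 0)))"
        using runs_mono[OF runs_clear[of 2 "J(o1 := ?t (Suc i))" X "\<lambda>_. 0" ?\<rho>2], of "2 * hb (S + hl S) + 1"]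
          assms hb(2)[OF bi] by simp
      have eq: "(?\<rho>2(2 := 0))(1 := Suc ((?\<rho>2(2 := 0)) 1)) = ?\<rho> (Suc i)" by (auto simp: fun_eq_iff)
      have "runs m (incr 1) (lay (J(o1 := ?t (Suc i))) X (\<lambda>_. 0) (?\<rho>2(2 := 0))) 1
          (lay (J(o1 := ?t (Suc i))) X (\<lambda>_. 0) ((?\<rho>2(2 := 0))(1 := Suc ((?\<rho>2(2 := 0)) 1))))"
        using assms by (intro runs_incr) simp
      then have e': "runs m (incr 1) (lay (J(o1 := ?t (Suc i))) X (\<lambda>_. 0) (?\<rho>2(2 := 0))) 1 (?lay (Suc i))"
        unfolding eq .
      show "runs m (seq (decr 0) (seq (comp [1] 2 tb)
          (seq (put m o1 (\<lambda>\<sigma>. Some (\<sigma> (reg 2) = None)) MoveRight) (seq (clear 2) (incr 1)))))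
          (?lay i) (T S) (?lay (Suc i))"
        unfolding T_def by (rule runs_seq[OF a runs_seq[OF b' runs_seq[OF c' runs_seq[OF d e']]]])
    next
      show "\<not> reads m (?lay ?N) (reg 0) = None" using assms by (subst reads_reg) simp_all
    qed simp
    have 3: "runs m (clear 1) (?lay ?N) (2 * hl S + 1) (lay (J(o1 := ?t ?N)) X (\<lambda>_. 0) (\<lambda>_. 0))"
    proof -
      have eq: "(?\<rho> ?N)(1 := 0) = (\<lambda>_. 0)" by (auto simp: fun_eq_iff)
      have "runs m (clear 1) (?lay ?N) (2 * ?\<rho> ?N 1 + 1) (lay (J(o1 := ?t ?N)) X (\<lambda>_. 0) ((?\<rho> ?N)(1 := 0)))"
        using assms by (intro runs_clear) simp
      then show ?thesis unfolding eq by (rule runs_mono) (use N in simp)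
    qed
    let ?t' = "((fst (?t ?N))(int ?N := None), int ?N)"
    have 4: "runs m (put m o1 (\<lambda>\<sigma>. None) Stay) (lay (J(o1 := ?t ?N)) X (\<lambda>_. 0) (\<lambda>_. 0)) 1
        (lay (J(o1 := ?t')) X (\<lambda>_. 0) (\<lambda>_. 0))"
    proof -
      let ?\<tau> = "lay (J(o1 := ?t ?N)) X (\<lambda>_. 0) (\<lambda>_. 0)"
      have "?\<tau> o1 = ?t ?N" using o unfolding lay_def by (simp only: if_True fun_upd_same)
      then have act: "act (None, Stay) (?\<tau> o1) = ?t'" by (simp only: act.simps move.simps fst_conv)
      have eq: "?\<tau>(o1 := act (None, Stay) (?\<tau> o1)) = lay (J(o1 := ?t')) X (\<lambda>_. 0) (\<lambda>_. 0)"
        unfolding act lay_upd[OF o] fun_upd_upd ..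
      show ?thesis using runs_put[of m o1 "\<lambda>\<sigma>. None" Stay ?\<tau>] unfolding eq .
    qed
    have "runs m (emit o1 tn tb) (lay J X (\<lambda>_. 0) (\<lambda>_. 0))
        (gl S + ((?N * Suc (T S) + 1) + ((2 * hl S + 1) + 1))) (lay (J(o1 := ?t')) X (\<lambda>_. 0) (\<lambda>_. 0))"
      unfolding emit_def by (rule runs_seq[OF 1 runs_seq[OF 2 runs_seq[OF 3 4]]])
    moreover have "gl S + ((?N * Suc (T S) + 1) + ((2 * hl S + 1) + 1)) \<le> g S"
      using mult_le_mono1[OF N, of "Suc (T S)"] unfolding g_def by simp
    ultimately have "runs m (emit o1 tn tb) (lay J X (\<lambda>_. 0) (\<lambda>_. 0)) (g S)
        (lay (J(o1 := ?t')) X (\<lambda>_. 0) (\<lambda>_. 0))" by (rule runs_mono)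
    moreover have "holds_string ?t' (string_of tn tb X)"
      by (simp add: holds_string_def string_of_def)
    ultimately show ?thesis by (intro exI[of _ ?t'] conjI)
  qed
  ultimately show ?thesis by (intro exI[of _ g] conjI allI impI)
qed

end

section \<open>Running a given machine and handing its outputs on\<close>

definition copy_in :: "nat \<Rightarrow> nat \<Rightarrow> nat \<Rightarrow> tm" where
  "copy_in m s d = seq (loop (\<lambda>\<sigma>. \<sigma> s \<noteq> None) (basic m (\<lambda>i \<sigma>.
       if i = s then (\<sigma> i, MoveRight) else if i = d then (\<sigma> s, MoveRight) else (\<sigma> i, Stay))))
     (seq (mover m (\<lambda>i \<sigma>. if i = s \<or> i = d then MoveLeft else Stay))
     (seq (loop (\<lambda>\<sigma>. \<sigma> d \<noteq> None) (mover m (\<lambda>i \<sigma>. if i = s \<or> i = d then MoveLeft else Stay)))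
       (mover m (\<lambda>i \<sigma>. if i = s \<or> i = d then MoveRight else Stay))))"

lemma machine_copy_in [simp]: "machine m (copy_in m s d)"
  by (simp add: copy_in_def)

text \<open>The way back is controlled by the target tape, which is blank to the left of cell 0. The
  source belongs to an arbitrary machine, which may have written there.\<close>

lemma runs_copy_in:
  assumes "s < m" "d < m" "s \<noteq> d" "\<tau> s = (c, 0)" "holds_string (\<tau> s) x" "\<tau> d = string_tape []"
  shows "runs m (copy_in m s d) \<tau> (4 * length x + 4) (\<tau>(d := string_tape x))"
proof -
  let ?n = "length x"
  let ?f = "\<lambda>i. \<tau>(s := (c, int i), d := (fst (string_tape (take i x)), int i))"
  let ?g = "\<lambda>i. \<tau>(s := (c, int ?n - 1 - int i), d := (fst (string_tape x), int ?n - 1 - int i))"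
  have c: "\<And>i. i < ?n \<Longrightarrow> c (int i) = Some (x ! i)" "c (int ?n) = None"
    using assms(4,5) by (auto simp: holds_string_def)
  have f0: "?f 0 = \<tau>" using assms by (auto simp: fun_eq_iff string_tape_def)
  have 1: "runs m (loop (\<lambda>\<sigma>. \<sigma> s \<noteq> None) (basic m (\<lambda>i \<sigma>.
       if i = s then (\<sigma> i, MoveRight) else if i = d then (\<sigma> s, MoveRight) else (\<sigma> i, Stay))))
     (?f 0) (?n * Suc 1 + 1) (?f ?n)"
  proof (rule runs_loop_iter[where s = ?f])
    fix i assume i: "i < ?n"
    then show "reads m (?f i) s \<noteq> None" using assms c by (simp add: reads_def)
    have rs: "reads m (?f i) s = Some (x ! i)" using i assms c by (simp add: reads_def)
    show "runs m (basic m (\<lambda>i \<sigma>.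
       if i = s then (\<sigma> i, MoveRight) else if i = d then (\<sigma> s, MoveRight) else (\<sigma> i, Stay)))
       (?f i) 1 (?f (Suc i))"
    proof (rule runs_cong[OF runs_basic])
      fix j assume j: "j < m"
      consider "j = s" | "j = d" | "j \<noteq> s" "j \<noteq> d" by blast
      then show "act (if j = s then (reads m (?f i) j, MoveRight)
          else if j = d then (reads m (?f i) s, MoveRight) else (reads m (?f i) j, Stay)) (?f i j)
          = ?f (Suc i) j"
      proof cases
        case 1
        then show ?thesis using assms c rs i by (auto simp: fun_eq_iff)
      next
        case 2
        then show ?thesis using assms rs i
          by (auto simp: fun_eq_iff string_tape_def min_def nth_append less_Suc_eq split: if_splits)
      next
        case 3
        then show ?thesis using j by (cases "\<tau> j") (auto simp: reads_def)
      qed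
    qed
  qed (use assms c in \<open>simp_all add: reads_def\<close>)
  have 2: "runs m (mover m (\<lambda>i \<sigma>. if i = s \<or> i = d then MoveLeft else Stay)) (?f ?n) 1 (?g 0)"
    by (rule runs_mover) (use assms in auto)
  have 3: "runs m (loop (\<lambda>\<sigma>. \<sigma> d \<noteq> None) (mover m (\<lambda>i \<sigma>. if i = s \<or> i = d then MoveLeft else Stay)))
     (?g 0) (?n * Suc 1 + 1) (?g ?n)"
  proof (rule runs_loop_iter[where s = ?g])
    fix i assume i: "i < ?n"
    then show "reads m (?g i) d \<noteq> None" using assms by (simp add: reads_def string_tape_def)
    show "runs m (mover m (\<lambda>i \<sigma>. if i = s \<or> i = d then MoveLeft else Stay)) (?g i) 1 (?g (Suc i))"
      by (rule runs_mover) (use assms in auto)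
  qed (use assms in \<open>simp_all add: reads_def string_tape_def\<close>)
  have 4: "runs m (mover m (\<lambda>i \<sigma>. if i = s \<or> i = d then MoveRight else Stay)) (?g ?n) 1
      (\<tau>(d := string_tape x))"
    by (rule runs_mover) (use assms in \<open>auto simp: string_tape_def\<close>)
  have "runs m (copy_in m s d) (?f 0) ((?n * Suc 1 + 1) + (1 + ((?n * Suc 1 + 1) + 1))) (\<tau>(d := string_tape x))"
    unfolding copy_in_def by (rule runs_seq[OF 1 runs_seq[OF 2 runs_seq[OF 3 4]]])
  then show ?thesis unfolding f0 by (rule runs_mono) simp
qed

text \<open>
  The lifted machine runs \<open>M\<close> next to a clock tape (which moves right in every step) and two rulers
  that follow the heads of tapes 0 and 1; these allow both heads to be returned to cell 0 afterwards.
\<close>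

definition lifted :: "nat \<Rightarrow> nat \<Rightarrow> tm \<Rightarrow> tm" where
  "lifted m k M = \<lparr>num_tapes = m, num_states = num_states M,
     delta = (\<lambda>q ss. let (q', as) = delta M q (take (num_tapes M) ss);
         dir = (\<lambda>j. if j < num_tapes M then snd (as ! j) else Stay) in
       (q', map (\<lambda>i. if i < num_tapes M then as ! i
          else (ss ! i, if i = k then MoveRight else if i = Suc k then dir 0
            else if i = Suc (Suc k) then dir 1 else Stay)) [0..<m]))\<rparr>"

lemma machine_lifted: "wf_tm M \<Longrightarrow> num_tapes M \<le> m \<Longrightarrow> machine m (lifted m k M)"
  unfolding machine_def wf_tm_def lifted_def
  by (auto simp: Let_def split: prod.splits) (metis fst_conv length_take min.absorb2)

lemma abs_move: "\<bar>move dir h - h\<bar> \<le> 1"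
  by (cases dir) auto

text \<open>The rulers copy the moves of heads 0 and 1 on tapes whose cell 0 is marked, so they know
  where these heads are. A head moves by at most one cell per step; hence the clock bounds both
  displacements.\<close>

lemma halts_lifted:
  assumes "wf_tm M" "num_tapes M \<le> k" "2 \<le> k" "k + 2 < m"
  shows "halts M c t ts' \<Longrightarrow> snd c = map \<tau> [0..<num_tapes M] \<Longrightarrow> \<tau> k = (marker, int n) \<Longrightarrow>
    \<tau> (Suc k) = (marker, snd (\<tau> 0)) \<Longrightarrow> \<tau> (Suc (Suc k)) = (marker, snd (\<tau> 1)) \<Longrightarrow>
    \<exists>\<tau>'. halts (lifted m k M) (fst c, map \<tau> [0..<m]) t (map \<tau>' [0..<m]) \<and>
      ts' = map \<tau>' [0..<num_tapes M] \<and> \<tau>' k = (marker, int (n + t)) \<and>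
      \<tau>' (Suc k) = (marker, snd (\<tau>' 0)) \<and> \<tau>' (Suc (Suc k)) = (marker, snd (\<tau>' 1)) \<and>
      \<bar>snd (\<tau>' 0) - snd (\<tau> 0)\<bar> \<le> int t \<and> \<bar>snd (\<tau>' 1) - snd (\<tau> 1)\<bar> \<le> int t \<and>
      (\<forall>i > k + 2. \<tau>' i = \<tau> i)"
proof (induction arbitrary: \<tau> n rule: halts.induct)
  case (halts_now ts)
  then show ?case
    using halts.halts_now[of "lifted m k M"] by (auto simp: lifted_def intro!: exI[of _ \<tau>])
next
  case (halts_step q ts t ts')
  let ?mt = "num_tapes M"
  have ts: "ts = map \<tau> [0..<?mt]" using halts_step.prems by simp
  obtain q' as where d: "delta M q (map (reads ?mt \<tau>) [0..<?mt]) = (q', as)"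
    by (cases "delta M q (map (reads ?mt \<tau>) [0..<?mt])")
  have las: "length as = ?mt"
    using assms(1) halts_step.hyps(1) d unfolding wf_tm_def by (metis length_map length_upt snd_conv diff_zero)
  define dir where "dir = (\<lambda>j. if j < ?mt then snd (as ! j) else Stay)"
  define \<alpha> where "\<alpha> = (\<lambda>i. if i < ?mt then as ! i
          else (reads m \<tau> i, if i = k then MoveRight else if i = Suc k then dir 0
            else if i = Suc (Suc k) then dir 1 else Stay))"
  define \<tau>1 where "\<tau>1 = (\<lambda>i. if i < m then act (\<alpha> i) (\<tau> i) else \<tau> i)"
  have mt: "?mt < m" using assms by simp
  have s1: "step M (q, ts) = (q', map \<tau>1 [0..<?mt])"
  proof -
    have as: "as = map (\<lambda>i. as ! i) [0..<?mt]" using las by (metis map_nth)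
    have "map2 act as ts = map (\<lambda>i. act (as ! i) (\<tau> i)) [0..<?mt]"
      by (subst as) (simp only: ts map2_act)
    also have "\<dots> = map \<tau>1 [0..<?mt]" using mt by (auto simp: \<tau>1_def \<alpha>_def)
    finally show ?thesis using halts_step.hyps(1) d unfolding ts
      by (simp del: map_map add: map_read)
  qed
  have s2: "step (lifted m k M) (q, map \<tau> [0..<m]) = (q', map \<tau>1 [0..<m])"
  proof -
    have tk: "take ?mt (map (reads m \<tau>) [0..<m]) = map (reads ?mt \<tau>) [0..<?mt]"
      using mt by (auto simp: take_map reads_def)
    have "delta (lifted m k M) q (map (reads m \<tau>) [0..<m]) = (q', map \<alpha> [0..<m])"
      by (simp add: lifted_def tk d \<alpha>_def dir_def)
    then have "step (lifted m k M) (q, map \<tau> [0..<m]) = (q', map2 act (map \<alpha> [0..<m]) (map \<tau> [0..<m]))"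
      using halts_step.hyps(1) by (simp del: map_map add: map_read) (simp add: lifted_def)
    also have "\<dots> = (q', map \<tau>1 [0..<m])" unfolding map2_act by (auto simp: \<tau>1_def)
    finally show ?thesis .
  qed
  have stay: "act (reads m \<tau> i, e) (\<tau> i) = (fst (\<tau> i), move e (snd (\<tau> i)))" if "i < m" for i e
    using that by (cases "\<tau> i") (simp add: reads_def)
  have hd: "snd (\<tau>1 j) = move (dir j) (snd (\<tau> j))" if "j < 2" for j
  proof (cases "j < ?mt")
    case True
    then show ?thesis using mt by (cases "as ! j"; cases "\<tau> j") (simp add: \<tau>1_def \<alpha>_def dir_def)
  next
    case False
    then show ?thesis using that assms by (simp add: \<tau>1_def \<alpha>_def dir_def stay)
  qed
  have hi: "\<tau>1 i = (fst (\<tau> i), move (if i = k then MoveRight else if i = Suc k then dir 0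
      else if i = Suc (Suc k) then dir 1 else Stay) (snd (\<tau> i)))" if "k \<le> i" "i < m" for i
    using that assms by (simp only: \<tau>1_def \<alpha>_def stay if_True if_False) (simp add: stay)
  have "\<tau>1 k = (marker, int (Suc n))" using assms halts_step.prems hi[of k] by simp
  moreover have "\<tau>1 (Suc k) = (marker, snd (\<tau>1 0))"
    using assms halts_step.prems hd[of 0] hi[of "Suc k"] by simp
  moreover have "\<tau>1 (Suc (Suc k)) = (marker, snd (\<tau>1 1))"
    using assms halts_step.prems hd[of 1] hi[of "Suc (Suc k)"] by simp
  ultimately obtain \<tau>' where \<tau>': "halts (lifted m k M) (q', map \<tau>1 [0..<m]) t (map \<tau>' [0..<m])"
      "ts' = map \<tau>' [0..<?mt]" "\<tau>' k = (marker, int (Suc n + t))"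
      "\<tau>' (Suc k) = (marker, snd (\<tau>' 0))" "\<tau>' (Suc (Suc k)) = (marker, snd (\<tau>' 1))"
      "\<bar>snd (\<tau>' 0) - snd (\<tau>1 0)\<bar> \<le> int t" "\<bar>snd (\<tau>' 1) - snd (\<tau>1 1)\<bar> \<le> int t"
      "\<forall>i > k + 2. \<tau>' i = \<tau>1 i"
    using halts_step.IH[of \<tau>1 "Suc n"] s1 by auto
  have "\<bar>snd (\<tau>' j) - snd (\<tau> j)\<bar> \<le> int (Suc t)" if "j < 2" "\<bar>snd (\<tau>' j) - snd (\<tau>1 j)\<bar> \<le> int t" for j
    using hd[OF that(1)] that(2) abs_move[of "dir j" "snd (\<tau> j)"] by linarith
  moreover have "\<tau>1 i = \<tau> i" if "i > k + 2" for i
    using that hi[of i] by (cases "i < m") (simp_all add: \<tau>1_def)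
  moreover have "halts (lifted m k M) (q, map \<tau> [0..<m]) (Suc t) (map \<tau>' [0..<m])"
    using \<tau>'(1) halts_step.hyps(1) by (intro halts.halts_step) (simp_all only: s2, simp add: lifted_def)
  ultimately show ?case using \<tau>' by (intro exI[of _ \<tau>']) auto
qed

text \<open>Going left by the clock value brings both heads to cell 0 or to the left of it, whatever
  side they were on. From there \<open>advance\<close> moves a head right until its ruler meets the
  marked cell.\<close>

definition retreat :: "nat \<Rightarrow> nat \<Rightarrow> tm" where
  "retreat m k = loop (\<lambda>\<sigma>. \<sigma> k = None)
     (mover m (\<lambda>i \<sigma>. if i \<in> {0, 1, k, Suc k, Suc (Suc k)} then MoveLeft else Stay))"

definition advance :: "nat \<Rightarrow> nat \<Rightarrow> nat \<Rightarrow> tm" where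
  "advance m j r = loop (\<lambda>\<sigma>. \<sigma> r = None)
     (mover m (\<lambda>i \<sigma>. if i = j \<or> i = r then MoveRight else Stay))"

lemma machine_retreat_advance [simp]: "machine m (retreat m k)" "machine m (advance m j r)"
  by (simp_all add: retreat_def advance_def)

lemma runs_retreat:
  assumes "2 \<le> k" "k + 2 < m" "\<tau> k = (marker, int n)"
  shows "runs m (retreat m k) \<tau> (2 * n + 1)
    (\<lambda>i. if i \<in> {0, 1, k, Suc k, Suc (Suc k)} then (fst (\<tau> i), snd (\<tau> i) - int n) else \<tau> i)"
proof -
  let ?f = "\<lambda>l i. if i \<in> {0, 1, k, Suc k, Suc (Suc k)} then (fst (\<tau> i), snd (\<tau> i) - int l) else \<tau> i"
  have "runs m (retreat m k) (?f 0) (n * Suc 1 + 1) (?f n)"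
    unfolding retreat_def
  proof (rule runs_loop_iter[where s = ?f])
    fix l
    show "runs m (mover m (\<lambda>i \<sigma>. if i \<in> {0, 1, k, Suc k, Suc (Suc k)} then MoveLeft else Stay))
        (?f l) 1 (?f (Suc l))" by (rule runs_mover) auto
  qed (use assms in \<open>auto simp: reads_def marker_def\<close>)
  moreover have "?f 0 = \<tau>" by auto
  ultimately show ?thesis by (simp only: mult_Suc_right) (erule runs_mono, simp)
qed

lemma runs_advance:
  assumes "j < m" "r < m" "j \<noteq> r" "\<tau> r = (marker, snd (\<tau> j))" "snd (\<tau> j) = - int n"
  shows "runs m (advance m j r) \<tau> (2 * n + 1) (\<tau>(j := (fst (\<tau> j), 0), r := (marker, 0)))"
proof -
  let ?f = "\<lambda>l. \<tau>(j := (fst (\<tau> j), int l - int n), r := (marker, int l - int n))"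
  have "runs m (advance m j r) (?f 0) (n * Suc 1 + 1) (?f n)"
    unfolding advance_def
  proof (rule runs_loop_iter[where s = ?f])
    fix l
    show "runs m (mover m (\<lambda>i \<sigma>. if i = j \<or> i = r then MoveRight else Stay))
        (?f l) 1 (?f (Suc l))" by (rule runs_mover) (use assms in auto)
  qed (use assms in \<open>auto simp: reads_def marker_def\<close>)
  moreover have "?f 0 = \<tau>" using assms by (auto simp: fun_eq_iff prod_eq_iff)
  ultimately show ?thesis by (simp only: mult_Suc_right) (auto elim!: runs_mono)
qed

lemma halts_steps: "halts N c t ts \<Longrightarrow> (step N ^^ t) c = (num_states N, ts)"
  by (induction rule: halts.induct) (simp_all add: funpow_Suc_right del: funpow.simps step.simps)

lemma steps_halts:
  assumes "wf_tm M"
  shows "(step M ^^ n) (q, ts) = (q', ts') \<Longrightarrow> num_states M \<le> q' \<Longrightarrow> q \<le> num_states M \<Longrightarrow>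
    length ts = num_tapes M \<Longrightarrow> \<exists>t \<le> n. halts M (q, ts) t ts'"
proof (induction n arbitrary: q ts)
  case 0
  then have "q = num_states M" "ts' = ts" by auto
  then show ?case using halts_now by auto
next
  case (Suc n)
  show ?case
  proof (cases "q = num_states M")
    case True
    have "(step M ^^ i) (num_states M, ts) = (num_states M, ts)" for i by (induction i) auto
    then have "ts' = ts" using Suc.prems True by (metis prod.inject)
    then show ?thesis using True halts_now by blast
  next
    case False
    then have q: "q < num_states M" using Suc.prems by simp
    obtain q1 as where d: "delta M q (map (\<lambda>(c, h). c h) ts) = (q1, as)"
      by (cases "delta M q (map (\<lambda>(c, h). c h) ts)")
    have st: "step M (q, ts) = (q1, map2 act as ts)" using q d by simp
    have "q1 \<le> num_states M \<and> length as = num_tapes M"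
      using assms q d Suc.prems(4) unfolding wf_tm_def by (metis fst_conv length_map snd_conv)
    moreover have "(step M ^^ n) (q1, map2 act as ts) = (q', ts')"
      using Suc.prems(1) st by (simp add: funpow_Suc_right del: funpow.simps step.simps)
    ultimately obtain t where "t \<le> n" "halts M (q1, map2 act as ts) t ts'"
      using Suc.IH Suc.prems by fastforce
    then show ?thesis using halts_step[OF q] st by (metis Suc_le_mono)
  qed
qed

text \<open>Tapes \<open>k\<close> to \<open>k + 2\<close> are the clock and the rulers,
  \<open>k + 3\<close> and \<open>k + 4\<close> the two inputs of \<open>N\<close>. With
  \<open>two\<close> these inputs are the first two outputs of \<open>M\<close>; otherwise the
  second one is the original input, saved before \<open>M\<close> can overwrite it.\<close>

definition pipeline :: "nat \<Rightarrow> nat \<Rightarrow> bool \<Rightarrow> tm \<Rightarrow> tm \<Rightarrow> tm" where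
  "pipeline m k two M N =
     seq (basic m (\<lambda>i \<sigma>. (if k \<le> i \<and> i \<noteq> k + 3 \<and> i \<noteq> k + 4 then Some True else \<sigma> i, Stay)))
     (seq (if two then mover m (\<lambda>i \<sigma>. Stay) else copy_in m 0 (k + 4))
     (seq (lifted m k M) (seq (retreat m k) (seq (advance m 0 (Suc k)) (seq (advance m 1 (Suc (Suc k)))
     (seq (copy_in m 0 (k + 3))
     (seq (if two then copy_in m 1 (k + 4) else mover m (\<lambda>i \<sigma>. Stay)) N)))))))"

lemma runs_pipeline:
  assumes M: "wf_tm M" "num_tapes M \<le> k" "2 \<le> k" "k + 4 < m"
    and xs: "length xs \<le> 2"
    and ys: "0 < length ys" "two \<Longrightarrow> 1 < length ys" "\<not> two \<Longrightarrow> 0 < length xs"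
    and comp: "computes_within M xs ys T"
    and X: "X = (ys ! 0, if two then ys ! 1 else xs ! 0)"
    and N: "\<And>J. snd (J 0) = 0 \<Longrightarrow> snd (J 1) = 0 \<Longrightarrow>
        runs m N (layout.lay (k + 3) J X (\<lambda>_. 0) (\<lambda>_. 0)) T' (F J)"
  shows "\<exists>J. snd (J 0) = 0 \<and> snd (J 1) = 0 \<and>
    runs m (pipeline m k two M N) (\<lambda>i. string_tape (if i < length xs then xs ! i else []))
    (11 * T + 4 * length (fst X) + 8 * length (snd X) + T' + 40) (F J)"
proof -
  interpret layout m "k + 3" .
  let ?x = "\<lambda>i. if i < length xs then xs ! i else []"
  let ?mt = "num_tapes M"
  let ?stay = "mover m (\<lambda>i \<sigma>. Stay)"
  have stay: "runs m ?stay \<tau> 1 \<tau>" for \<tau> by (rule runs_mover) simp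
  define \<tau>0 where "\<tau>0 = (\<lambda>i. string_tape (?x i))"
  have \<tau>0: "\<tau>0 i = (\<lambda>_. None, 0)" if "2 \<le> i" for i
    using that xs by (auto simp: \<tau>0_def string_tape_def)
  define \<tau>1 where "\<tau>1 = (\<lambda>i. if k \<le> i \<and> i \<noteq> k + 3 \<and> i \<noteq> k + 4 then (marker, 0) else \<tau>0 i)"
  have 1: "runs m (basic m (\<lambda>i \<sigma>. (if k \<le> i \<and> i \<noteq> k + 3 \<and> i \<noteq> k + 4 then Some True else \<sigma> i, Stay))) \<tau>0 1 \<tau>1"
  proof (rule runs_cong[OF runs_basic])
    fix i assume i: "i < m"
    show "act (if k \<le> i \<and> i \<noteq> k + 3 \<and> i \<noteq> k + 4 then Some True else reads m \<tau>0 i, Stay) (\<tau>0 i) = \<tau>1 i"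
    proof (cases "k \<le> i \<and> i \<noteq> k + 3 \<and> i \<noteq> k + 4")
      case True
      then show ?thesis using M(3) \<tau>0[of i] by (auto simp: \<tau>1_def marker_def fun_eq_iff)
    next
      case False
      then show ?thesis using i by (cases "\<tau>0 i") (auto simp: \<tau>1_def reads_def)
    qed
  qed
  define \<tau>2 where "\<tau>2 = (if two then \<tau>1 else \<tau>1(k + 4 := string_tape (xs ! 0)))"
  have e4: "\<tau>1 (k + 4) = string_tape []" "\<tau>1 (k + 3) = string_tape []"
    using \<tau>0[of "k + 4"] \<tau>0[of "k + 3"] by (auto simp: \<tau>1_def string_tape_def)
  have low: "\<tau>1 i = string_tape (?x i)" if "i < k" for i using that by (simp add: \<tau>1_def \<tau>0_def)
  have hs: "holds_string (string_tape z) z" for z by (simp add: holds_string_def string_tape_def)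
  have 2: "runs m (if two then ?stay else copy_in m 0 (k + 4)) \<tau>1 (4 * length (snd X) + 4) \<tau>2"
  proof (cases two)
    case True
    then show ?thesis using runs_mono[OF stay[of \<tau>1]] by (simp add: \<tau>2_def)
  next
    case False
    have "\<tau>1 0 = string_tape (xs ! 0)" using low[of 0] M(3) ys(3)[OF False] by simp
    moreover have "\<tau>1 0 = (fst (\<tau>1 0), 0)" using calculation by (simp add: string_tape_def)
    ultimately have "runs m (copy_in m 0 (k + 4)) \<tau>1 (4 * length (xs ! 0) + 4) (\<tau>1(k + 4 := string_tape (xs ! 0)))"
      using M e4 hs by (intro runs_copy_in[of _ _ _ _ "fst (\<tau>1 0)"]) auto
    then show ?thesis using False by (simp add: \<tau>2_def X)
  qed
  obtain n q ts where run: "n \<le> T" "(step M ^^ n) (init_config M xs) = (q, ts)" "num_states M \<le> q"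
    and out: "\<And>i. i < length ys \<Longrightarrow> holds_string (ts ! i) (ys ! i)"
    and len: "length xs \<le> ?mt" "length ys \<le> ?mt"
    using comp unfolding computes_within_def by blast
  have ini: "init_config M xs = (0, map \<tau>2 [0..<?mt])"
    using M(2) low by (auto simp: init_config_def \<tau>2_def)
  obtain t where t': "t \<le> n" and t2: "halts M (0, map \<tau>2 [0..<?mt]) t ts"
    using steps_halts[OF M(1), of n 0 "map \<tau>2 [0..<?mt]" q ts] run ini by auto
  then have t: "t \<le> T" "halts M (0, map \<tau>2 [0..<?mt]) t ts" using run(1) by auto
  have h2: "snd (\<tau>2 0) = 0" "snd (\<tau>2 1) = 0"
    using low[of 0] low[of 1] M(3) by (auto simp: \<tau>2_def string_tape_def)
  obtain \<tau>3 where \<tau>3: "halts (lifted m k M) (0, map \<tau>2 [0..<m]) t (map \<tau>3 [0..<m])"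
      "ts = map \<tau>3 [0..<?mt]" "\<tau>3 k = (marker, int t)"
      "\<tau>3 (Suc k) = (marker, snd (\<tau>3 0))" "\<tau>3 (Suc (Suc k)) = (marker, snd (\<tau>3 1))"
      "\<bar>snd (\<tau>3 0)\<bar> \<le> int t" "\<bar>snd (\<tau>3 1)\<bar> \<le> int t" "\<forall>i > k + 2. \<tau>3 i = \<tau>2 i"
  proof -
    have "\<tau>2 k = (marker, 0)" "\<tau>2 (Suc k) = (marker, 0)" "\<tau>2 (Suc (Suc k)) = (marker, 0)"
      by (auto simp: \<tau>2_def \<tau>1_def)
    then show ?thesis using halts_lifted[OF M(1,2,3) _ t(2), of m \<tau>2 0] M h2 that by auto
  qed
  have 3: "runs m (lifted m k M) \<tau>2 T \<tau>3" unfolding runs_def using \<tau>3(1) t(1) by auto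
  define \<tau>4 where "\<tau>4 = (\<lambda>i. if i \<in> {0, 1, k, Suc k, Suc (Suc k)} then (fst (\<tau>3 i), snd (\<tau>3 i) - int t) else \<tau>3 i)"
  have 4: "runs m (retreat m k) \<tau>3 (2 * T + 1) \<tau>4"
    unfolding \<tau>4_def by (rule runs_mono[OF runs_retreat]) (use M \<tau>3 t in auto)
  define n0 where "n0 = nat (- snd (\<tau>4 0))"
  define n1 where "n1 = nat (- snd (\<tau>4 1))"
  have n0: "snd (\<tau>4 0) = - int n0" "n0 \<le> 2 * T" "\<tau>4 (Suc k) = (marker, snd (\<tau>4 0))"
    using \<tau>3 t(1) M by (auto simp: n0_def \<tau>4_def)
  have n1: "snd (\<tau>4 1) = - int n1" "n1 \<le> 2 * T" "\<tau>4 (Suc (Suc k)) = (marker, snd (\<tau>4 1))"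
    using \<tau>3 t(1) M by (auto simp: n1_def \<tau>4_def)
  define \<tau>5 where "\<tau>5 = \<tau>4(0 := (fst (\<tau>4 0), 0), Suc k := (marker, 0))"
  have 5: "runs m (advance m 0 (Suc k)) \<tau>4 (4 * T + 1) \<tau>5"
    unfolding \<tau>5_def using M n0 by (intro runs_mono[OF runs_advance[of _ _ _ _ n0]]) auto
  define \<tau>6 where "\<tau>6 = \<tau>5(1 := (fst (\<tau>5 1), 0), Suc (Suc k) := (marker, 0))"
  have 6: "runs m (advance m 1 (Suc (Suc k))) \<tau>5 (4 * T + 1) \<tau>6"
    unfolding \<tau>6_def using M n1 by (intro runs_mono[OF runs_advance[of _ _ _ _ n1]]) (auto simp: \<tau>5_def)
  have f6: "fst (\<tau>6 j) = fst (\<tau>3 j)" "snd (\<tau>6 j) = 0" if "j < 2" for j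
    using that M by (auto simp: \<tau>6_def \<tau>5_def \<tau>4_def less_2_cases_iff)
  have o6: "holds_string (\<tau>6 j) (ys ! j)" if "j < length ys" "j < 2" for j
  proof -
    have "holds_string (\<tau>3 j) (ys ! j)" using out[OF that(1)] \<tau>3(2) len that by simp
    then show ?thesis using f6(1)[OF that(2)] by (simp add: holds_string_def)
  qed
  have h6: "\<tau>6 i = \<tau>2 i" if "i > k + 2" for i
    using that M(3) \<tau>3(8) by (simp add: \<tau>6_def \<tau>5_def \<tau>4_def)
  define \<tau>7 where "\<tau>7 = \<tau>6(k + 3 := string_tape (ys ! 0))"
  have 7: "runs m (copy_in m 0 (k + 3)) \<tau>6 (4 * length (fst X) + 4) \<tau>7"
    unfolding \<tau>7_def X fst_conv
    using M ys(1) o6[of 0] f6(2)[of 0] h6[of "k + 3"] e4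
    by (intro runs_copy_in[of _ _ _ _ "fst (\<tau>6 0)"]) (auto simp: prod_eq_iff \<tau>2_def)
  define \<tau>8 where "\<tau>8 = (if two then \<tau>7(k + 4 := string_tape (ys ! 1)) else \<tau>7)"
  have 8: "runs m (if two then copy_in m 1 (k + 4) else ?stay) \<tau>7 (4 * length (snd X) + 4) \<tau>8"
  proof (cases two)
    case True
    have "runs m (copy_in m 1 (k + 4)) \<tau>7 (4 * length (ys ! 1) + 4) (\<tau>7(k + 4 := string_tape (ys ! 1)))"
      using M ys(2) True o6[of 1] f6(2)[of 1] h6[of "k + 4"] e4
      by (intro runs_copy_in[of _ _ _ _ "fst (\<tau>6 1)"]) (auto simp: prod_eq_iff \<tau>2_def \<tau>7_def)
    then show ?thesis using True by (simp add: \<tau>8_def X)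
  next
    case False
    then show ?thesis using runs_mono[OF stay[of \<tau>7]] by (simp add: \<tau>8_def)
  qed
  have lay8: "lay \<tau>8 X (\<lambda>_. 0) (\<lambda>_. 0) i = \<tau>8 i" for i
  proof -
    consider "i < k + 3" | "i = k + 3" | "i = k + 4" | "i > k + 4" by linarith
    then show ?thesis
    proof cases
      case 2
      then show ?thesis by (simp add: lay_def \<tau>8_def \<tau>7_def X) (simp add: string_tape_def)
    next
      case 3
      then show ?thesis using h6[of "k + 4"]
        by (simp add: lay_def \<tau>8_def \<tau>7_def X \<tau>2_def) (simp add: string_tape_def)
    next
      case 4
      then show ?thesis using h6[of i] by (simp add: lay_def \<tau>8_def \<tau>7_def \<tau>2_def \<tau>1_def)
    qed (simp add: lay_def)
  qed
  have s8: "snd (\<tau>8 0) = 0" "snd (\<tau>8 1) = 0" using f6 M by (auto simp: \<tau>8_def \<tau>7_def)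
  have 9: "runs m N \<tau>8 T' (F \<tau>8)"
  proof -
    have "lay \<tau>8 X (\<lambda>_. 0) (\<lambda>_. 0) = \<tau>8" using lay8 by (simp add: fun_eq_iff)
    then show ?thesis using N[OF s8] by simp
  qed
  have "runs m (pipeline m k two M N) \<tau>0 (1 + ((4 * length (snd X) + 4) + (T + ((2 * T + 1) +
      ((4 * T + 1) + ((4 * T + 1) + ((4 * length (fst X) + 4) + ((4 * length (snd X) + 4) + T')))))))) (F \<tau>8)"
    unfolding pipeline_def
    by (rule runs_seq[OF 1 runs_seq[OF 2 runs_seq[OF 3 runs_seq[OF 4 runs_seq[OF 5 runs_seq[OF 6
        runs_seq[OF 7 runs_seq[OF 8 9]]]]]]]])
  then have "runs m (pipeline m k two M N) \<tau>0
      (11 * T + 4 * length (fst X) + 8 * length (snd X) + T' + 40) (F \<tau>8)"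
    by (rule runs_mono) simp
  then show ?thesis using s8 unfolding \<tau>0_def by blast
qed

text \<open>The case \<open>two\<close> continues a parameterized reduction, whose outputs are an
  instance and a parameter. The other case serves bounds such as
  \<open>(3 * h k + k + 3) ^ c\<close>, which depend on a computed number and on its
  argument.\<close>

theorem compose_string_function:
  fixes tl0 tb0 tl1 tb1 :: trm
  assumes "wf_tm M"
  obtains M' g where "wf_tm M'" "poly_bounded g"
    "\<And>xs ys T X. length xs \<le> 2 \<Longrightarrow> 0 < length ys \<Longrightarrow> (if two then 1 < length ys else 0 < length xs) \<Longrightarrow>
      computes_within M xs ys T \<Longrightarrow> X = (ys ! 0, if two then ys ! 1 else xs ! 0) \<Longrightarrow>
      computes_within M' xs [string_of tl0 tb0 X, string_of tl1 tb1 X]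
        (g (T + length (fst X) + length (snd X)))"
proof -
  define k where "k = max 2 (num_tapes M)"
  define m where "m = k + 3 + 2 + (3 + width tl0 + width tb0) + (3 + width tl1 + width tb1)"
  interpret layout m "k + 3" .
  let ?N = "seq (emit 0 tl0 tb0) (emit 1 tl1 tb1)"
  define M' where "M' = pipeline m k two M ?N"
  have k: "num_tapes M \<le> k" "2 \<le> k" "k + 4 < m" by (auto simp: k_def m_def)
  have M': "machine m M'"
    unfolding M'_def pipeline_def using k machine_lifted[OF assms] by auto
  obtain g0 where g0: "poly_bounded g0" "\<And>X S J c o1. o1 < k + 3 \<Longrightarrow> J o1 = (c, 0) \<Longrightarrow>
      bounded_by S X (\<lambda>_. 0) \<Longrightarrow> \<exists>t. holds_string t (string_of tl0 tb0 X) \<and>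
       runs m (emit o1 tl0 tb0) (lay J X (\<lambda>_. 0) (\<lambda>_. 0)) (g0 S) (lay (J(o1 := t)) X (\<lambda>_. 0) (\<lambda>_. 0))"
    using runs_emit[of tl0 tb0] unfolding m_def by auto
  obtain g1 where g1: "poly_bounded g1" "\<And>X S J c o1. o1 < k + 3 \<Longrightarrow> J o1 = (c, 0) \<Longrightarrow>
      bounded_by S X (\<lambda>_. 0) \<Longrightarrow> \<exists>t. holds_string t (string_of tl1 tb1 X) \<and>
       runs m (emit o1 tl1 tb1) (lay J X (\<lambda>_. 0) (\<lambda>_. 0)) (g1 S) (lay (J(o1 := t)) X (\<lambda>_. 0) (\<lambda>_. 0))"
    using runs_emit[of tl1 tb1] unfolding m_def by auto
  define g where "g = (\<lambda>S. 11 * S + 4 * S + 8 * S + (g0 S + g1 S) + 40)"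
  have g: "poly_bounded g" unfolding g_def by (intro poly_bounded_intros g0 g1)
  have main: "computes_within M' xs [string_of tl0 tb0 X, string_of tl1 tb1 X]
      (g (T + length (fst X) + length (snd X)))"
    if xs: "length xs \<le> 2" and ys: "0 < length ys" "if two then 1 < length ys else 0 < length xs"
      and c: "computes_within M xs ys T" and X: "X = (ys ! 0, if two then ys ! 1 else xs ! 0)"
    for xs ys T X
  proof -
    let ?S = "T + length (fst X) + length (snd X)"
    have bd: "bounded_by ?S X (\<lambda>_. 0)" by (simp add: bounded_by_def)
    have "\<exists>J'. holds_string (J' 0) (string_of tl0 tb0 X) \<and> holds_string (J' 1) (string_of tl1 tb1 X) \<and>
        runs m ?N (lay J X (\<lambda>_. 0) (\<lambda>_. 0)) (g0 ?S + g1 ?S) (lay J' X (\<lambda>_. 0) (\<lambda>_. 0))"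
      if J: "snd (J 0) = 0" "snd (J 1) = 0" for J :: "nat \<Rightarrow> tape"
    proof -
      obtain t0 where t0: "holds_string t0 (string_of tl0 tb0 X)"
        "runs m (emit 0 tl0 tb0) (lay J X (\<lambda>_. 0) (\<lambda>_. 0)) (g0 ?S) (lay (J(0 := t0)) X (\<lambda>_. 0) (\<lambda>_. 0))"
        using g0(2)[of 0 J "fst (J 0)" ?S X] J bd by (auto simp: prod_eq_iff)
      obtain t1 where t1: "holds_string t1 (string_of tl1 tb1 X)"
        "runs m (emit 1 tl1 tb1) (lay (J(0 := t0)) X (\<lambda>_. 0) (\<lambda>_. 0)) (g1 ?S)
          (lay (J(0 := t0, 1 := t1)) X (\<lambda>_. 0) (\<lambda>_. 0))"
        using g1(2)[of 1 "J(0 := t0)" "fst (J 1)" ?S X] J bd by (auto simp: prod_eq_iff)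
      show ?thesis using runs_seq[OF t0(2) t1(2)] t0(1) t1(1)
        by (intro exI[of _ "J(0 := t0, 1 := t1)"]) auto
    qed
    then obtain F where F: "\<And>J :: nat \<Rightarrow> tape. snd (J 0) = 0 \<Longrightarrow> snd (J 1) = 0 \<Longrightarrow>
        holds_string (F J 0) (string_of tl0 tb0 X) \<and> holds_string (F J 1) (string_of tl1 tb1 X) \<and>
        runs m ?N (lay J X (\<lambda>_. 0) (\<lambda>_. 0)) (g0 ?S + g1 ?S) (lay (F J) X (\<lambda>_. 0) (\<lambda>_. 0))"
      by metis
    have two: "two \<Longrightarrow> 1 < length ys" "\<not> two \<Longrightarrow> 0 < length xs" using ys(2) by auto
    obtain J where J: "snd (J 0) = 0" "snd (J 1) = 0"
      and r: "runs m M' (\<lambda>i. string_tape (if i < length xs then xs ! i else []))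
        (11 * T + 4 * length (fst X) + 8 * length (snd X) + (g0 ?S + g1 ?S) + 40)
        (lay (F J) X (\<lambda>_. 0) (\<lambda>_. 0))"
    proof -
      have "runs m ?N (lay J X (\<lambda>_. 0) (\<lambda>_. 0)) (g0 ?S + g1 ?S) (lay (F J) X (\<lambda>_. 0) (\<lambda>_. 0))"
        if "snd (J 0) = 0" "snd (J 1) = 0" for J :: "nat \<Rightarrow> tape" using F[OF that] by (elim conjE)
      from runs_pipeline[OF assms k xs ys(1) two c X, where N = ?N and T' = "g0 ?S + g1 ?S"
          and F = "\<lambda>J. lay (F J) X (\<lambda>_. 0) (\<lambda>_. 0)", OF _ _ this] that
      show ?thesis unfolding M'_def by auto
    qed
    obtain t where t: "t \<le> 11 * T + 4 * length (fst X) + 8 * length (snd X) + (g0 ?S + g1 ?S) + 40"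
      "halts M' (init_config M' xs) t (map (lay (F J) X (\<lambda>_. 0) (\<lambda>_. 0)) [0..<m])"
      using r M' unfolding runs_def init_config_def machine_def by auto
    have "t \<le> g ?S" using t(1) unfolding g_def by simp
    moreover have "\<forall>i < 2. holds_string (map (lay (F J) X (\<lambda>_. 0) (\<lambda>_. 0)) [0..<m] ! i)
        ([string_of tl0 tb0 X, string_of tl1 tb1 X] ! i)"
      using F[OF J] k by (auto simp: less_2_cases_iff lay_def)
    ultimately show ?thesis
      using halts_steps[OF t(2)] M' xs k unfolding computes_within_def machine_def
      by (intro conjI exI[of _ t] exI[of _ "num_states M'"]
          exI[of _ "map (lay (F J) X (\<lambda>_. 0) (\<lambda>_. 0)) [0..<m]"]) auto
  qed
  have "wf_tm M'" using M' by (simp add: machine_def)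
  then show ?thesis using g main by (rule that)
qed


section \<open>Definable functions\<close>

text \<open>Definability hides the concrete terms: from here on only closure rules are applied.
  Arguments of a definable function are the first entries \<open>e 0\<close>, \<open>e 1\<close>,
  ... of the environment.\<close>

definition dfn :: "(inp \<Rightarrow> (nat \<Rightarrow> nat) \<Rightarrow> nat) \<Rightarrow> bool" where
  "dfn F \<longleftrightarrow> (\<exists>t. \<forall>X e. ev X e t = F X e)"

definition dfb :: "(inp \<Rightarrow> (nat \<Rightarrow> nat) \<Rightarrow> bool) \<Rightarrow> bool" where
  "dfb P \<longleftrightarrow> dfn (\<lambda>X e. of_bool (P X e))"

lemma dfnI: "(\<And>X e. ev X e t = F X e) \<Longrightarrow> dfn F"
  unfolding dfn_def by blast

lemma dfn_var: "dfn (\<lambda>X e. e k)"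
  by (rule dfnI[of "TVar k"]) simp

lemma dfn_add:
  assumes "dfn f" "dfn g"
  shows "dfn (\<lambda>X e. f X e + g X e)"
proof -
  obtain s t where "\<And>X e. ev X e s = f X e" "\<And>X e. ev X e t = g X e" using assms unfolding dfn_def by blast
  then show ?thesis by (intro dfnI[of "TAdd s t"]) simp
qed

lemma dfn_diff:
  assumes "dfn f" "dfn g"
  shows "dfn (\<lambda>X e. f X e - g X e)"
proof -
  obtain s t where "\<And>X e. ev X e s = f X e" "\<And>X e. ev X e t = g X e" using assms unfolding dfn_def by blast
  then show ?thesis by (intro dfnI[of "TSub s t"]) simp
qed

lemma dfn_zero: "dfn (\<lambda>X e. 0)"
  by (rule dfnI[of TZero]) simp

lemma dfn_one: "dfn (\<lambda>X e. 1)"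
  by (rule dfnI[of TOne]) simp

lemma dfn_Suc: "dfn f \<Longrightarrow> dfn (\<lambda>X e. Suc (f X e))"
  using dfn_add[OF _ dfn_one] by simp

lemma dfn_const: "dfn (\<lambda>X e. c)"
  by (induction c) (auto intro: dfn_zero dfn_Suc)

lemma dfn_len_fst: "dfn (\<lambda>X e. length (fst X))"
  by (rule dfnI[of "TLen False"]) (simp add: component_def)

lemma dfn_len_snd: "dfn (\<lambda>X e. length (snd X))"
  by (rule dfnI[of "TLen True"]) (simp add: component_def)

definition bit_at :: "bool list \<Rightarrow> nat \<Rightarrow> bool" where
  "bit_at xs i \<longleftrightarrow> i < length xs \<and> xs ! i"

lemma dfb_bit_fst:
  assumes "dfn f"
  shows "dfb (\<lambda>X e. bit_at (fst X) (f X e))"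
proof -
  obtain t where "\<And>X e. ev X e t = f X e" using assms unfolding dfn_def by blast
  then show ?thesis unfolding dfb_def bit_at_def by (intro dfnI[of "TBit False t"]) (simp add: component_def)
qed

lemma dfn_sum:
  assumes "dfn n" "dfn (\<lambda>X e. f X (e 0) (\<lambda>k. e (Suc k)))"
  shows "dfn (\<lambda>X e. \<Sum>i<n X e. f X i e)"
proof -
  obtain s t where "\<And>X e. ev X e s = n X e" "\<And>X e. ev X e t = f X (e 0) (\<lambda>k. e (Suc k))"
    using assms unfolding dfn_def by blast
  then show ?thesis by (intro dfnI[of "TSum s t"]) simp
qed

lemma dfn_rec:
  assumes "dfn c" "dfn n" "dfn (\<lambda>X e. f X (e 0) (e (Suc 0)) (\<lambda>k. e (Suc (Suc k))))"
  shows "dfn (\<lambda>X e. rec_nat 0 (\<lambda>i a. min (c X e) (f X i a e)) (n X e))"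
proof -
  obtain r s t where "\<And>X e. ev X e r = c X e" "\<And>X e. ev X e s = n X e"
    "\<And>X e. ev X e t = f X (e 0) (e (Suc 0)) (\<lambda>k. e (Suc (Suc k)))"
    using assms unfolding dfn_def by blast
  then show ?thesis by (intro dfnI[of "TRec r s t"]) simp
qed

lemma dfn_let:
  assumes "dfn a" "dfn (\<lambda>X e. f X (e 0) (\<lambda>k. e (Suc k)))"
  shows "dfn (\<lambda>X e. f X (a X e) e)"
proof -
  obtain s t where "\<And>X e. ev X e s = a X e" "\<And>X e. ev X e t = f X (e 0) (\<lambda>k. e (Suc k))"
    using assms unfolding dfn_def by blast
  then show ?thesis by (intro dfnI[of "TLet s t"]) simp
qed

section \<open>Substitution into definable functions\<close>

fun rename :: "(nat \<Rightarrow> nat) \<Rightarrow> trm \<Rightarrow> trm" where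
  "rename r (TVar k) = TVar (r k)"
| "rename r (TAdd s t) = TAdd (rename r s) (rename r t)"
| "rename r (TSub s t) = TSub (rename r s) (rename r t)"
| "rename r (TBit w t) = TBit w (rename r t)"
| "rename r (TSum n f) = TSum (rename r n) (rename (case_nat 0 (\<lambda>k. Suc (r k))) f)"
| "rename r (TRec c n f) = TRec (rename r c) (rename r n)
     (rename (case_nat 0 (case_nat (Suc 0) (\<lambda>k. Suc (Suc (r k))))) f)"
| "rename r (TLet s t) = TLet (rename r s) (rename (case_nat 0 (\<lambda>k. Suc (r k))) t)"
| "rename r t = t"

lemma ev_rename: "ev X e (rename r t) = ev X (\<lambda>k. e (r k)) t"
proof (induction t arbitrary: r e)
  case (TSum n f)
  have "(\<lambda>k. case_nat i e (case_nat 0 (\<lambda>k. Suc (r k)) k)) = case_nat i (\<lambda>k. e (r k))" for i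
    by (auto simp: fun_eq_iff split: nat.splits)
  then show ?case using TSum by simp
next
  case (TRec c n f)
  have "(\<lambda>k. case_nat i (case_nat a e) (case_nat 0 (case_nat (Suc 0) (\<lambda>k. Suc (Suc (r k)))) k))
      = case_nat i (case_nat a (\<lambda>k. e (r k)))" for i a
    by (auto simp: fun_eq_iff split: nat.splits)
  then show ?case using TRec by simp
next
  case (TLet s t)
  have "(\<lambda>k. case_nat i e (case_nat 0 (\<lambda>k. Suc (r k)) k)) = case_nat i (\<lambda>k. e (r k))" for i
    by (auto simp: fun_eq_iff split: nat.splits)
  then show ?case using TLet by simp
qed simp_all

lemma dfn_rename:
  assumes "dfn F"
  shows "dfn (\<lambda>X e. F X (\<lambda>k. e (r k)))"
proof -
  obtain t where "\<And>X e. ev X e t = F X e" using assms unfolding dfn_def by blast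
  then show ?thesis by (intro dfnI[of "rename r t"]) (simp add: ev_rename)
qed

text \<open>Arguments are substituted by nested \<open>TLet\<close>. Each binder shifts the
  variables of the arguments still to be substituted, and \<open>dfn_rename\<close> performs that
  shift.\<close>

lemma dfn_subst:
  assumes "dfn F" "\<And>k. k < n \<Longrightarrow> dfn (a k)"
  shows "dfn (\<lambda>X e. F X (\<lambda>k. if k < n then a k X e else e (k - n)))"
  using assms
proof (induction n arbitrary: a)
  case (Suc n)
  define G where "G = (\<lambda>X y e. F X (\<lambda>k. if k < n then a k X e else if k = n then y else e (k - Suc n)))"
  have "dfn (\<lambda>X e. F X (\<lambda>k. if k < n then a k X (\<lambda>j. e (Suc j)) else e (k - n)))"
    using Suc.prems by (intro Suc.IH) (auto intro: dfn_rename)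
  moreover have "(\<lambda>X e. F X (\<lambda>k. if k < n then a k X (\<lambda>j. e (Suc j)) else e (k - n)))
      = (\<lambda>X e. G X (e 0) (\<lambda>k. e (Suc k)))"
    unfolding G_def by (intro ext arg_cong[of _ _ "F _"]) (auto simp: Suc_diff_Suc)
  ultimately have "dfn (\<lambda>X e. G X (a n X e) e)" using dfn_let[of "a n" G] Suc.prems(2)[of n] by simp
  moreover have "(\<lambda>X e. G X (a n X e) e) = (\<lambda>X e. F X (\<lambda>k. if k < Suc n then a k X e else e (k - Suc n)))"
    unfolding G_def by (intro ext arg_cong[of _ _ "F _"]) (auto simp: less_Suc_eq)
  ultimately show ?case by simp
qed simp

lemma dfn_app1:
  assumes "dfn (\<lambda>X e. f X (e 0))" "dfn a"
  shows "dfn (\<lambda>X e. f X (a X e))"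
  using dfn_let[of a "\<lambda>X y e. f X y"] assms by simp

lemma dfn_app2:
  assumes "dfn (\<lambda>X e. f X (e 0) (e 1))" "dfn a" "dfn b"
  shows "dfn (\<lambda>X e. f X (a X e) (b X e))"
  using dfn_subst[OF assms(1), of 2 "case_nat a (\<lambda>_. b)"] assms(2,3) by (simp split: nat.splits)

lemma dfn_app3:
  assumes "dfn (\<lambda>X e. f X (e 0) (e 1) (e 2))" "dfn a" "dfn b" "dfn c"
  shows "dfn (\<lambda>X e. f X (a X e) (b X e) (c X e))"
  using dfn_subst[OF assms(1), of 3 "case_nat a (case_nat b (\<lambda>_. c))"] assms(2-)
  by (simp add: numeral_2_eq_2 split: nat.splits)

lemma dfn_app4:
  assumes "dfn (\<lambda>X e. f X (e 0) (e 1) (e 2) (e 3))" "dfn a" "dfn b" "dfn c" "dfn d"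
  shows "dfn (\<lambda>X e. f X (a X e) (b X e) (c X e) (d X e))"
  using dfn_subst[OF assms(1), of 4 "case_nat a (case_nat b (case_nat c (\<lambda>_. d)))"] assms(2-)
  by (simp add: numeral_2_eq_2 numeral_3_eq_3 split: nat.splits)

lemma dfb_app1:
  "dfb (\<lambda>X e. f X (e 0)) \<Longrightarrow> dfn a \<Longrightarrow> dfb (\<lambda>X e. f X (a X e))"
  unfolding dfb_def by (rule dfn_app1)

lemma dfb_app2:
  "dfb (\<lambda>X e. f X (e 0) (e 1)) \<Longrightarrow> dfn a \<Longrightarrow> dfn b \<Longrightarrow> dfb (\<lambda>X e. f X (a X e) (b X e))"
  unfolding dfb_def by (rule dfn_app2)

lemma dfb_app3:
  "dfb (\<lambda>X e. f X (e 0) (e 1) (e 2)) \<Longrightarrow> dfn a \<Longrightarrow> dfn b \<Longrightarrow> dfn c \<Longrightarrow>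
   dfb (\<lambda>X e. f X (a X e) (b X e) (c X e))"
  unfolding dfb_def by (rule dfn_app3)

lemma dfb_app4:
  "dfb (\<lambda>X e. f X (e 0) (e 1) (e 2) (e 3)) \<Longrightarrow> dfn a \<Longrightarrow> dfn b \<Longrightarrow> dfn c \<Longrightarrow> dfn d \<Longrightarrow>
   dfb (\<lambda>X e. f X (a X e) (b X e) (c X e) (d X e))"
  unfolding dfb_def by (rule dfn_app4)

section \<open>Arithmetic, logic and bounded quantifiers\<close>

lemma dfn_mult:
  assumes "dfn f" "dfn g"
  shows "dfn (\<lambda>X e. f X e * g X e)"
  using dfn_sum[of f "\<lambda>X i e. g X e"] assms dfn_rename[OF assms(2), of Suc] by simp

lemma dfb_not: "dfb P \<Longrightarrow> dfb (\<lambda>X e. \<not> P X e)"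
proof -
  have "of_bool (\<not> p) = (1 :: nat) - of_bool p" for p by simp
  then show "dfb P \<Longrightarrow> dfb (\<lambda>X e. \<not> P X e)" unfolding dfb_def by (simp only:) (intro dfn_diff dfn_one)
qed

lemma dfb_conj: "dfb P \<Longrightarrow> dfb Q \<Longrightarrow> dfb (\<lambda>X e. P X e \<and> Q X e)"
  unfolding dfb_def of_bool_conj by (rule dfn_mult)

lemma dfb_disj:
  assumes "dfb P" "dfb Q"
  shows "dfb (\<lambda>X e. P X e \<or> Q X e)"
proof -
  have "dfb (\<lambda>X e. \<not> (\<not> P X e \<and> \<not> Q X e))" by (intro dfb_not dfb_conj assms)
  then show ?thesis by simp
qed

lemma dfb_imp:
  assumes "dfb P" "dfb Q"
  shows "dfb (\<lambda>X e. P X e \<longrightarrow> Q X e)"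
  unfolding imp_conv_disj by (intro dfb_disj dfb_not assms)

lemma dfb_iff:
  assumes "dfb P" "dfb Q"
  shows "dfb (\<lambda>X e. P X e = Q X e)"
  unfolding iff_conv_conj_imp by (intro dfb_conj dfb_imp assms)

lemma dfb_le: "dfn f \<Longrightarrow> dfn g \<Longrightarrow> dfb (\<lambda>X e. f X e \<le> g X e)"
proof -
  have "of_bool (a \<le> b) = 1 - (a - b)" for a b :: nat by auto
  then show "dfn f \<Longrightarrow> dfn g \<Longrightarrow> dfb (\<lambda>X e. f X e \<le> g X e)"
    unfolding dfb_def by (simp only:) (intro dfn_diff dfn_one)
qed

lemma dfb_less:
  assumes "dfn f" "dfn g"
  shows "dfb (\<lambda>X e. f X e < g X e)"
  unfolding Suc_le_eq[symmetric] by (intro dfb_le dfn_Suc assms)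

lemma dfb_eq:
  assumes "dfn f" "dfn g"
  shows "dfb (\<lambda>X e. f X e = g X e)"
  unfolding order_eq_iff by (intro dfb_conj dfb_le assms)

lemma dfb_const: "dfb (\<lambda>X e. c)"
  unfolding dfb_def by (rule dfn_const)

lemma dfn_of_bool: "dfb P \<Longrightarrow> dfn (\<lambda>X e. of_bool (P X e))"
  unfolding dfb_def .

lemma dfn_if:
  assumes "dfb P" "dfn f" "dfn g"
  shows "dfn (\<lambda>X e. if P X e then f X e else g X e)"
proof -
  have "dfn (\<lambda>X e. of_bool (P X e) * f X e + (1 - of_bool (P X e)) * g X e)"
    using assms unfolding dfb_def by (intro dfn_add dfn_mult dfn_diff dfn_one)
  moreover have "(\<lambda>X e. of_bool (P X e) * f X e + (1 - of_bool (P X e)) * g X e)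
      = (\<lambda>X e. if P X e then f X e else g X e)" by (auto simp: fun_eq_iff)
  ultimately show ?thesis by simp
qed

lemma dfb_if:
  assumes "dfb P" "dfb Q" "dfb R"
  shows "dfb (\<lambda>X e. if P X e then Q X e else R X e)"
  unfolding if_bool_eq_conj by (intro dfb_conj dfb_imp dfb_not assms)

lemma dfb_ex:
  assumes "dfn n" "dfb (\<lambda>X e. P X (e 0) (\<lambda>k. e (Suc k)))"
  shows "dfb (\<lambda>X e. \<exists>i < n X e. P X i e)"
proof -
  have "dfb (\<lambda>X e. 0 < (\<Sum>i<n X e. of_bool (P X i e) :: nat))"
    using assms unfolding dfb_def[of "\<lambda>X e. P X (e 0) (\<lambda>k. e (Suc k))"]
    by (intro dfb_less dfn_zero dfn_sum[where f = "\<lambda>X i e. of_bool (P X i e)"])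
  moreover have "(\<lambda>X e. 0 < (\<Sum>i<n X e. of_bool (P X i e) :: nat)) = (\<lambda>X e. \<exists>i < n X e. P X i e)"
    by (auto simp: fun_eq_iff zero_less_iff_neq_zero)
  ultimately show ?thesis by simp
qed

lemma dfb_all:
  assumes "dfn n" "dfb (\<lambda>X e. P X (e 0) (\<lambda>k. e (Suc k)))"
  shows "dfb (\<lambda>X e. \<forall>i < n X e. P X i e)"
proof -
  have "dfb (\<lambda>X e. \<not> (\<exists>i < n X e. \<not> P X i e))" by (intro dfb_not dfb_ex assms)
  then show ?thesis by simp
qed

text \<open>The quotient counts the \<open>i\<close> below the dividend with
  \<open>Suc i * b \<le> a\<close>. The condition \<open>0 < b\<close> reproduces the convention
  that division by 0 gives 0.\<close>

lemma dfn_div: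
  assumes "dfn f" "dfn g"
  shows "dfn (\<lambda>X e. f X e div g X e)"
proof -
  have "dfn (\<lambda>X e. \<Sum>i<e 0. of_bool (0 < e 1 \<and> Suc i * e 1 \<le> e 0))"
    by (intro dfn_sum dfn_of_bool dfb_conj dfb_less dfb_le dfn_mult dfn_Suc dfn_var dfn_zero)
  moreover have "(\<Sum>i<a. of_bool (0 < b \<and> Suc i * b \<le> a)) = a div b" for a b :: nat
  proof (cases "b = 0")
    case False
    have "{..<a} \<inter> {i. 0 < b \<and> Suc i * b \<le> a} = {..<a div b}"
      using False by (auto simp: less_eq_div_iff_mult_less_eq[symmetric] Suc_le_eq simp del: mult_Suc)
        (meson div_le_dividend less_le_trans)
    then have "(\<Sum>i<a. of_bool (0 < b \<and> Suc i * b \<le> a)) = card {..<a div b}"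
      by (subst sum_of_bool_eq) (auto simp: Collect_conj_eq lessThan_def)
    then show ?thesis by simp
  qed simp
  ultimately have "dfn (\<lambda>X e. e 0 div e 1)" by simp
  then show ?thesis using assms by (rule dfn_app2[where f = "\<lambda>X a b. a div b"])
qed

lemma dfn_mod: "dfn f \<Longrightarrow> dfn g \<Longrightarrow> dfn (\<lambda>X e. f X e mod g X e)"
  unfolding modulo_nat_def by (intro dfn_diff dfn_mult dfn_div)

lemma dfn_power: "dfn f \<Longrightarrow> dfn (\<lambda>X e. f X e ^ c)"
  by (induction c) (auto intro: dfn_mult dfn_one[simplified])

lemma dfn_poly:
  fixes p :: "nat poly"
  assumes "dfn f"
  shows "dfn (\<lambda>X e. poly p (f X e))"
proof (induction p)
  case (pCons a p)
  then show ?case using assms by (auto intro!: dfn_add dfn_mult dfn_const)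
qed (simp add: dfn_zero)

text \<open>In contrast to \<open>dfb_all\<close>, every instance may have a term of its own. This
  is required where \<open>j\<close> is a digit position or selects a table, since exponents and
  tables are fixed in a term.\<close>

lemma dfb_all_const:
  assumes "\<And>j. j < c \<Longrightarrow> dfb (\<lambda>X e. P j X e)"
  shows "dfb (\<lambda>X e. \<forall>j < (c :: nat). P j X e)"
  using assms by (induction c) (auto simp: All_less_Suc intro: dfb_conj dfb_const)

lemma dfb_ex_const:
  assumes "\<And>j. j < c \<Longrightarrow> dfb (\<lambda>X e. P j X e)"
  shows "dfb (\<lambda>X e. \<exists>j < (c :: nat). P j X e)"
  using assms by (induction c) (auto simp: Ex_less_Suc intro: dfb_disj dfb_const)

text \<open>For a constant \<open>c\<close> an arbitrary \<open>\<phi>\<close> is a finite case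
  distinction. In this way the transition function of a fixed machine enters a term.\<close>

lemma dfn_table:
  assumes "dfn f"
  shows "dfn (\<lambda>X e. if f X e < c then \<phi> (f X e) else 0)"
proof (induction c)
  case (Suc c)
  have "dfn (\<lambda>X e. if f X e = c then \<phi> c else (if f X e < c then \<phi> (f X e) else 0))"
    by (intro dfn_if dfb_eq assms dfn_const Suc)
  moreover have "(\<lambda>X e. if f X e = c then \<phi> c else (if f X e < c then \<phi> (f X e) else 0))
      = (\<lambda>X e. if f X e < Suc c then \<phi> (f X e) else 0)" by (auto simp: fun_eq_iff less_Suc_eq)
  ultimately show ?case by simp
qed (simp add: dfn_zero)

lemmas definable_intros =
  dfn_var dfn_const dfn_add dfn_diff dfn_Suc dfn_mult dfn_div dfn_mod dfn_power dfn_if dfn_of_bool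
  dfn_len_fst dfn_len_snd dfb_bit_fst dfb_not dfb_conj dfb_disj dfb_imp dfb_iff dfb_le dfb_less
  dfb_eq dfb_const dfb_if dfb_ex dfb_all


section \<open>Definable string functions and running times\<close>

definition dfs :: "(inp \<Rightarrow> bool list) \<Rightarrow> bool" where
  "dfs F \<longleftrightarrow> (\<exists>n P. dfn (\<lambda>X e. n X) \<and> dfb (\<lambda>X e. P X (e 0)) \<and> (\<forall>X. F X = map (P X) [0..<n X]))"

lemma dfs_string_of:
  assumes "dfs F"
  obtains tn tb where "\<And>X. F X = string_of tn tb X"
proof -
  obtain n P where n: "dfn (\<lambda>X e. n X)" and P: "dfb (\<lambda>X e. P X (e 0))"
    and F: "\<And>X. F X = map (P X) [0..<n X]" using assms unfolding dfs_def by blast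
  obtain tn tb where "\<And>X e. ev X e tn = n X" "\<And>X e. ev X e tb = of_bool (P X (e 0))"
    using n P unfolding dfn_def dfb_def by blast
  then have "F X = string_of tn tb X" for X using F by (simp add: string_of_def)
  then show ?thesis using that by blast
qed

lemma dfs_map: "dfn (\<lambda>X e. n X) \<Longrightarrow> dfb (\<lambda>X e. P X (e 0)) \<Longrightarrow> dfs (\<lambda>X. map (P X) [0..<n X])"
  unfolding dfs_def by blast

lemma dfs_unary: "dfn (\<lambda>X e. n X) \<Longrightarrow> dfs (\<lambda>X. unary (n X))"
  using dfs_map[of n "\<lambda>_ _. True"] by (simp add: unary_def map_replicate_const dfb_const)

lemma dfs_append:
  assumes "dfs F" "dfs G"
  shows "dfs (\<lambda>X. F X @ G X)"
proof -
  obtain n P where n: "dfn (\<lambda>X e. n X)" and P: "dfb (\<lambda>X e. P X (e 0))"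
    and F: "\<And>X. F X = map (P X) [0..<n X]" using assms unfolding dfs_def by blast
  obtain m Q where m: "dfn (\<lambda>X e. m X)" and Q: "dfb (\<lambda>X e. Q X (e 0))"
    and G: "\<And>X. G X = map (Q X) [0..<m X]" using assms unfolding dfs_def by blast
  have "F X @ G X = map (\<lambda>i. if i < n X then P X i else Q X (i - n X)) [0..<n X + m X]" for X
    by (rule nth_equalityI) (auto simp: F G nth_append)
  moreover have "dfb (\<lambda>X e. if e 0 < n X then P X (e 0) else Q X (e 0 - n X))"
    by (intro dfb_if dfb_less dfn_var n P dfb_app1[OF Q] dfn_diff)
  ultimately show ?thesis by (simp only:) (intro dfs_map dfn_add n m)
qed

lemma dfs_enc_nat: "dfn (\<lambda>X e. n X) \<Longrightarrow> dfs (\<lambda>X. enc_nat (n X))"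
proof -
  assume n: "dfn (\<lambda>X e. n X)"
  have "dfs (\<lambda>X. unary (n X) @ map (\<lambda>_. False) [0..<1])"
    by (intro dfs_append dfs_unary n dfs_map dfn_const dfb_const)
  then show ?thesis by (simp add: enc_nat_def unary_def)
qed

lemma concat_matrix:
  "concat (map (\<lambda>i. map (P i) [0..<n]) [0..<m]) = map (\<lambda>l. P (l div n) (l mod n)) [0..<m * n]"
proof (induction m)
  case (Suc m)
  have "map (\<lambda>l. P (l div n) (l mod n)) [0..<Suc m * n]
      = map (\<lambda>l. P (l div n) (l mod n)) [0..<m * n] @ map (\<lambda>l. P (l div n) (l mod n)) [m * n..<m * n + n]"
    using upt_add_eq_append[of 0 "m * n" n] by (simp add: add.commute)
  also have "map (\<lambda>l. P (l div n) (l mod n)) [m * n..<m * n + n] = map (P m) [0..<n]"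
    by (rule nth_equalityI) auto
  finally show ?case using Suc by simp
qed simp

lemma dfs_matrix:
  assumes n: "dfn (\<lambda>X e. n X)" and P: "dfb (\<lambda>X e. P X (e 0) (e 1))"
  shows "dfs (\<lambda>X. concat (map (\<lambda>i. map (P X i) [0..<n X]) [0..<n X]))"
  unfolding concat_matrix
  by (intro dfs_map dfn_mult n dfb_app2[OF P] dfn_div dfn_mod dfn_var)

text \<open>A step writes at most one cell per tape and moves a head by at most one, so after
  \<open>n\<close> steps all cells from \<open>n\<close> behind the input on are still blank. An
  output ends before the first blank. The bound is what a second machine needs for its running
  time.\<close>

lemma computes_length:
  assumes "wf_tm M" "computes_within M xs ys T" "i < length ys"
  shows "length (ys ! i) \<le> length (if i < length xs then xs ! i else []) + T"
proof -
  let ?x = "\<lambda>i. if i < length xs then xs ! i else []"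
  obtain n q ts where n: "n \<le> T" "(step M ^^ n) (init_config M xs) = (q, ts)"
    and hs: "holds_string (ts ! i) (ys ! i)" and i: "i < num_tapes M"
    using assms(2,3) unfolding computes_within_def by fastforce
  have "\<forall>q ts. (step M ^^ n) (init_config M xs) = (q, ts) \<longrightarrow> length ts = num_tapes M \<and>
     snd (ts ! i) \<le> int n \<and> (\<forall>p \<ge> int (length (?x i) + n). fst (ts ! i) p = None)" for n
  proof (induction n)
    case 0
    then show ?case using i by (auto simp: init_config_def string_tape_def)
  next
    case (Suc n)
    obtain q ts where c: "(step M ^^ n) (init_config M xs) = (q, ts)"
      by (cases "(step M ^^ n) (init_config M xs)")
    then have inv: "length ts = num_tapes M" "snd (ts ! i) \<le> int n"
      "\<And>p. p \<ge> int (length (?x i) + n) \<Longrightarrow> fst (ts ! i) p = None" using Suc by auto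
    show ?case
    proof (cases "q < num_states M")
      case True
      obtain q' as where d: "delta M q (map (\<lambda>(c, h). c h) ts) = (q', as)"
        by (cases "delta M q (map (\<lambda>(c, h). c h) ts)")
      have las: "length as = num_tapes M"
        using assms(1) True d inv(1) unfolding wf_tm_def by (metis length_map snd_conv)
      obtain c' h s dir where ci: "ts ! i = (c', h)" "as ! i = (s, dir)"
        by (cases "ts ! i"; cases "as ! i")
      have "map2 act as ts ! i = (c'(h := s), move dir h)" using ci i inv(1) las by simp
      moreover have "move dir h \<le> h + 1" by (cases dir) auto
      ultimately show ?thesis using c d True inv las ci by auto
    next
      case False
      then show ?thesis using c inv by auto
    qed
  qed
  then have "fst (ts ! i) (int (length (?x i) + n)) = None" using n(2) by blast
  then have "length (ys ! i) \<le> length (?x i) + n"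
    using hs unfolding holds_string_def by (metis leI option.distinct(1))
  then show ?thesis using n(1) by linarith
qed

lemma computes_within_mono: "computes_within M xs ys T \<Longrightarrow> T \<le> T' \<Longrightarrow> computes_within M xs ys T'"
  unfolding computes_within_def by (meson order_trans)

lemma computes_within_take: "computes_within M xs (y # ys) T \<Longrightarrow> computes_within M xs [y] T"
  unfolding computes_within_def by fastforce

text \<open>Presents a single string to \<open>compose_string_function\<close> as the pair of this
  string and the empty one.\<close>

definition id_tm :: tm where
  "id_tm = mover 2 (\<lambda>i \<sigma>. Stay)"

lemma id_tm: "wf_tm id_tm" "computes_within id_tm [x] [x, []] 1"
proof -
  have m: "machine 2 id_tm" by (simp add: id_tm_def)
  then show "wf_tm id_tm" by (simp add: machine_def)
  let ?\<tau> = "\<lambda>i. string_tape (if i < length [x] then [x] ! i else [])"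
  have "runs 2 id_tm ?\<tau> 1 ?\<tau>" unfolding id_tm_def by (rule runs_mover) simp
  then obtain t where t: "t \<le> 1" "halts id_tm (init_config id_tm [x]) t (map ?\<tau> [0..<2])"
    using m unfolding runs_def init_config_def machine_def by auto
  have "holds_string (string_tape z) z" for z by (simp add: holds_string_def string_tape_def)
  then have "\<forall>i < 2. holds_string (map ?\<tau> [0..<2] ! i) ([x, []] ! i)"
    by (auto simp: less_2_cases_iff)
  then show "computes_within id_tm [x] [x, []] 1"
    using halts_steps[OF t(2)] t(1) m unfolding computes_within_def machine_def
    by (intro conjI exI[of _ t] exI[of _ "num_states id_tm"] exI[of _ "map ?\<tau> [0..<2]"]) auto
qed

lemma poly_shifted_power: "poly ([:c, 1:] ^ d) n = (c + n) ^ d" for n :: nat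
  by (simp add: poly_power)

lemma polytime_dfs:
  assumes "dfs F"
  shows "polytime (\<lambda>x. F (x, []))"
proof -
  obtain tn tb where F: "\<And>X. F X = string_of tn tb X" using dfs_string_of[OF assms] by blast
  obtain M g where M: "wf_tm M" and g: "poly_bounded g" and
    comp: "\<And>xs ys T X. length xs \<le> 2 \<Longrightarrow> 0 < length ys \<Longrightarrow> 1 < length ys \<Longrightarrow>
      computes_within id_tm xs ys T \<Longrightarrow> X = (ys ! 0, ys ! 1) \<Longrightarrow>
      computes_within M xs [string_of tn tb X, string_of tn tb X] (g (T + length (fst X) + length (snd X)))"
    by (rule compose_string_function[OF id_tm(1), of True tn tb tn tb, unfolded if_True]) (rule that)
  obtain c where c: "\<And>n. g n \<le> (n + 2) ^ c" using g unfolding poly_bounded_def by blast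
  \<comment> \<open>The identity machine takes one step, so the bound \<open>(n + 2) ^ c\<close> is
    evaluated at \<open>n = 1 + length x\<close>.\<close>
  have "computes_within M [x] [F (x, [])] (poly ([:3, 1:] ^ c) (length x))" for x
  proof -
    have "computes_within M [x] [F (x, []), F (x, [])] (g (1 + length x))"
    proof -
      have "computes_within M [x] [string_of tn tb (x, []), string_of tn tb (x, [])]
          (g (1 + length (fst ((x, []) :: inp)) + length (snd ((x, []) :: inp))))"
        by (rule comp[OF _ _ _ id_tm(2)]) simp_all
      then show ?thesis by (simp add: F)
    qed
    then show ?thesis using c[of "1 + length x"]
      by (intro computes_within_mono[OF computes_within_take])
        (auto simp: poly_shifted_power numeral_3_eq_3)
  qed
  then show ?thesis unfolding polytime_def using M by blast
qed

lemma computable_dfn: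
  assumes "computable h" and "dfn (\<lambda>X e. H (length (fst X)) (length (snd X)))"
  shows "computable (\<lambda>n. H (h n) n)"
proof -
  obtain M where M: "wf_tm M" "\<And>n. \<exists>T. computes_within M [unary n] [unary (h n)] T"
    using assms(1) unfolding computable_def by blast
  obtain tn tb where F: "\<And>X. unary (H (length (fst X)) (length (snd X))) = string_of tn tb X"
    using dfs_string_of[OF dfs_unary[OF assms(2)]] by blast
  obtain M' g where M': "wf_tm M'" and "poly_bounded g" and
    comp: "\<And>xs ys T X. length xs \<le> 2 \<Longrightarrow> 0 < length ys \<Longrightarrow> 0 < length xs \<Longrightarrow>
      computes_within M xs ys T \<Longrightarrow> X = (ys ! 0, xs ! 0) \<Longrightarrow>
      computes_within M' xs [string_of tn tb X, string_of tn tb X] (g (T + length (fst X) + length (snd X)))"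
    by (rule compose_string_function[OF M(1), of False tn tb tn tb, unfolded if_False]) (rule that)
  have "\<exists>T. computes_within M' [unary n] [unary (H (h n) n)] T" for n
  proof -
    obtain T where T: "computes_within M [unary n] [unary (h n)] T" using M(2) by blast
    let ?X = "(unary (h n), unary n)"
    have H: "string_of tn tb ?X = unary (H (h n) n)" using F[of ?X] by (simp add: unary_def)
    have "computes_within M' [unary n] [string_of tn tb ?X, string_of tn tb ?X]
        (g (T + length (fst ?X) + length (snd ?X)))"
      by (rule comp[OF _ _ _ T]) simp_all
    then show ?thesis unfolding H by (intro exI) (rule computes_within_take)
  qed
  then show ?thesis unfolding computable_def using M' by blast
qed

lemma fpt_time_compose:
  assumes "fpt_time f" and F: "dfs F" and K: "dfn (\<lambda>X e. K X)"
    and f': "\<And>x k. f' (x, k) = (F (fst (f (x, k)), unary (snd (f (x, k)))),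
      K (fst (f (x, k)), unary (snd (f (x, k)))))"
  shows "fpt_time f'"
proof -
  obtain M h and p :: "nat poly" where M: "wf_tm M" and h: "computable h" and
    run: "\<And>x k. computes_within M [x, unary k] [fst (f (x, k)), unary (snd (f (x, k)))]
              (h k * poly p (length x))"
    using assms(1) unfolding fpt_time_def by blast
  obtain tn tb where tF: "\<And>X. F X = string_of tn tb X" using dfs_string_of[OF F] by blast
  obtain tn' tb' where tK: "\<And>X. unary (K X) = string_of tn' tb' X"
    using dfs_string_of[OF dfs_unary[OF K]] by blast
  obtain M' g where M': "wf_tm M'" and g: "poly_bounded g" and
    comp: "\<And>xs ys T X. length xs \<le> 2 \<Longrightarrow> 0 < length ys \<Longrightarrow> 1 < length ys \<Longrightarrow>
      computes_within M xs ys T \<Longrightarrow> X = (ys ! 0, ys ! 1) \<Longrightarrow>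
      computes_within M' xs [string_of tn tb X, string_of tn' tb' X] (g (T + length (fst X) + length (snd X)))"
    by (rule compose_string_function[OF M, of True tn tb tn' tb', unfolded if_True]) (rule that)
  obtain c where c: "\<And>n. g n \<le> (n + 2) ^ c" using g unfolding poly_bounded_def by blast
  \<comment> \<open>Each output is longer than its input by at most the running time
    \<open>h k * poly p (length x)\<close>. Adding the time itself gives the factor 3, and the sum
    is dominated by a product of a function of \<open>k\<close> and a function of
    \<open>length x\<close>, as \<open>fpt_time\<close> demands.\<close>
  define h' where "h' = (\<lambda>k. (3 * h k + k + 3) ^ c)"
  define p' where "p' = (p + [:1, 1:]) ^ c"
  have "computable h'" unfolding h'_def
    by (rule computable_dfn[OF h, of "\<lambda>a b. (3 * a + b + 3) ^ c"]) (intro definable_intros)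
  moreover have "computes_within M' [x, unary k] [fst (f' (x, k)), unary (snd (f' (x, k)))]
      (h' k * poly p' (length x))" for x k
  proof -
    let ?y = "fst (f (x, k))" and ?u = "unary (snd (f (x, k)))" and ?T = "h k * poly p (length x)"
    have "length ?y \<le> length x + ?T"
      using computes_length[OF M run[of x k], of 0] by simp
    moreover have "length ?u \<le> k + ?T"
      using computes_length[OF M run[of x k], of 1] by (simp add: unary_def)
    ultimately have "?T + length ?y + length ?u + 2 \<le> 3 * ?T + length x + k + 2" by linarith
    also have "\<dots> \<le> (3 * h k + k + 3) * (poly p (length x) + length x + 1)"
      by (simp add: algebra_simps)
    finally have "(?T + length ?y + length ?u + 2) ^ c \<le> ((3 * h k + k + 3) * (poly p (length x) + length x + 1)) ^ c"
      by (rule power_mono) simp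
    then have "g (?T + length ?y + length ?u) \<le> h' k * poly p' (length x)"
      using c[of "?T + length ?y + length ?u"] unfolding h'_def p'_def
      by (simp add: poly_power power_mult_distrib[symmetric] add.commute add.left_commute del: power_mult_distrib)
    moreover have "computes_within M' [x, unary k] [F (?y, ?u), unary (K (?y, ?u))]
        (g (?T + length ?y + length ?u))"
    proof -
      have "computes_within M' [x, unary k] [string_of tn tb (?y, ?u), string_of tn' tb' (?y, ?u)]
          (g (?T + length (fst (?y, ?u)) + length (snd (?y, ?u))))"
        by (rule comp[OF _ _ _ run[of x k]]) simp_all
      then show ?thesis by (simp add: tF tK)
    qed
    ultimately show ?thesis using f' computes_within_mono by auto
  qed
  ultimately show ?thesis unfolding fpt_time_def using M' by blast
qed


section \<open>From hitting sets to token sliding\<close>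

text \<open>Connectedness of a digraph refers to its symmetric closure and includes the existence of
  a vertex. For symmetric arcs it becomes reachability, but non-emptiness remains to be
  shown.\<close>

lemma connected_iff_rtrancl:
  assumes "sym (parcs T)" "parcs T \<subseteq> pverts T \<times> pverts T"
  shows "Digraph_Component.connected (with_proj T) \<longleftrightarrow>
    pverts T \<noteq> {} \<and> (\<forall>u \<in> pverts T. \<forall>v \<in> pverts T. (u, v) \<in> (parcs T)\<^sup>*)"
proof -
  have p: "parcs (mk_symmetric (with_proj T)) = parcs T"
    using assms(1) by (auto simp: parcs_mk_symmetric dest: symD)
  have "(u, v) \<in> rtrancl_on (pverts T) (parcs T)" if "(u, v) \<in> (parcs T)\<^sup>*" "u \<in> pverts T" for u v
    using that by (induction rule: rtrancl_induct) (use assms(2) in \<open>auto intro: rtrancl_on_into_rtrancl_on\<close>)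
  then have "u \<in> pverts T \<Longrightarrow> (u, v) \<in> rtrancl_on (pverts T) (parcs T) \<longleftrightarrow> (u, v) \<in> (parcs T)\<^sup>*" for u v
    using rtrancl_on_rtranclI[of u v "pverts T" "parcs T"] by blast
  then show ?thesis
    unfolding Digraph_Component.connected_def strongly_connected_def reachable_def by (simp add: p)
qed

lemma sym_TS: "sym (parcs G) \<Longrightarrow> sym (parcs (TS k G))"
  unfolding TS_def sym_def by auto

lemma TS_subset: "parcs (TS k G) \<subseteq> pverts (TS k G) \<times> pverts (TS k G)"
  unfolding TS_def by auto

locale hitting_graph =
  fixes G :: "'a pair_pre_digraph" and U C :: "'a set" and w :: 'a
  assumes verts: "pverts G = insert w U \<union> C" and fin: "finite U"
    and disj: "w \<notin> U" "w \<notin> C" "U \<inter> C = {}"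
    and sym: "sym (parcs G)"
    and indep: "\<And>u v. u \<in> insert w U \<Longrightarrow> v \<in> insert w U \<Longrightarrow> (u, v) \<notin> parcs G"
    and cliq: "\<And>u v. u \<in> C \<Longrightarrow> v \<in> C \<Longrightarrow> (u, v) \<in> parcs G \<longleftrightarrow> u \<noteq> v"
    and center: "\<And>c. c \<in> C \<Longrightarrow> (c, w) \<in> parcs G"
begin

text \<open>A slide must enter the clique, as the other side has no edges. Its target is adjacent to
  \<open>w\<close> and to some element of \<open>H\<close>, and at most one of these two tokens has
  left. The bound \<open>k < card U\<close> supplies a second configuration, inside
  \<open>U\<close>.\<close>

lemma frozen:
  assumes H: "H \<subseteq> U" "card H = k" "k < card U" and hit: "\<And>c. c \<in> C \<Longrightarrow> \<exists>u \<in> H. (c, u) \<in> parcs G"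
  shows "\<not> Digraph_Component.connected (with_proj (TS (Suc k) G))"
proof
  assume con: "Digraph_Component.connected (with_proj (TS (Suc k) G))"
  let ?I = "insert w H"
  have finH: "finite H" using H(1) fin by (rule finite_subset)
  moreover have "w \<notin> H" using H(1) disj(1) by auto
  ultimately have "card ?I = Suc k" using H(2) by simp
  then have I: "?I \<in> k_indep_sets (Suc k) G"
    using H disj finH indep verts unfolding k_indep_sets_def indep_set_def by (auto simp: subset_iff)
  obtain J where J: "J \<subseteq> U" "card J = Suc k" using H(3) by (meson Suc_leI obtain_subset_with_card_n)
  then have J': "J \<in> k_indep_sets (Suc k) G"
    using indep verts unfolding k_indep_sets_def indep_set_def by (auto simp: subset_iff)
  have "(?I, J) \<in> (parcs (TS (Suc k) G))\<^sup>*"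
    using con I J' unfolding connected_iff_rtrancl[OF sym_TS[OF sym] TS_subset] by (simp add: TS_def)
  moreover have "?I \<noteq> J" using J(1) disj by auto
  ultimately obtain I' where I': "(?I, I') \<in> parcs (TS (Suc k) G)" by (meson converse_rtranclE)
  then obtain u v where uv: "?I - I' = {v}" "I' - ?I = {u}" "(u, v) \<in> parcs G" and ind: "indep_set G I'"
    unfolding TS_def k_indep_sets_def by auto
  have v: "v \<in> insert w U" using uv(1) H(1) by auto
  have "u \<in> pverts G" using uv(2) ind unfolding indep_set_def by auto
  then have u: "u \<in> C" using indep[OF _ v] uv(3) verts by auto
  obtain h where h: "h \<in> H" "(u, h) \<in> parcs G" using hit[OF u] by blast
  have "w \<noteq> h" using h(1) H(1) disj(1) by auto
  then have "w \<in> I' \<or> h \<in> I'" using uv(1) h(1) by (metis DiffI insertCI singletonD)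
  moreover have "u \<in> I'" using uv(2) by auto
  ultimately show False using ind center[OF u] h(2) unfolding indep_set_def by auto
qed

text \<open>Every configuration is brought to the form \<open>insert w H\<close> with
  \<open>H \<subseteq> U\<close>, and two configurations of this form are joined by exchanging one
  element at a time. The bound on \<open>k\<close> makes the graph non-empty.\<close>

lemma connected_if_unhit:
  assumes k: "k \<le> card U"
    and unhit: "\<And>H u. H \<subseteq> U \<Longrightarrow> card H = k \<Longrightarrow> u \<in> U \<Longrightarrow> \<exists>c \<in> C. (c, u) \<in> parcs G \<and> (\<forall>h \<in> H - {u}. (c, h) \<notin> parcs G)"
  shows "Digraph_Component.connected (with_proj (TS (Suc k) G))"
proof -
  let ?T = "TS (Suc k) G" and ?R = "(parcs (TS (Suc k) G))\<^sup>*"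
  have symR: "sym ?R" using sym_rtrancl[OF sym_TS[OF sym]] .
  have finS: "finite H" if "H \<subseteq> U" for H using that fin by (rule finite_subset)
  have vU: "I \<in> k_indep_sets (Suc k) G" if "I \<subseteq> insert w U" "card I = Suc k" for I
    using that indep verts unfolding k_indep_sets_def indep_set_def by (auto simp: subset_iff)
  have vC: "insert c H \<in> k_indep_sets (Suc k) G"
    if "c \<in> C" "H \<subseteq> U" "card H = k" "\<And>h. h \<in> H \<Longrightarrow> (c, h) \<notin> parcs G" for c H
  proof -
    have "(h, c) \<notin> parcs G" if "h \<in> H" for h using \<open>\<And>h. h \<in> H \<Longrightarrow> (c, h) \<notin> parcs G\<close>[OF that] sym by (auto dest: symD)
    moreover have "c \<notin> H" using that disj by auto
    ultimately show ?thesis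
      using that indep verts finS[OF that(2)] cliq[of c c] unfolding k_indep_sets_def indep_set_def
      by (auto simp: subset_iff)
  qed
  have slide: "(insert x H, insert c H) \<in> ?R"
    if "c \<in> C" "H \<subseteq> U" "card H = k" "\<And>h. h \<in> H \<Longrightarrow> (c, h) \<notin> parcs G" "x \<in> insert w U" "x \<notin> H" "(c, x) \<in> parcs G" for x c H
  proof -
    have "insert x H \<in> k_indep_sets (Suc k) G"
      using that disj finS[OF that(2)] by (intro vU) auto
    moreover have "insert x H - insert c H = {x}" "insert c H - insert x H = {c}"
      using that disj by auto
    ultimately have "(insert x H, insert c H) \<in> parcs ?T"
      using vC[OF that(1-4)] that(7) unfolding TS_def by auto
    then show ?thesis by blast
  qed
  \<comment> \<open>The basic move: a clique vertex adjacent to \<open>w\<close> and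
    \<open>u\<close> but to no token of \<open>H\<close> lets the token go from \<open>w\<close> to
    \<open>u\<close> in two slides.\<close>
  have fill: "(insert w H, insert u H) \<in> ?R" if H: "H \<subseteq> U" "card H = k" and u: "u \<in> U" "u \<notin> H" for H u
  proof -
    obtain c where c: "c \<in> C" "(c, u) \<in> parcs G" "\<And>h. h \<in> H \<Longrightarrow> (c, h) \<notin> parcs G"
      using unhit[OF H u(1)] u(2) by auto
    have "(insert w H, insert c H) \<in> ?R" using slide[of c H w] c H disj center by auto
    moreover have "(insert u H, insert c H) \<in> ?R" using slide[of c H u] c H u by auto
    ultimately show ?thesis using symR by (meson rtrancl_trans symD)
  qed
  \<comment> \<open>Filling \<open>H\<close> with \<open>u\<close> and filling the exchanged set
    with \<open>u'\<close> lead to the same configuration.\<close>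
  have exch: "(insert w H, insert w (insert u (H - {u'}))) \<in> ?R"
    if H: "H \<subseteq> U" "card H = k" and u: "u \<in> U" "u \<notin> H" "u' \<in> H" for H u u'
  proof -
    let ?H' = "insert u (H - {u'})"
    have "card ?H' = k" using card_Suc_Diff1[OF finS[OF H(1)] u(3)] H u finS[OF H(1)] by simp
    moreover have "insert u' ?H' = insert u H" using u by auto
    ultimately have "(insert w ?H', insert u H) \<in> ?R" using fill[of ?H' u'] H u by auto
    then show ?thesis using fill[OF H u(1,2)] symR by (meson rtrancl_trans symD)
  qed
  have all: "(insert w H, insert w H') \<in> ?R"
    if "H \<subseteq> U" "card H = k" "H' \<subseteq> U" "card H' = k" for H H'
    using that
  proof (induction "card (H - H')" arbitrary: H rule: less_induct)
    case less
    have f: "finite H" "finite H'" using finS less.prems by auto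
    show ?case
    proof (cases "H \<subseteq> H'")
      case True
      then have "H = H'" using less.prems f by (intro card_subset_eq) auto
      then show ?thesis by simp
    next
      case False
      then obtain u' where u': "u' \<in> H" "u' \<notin> H'" by auto
      have "\<not> H' \<subseteq> H" using False f less.prems card_subset_eq[of H H'] by auto
      then obtain u where u: "u \<in> H'" "u \<notin> H" by auto
      let ?H1 = "insert u (H - {u'})"
      have "?H1 - H' = (H - H') - {u'}" using u by auto
      then have "card (?H1 - H') < card (H - H')"
        using u' f by (metis DiffI card_Diff1_less finite_Diff)
      moreover have "card ?H1 = k"
        using card_Suc_Diff1[OF f(1) u'(1)] u f less.prems(2) by simp
      moreover have "?H1 \<subseteq> U" using u less.prems by auto
      ultimately have "(insert w ?H1, insert w H') \<in> ?R" using less by auto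
      moreover have "(insert w H, insert w ?H1) \<in> ?R" using exch u u' less.prems by auto
      ultimately show ?thesis by (meson rtrancl_trans)
    qed
  qed
  \<comment> \<open>At most one token is in the clique, and it excludes a token on \<open>w\<close>;
    the others then lie in \<open>U\<close>, so it can slide to \<open>w\<close>. A configuration
    inside \<open>U\<close> is treated by reversing a filling move.\<close>
  have norm: "\<exists>H. H \<subseteq> U \<and> card H = k \<and> (I, insert w H) \<in> ?R" if I: "I \<in> k_indep_sets (Suc k) G" for I
  proof -
    have sub: "I \<subseteq> insert w U \<union> C" and cI: "card I = Suc k" and ind: "\<And>u v. u \<in> I \<Longrightarrow> v \<in> I \<Longrightarrow> (u, v) \<notin> parcs G"
      using I verts unfolding k_indep_sets_def indep_set_def by auto
    have fI: "finite I" using cI by (metis card.infinite nat.distinct(1))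
    consider (c) c where "c \<in> I" "c \<in> C" | (w) "w \<in> I" "I \<inter> C = {}" | (u) "I \<subseteq> U" using sub by auto
    then show ?thesis
    proof cases
      case c
      let ?H = "I - {c}"
      have "x \<in> U" if "x \<in> ?H" for x
        using that ind[of c x] c center cliq[of c x] sub by auto
      then have H: "?H \<subseteq> U" "card ?H = k" using c cI fI by auto
      moreover have "(insert w ?H, insert c ?H) \<in> ?R"
        using slide[of c ?H w] c H ind disj center by auto
      ultimately show ?thesis using symR c(1) by (metis insert_Diff symD)
    next
      case w
      then have "I - {w} \<subseteq> U" "card (I - {w}) = k" "insert w (I - {w}) = I" using sub cI fI by auto
      then show ?thesis by (metis rtrancl.rtrancl_refl)
    next
      case u
      obtain x where x: "x \<in> I" using cI by fastforce
      let ?H = "I - {x}"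
      have "?H \<subseteq> U" "card ?H = k" "insert x ?H = I" using u x cI fI by auto
      moreover have "(insert w ?H, insert x ?H) \<in> ?R" using fill[of ?H x] calculation x u by auto
      ultimately show ?thesis using symR by (metis symD)
    qed
  qed
  obtain H where H: "H \<subseteq> U" "card H = k" using k by (meson obtain_subset_with_card_n)
  have "w \<notin> H" using H(1) disj(1) by auto
  then have "insert w H \<in> k_indep_sets (Suc k) G" using finS[OF H(1)] H by (intro vU) auto
  moreover have "(I, J) \<in> ?R" if I: "I \<in> k_indep_sets (Suc k) G" and J: "J \<in> k_indep_sets (Suc k) G" for I J
  proof -
    obtain H1 where H1: "H1 \<subseteq> U" "card H1 = k" "(I, insert w H1) \<in> ?R" using norm[OF I] by blast
    obtain H2 where H2: "H2 \<subseteq> U" "card H2 = k" "(J, insert w H2) \<in> ?R" using norm[OF J] by blast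
    have "(I, insert w H2) \<in> ?R" using H1(3) all[OF H1(1,2) H2(1,2)] by (rule rtrancl_trans)
    then show ?thesis using symD[OF symR H2(3)] by (rule rtrancl_trans)
  qed
  ultimately show ?thesis
    unfolding connected_iff_rtrancl[OF sym_TS[OF sym] TS_subset] by (auto simp: TS_def)
qed

end

section \<open>The concrete graph of a hitting set instance\<close>

text \<open>
  Elements \<open>0, \<dots>, n - 1\<close> and the extra vertex \<open>n\<close> form the independent side; the clique vertex of the
  pair of a set \<open>z\<close> and an element \<open>u\<close> is adjacent to \<open>u\<close>, to the elements of \<open>z\<close> and to \<open>n\<close>.
\<close>

definition hs_half :: "nat \<Rightarrow> (nat \<Rightarrow> nat \<Rightarrow> bool) \<Rightarrow> nat \<Rightarrow> nat \<Rightarrow> bool" where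
  "hs_half n S a b \<longleftrightarrow> n < a \<and> b \<le> n \<and> (b = n \<or> b = (a - Suc n) mod n \<or> S ((a - Suc n) div n) b)"

definition hs_adj :: "nat \<Rightarrow> (nat \<Rightarrow> nat \<Rightarrow> bool) \<Rightarrow> nat \<Rightarrow> nat \<Rightarrow> bool" where
  "hs_adj n S a b \<longleftrightarrow> (n < a \<and> n < b \<and> a \<noteq> b) \<or> hs_half n S a b \<or> hs_half n S b a"

definition hs_size :: "nat \<Rightarrow> nat \<Rightarrow> nat" where
  "hs_size n m = Suc n + m * n"

definition hs_graph :: "nat \<Rightarrow> nat \<Rightarrow> (nat \<Rightarrow> nat \<Rightarrow> bool) \<Rightarrow> nat pair_pre_digraph" where
  "hs_graph n m S = \<lparr>pverts = {..<hs_size n m},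
     parcs = {(a, b). a < hs_size n m \<and> b < hs_size n m \<and> hs_adj n S a b}\<rparr>"

definition hitting :: "nat \<Rightarrow> nat \<Rightarrow> (nat \<Rightarrow> nat \<Rightarrow> bool) \<Rightarrow> nat \<Rightarrow> bool" where
  "hitting n m S k \<longleftrightarrow> (\<exists>H \<subseteq> {..<n}. card H = k \<and> (\<forall>z < m. \<exists>u \<in> H. S z u))"

lemma hitting_graph_hs: "hitting_graph (hs_graph n m S) {..<n} {Suc n..<hs_size n m} n"
  by unfold_locales (auto simp: hs_graph_def hs_size_def hs_adj_def hs_half_def sym_def)

lemma split_hs_graph: "split_graph (hs_graph n m S)"
proof -
  interpret hitting_graph "hs_graph n m S" "{..<n}" "{Suc n..<hs_size n m}" n by (rule hitting_graph_hs)
  have "parcs (hs_graph n m S) \<subseteq> {..<hs_size n m} \<times> {..<hs_size n m}" by (auto simp: hs_graph_def)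
  then have "finite (parcs (hs_graph n m S))" by (rule finite_subset) auto
  then have "pair_graph (hs_graph n m S)"
    using sym by unfold_locales (auto simp: hs_graph_def symmetric_def hs_adj_def hs_half_def)
  moreover have "clique (hs_graph n m S) {Suc n..<hs_size n m}"
    using cliq by (auto simp: clique_def hs_graph_def)
  moreover have "indep_set (hs_graph n m S) (insert n {..<n})"
    using indep by (auto simp: indep_set_def hs_graph_def hs_size_def)
  moreover have "{Suc n..<hs_size n m} \<union> insert n {..<n} = pverts (hs_graph n m S)"
    using verts by auto
  moreover have "{Suc n..<hs_size n m} \<inter> insert n {..<n} = {}" by auto
  ultimately show ?thesis unfolding split_graph_def by blast
qed

theorem hitting_iff_disconnected:
  assumes "k < n"
  shows "Digraph_Component.connected (with_proj (TS (Suc k) (hs_graph n m S))) \<longleftrightarrow> \<not> hitting n m S k"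
proof -
  interpret hitting_graph "hs_graph n m S" "{..<n}" "{Suc n..<hs_size n m}" n by (rule hitting_graph_hs)
  have arc: "(c, u) \<in> parcs (hs_graph n m S) \<longleftrightarrow> hs_half n S c u"
    if "c \<in> {Suc n..<hs_size n m}" "u < n" for c u
    using that by (auto simp: hs_graph_def hs_adj_def hs_half_def hs_size_def)
  have n: "0 < n" using assms by simp
  have 1: "\<not> Digraph_Component.connected (with_proj (TS (Suc k) (hs_graph n m S)))" if h: "hitting n m S k"
  proof -
    obtain H where H: "H \<subseteq> {..<n}" "card H = k" "\<And>z. z < m \<Longrightarrow> \<exists>u \<in> H. S z u"
      using h unfolding hitting_def by blast
    have "\<exists>u \<in> H. (c, u) \<in> parcs (hs_graph n m S)" if c: "c \<in> {Suc n..<hs_size n m}" for c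
    proof -
      have "(c - Suc n) div n < m" using c n by (auto simp: hs_size_def less_mult_imp_div_less)
      then obtain u where "u \<in> H" "S ((c - Suc n) div n) u" using H(3) by blast
      moreover have "u < n" using \<open>u \<in> H\<close> H(1) by auto
      moreover have "n < c" using c by simp
      ultimately show ?thesis using arc[OF c \<open>u < n\<close>] by (intro bexI[of _ u]) (simp_all add: hs_half_def)
    qed
    then show ?thesis using frozen[OF H(1,2)] assms by simp
  qed
  have 2: "Digraph_Component.connected (with_proj (TS (Suc k) (hs_graph n m S)))" if nh: "\<not> hitting n m S k"
  proof (rule connected_if_unhit)
    fix H u assume H: "H \<subseteq> {..<n}" "card H = k" and u: "u \<in> {..<n}"
    have "\<not> (\<forall>z < m. \<exists>u \<in> H. S z u)"
    proof
      assume "\<forall>z < m. \<exists>u \<in> H. S z u"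
      then have "hitting n m S k" unfolding hitting_def using H by (intro exI[of _ H]) simp
      then show False using nh by simp
    qed
    then obtain z where z: "z < m" "\<And>h. h \<in> H \<Longrightarrow> \<not> S z h" by auto
    \<comment> \<open>The vertex of the pair \<open>(z, u)\<close> is adjacent to \<open>u\<close>
      even if \<open>z\<close> does not contain \<open>u\<close>, and to no other token of
      \<open>H\<close> because \<open>z\<close> is missed.\<close>
    let ?c = "Suc n + (z * n + u)"
    have "z * n + u < m * n"
    proof -
      have "z * n + u < Suc z * n" using u by simp
      also have "\<dots> \<le> m * n" using z(1) by (intro mult_le_mono1) simp
      finally show ?thesis .
    qed
    then have c: "?c \<in> {Suc n..<hs_size n m}" by (simp add: hs_size_def)
    have "(?c - Suc n) div n = z" "(?c - Suc n) mod n = u" using u by auto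
    then have half: "hs_half n S ?c h \<longleftrightarrow> h = u \<or> S z h" if "h < n" for h
      using that by (simp add: hs_half_def)
    show "\<exists>c \<in> {Suc n..<hs_size n m}. (c, u) \<in> parcs (hs_graph n m S) \<and>
        (\<forall>h \<in> H - {u}. (c, h) \<notin> parcs (hs_graph n m S))"
    proof (intro bexI[OF _ c] conjI ballI)
      show "(?c, u) \<in> parcs (hs_graph n m S)" using arc[OF c] half u by simp
      fix h assume h: "h \<in> H - {u}"
      then have "h < n" using H(1) by auto
      then show "(?c, h) \<notin> parcs (hs_graph n m S)" using arc[OF c] half z(2) h by simp
    qed
  qed (use assms in simp)
  show ?thesis using 1 2 by (cases "hitting n m S k") simp_all
qed


section \<open>Constraint satisfaction problems\<close>

text \<open>The case \<open>t = t'\<close> of a binary constraint expresses conditions on a single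
  variable. A clause \<open>A z\<close> is the same predicate for all variables, so a variable that
  depends on its index must be controlled through \<open>cons\<close>.\<close>

definition csp :: "nat \<Rightarrow> nat \<Rightarrow> nat \<Rightarrow> (nat \<Rightarrow> nat \<Rightarrow> nat \<Rightarrow> nat \<Rightarrow> bool) \<Rightarrow> (nat \<Rightarrow> nat \<Rightarrow> bool) \<Rightarrow> bool" where
  "csp K N Z cons A \<longleftrightarrow> (\<exists>y. (\<forall>t < K. y t < N) \<and> (\<forall>t < K. \<forall>t' < K. cons t (y t) t' (y t')) \<and>
     (\<forall>z < Z. \<exists>t < K. A z (y t)))"

text \<open>The element \<open>t * N + v\<close> stands for the choice \<open>y t = v\<close>.\<close>

definition csp_set :: "nat \<Rightarrow> nat \<Rightarrow> (nat \<Rightarrow> nat \<Rightarrow> nat \<Rightarrow> nat \<Rightarrow> bool) \<Rightarrow> (nat \<Rightarrow> nat \<Rightarrow> bool) \<Rightarrow> nat \<Rightarrow> nat \<Rightarrow> bool" where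
  "csp_set K N cons A z u \<longleftrightarrow> (if z < K then u div N = z
     else if z < K + K * (K * N) then
       (u div N = (z - K) mod (K * N) div N \<and> u mod N \<noteq> (z - K) mod (K * N) mod N) \<or>
       (u div N = (z - K) div (K * N) \<and>
        cons ((z - K) mod (K * N) div N) ((z - K) mod (K * N) mod N) ((z - K) div (K * N)) (u mod N))
     else A (z - K - K * (K * N)) (u mod N))"

text \<open>The first \<open>K\<close> sets are disjoint and contain all choices of one variable;
  hence a hitting set of size \<open>K\<close> makes exactly one choice for each. The next
  \<open>K * (K * N)\<close> sets express the constraints: for a choice \<open>(t, v)\<close> and a
  variable \<open>t'\<close> the set has the other choices of \<open>t\<close> and those choices of
  \<open>t'\<close> that are compatible with \<open>(t, v)\<close>. The remaining sets are the
  clauses.\<close>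

lemma csp_iff_hitting:
  assumes N: "0 < N"
  shows "csp K N Z cons A \<longleftrightarrow> hitting (K * N) (K + K * (K * N) + Z) (csp_set K N cons A) K"
proof
  assume "csp K N Z cons A"
  then obtain y where y: "\<And>t. t < K \<Longrightarrow> y t < N" "\<And>t t'. t < K \<Longrightarrow> t' < K \<Longrightarrow> cons t (y t) t' (y t')"
    "\<And>z. z < Z \<Longrightarrow> \<exists>t < K. A z (y t)" unfolding csp_def by blast
  let ?f = "\<lambda>t. t * N + y t"
  let ?H = "?f ` {..<K}"
  have f: "?f t div N = t" "?f t mod N = y t" if "t < K" for t using y(1)[OF that] by auto
  have "inj_on ?f {..<K}"
  proof (rule inj_onI)
    fix a b assume a: "a \<in> {..<K}" and b: "b \<in> {..<K}" and eq: "?f a = ?f b"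
    have "?f a div N = ?f b div N" unfolding eq ..
    then show "a = b" unfolding f(1)[OF a[unfolded lessThan_iff]] f(1)[OF b[unfolded lessThan_iff]] .
  qed
  then have "card ?H = K" by (simp add: card_image)
  moreover have "?f t < K * N" if "t < K" for t
  proof -
    have "?f t < Suc t * N" using y(1)[OF that] by simp
    also have "\<dots> \<le> K * N" using that by (intro mult_le_mono1) simp
    finally show ?thesis .
  qed
  then have "?H \<subseteq> {..<K * N}" by auto
  moreover have "\<exists>u \<in> ?H. csp_set K N cons A z u" if z: "z < K + K * (K * N) + Z" for z
  proof -
    consider "z < K" | "\<not> z < K" "z < K + K * (K * N)" | "\<not> z < K + K * (K * N)" by linarith
    then show ?thesis
    proof cases
      case 1
      then show ?thesis using f[OF 1] by (intro bexI[of _ "?f z"]) (auto simp: csp_set_def)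
    next
      case 2
      let ?t = "(z - K) div (K * N)" and ?s = "(z - K) mod (K * N)"
      have K: "0 < K" using 2 by (cases K) auto
      have t: "?t < K" using 2 by (intro less_mult_imp_div_less) linarith
      have s: "?s div N < K" using K N by (intro less_mult_imp_div_less) simp
      show ?thesis
      proof (cases "y (?s div N) = ?s mod N")
        case True
        then have "csp_set K N cons A z (?f ?t)"
          using 2 f[OF t] y(2)[OF s t] unfolding csp_set_def by simp
        then show ?thesis using t by blast
      next
        case False
        then have "csp_set K N cons A z (?f (?s div N))"
          using 2 f[OF s] unfolding csp_set_def by simp
        then show ?thesis using s by blast
      qed
    next
      case 3
      then have "z - K - K * (K * N) < Z" using z by linarith
      then obtain t where t: "t < K" "A (z - K - K * (K * N)) (y t)" using y(3) by blast
      then have "csp_set K N cons A z (?f t)" using 3 f[OF t(1)] unfolding csp_set_def by simp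
      then show ?thesis using t by blast
    qed
  qed
  ultimately show "hitting (K * N) (K + K * (K * N) + Z) (csp_set K N cons A) K"
    unfolding hitting_def by blast
next
  assume "hitting (K * N) (K + K * (K * N) + Z) (csp_set K N cons A) K"
  then obtain H where H: "H \<subseteq> {..<K * N}" "card H = K"
    and hit: "\<And>z. z < K + K * (K * N) + Z \<Longrightarrow> \<exists>u \<in> H. csp_set K N cons A z u"
    unfolding hitting_def by blast
  have finH: "finite H" using H(1) by (rule finite_subset) simp
  have "(\<lambda>u. u div N) ` H = {..<K}"
  proof
    show "(\<lambda>u. u div N) ` H \<subseteq> {..<K}" using H(1) by (auto intro: less_mult_imp_div_less)
    show "{..<K} \<subseteq> (\<lambda>u. u div N) ` H"
    proof
      fix t assume t: "t \<in> {..<K}"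
      then obtain u where "u \<in> H" "u div N = t" using hit[of t] by (auto simp: csp_set_def)
      then show "t \<in> (\<lambda>u. u div N) ` H" by auto
    qed
  qed
  then have bij: "bij_betw (\<lambda>u. u div N) H {..<K}"
    using H(2) finH by (simp add: bij_betw_def eq_card_imp_inj_on)
  define y where "y t = the_inv_into H (\<lambda>u. u div N) t mod N" for t
  have y: "y (u div N) = u mod N" if "u \<in> H" for u
    unfolding y_def the_inv_into_f_f[OF bij_betw_imp_inj_on[OF bij] that] ..
  have ex: "\<exists>u \<in> H. u div N = t \<and> y t = u mod N" if "t < K" for t
  proof -
    have "t \<in> (\<lambda>u. u div N) ` H" using bij that by (simp add: bij_betw_def)
    then show ?thesis using y by auto
  qed
  have "\<forall>t < K. y t < N" using N by (simp add: y_def)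
  moreover have "cons t (y t) t' (y t')" if t: "t < K" "t' < K" for t t'
  proof -
    let ?s = "t * N + y t"
    \<comment> \<open>The set for the choice actually made at \<open>t\<close>, paired with
      \<open>t'\<close>. No other choice of \<open>t\<close> belongs to \<open>H\<close>, so the set
      is hit by a compatible choice of \<open>t'\<close>.\<close>
    let ?z = "K + (t' * (K * N) + ?s)"
    have yt: "y t < N" using N by (simp add: y_def)
    have "?s < Suc t * N" using yt by simp
    also have "\<dots> \<le> K * N" using t(1) by (intro mult_le_mono1) simp
    finally have s: "?s < K * N" .
    then have "t' * (K * N) + ?s < Suc t' * (K * N)" by simp
    also have "\<dots> \<le> K * (K * N)" using t(2) by (intro mult_le_mono1) simp
    finally have z: "?z < K + K * (K * N)" by simp
    have divmod: "(a * L + b) div L = a \<and> (a * L + b) mod L = b" if "b < L" for a b L :: nat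
      using that by auto
    have d: "(?z - K) div (K * N) = t'" "(?z - K) mod (K * N) = ?s" "?s div N = t" "?s mod N = y t"
      using divmod[OF s, of t'] divmod[OF yt, of t] by simp_all
    obtain u where u: "u \<in> H" "csp_set K N cons A ?z u" using hit[of ?z] z by auto
    then have "(u div N = t \<and> u mod N \<noteq> y t) \<or> (u div N = t' \<and> cons t (y t) t' (u mod N))"
      using z d unfolding csp_set_def by auto
    then show ?thesis using y[OF u(1)] by auto
  qed
  moreover have "\<exists>t < K. A z (y t)" if z: "z < Z" for z
  proof -
    obtain u where u: "u \<in> H" "csp_set K N cons A (K + K * (K * N) + z) u"
      using hit[of "K + K * (K * N) + z"] z by auto
    then have "A z (y (u div N))" using y[OF u(1)] unfolding csp_set_def by auto
    moreover have "u div N < K" using u(1) H(1) by (auto intro: less_mult_imp_div_less)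
    ultimately show ?thesis by blast
  qed
  ultimately show "csp K N Z cons A" unfolding csp_def by blast
qed

definition csp_size :: "nat \<Rightarrow> nat \<Rightarrow> nat \<Rightarrow> nat" where
  "csp_size K N Z = hs_size (K * N) (K + K * (K * N) + Z)"

definition csp_graph :: "nat \<Rightarrow> nat \<Rightarrow> nat \<Rightarrow> (nat \<Rightarrow> nat \<Rightarrow> nat \<Rightarrow> nat \<Rightarrow> bool) \<Rightarrow> (nat \<Rightarrow> nat \<Rightarrow> bool) \<Rightarrow>
    nat pair_pre_digraph" where
  "csp_graph K N Z cons A = hs_graph (K * N) (K + K * (K * N) + Z) (csp_set K N cons A)"

text \<open>There is one token for each variable and one for \<open>w\<close>. With at least two
  values per variable, \<open>K < K * N\<close> holds, so that a configuration without
  \<open>w\<close> exists beside a frozen one.\<close>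

lemma csp_graph:
  assumes "0 < K" "1 < N"
  shows "split_graph (csp_graph K N Z cons A)" "pverts (csp_graph K N Z cons A) = {..<csp_size K N Z}"
    "Digraph_Component.connected (with_proj (TS (Suc K) (csp_graph K N Z cons A))) \<longleftrightarrow> \<not> csp K N Z cons A"
proof -
  have "K < K * N" using assms by simp
  then show "split_graph (csp_graph K N Z cons A)" "pverts (csp_graph K N Z cons A) = {..<csp_size K N Z}"
    "Digraph_Component.connected (with_proj (TS (Suc K) (csp_graph K N Z cons A))) \<longleftrightarrow> \<not> csp K N Z cons A"
    using assms by (simp_all add: csp_graph_def csp_size_def split_hs_graph hitting_iff_disconnected csp_iff_hitting)
      (simp add: hs_graph_def)
qed

lemma dfs_enc_csp_graph:
  assumes K: "dfn (\<lambda>X e. K X)" and N: "dfn (\<lambda>X e. N X)" and Z: "dfn (\<lambda>X e. Z X)"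
    and cons: "dfb (\<lambda>X e. cons X (e 0) (e 1) (e 2) (e 3))" and A: "dfb (\<lambda>X e. A X (e 0) (e 1))"
  shows "dfs (\<lambda>X. enc_graph (csp_size (K X) (N X) (Z X)) (csp_graph (K X) (N X) (Z X) (cons X) (A X)))"
proof -
  note KNZ = K N Z
  have S: "dfb (\<lambda>X e. csp_set (K X) (N X) (cons X) (A X) (e 0) (e 1))"
    unfolding csp_set_def by (intro definable_intros KNZ dfb_app4[OF cons] dfb_app2[OF A])
  have half: "dfb (\<lambda>X e. hs_half (K X * N X) (csp_set (K X) (N X) (cons X) (A X)) (e 0) (e 1))"
    unfolding hs_half_def by (intro definable_intros KNZ dfb_app2[OF S])
  have adj: "dfb (\<lambda>X e. hs_adj (K X * N X) (csp_set (K X) (N X) (cons X) (A X)) (e 0) (e 1))"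
    unfolding hs_adj_def by (intro definable_intros KNZ dfb_app2[OF half])
  have size: "dfn (\<lambda>X e. csp_size (K X) (N X) (Z X))"
    unfolding csp_size_def hs_size_def by (intro definable_intros KNZ)
  have "dfb (\<lambda>X e. e 0 < csp_size (K X) (N X) (Z X) \<and> e 1 < csp_size (K X) (N X) (Z X) \<and>
      hs_adj (K X * N X) (csp_set (K X) (N X) (cons X) (A X)) (e 0) (e 1))"
    by (intro definable_intros size adj)
  moreover have "(i, j) \<in> parcs (csp_graph (K X) (N X) (Z X) (cons X) (A X)) \<longleftrightarrow>
      i < csp_size (K X) (N X) (Z X) \<and> j < csp_size (K X) (N X) (Z X) \<and>
      hs_adj (K X * N X) (csp_set (K X) (N X) (cons X) (A X)) i j" for X i j
    by (simp add: csp_graph_def hs_graph_def csp_size_def)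
  ultimately have P: "dfb (\<lambda>X e. (e 0, e 1) \<in> parcs (csp_graph (K X) (N X) (Z X) (cons X) (A X)))"
    by (simp only:)
  show ?thesis unfolding enc_graph_def
    by (intro dfs_append dfs_enc_nat size dfs_matrix[where
          P = "\<lambda>X i j. (i, j) \<in> parcs (csp_graph (K X) (N X) (Z X) (cons X) (A X))"] P)
qed


section \<open>Digits\<close>

text \<open>A value of a constraint variable is a tuple of bounded numbers, stored as digits in base
  \<open>Q\<close>. For a constant number of digits the number of values stays polynomial.\<close>

definition dig :: "nat \<Rightarrow> nat \<Rightarrow> nat \<Rightarrow> nat" where
  "dig Q v i = v div Q ^ i mod Q"

lemma dig_less: "0 < Q \<Longrightarrow> dig Q v i < Q"
  by (simp add: dig_def)

lemma digits_exist:
  assumes "\<And>i. i < l \<Longrightarrow> d i < Q"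
  shows "\<exists>v < Q ^ l. \<forall>i < l. dig Q v i = d i"
  using assms
proof (induction l)
  case (Suc l)
  then obtain v where v: "v < Q ^ l" "\<And>i. i < l \<Longrightarrow> dig Q v i = d i" by auto
  let ?v = "v + d l * Q ^ l"
  have dl: "d l < Q" using Suc.prems by simp
  have "?v < Suc (d l) * Q ^ l" using v(1) by simp
  also have "\<dots> \<le> Q * Q ^ l" using dl by (intro mult_le_mono1) simp
  finally have "?v < Q ^ Suc l" by simp
  moreover have "dig Q ?v i = d i" if "i < Suc l" for i
  proof (cases "i = l")
    case True
    have nz: "Q ^ l \<noteq> 0" using v(1) by (metis not_less0)
    have "?v div Q ^ l = d l" unfolding div_mult_self1[OF nz] using v(1) by simp
    then show ?thesis using True dl by (simp add: dig_def)
  next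
    case False
    then have i: "i < l" using that by simp
    have e: "Q ^ l = Q ^ i * (Q * Q ^ (l - Suc i))"
      using i by (simp flip: power_Suc power_add)
    have nz: "Q ^ i \<noteq> 0" using v(1) e by (metis mult_0 not_less0)
    have "?v = v + d l * (Q * Q ^ (l - Suc i)) * Q ^ i" by (subst e) (simp add: ac_simps)
    then have "?v div Q ^ i = v div Q ^ i + d l * (Q * Q ^ (l - Suc i))"
      using div_mult_self1[OF nz, of v "d l * (Q * Q ^ (l - Suc i))"] by (simp only: add.commute)
    then have "?v div Q ^ i mod Q = v div Q ^ i mod Q"
      by (simp add: mult.left_commute[of _ Q])
    then show ?thesis using v(2)[OF i] by (simp add: dig_def)
  qed
  ultimately show ?case by blast
qed auto

lemma dfn_dig: "dfn Q \<Longrightarrow> dfn v \<Longrightarrow> dfn (\<lambda>X e. dig (Q X e) (v X e) i)"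
  unfolding dig_def by (intro definable_intros)


section \<open>Computations as constraint satisfaction problems\<close>

text \<open>A cell \<open>h\<close> keeps its content from time \<open>r\<close> on as long as the
  head \<open>g\<close> stays away; \<open>r\<close> will be the successor of the time of the last
  visit.\<close>

lemma fun_upd_seq_unchanged:
  assumes "\<And>t'. r \<le> t' \<Longrightarrow> t' < t \<Longrightarrow> f (Suc t') = (f t')(g t' := w t')" "r \<le> (t :: nat)"
    and "\<And>t'. r \<le> t' \<Longrightarrow> t' < t \<Longrightarrow> g t' \<noteq> h"
  shows "f t h = f r h"
  using assms(2,1,3)
proof (induction t rule: dec_induct)
  case (step n)
  then show ?case by auto
qed simp

lemma poly_nat_mono: "a \<le> b \<Longrightarrow> poly q a \<le> poly q b" for q :: "nat poly"
  by (induction q) (auto intro!: add_mono mult_mono)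

definition sym_code :: "symbol \<Rightarrow> nat" where
  "sym_code s = (case s of None \<Rightarrow> 0 | Some b \<Rightarrow> if b then 2 else 1)"

lemma sym_code_inj [simp]: "sym_code s = sym_code s' \<longleftrightarrow> s = s'"
  by (auto simp: sym_code_def split: option.splits if_splits)

lemma sym_code_iff: "sym_code s = 0 \<longleftrightarrow> s = None" "sym_code s = 2 \<longleftrightarrow> s = Some True"
  by (auto simp: sym_code_def split: option.splits if_splits)

definition dir_code :: "direction \<Rightarrow> nat" where
  "dir_code d = (case d of MoveLeft \<Rightarrow> 0 | Stay \<Rightarrow> 1 | MoveRight \<Rightarrow> 2)"

lemma dir_code: "int (dir_code d) = move d h - h + 1"
  by (cases d) (auto simp: dir_code_def)

locale verifier =
  fixes M :: tm and R :: "bool list \<Rightarrow> bool list \<Rightarrow> bool" and p q :: "nat poly"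
  assumes wf: "wf_tm M"
    and comp: "\<And>x u. computes_within M [x, u] [[R x u]] (poly q (length x + length u))"
begin

abbreviation "m \<equiv> num_tapes M"
abbreviation "s \<equiv> num_states M"

lemma m2: "2 \<le> m"
  using comp[of "[]" "[]"] by (simp add: computes_within_def)

text \<open>
  A local state consists of the state and of the scanned symbols; the local states are numbered by
  their positions in a list.  After halting, the machine is taken to rewrite what it reads.
\<close>

definition local_states :: "(nat \<times> symbol list) list" where
  "local_states = (SOME l. set l = {..s} \<times> {ss. length ss = m})"

lemma set_local_states: "set local_states = {..s} \<times> {ss. length ss = m}"
proof -
  have "finite {ss :: symbol list. set ss \<subseteq> UNIV \<and> length ss = m}" by (intro finite_lists_length_eq) simp
  then have "finite ({..s} \<times> {ss :: symbol list. length ss = m})" by simp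
  then show ?thesis unfolding local_states_def by (rule someI_ex[OF finite_list])
qed

abbreviation "c \<equiv> length local_states"

definition st :: "nat \<Rightarrow> nat" where "st a = fst (local_states ! a)"
definition scanned :: "nat \<Rightarrow> symbol list" where "scanned a = snd (local_states ! a)"
definition next_st :: "nat \<Rightarrow> nat" where
  "next_st a = (if st a < s then fst (delta M (st a) (scanned a)) else st a)"
definition written :: "nat \<Rightarrow> nat \<Rightarrow> symbol" where
  "written a j = (if st a < s then fst (snd (delta M (st a) (scanned a)) ! j) else scanned a ! j)"
definition dir :: "nat \<Rightarrow> nat \<Rightarrow> direction" where
  "dir a j = (if st a < s then snd (snd (delta M (st a) (scanned a)) ! j) else Stay)"

lemma local_state: "a < c \<Longrightarrow> st a \<le> s \<and> length (scanned a) = m"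
  using nth_mem[of a local_states] unfolding set_local_states
  by (cases "local_states ! a") (simp add: st_def scanned_def)

lemma step_local:
  assumes a: "a < c" and rd: "\<And>j. j < m \<Longrightarrow> f j (g j) = scanned a ! j"
  shows "step M (st a, map (\<lambda>j. (f j, g j)) [0..<m])
    = (next_st a, map (\<lambda>j. ((f j)(g j := written a j), move (dir a j) (g j))) [0..<m])"
proof -
  let ?ts = "map (\<lambda>j. (f j, g j)) [0..<m]"
  have len: "length (scanned a) = m" using local_state[OF a] by simp
  have rds: "map (\<lambda>(c, h). c h) ?ts = scanned a"
    by (rule nth_equalityI) (use len rd in auto)
  show ?thesis
  proof (cases "st a < s")
    case True
    obtain q' as where d: "delta M (st a) (scanned a) = (q', as)" by (cases "delta M (st a) (scanned a)")
    have las: "length as = m" using wf True len d unfolding wf_tm_def by (metis snd_conv)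
    have "map2 act as ?ts = map (\<lambda>j. ((f j)(g j := written a j), move (dir a j) (g j))) [0..<m]"
    proof (rule nth_equalityI)
      fix i assume "i < length (map2 act as ?ts)"
      then have "i < m" using las by simp
      then show "map2 act as ?ts ! i = map (\<lambda>j. ((f j)(g j := written a j), move (dir a j) (g j))) [0..<m] ! i"
        using las d True by (cases "as ! i") (simp add: written_def dir_def)
    qed (use las in simp)
    then show ?thesis using True d rds by (simp del: map_map add: next_st_def)
  next
    case False
    then show ?thesis using rd by (auto simp: next_st_def written_def dir_def fun_upd_idem)
  qed
qed

definition P :: "bool list \<Rightarrow> nat" where "P x = poly p (length x)"
definition T :: "bool list \<Rightarrow> nat" where "T x = poly q (length x + P x)"
text \<open>A base larger than every stored component: local states below \<open>c\<close>, witness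
  lengths up to \<open>P x\<close>, shifted positions up to \<open>2 * T x\<close>, and encoded
  visit times up to \<open>T x + 1\<close>.\<close>

definition Q :: "bool list \<Rightarrow> nat" where "Q x = c + P x + 2 * T x + 3"

abbreviation "loc x v \<equiv> dig (Q x) v 0"
abbreviation "wlen x v \<equiv> dig (Q x) v 1"
abbreviation "pos x v j \<equiv> dig (Q x) v (2 + 2 * j)"
abbreviation "prev x v j \<equiv> dig (Q x) v (3 + 2 * j)"

text \<open>
  The value \<open>y t\<close> consists of the local state at time \<open>t\<close>, the length of the witness and, for each
  tape, the head position (shifted by \<open>T x\<close>) and the successor of the time of the previous visit to
  this cell (0 if there is none).  The additional time \<open>Suc (T x)\<close> serves to read the output cell.
\<close>

definition unary_ok :: "bool list \<Rightarrow> nat \<Rightarrow> nat \<Rightarrow> bool" where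
  "unary_ok x t v \<longleftrightarrow> loc x v < c \<and> wlen x v \<le> P x \<and>
     (t = 0 \<longrightarrow> st (loc x v) = 0 \<and> (\<forall>j < m. pos x v j = T x)) \<and>
     (t = T x \<longrightarrow> st (loc x v) = s) \<and>
     (t = Suc (T x) \<longrightarrow> pos x v 0 = T x \<and> sym_code (scanned (loc x v) ! 0) = 2) \<and>
     (\<forall>j < m. prev x v j \<le> t \<and> (prev x v j = 0 \<longrightarrow>
        (if j = 1 then sym_code (scanned (loc x v) ! j) = 0 \<longleftrightarrow> \<not> (T x \<le> pos x v j \<and> pos x v j - T x < wlen x v)
         else sym_code (scanned (loc x v) ! j) =
           (if j = 0 \<and> T x \<le> pos x v j \<and> pos x v j - T x < length x
            then if bit_at x (pos x v j - T x) then 2 else 1 else 0))))"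

text \<open>No tape content is stored. The symbol scanned at time \<open>t\<close> equals the one
  written at the previous visit \<open>t'\<close>, and all times after \<open>t'\<close> must have
  been spent on other cells. Each of these conditions compares just two times.\<close>

definition binary_ok :: "bool list \<Rightarrow> nat \<Rightarrow> nat \<Rightarrow> nat \<Rightarrow> nat \<Rightarrow> bool" where
  "binary_ok x t v t' v' \<longleftrightarrow> wlen x v' = wlen x v \<and>
     (t' = Suc t \<and> t < T x \<longrightarrow> st (loc x v') = next_st (loc x v) \<and>
        (\<forall>j < m. Suc (pos x v' j) = pos x v j + dir_code (dir (loc x v) j))) \<and>
     (t' < t \<longrightarrow> (\<forall>j < m.
        (prev x v j = Suc t' \<longrightarrow> pos x v' j = pos x v j \<and>
           sym_code (scanned (loc x v) ! j) = sym_code (written (loc x v') j)) \<and>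
        (prev x v j \<le> t' \<longrightarrow> pos x v' j \<noteq> pos x v j)))"

text \<open>The bound on \<open>loc x v'\<close> keeps both local states inside the range of the
  tables by which \<open>binary_ok\<close> is expressed as a term.\<close>

definition run_ok :: "bool list \<Rightarrow> nat \<Rightarrow> nat \<Rightarrow> nat \<Rightarrow> nat \<Rightarrow> bool" where
  "run_ok x t v t' v' \<longleftrightarrow> unary_ok x t v \<and> loc x v' < c \<and> binary_ok x t v t' v'"

definition run_csp :: "bool list \<Rightarrow> bool" where
  "run_csp x \<longleftrightarrow> csp (T x + 2) (Q x ^ (2 + 2 * m)) 0 (run_ok x) (\<lambda>_ _. True)"

section \<open>Correctness of the constraints for a run\<close>

definition init_cell :: "bool list \<Rightarrow> bool list \<Rightarrow> nat \<Rightarrow> int \<Rightarrow> symbol" where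
  "init_cell x u j = fst (string_tape (if j < length [x, u] then [x, u] ! j else []))"

lemma init_config_eq: "init_config M [x, u] = (0, map (\<lambda>j. (init_cell x u j, 0)) [0..<m])"
  by (simp add: init_config_def init_cell_def string_tape_def)

text \<open>By monotonicity of \<open>q\<close> the time \<open>T x\<close> suffices for every
  admissible witness, and a halted configuration no longer changes.\<close>

lemma halted_output:
  assumes "length u \<le> P x" "(step M ^^ T x) (init_config M [x, u]) = (r, ts)"
  shows "s \<le> r" "fst (ts ! 0) 0 = Some (R x u)"
proof -
  obtain n r' ts' where n: "n \<le> poly q (length x + length u)" "(step M ^^ n) (init_config M [x, u]) = (r', ts')"
    "s \<le> r'" "holds_string (ts' ! 0) [R x u]"
    using comp[of x u] unfolding computes_within_def by auto
  have "n \<le> T x" using n(1) poly_nat_mono[of "length x + length u" "length x + P x" q] assms(1)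
    by (simp add: T_def)
  moreover have "(step M ^^ i) (r', ts') = (r', ts')" for i by (induction i) (use n(3) in auto)
  ultimately have "(step M ^^ T x) (init_config M [x, u]) = (r', ts')"
    using n(2) funpow_add[of "T x - n" n "step M"] by simp
  then have "r = r'" "ts = ts'" using assms(2) by auto
  then show "s \<le> r" "fst (ts ! 0) 0 = Some (R x u)" using n(3,4) by (auto simp: holds_string_def)
qed

lemma run_csp_sound:
  assumes "run_csp x"
  shows "\<exists>u. length u \<le> P x \<and> R x u"
proof -
  let ?T = "T x"
  obtain y where y: "\<And>t t'. t < ?T + 2 \<Longrightarrow> t' < ?T + 2 \<Longrightarrow> run_ok x t (y t) t' (y t')"
    using assms unfolding run_csp_def csp_def by auto
  define a where "a t = loc x (y t)" for t
  define H where "H j t = pos x (y t) j" for j t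
  define Pv where "Pv j t = prev x (y t) j" for j t
  define l where "l = wlen x (y 0)"
  have un: "unary_ok x t (y t)" if "t < ?T + 2" for t using y[OF that that] by (simp add: run_ok_def)
  have bi: "binary_ok x t (y t) t' (y t')" if "t < ?T + 2" "t' < ?T + 2" for t t'
    using y[OF that] by (simp add: run_ok_def)
  have len: "wlen x (y t) = l" if "t < ?T + 2" for t
    using bi[of 0 t] that by (simp add: l_def binary_ok_def)
  have lP: "l \<le> P x" using un[of 0] by (simp add: l_def unary_ok_def)
  have ac: "a t < c" if "t < ?T + 2" for t using un[OF that] by (simp add: a_def unary_ok_def)
  \<comment> \<open>The witness is read off the run: a bit is what the first visit to its cell
    scans. Cells that are never visited get \<open>False\<close>.\<close>
  define u where "u = map (\<lambda>i. \<exists>t < ?T + 2. Pv 1 t = 0 \<and> H 1 t = ?T + i \<and> scanned (a t) ! 1 = Some True) [0..<l]"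
  \<comment> \<open>The tapes are rebuilt by replaying the claimed writes. It is then shown that the
    replay agrees with the scanned symbols, and only after that that it is the run of
    \<open>M\<close>.\<close>
  define cont where "cont j = rec_nat (init_cell x u j) (\<lambda>t f. f(int (H j t) - int ?T := written (a t) j))" for j
  have cont0: "cont j 0 = init_cell x u j" and contS: "cont j (Suc t) = (cont j t)(int (H j t) - int ?T := written (a t) j)" for j t
    by (simp_all add: cont_def)
  have visited: "H j t' = H j t \<and> scanned (a t) ! j = written (a t') j"
    if "t < ?T + 2" "j < m" "Pv j t = Suc t'" "t' < t" for t t' j
    using bi[of t t'] that unfolding binary_ok_def a_def H_def Pv_def by auto
  have unvisited: "H j t' \<noteq> H j t" if "t < ?T + 2" "j < m" "Pv j t \<le> t'" "t' < t" for t t' j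
    using bi[of t t'] that unfolding binary_ok_def H_def Pv_def by auto
  have fresh: "init_cell x u j (int (H j t) - int ?T) = scanned (a t) ! j"
    if t: "t < ?T + 2" and j: "j < m" and Pv: "Pv j t = 0" for t j
  proof -
    have ok: "if j = 1 then sym_code (scanned (a t) ! j) = 0 \<longleftrightarrow> \<not> (?T \<le> H j t \<and> H j t - ?T < l)
         else sym_code (scanned (a t) ! j) =
           (if j = 0 \<and> ?T \<le> H j t \<and> H j t - ?T < length x
            then if bit_at x (H j t - ?T) then 2 else 1 else 0)"
      using un[OF t] j Pv len[OF t] unfolding unary_ok_def a_def H_def Pv_def by auto
    have pos: "init_cell x u j (int (H j t) - int ?T) = (let z = (if j < length [x, u] then [x, u] ! j else []) in
        if ?T \<le> H j t \<and> H j t - ?T < length z then Some (z ! (H j t - ?T)) else None)"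
      by (auto simp: init_cell_def string_tape_def Let_def nat_diff_distrib)
    consider "j = 0" | "j = 1" | "2 \<le> j" by linarith
    then show ?thesis
    proof cases
      case 1
      then show ?thesis using ok unfolding pos
        by (auto simp: sym_code_def bit_at_def Let_def split: if_splits option.splits)
    next
      case 2
      show ?thesis
      proof (cases "?T \<le> H 1 t \<and> H 1 t - ?T < l")
        case True
        have "u ! (H 1 t - ?T) \<longleftrightarrow> scanned (a t) ! 1 = Some True"
        proof
          assume "u ! (H 1 t - ?T)"
          then obtain t' where t': "t' < ?T + 2" "Pv 1 t' = 0" "H 1 t' = H 1 t" "scanned (a t') ! 1 = Some True"
            using True by (auto simp: u_def)
          \<comment> \<open>Two first visits to one cell coincide, since the later of them would
            have an earlier visit. Hence no constraint has to mention the witness bits.\<close>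
          have "t' = t" using unvisited[OF t, of 1 t'] unvisited[OF t'(1), of 1 t] t'(2,3) Pv 2 j
            by (metis le0 nat_neq_iff)
          then show "scanned (a t) ! 1 = Some True" using t'(4) by simp
        next
          assume "scanned (a t) ! 1 = Some True"
          then show "u ! (H 1 t - ?T)" using True t Pv 2 by (auto simp: u_def)
        qed
        moreover have "scanned (a t) ! 1 \<noteq> None" using ok 2 True by (simp add: sym_code_iff)
        moreover have "length u = l" by (simp add: u_def)
        ultimately show ?thesis using True 2 unfolding pos by (auto simp: Let_def)
      next
        case False
        then have "scanned (a t) ! 1 = None" using ok 2 False by (simp add: sym_code_iff)
        moreover have "length u = l" by (simp add: u_def)
        ultimately show ?thesis using False 2 unfolding pos by (auto simp: Let_def)
      qed
    next
      case 3
      then have "sym_code (scanned (a t) ! j) = 0" using ok by auto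
      then have "scanned (a t) ! j = None" by (simp add: sym_code_iff)
      then show ?thesis using 3 unfolding pos by (simp add: Let_def)
    qed
  qed
  have read: "cont j t (int (H j t) - int ?T) = scanned (a t) ! j" if t: "t < ?T + 2" and j: "j < m" for t j
  proof -
    have le: "Pv j t \<le> t" using un[OF t] j unfolding unary_ok_def Pv_def by auto
    have "int (H j t') - int ?T \<noteq> int (H j t) - int ?T" if "Pv j t \<le> t'" "t' < t" for t'
      using unvisited[OF t j that] by simp
    then have e: "cont j t (int (H j t) - int ?T) = cont j (Pv j t) (int (H j t) - int ?T)"
      using le by (intro fun_upd_seq_unchanged[where g = "\<lambda>t. int (H j t) - int ?T" and w = "\<lambda>t. written (a t) j"])
        (auto simp: contS)
    show ?thesis
    proof (cases "Pv j t")
      case 0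
      then show ?thesis using e fresh[OF t j 0] cont0 by simp
    next
      case (Suc t')
      then show ?thesis using e visited[OF t j Suc] le contS[of j t'] by simp
    qed
  qed
  have config: "(step M ^^ t) (init_config M [x, u]) = (st (a t), map (\<lambda>j. (cont j t, int (H j t) - int ?T)) [0..<m])"
    if "t \<le> ?T" for t
    using that
  proof (induction t)
    case 0
    have "st (a 0) = 0" "\<And>j. j < m \<Longrightarrow> H j 0 = ?T" using un[of 0] by (auto simp: unary_ok_def a_def H_def)
    then show ?case by (auto simp: init_config_eq cont0)
  next
    case (Suc t)
    have t: "t < ?T + 2" "Suc t < ?T + 2" "t < ?T" using Suc.prems by auto
    have "st (a (Suc t)) = next_st (a t)" "\<And>j. j < m \<Longrightarrow> Suc (H j (Suc t)) = H j t + dir_code (dir (a t) j)"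
      using bi[OF t(1,2)] t(3) by (auto simp: binary_ok_def a_def H_def)
    moreover have "move (dir (a t) j) (int (H j t) - int ?T) = int (H j (Suc t)) - int ?T"
      if "Suc (H j (Suc t)) = H j t + dir_code (dir (a t) j)" for j
      using dir_code[of "dir (a t) j" "int (H j t) - int ?T"] that by linarith
    moreover have "(step M ^^ Suc t) (init_config M [x, u])
        = step M (st (a t), map (\<lambda>j. (cont j t, int (H j t) - int ?T)) [0..<m])"
      using Suc by (simp del: step.simps)
    ultimately show ?case
      using step_local[OF ac[OF t(1)], of "\<lambda>j. cont j t" "\<lambda>j. int (H j t) - int ?T"] read[OF t(1)]
      by (simp add: contS fun_upd_def del: step.simps)
  qed
  have lu: "length u \<le> P x" using lP by (simp add: u_def)
  have sT: "st (a ?T) = s" using un[of ?T] by (simp add: unary_ok_def a_def)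
  have "cont 0 ?T 0 = Some (R x u)"
    using halted_output(2)[OF lu config[of ?T]] m2 by simp
  \<comment> \<open>The additional time puts the head of tape 0 on the output cell. As the state at
    time \<open>T x\<close> is halting, the write at that time changes nothing, so the symbol read
    is the output.\<close>
  moreover have "cont 0 (Suc ?T) 0 = Some True"
  proof -
    have "H 0 (Suc ?T) = ?T" "sym_code (scanned (a (Suc ?T)) ! 0) = 2"
      using un[of "Suc ?T"] by (auto simp: unary_ok_def a_def H_def)
    moreover have "scanned (a (Suc ?T)) ! 0 = Some True" using calculation(2) by (simp add: sym_code_iff)
    ultimately show ?thesis using read[of "Suc ?T" 0] m2 by simp
  qed
  moreover have "cont 0 (Suc ?T) = cont 0 ?T"
    unfolding contS using read[of ?T 0] m2 sT by (simp add: written_def fun_upd_idem)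
  ultimately have "R x u" by simp
  then show ?thesis using lu by blast
qed

lemma run_csp_complete:
  assumes "length u \<le> P x" "R x u"
  shows "run_csp x"
proof -
  let ?T = "T x" and ?C = "\<lambda>t. (step M ^^ t) (init_config M [x, u])"
  define S where "S t = fst (?C t)" for t
  define cont where "cont t j = fst (snd (?C t) ! j)" for t j
  define hd where "hd t j = snd (snd (?C t) ! j)" for t j
  have inv: "length (snd (?C t)) = m \<and> S t \<le> s" for t
  proof (induction t)
    case 0
    then show ?case by (simp add: S_def init_config_eq)
  next
    case (Suc t)
    obtain r ts where c: "?C t = (r, ts)" by (cases "?C t")
    obtain r' as where d: "delta M r (map (\<lambda>(c, h). c h) ts) = (r', as)"
      by (cases "delta M r (map (\<lambda>(c, h). c h) ts)")
    show ?case
    proof (cases "r < s")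
      case True
      have "length ts = m" using Suc c by simp
      then have "r' \<le> s" "length as = m" using wf True d unfolding wf_tm_def
        by (metis fst_conv length_map, metis snd_conv length_map)
      then show ?thesis using c d True \<open>length ts = m\<close> by (simp add: S_def)
    next
      case False
      then show ?thesis using Suc c by (simp add: S_def)
    qed
  qed
  have C: "?C t = (S t, map (\<lambda>j. (cont t j, hd t j)) [0..<m])" for t
  proof -
    have "snd (?C t) = map (\<lambda>j. (cont t j, hd t j)) [0..<m]"
      using inv[of t] by (intro nth_equalityI) (auto simp: cont_def hd_def)
    then show ?thesis by (simp add: S_def prod_eq_iff)
  qed
  \<comment> \<open>At the additional time all heads are declared to be on cell 0, whose shifted
    position is \<open>T x\<close>.\<close>
  define vh where "vh t j = (if t \<le> ?T then nat (hd t j + int ?T) else ?T)" for t j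
  define vp where "vp t j = int (vh t j) - int ?T" for t j
  define ss where "ss t = map (\<lambda>j. cont t j (vp t j)) [0..<m]" for t
  have "\<exists>b. b < c \<and> local_states ! b = (S t, ss t)" for t
  proof -
    have "(S t, ss t) \<in> set local_states" using inv[of t] set_local_states by (simp add: ss_def)
    then show ?thesis by (auto simp: in_set_conv_nth)
  qed
  then obtain a where a: "\<And>t. a t < c" "\<And>t. local_states ! a t = (S t, ss t)" by metis
  have st: "st (a t) = S t" and sc: "scanned (a t) = ss t" for t using a(2) by (auto simp: st_def scanned_def)
  have scj: "scanned (a t) ! j = cont t j (vp t j)" if "j < m" for t j using that by (simp add: sc ss_def)
  have head: "\<bar>hd t j\<bar> \<le> int t" if j: "j < m" for t j
  proof (induction t)
    case 0
    then show ?case using j by (simp add: hd_def init_config_eq)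
  next
    case (Suc t)
    obtain r ts where c: "?C t = (r, ts)" by (cases "?C t")
    obtain r' as where d: "delta M r (map (\<lambda>(c, h). c h) ts) = (r', as)"
      by (cases "delta M r (map (\<lambda>(c, h). c h) ts)")
    have lt: "length ts = m" using inv[of t] c by simp
    show ?case
    proof (cases "r < s")
      case True
      then have "length as = m" using wf lt d unfolding wf_tm_def by (metis snd_conv length_map)
      then have "hd (Suc t) j = snd (act (as ! j) (ts ! j))" using c d True lt j by (simp add: hd_def)
      also have "\<dots> = move (snd (as ! j)) (hd t j)" using c by (cases "as ! j"; cases "ts ! j") (simp add: hd_def)
      finally show ?thesis using Suc abs_move[of "snd (as ! j)" "hd t j"] by linarith
    next
      case False
      then show ?thesis using Suc c by (simp add: hd_def)
    qed
  qed
  have vp: "vp t j = hd t j" if "t \<le> ?T" "j < m" for t j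
    using head[OF that(2), of t] that(1) by (simp add: vp_def vh_def)
  have step: "S (Suc t) = next_st (a t) \<and> (\<forall>j < m. cont (Suc t) j = (cont t j)(vp t j := written (a t) j)
      \<and> hd (Suc t) j = move (dir (a t) j) (vp t j))" if t: "t \<le> ?T" for t
  proof -
    have hv: "map (\<lambda>j. (cont t j, hd t j)) [0..<m] = map (\<lambda>j. (cont t j, vp t j)) [0..<m]" using vp[OF t] by auto
    have "?C (Suc t) = step M (st (a t), map (\<lambda>j. (cont t j, vp t j)) [0..<m])"
      using C[of t] st[of t] hv by (simp del: step.simps)
    also have "\<dots> = (next_st (a t), map (\<lambda>j. ((cont t j)(vp t j := written (a t) j), move (dir (a t) j) (vp t j))) [0..<m])"
      using scj[of _ t] by (intro step_local a) auto
    finally show ?thesis by (simp add: S_def cont_def hd_def del: step.simps)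
  qed
  define Pv where "Pv t j = (if \<exists>t' < t. vh t' j = vh t j then Suc (GREATEST t'. t' < t \<and> vh t' j = vh t j) else 0)" for t j
  have Pv_Suc: "t' < t \<and> vh t' j = vh t j" if "Pv t j = Suc t'" for t t' j
  proof -
    have ex: "\<exists>t' < t. vh t' j = vh t j" and e: "t' = (GREATEST t'. t' < t \<and> vh t' j = vh t j)"
      using that by (auto simp: Pv_def split: if_splits)
    have b: "\<And>y. y < t \<and> vh y j = vh t j \<Longrightarrow> y \<le> t" by simp
    show ?thesis using GreatestI_ex_nat[where P = "\<lambda>t'. t' < t \<and> vh t' j = vh t j", OF ex b] unfolding e .
  qed
  have Pv_le: "Pv t j \<le> t" for t j using Pv_Suc[of t j] by (cases "Pv t j") auto
  have Pv_after: "vh t' j \<noteq> vh t j" if "Pv t j \<le> t'" "t' < t" for t t' j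
  proof
    assume e: "vh t' j = vh t j"
    then have "t' < t \<and> vh t' j = vh t j" using that(2) by simp
    then have "t' \<le> (GREATEST t'. t' < t \<and> vh t' j = vh t j)"
      by (rule Greatest_le_nat[where P = "\<lambda>t'. t' < t \<and> vh t' j = vh t j" and b = t]) simp
    then show False using that e by (auto simp: Pv_def split: if_splits)
  qed
  have vph: "vp t' j = vp t j \<longleftrightarrow> vh t' j = vh t j" for t t' j by (simp add: vp_def)
  have keep: "cont t j (vp t j) = cont (Pv t j) j (vp t j)" if t: "t < ?T + 2" and j: "j < m" for t j
  proof (rule fun_upd_seq_unchanged[where f = "\<lambda>t. cont t j" and g = "\<lambda>t. vp t j" and w = "\<lambda>t. written (a t) j"])
    fix t' assume t': "Pv t j \<le> t'" "t' < t"
    then have "t' \<le> ?T" using t by simp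
    then show "cont (Suc t') j = (cont t' j)(vp t' j := written (a t') j)" using step j by blast
    show "vp t' j \<noteq> vp t j" using Pv_after[OF t'] vph by simp
  qed (rule Pv_le)
  have Q: "a t < Q x" "length u < Q x" "vh t j < Q x" "t < ?T + 2 \<Longrightarrow> Pv t j < Q x" if "j < m" for t j
  proof -
    show "a t < Q x" using a(1)[of t] by (simp add: Q_def)
    show "length u < Q x" using assms(1) by (simp add: Q_def)
    show "vh t j < Q x" using head[OF that, of t] by (auto simp: vh_def Q_def)
    show "t < ?T + 2 \<Longrightarrow> Pv t j < Q x" using Pv_le[of t j] by (simp add: Q_def)
  qed
  define d where "d t i = (if i = 0 then a t else if i = 1 then length u else if even i
      then vh t ((i - 2) div 2) else Pv t ((i - 3) div 2))" for t i
  have "\<exists>v < Q x ^ (2 + 2 * m). \<forall>i < 2 + 2 * m. dig (Q x) v i = d t i" if t: "t < ?T + 2" for t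
  proof (rule digits_exist)
    fix i assume i: "i < 2 + 2 * m"
    show "d t i < Q x"
    proof (cases "i < 2")
      case True
      then show ?thesis using Q(1)[of 0 t] Q(2)[of 0] m2 by (auto simp: d_def less_2_cases_iff)
    next
      case False
      then have "(i - 2) div 2 < m" "odd i \<Longrightarrow> (i - 3) div 2 < m" using i by auto
      then show ?thesis using Q(3)[of "(i - 2) div 2" t] Q(4)[of "(i - 3) div 2" t] t False by (auto simp: d_def)
    qed
  qed
  then obtain y where y: "\<And>t. t < ?T + 2 \<Longrightarrow> y t < Q x ^ (2 + 2 * m)"
    "\<And>t i. t < ?T + 2 \<Longrightarrow> i < 2 + 2 * m \<Longrightarrow> dig (Q x) (y t) i = d t i" by metis
  have dg: "loc x (y t) = a t" "wlen x (y t) = length u" if "t < ?T + 2" for t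
    using y(2)[OF that] m2 by (simp_all add: d_def)
  have dj: "pos x (y t) j = vh t j" "prev x (y t) j = Pv t j" if "t < ?T + 2" "j < m" for t j
  proof -
    have "dig (Q x) (y t) (2 + 2 * j) = d t (2 + 2 * j)" "dig (Q x) (y t) (3 + 2 * j) = d t (3 + 2 * j)"
      using that by (auto intro!: y(2))
    moreover have "d t (2 + 2 * j) = vh t j" "d t (3 + 2 * j) = Pv t j" by (simp_all add: d_def)
    ultimately show "pos x (y t) j = vh t j" "prev x (y t) j = Pv t j" by simp_all
  qed
  have ST: "S ?T = s" "S (Suc ?T) = s" "cont ?T 0 0 = Some True" "cont (Suc ?T) 0 0 = Some True"
  proof -
    have h: "s \<le> S ?T" "fst (snd (?C ?T) ! 0) 0 = Some (R x u)"
      using halted_output[OF assms(1), of "fst (?C ?T)" "snd (?C ?T)"] by (simp_all add: S_def)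
    then show 1: "S ?T = s" "cont ?T 0 0 = Some True" using inv[of ?T] assms(2) by (simp_all add: cont_def)
    have "?C (Suc ?T) = ?C ?T" using 1(1) C[of ?T] by simp
    then show "S (Suc ?T) = s" "cont (Suc ?T) 0 0 = Some True" using 1 by (simp_all add: S_def cont_def)
  qed
  have "unary_ok x t (y t)" if t: "t < ?T + 2" for t
    unfolding unary_ok_def dg[OF t]
  proof (intro conjI impI allI)
    fix j assume j: "j < m"
    show "prev x (y t) j \<le> t" using Pv_le dj[OF t j] by simp
    assume "prev x (y t) j = 0"
    then have "scanned (a t) ! j = cont 0 j (vp t j)" using keep[OF t j] scj[OF j] dj[OF t j] by simp
    moreover have "cont 0 j = init_cell x u j" using j by (simp add: cont_def init_config_eq)
    moreover have "init_cell x u j (vp t j) = (let z = (if j < length [x, u] then [x, u] ! j else []) in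
        if ?T \<le> vh t j \<and> vh t j - ?T < length z then Some (z ! (vh t j - ?T)) else None)"
      by (auto simp: init_cell_def string_tape_def vp_def Let_def nat_diff_distrib)
    ultimately have sc: "scanned (a t) ! j = (let z = (if j < length [x, u] then [x, u] ! j else []) in
        if ?T \<le> vh t j \<and> vh t j - ?T < length z then Some (z ! (vh t j - ?T)) else None)" by (simp only:)
    consider "j = 0" | "j = 1" | "2 \<le> j" by linarith
    then show "if j = 1
      then sym_code (scanned (a t) ! j) = 0 \<longleftrightarrow> \<not> (?T \<le> pos x (y t) j \<and> pos x (y t) j - ?T < length u)
      else sym_code (scanned (a t) ! j) =
           (if j = 0 \<and> ?T \<le> pos x (y t) j \<and> pos x (y t) j - ?T < length x
            then if bit_at x (pos x (y t) j - ?T) then 2 else 1 else 0)"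
      unfolding dj[OF t j] sc by cases (simp_all add: sym_code_def bit_at_def)
  next
    show "a t < c" "length u \<le> P x" using a assms by auto
    show "t = 0 \<Longrightarrow> st (a t) = 0" by (simp add: st S_def init_config_eq)
    show "pos x (y t) j = ?T" if "t = 0" "j < m" for j
      using dj[OF t that(2)] that by (simp add: vh_def hd_def init_config_eq)
    show "t = ?T \<Longrightarrow> st (a t) = s" by (simp add: st ST)
    have m0: "0 < m" using m2 by simp
    show "t = Suc ?T \<Longrightarrow> pos x (y t) 0 = ?T" using dj[OF t m0] by (simp add: vh_def)
    show "t = Suc ?T \<Longrightarrow> sym_code (scanned (a t) ! 0) = 2"
      using scj[OF m0, of t] ST(4) by (simp add: vp_def vh_def sym_code_def)
  qed
  moreover have "binary_ok x t (y t) t' (y t')" if t: "t < ?T + 2" and t': "t' < ?T + 2" for t t'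
    unfolding binary_ok_def dg[OF t] dg[OF t']
  proof (intro conjI impI allI)
    assume n: "t' = Suc t \<and> t < ?T"
    then show "st (a t') = next_st (a t)" using step[of t] by (simp add: st)
    fix j assume j: "j < m"
    have "hd t' j = move (dir (a t) j) (vp t j)" "t' \<le> ?T" using step[of t] n j by auto
    then show "Suc (pos x (y t') j) = pos x (y t) j + dir_code (dir (a t) j)"
      using dj[OF t j] dj[OF t' j] dir_code[of "dir (a t) j" "vp t j"] vp[of t' j] j
      unfolding vp_def by linarith
  next
    fix j assume j: "j < m" and lt: "t' < t" and e: "prev x (y t) j = Suc t'"
    have Pv: "Pv t j = Suc t'" using e dj[OF t j] by simp
    then show "pos x (y t') j = pos x (y t) j" using Pv_Suc dj[OF t j] dj[OF t' j] by auto
    have "t' \<le> ?T" using lt t by simp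
    then have "cont (Suc t') j (vp t j) = written (a t') j"
      using step[of t'] j Pv_Suc[OF Pv] vph[of t' j t] by auto
    then show "sym_code (scanned (a t) ! j) = sym_code (written (a t') j)"
      using scj[OF j, of t] keep[OF t j] Pv by simp
  next
    fix j assume j: "j < m" and "t' < t" "prev x (y t) j \<le> t'"
    then show "pos x (y t') j \<noteq> pos x (y t) j" using Pv_after dj[OF t j] dj[OF t' j] by auto
  qed simp
  ultimately show ?thesis
    unfolding run_csp_def csp_def run_ok_def using y(1) a(1) dg(1) by (intro exI[of _ y]) simp
qed

lemma run_csp_iff: "run_csp x \<longleftrightarrow> (\<exists>u. length u \<le> P x \<and> R x u)"
  using run_csp_sound run_csp_complete by blast

text \<open>The machine is fixed, so functions of the local state are finite tables. The predicates
  \<open>un\<close> and \<open>bi\<close> restate the constraints with table lookups; they agree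
  with the originals for local states below \<open>c\<close>.\<close>

lemma definable_run:
  "dfn (\<lambda>X e. T (fst X))" "dfn (\<lambda>X e. Q (fst X))"
  "dfb (\<lambda>X e. run_ok (fst X) (e 0) (e 1) (e 2) (e 3))"
proof -
  have P: "dfn (\<lambda>X e. P (fst X))" unfolding P_def by (intro dfn_poly definable_intros)
  show T: "dfn (\<lambda>X e. T (fst X))" unfolding T_def by (intro dfn_poly definable_intros P)
  show Q: "dfn (\<lambda>X e. Q (fst X))" unfolding Q_def by (intro definable_intros P T)
  define tab where "tab \<phi> b = (if b < c then \<phi> b else 0)" for \<phi> :: "nat \<Rightarrow> nat" and b
  have tab: "dfn f \<Longrightarrow> dfn (\<lambda>X e. tab \<phi> (f X e))" for f \<phi> unfolding tab_def by (rule dfn_table)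
  define un where "un x t v \<longleftrightarrow> loc x v < c \<and> wlen x v \<le> P x \<and>
     (t = 0 \<longrightarrow> tab st (loc x v) = 0 \<and> (\<forall>j < m. pos x v j = T x)) \<and>
     (t = T x \<longrightarrow> tab st (loc x v) = s) \<and>
     (t = Suc (T x) \<longrightarrow> pos x v 0 = T x \<and> tab (\<lambda>b. sym_code (scanned b ! 0)) (loc x v) = 2) \<and>
     (\<forall>j < m. prev x v j \<le> t \<and> (prev x v j = 0 \<longrightarrow>
        (if j = 1 then tab (\<lambda>b. sym_code (scanned b ! j)) (loc x v) = 0 \<longleftrightarrow> \<not> (T x \<le> pos x v j \<and> pos x v j - T x < wlen x v)
         else tab (\<lambda>b. sym_code (scanned b ! j)) (loc x v) =
           (if j = 0 \<and> T x \<le> pos x v j \<and> pos x v j - T x < length x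
            then if bit_at x (pos x v j - T x) then 2 else 1 else 0))))" for x t v
  have un: "unary_ok x t v = un x t v" for x t v
    unfolding unary_ok_def un_def tab_def by (rule conj_cong) simp_all
  define bi where "bi x t v t' v' \<longleftrightarrow> wlen x v' = wlen x v \<and>
     (t' = Suc t \<and> t < T x \<longrightarrow> tab st (loc x v') = tab next_st (loc x v) \<and>
        (\<forall>j < m. Suc (pos x v' j) = pos x v j + tab (\<lambda>b. dir_code (dir b j)) (loc x v))) \<and>
     (t' < t \<longrightarrow> (\<forall>j < m.
        (prev x v j = Suc t' \<longrightarrow> pos x v' j = pos x v j \<and>
           tab (\<lambda>b. sym_code (scanned b ! j)) (loc x v) = tab (\<lambda>b. sym_code (written b j)) (loc x v')) \<and>
        (prev x v j \<le> t' \<longrightarrow> pos x v' j \<noteq> pos x v j)))" for x t v t' v'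
  have bi: "binary_ok x t v t' v' = bi x t v t' v'" if "loc x v < c" "loc x v' < c" for x t v t' v'
    unfolding binary_ok_def bi_def tab_def using that by simp
  have eq: "run_ok x t v t' v' \<longleftrightarrow> un x t v \<and> loc x v' < c \<and> bi x t v t' v'" for x t v t' v'
  proof (cases "un x t v \<and> loc x v' < c")
    case True
    then have "loc x v < c" by (simp add: un_def)
    then show ?thesis using True bi by (simp add: run_ok_def un)
  next
    case False
    then show ?thesis by (auto simp: run_ok_def un)
  qed
  have "dfb (\<lambda>X e. un (fst X) (e 0) (e 1))"
    unfolding un_def by (intro definable_intros dfb_all_const tab dfn_dig P T Q)
  moreover have "dfb (\<lambda>X e. bi (fst X) (e 0) (e 1) (e 2) (e 3))"
    unfolding bi_def by (intro definable_intros dfb_all_const tab dfn_dig P T Q)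
  moreover have "dfb (\<lambda>X e. loc (fst X) (e 3) < c)" by (intro definable_intros dfn_dig Q)
  ultimately have "dfb (\<lambda>X e. un (fst X) (e 0) (e 1) \<and> loc (fst X) (e 3) < c \<and> bi (fst X) (e 0) (e 1) (e 2) (e 3))"
    by (intro dfb_conj)
  then show "dfb (\<lambda>X e. run_ok (fst X) (e 0) (e 1) (e 2) (e 3))" by (simp only: eq)
qed

end


section \<open>Reading an encoded circuit\<close>

text \<open>
  A finite automaton for encoded circuits: state 0 expects a gate, states 1 to 3 read its type, state
  4 reads the input of a negation, states 5 and 6 read the input list of a conjunction or
  disjunction, and state 7 is reached after the last gate.
\<close>

definition next_state :: "nat \<Rightarrow> bool \<Rightarrow> nat" where
  "next_state q b = (if q = 0 then if b then 1 else 7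
     else if q = 1 then if b then 3 else 2
     else if q = 2 then if b then 4 else 0
     else if q = 3 then 5
     else if q = 4 then if b then 4 else 0
     else if q = 5 then if b then 6 else 0
     else if q = 6 then if b then 6 else 5 else 7)"

definition state_at :: "nat \<Rightarrow> bool list \<Rightarrow> nat \<Rightarrow> nat" where
  "state_at q x i = foldl next_state q (take i x)"

text \<open>A bit \<open>True\<close> read in state 0 announces a gate. The bit itself is not
  counted at its own position, so the announcement of gate \<open>g\<close> has the count
  \<open>g\<close> and the remaining code of this gate the count \<open>Suc g\<close>.\<close>

definition gates_before :: "bool list \<Rightarrow> nat \<Rightarrow> nat" where
  "gates_before x i = (\<Sum>j<i. of_bool (state_at 0 x j = 0 \<and> bit_at x j))"

definition number_at :: "bool list \<Rightarrow> nat \<Rightarrow> nat \<Rightarrow> bool" where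
  "number_at x i j \<longleftrightarrow> (\<forall>r < j. bit_at x (i + r)) \<and> i + j < length x \<and> \<not> bit_at x (i + j)"

text \<open>States 4 and 6 persist while a unary number is read; entering them from 2 and 5 singles
  out its first bit.\<close>

definition starts_number :: "nat \<Rightarrow> bool list \<Rightarrow> nat \<Rightarrow> bool" where
  "starts_number q x i \<longleftrightarrow> 0 < i \<and> (state_at q x i = 4 \<and> state_at q x (i - 1) = 2 \<or>
     state_at q x i = 6 \<and> state_at q x (i - 1) = 5)"

definition pred_code :: "bool list \<Rightarrow> nat \<Rightarrow> nat \<Rightarrow> bool" where
  "pred_code x g j \<longleftrightarrow> (\<exists>i < length x. gates_before x i = Suc g \<and> starts_number 0 x i \<and> number_at x i j)"

definition type_code :: "bool list \<Rightarrow> nat \<Rightarrow> bool \<Rightarrow> bool \<Rightarrow> bool" where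
  "type_code x g b c \<longleftrightarrow> (\<exists>i < length x. gates_before x i = g \<and> state_at 0 x i = 0 \<and> bit_at x i \<and>
     bit_at x (i + 1) = b \<and> bit_at x (i + 2) = c)"

definition size_code :: "bool list \<Rightarrow> nat" where
  "size_code x = gates_before x (length x)"

section \<open>Codes of concatenated blocks\<close>

lemma bit_at_append: "bit_at (u @ w) (length u + i) = bit_at w i"
  by (simp add: bit_at_def)

lemma bit_at_append1: "i < length u \<Longrightarrow> bit_at (u @ w) i = bit_at u i"
  by (simp add: bit_at_def nth_append)

lemma number_at_append: "number_at (u @ w) (length u + i) j = number_at w i j"
  by (simp add: number_at_def add.assoc bit_at_append)

lemma state_at_append: "state_at q (u @ w) (length u + i) = state_at (foldl next_state q u) w i"
  by (simp add: state_at_def)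

lemma state_at_append1: "i \<le> length u \<Longrightarrow> state_at q (u @ w) i = state_at q u i"
  by (simp add: state_at_def)

lemma starts_number_append1: "i \<le> length u \<Longrightarrow> starts_number q (u @ w) i = starts_number q u i"
  by (auto simp: starts_number_def state_at_append1)

lemma starts_number_append:
  "0 < i \<Longrightarrow> starts_number q (u @ w) (length u + i) = starts_number (foldl next_state q u) w i"
  using state_at_append[of q u w "i - 1"] by (simp add: starts_number_def state_at_append)

lemma number_at_enc: "number_at (enc_nat j @ w) 0 j' \<longleftrightarrow> j' = j"
proof -
  have b: "bit_at (enc_nat j @ w) r \<longleftrightarrow> r < j" if "r \<le> j" for r
    using that by (auto simp: bit_at_def enc_nat_def nth_append)
  show ?thesis
  proof
    assume a: "number_at (enc_nat j @ w) 0 j'"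
    have "\<not> j < j'" using a b[of j] by (auto simp: number_at_def)
    moreover have "\<not> j' < j" using a b[of j'] by (auto simp: number_at_def)
    ultimately show "j' = j" by simp
  next
    assume "j' = j"
    then show "number_at (enc_nat j @ w) 0 j'" using b by (auto simp: number_at_def enc_nat_def)
  qed
qed

lemma state_at_enc_nat:
  assumes "q = 4 \<or> q = 6"
  shows "foldl next_state q (enc_nat j) = (if q = 4 then 0 else 5)"
    "i \<le> j \<Longrightarrow> state_at q (enc_nat j) i = q"
proof -
  have r: "foldl next_state q (replicate i True) = q" for i
    by (induction i) (use assms in \<open>auto simp: next_state_def\<close>)
  then show "foldl next_state q (enc_nat j) = (if q = 4 then 0 else 5)"
    using assms by (auto simp: enc_nat_def next_state_def)
  show "i \<le> j \<Longrightarrow> state_at q (enc_nat j) i = q"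
    using r by (simp add: state_at_def enc_nat_def min_def)
qed

lemma length_enc_nat [simp]: "length (enc_nat j) = Suc j"
  by (simp add: enc_nat_def)

text \<open>Every list element is a block leading from state 5 back to state 5, so positions behind
  the first block behave like positions of the shorter list. The continuation \<open>w\<close> is
  arbitrary because numbers are read in the complete code.\<close>

lemma list_code:
  "foldl next_state 5 (enc_list enc_nat js) = 0"
  "i < length (enc_list enc_nat js) \<Longrightarrow> state_at 5 (enc_list enc_nat js) i \<in> {5, 6}"
  "(\<exists>i. 0 < i \<and> i < length (enc_list enc_nat js) \<and> starts_number 5 (enc_list enc_nat js) i \<and>
     number_at (enc_list enc_nat js @ w) i j) \<longleftrightarrow> j \<in> set js"
proof (induction js arbitrary: i)
  case Nil
  {
    case 1
    then show ?case by (simp add: enc_list_def next_state_def)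
  next
    case 2
    then show ?case by (simp add: enc_list_def state_at_def)
  next
    case 3
    then show ?case by (simp add: enc_list_def)
  }
next
  case (Cons k js)
  let ?b = "True # enc_nat k" and ?l = "enc_list enc_nat js"
  have l: "enc_list enc_nat (k # js) = ?b @ ?l" by (simp add: enc_list_def)
  have n5: "next_state 5 True = 6" by (simp add: next_state_def)
  have fb: "foldl next_state 5 ?b = 5" using state_at_enc_nat(1)[of 6 k] by (simp add: n5)
  have sb: "state_at 5 ?b (Suc i) = 6" if "i \<le> k" for i
    using state_at_enc_nat(2)[of 6 i k] that by (simp add: state_at_def n5)
  {
    case 1
    then show ?case using Cons.IH(1) fb unfolding l by simp
  next
    case 2
    show ?case
    proof (cases "i < length ?b")
      case True
      then have "state_at 5 (?b @ ?l) i = state_at 5 ?b i" by (intro state_at_append1) simp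
      moreover have "state_at 5 ?b i \<in> {5, 6}"
        using sb[of "i - 1"] True by (cases i) (simp_all add: state_at_def[of _ _ 0])
      ultimately show ?thesis unfolding l by simp
    next
      case False
      then obtain i' where i: "i = length ?b + i'" using le_Suc_ex not_less by blast
      then have "i' < length ?l" using 2 unfolding l by simp
      then show ?thesis unfolding l i state_at_append fb by (rule Cons.IH(2))
    qed
  next
    case 3
    have first: "starts_number 5 (?b @ ?l) i \<longleftrightarrow> i = 1" if "0 < i" "i < length ?b" for i
    proof (cases i)
      case (Suc i')
      then have "starts_number 5 (?b @ ?l) i \<longleftrightarrow> state_at 5 ?b i' = 5"
        using that sb[of i'] by (simp only: starts_number_append1) (simp add: starts_number_def)
      also have "\<dots> \<longleftrightarrow> i' = 0"
        using sb[of "i' - 1"] that Suc by (cases i') (auto simp: state_at_def)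
      finally show ?thesis using Suc by simp
    qed (use that in simp)
    have nb: "number_at ((?b @ ?l) @ w) 1 j \<longleftrightarrow> j = k"
      using number_at_append[of "[True]" "enc_nat k @ ?l @ w" 0 j] number_at_enc[of k "?l @ w" j] by simp
    have "state_at 5 (?b @ ?l) (length ?b) = 5" using fb by (simp add: state_at_def)
    then have mid: "\<not> starts_number 5 (?b @ ?l) (length ?b)" by (simp only: starts_number_def) simp
    have "(\<exists>i. 0 < i \<and> i < length (?b @ ?l) \<and> starts_number 5 (?b @ ?l) i \<and> number_at ((?b @ ?l) @ w) i j)
        \<longleftrightarrow> j = k \<or> (\<exists>i. 0 < i \<and> i < length ?l \<and> starts_number 5 ?l i \<and> number_at (?l @ w) i j)" (is "?A \<longleftrightarrow> ?B \<or> ?C")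
    proof
      assume ?A
      then obtain i where i: "0 < i" "i < length (?b @ ?l)" "starts_number 5 (?b @ ?l) i" "number_at ((?b @ ?l) @ w) i j" by blast
      consider "i < length ?b" | "i = length ?b" | "length ?b < i" by linarith
      then show "?B \<or> ?C"
      proof cases
        case 1
        then have "i = 1" using first[OF i(1) 1] i(3) by blast
        then show ?thesis using nb i(4) by blast
      next
        case 2
        then show ?thesis using mid i(3) by blast
      next
        case 3
        then obtain i' where e: "i = length ?b + i'" using le_Suc_ex less_imp_le by blast
        have p: "0 < i'" using 3 e by linarith
        have "starts_number 5 ?l i'" using i(3) unfolding e starts_number_append[OF p] fb .
        moreover have "number_at (?l @ w) i' j" using i(4) unfolding e append_assoc number_at_append .
        moreover have "i' < length ?l" using i(2) e by simp
        ultimately show ?thesis using p by blast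
      qed
    next
      assume "?B \<or> ?C"
      then show ?A
      proof
        assume ?B
        then show ?A using first[of 1] nb by (intro exI[of _ 1]) simp
      next
        assume ?C
        then obtain i where i: "0 < i" "i < length ?l" "starts_number 5 ?l i" "number_at (?l @ w) i j" by blast
        have "starts_number 5 (?b @ ?l) (length ?b + i)" unfolding starts_number_append[OF i(1)] fb by (rule i(3))
        moreover have "number_at ((?b @ ?l) @ w) (length ?b + i) j" unfolding append_assoc number_at_append by (rule i(4))
        moreover have "0 < length ?b + i" "length ?b + i < length (?b @ ?l)" using i by auto
        ultimately show ?A by blast
      qed
    qed
    then show ?case unfolding l using Cons.IH(3) by auto
  }
qed

text \<open>The block of a gate leads from state 0 back to state 0 and avoids it in between. Hence
  the automaton recognises the block boundaries.\<close>

lemma gate_code: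
  fixes g :: gate
  defines "x \<equiv> True # enc_gate g"
  shows "foldl next_state 0 x = 0" "0 < i \<Longrightarrow> i < length x \<Longrightarrow> state_at 0 x i \<noteq> 0"
    "(\<exists>i. 0 < i \<and> i < length x \<and> starts_number 0 x i \<and> number_at (x @ w) i j) \<longleftrightarrow> j \<in> set (preds g)"
proof -
  have small: "i = 0 \<or> i = 1 \<or> i = 2 \<or> (\<exists>r. i = 3 + r)" for i :: nat by presburger
  have "foldl next_state 0 x = 0 \<and> (\<forall>i. 0 < i \<and> i < length x \<longrightarrow> state_at 0 x i \<noteq> 0) \<and>
     ((\<exists>i. 0 < i \<and> i < length x \<and> starts_number 0 x i \<and> number_at (x @ w) i j) \<longleftrightarrow> j \<in> set (preds g))"
  proof (cases "\<exists>js b. g = And js \<or> g = Or js")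
    case True
    then obtain js where g: "g = And js \<or> g = Or js" by blast
    define b where "b = (case g of Or _ \<Rightarrow> True | _ \<Rightarrow> False)"
    have x: "x = [True, True, b] @ enc_list enc_nat js" and p: "preds g = js" using g by (auto simp: x_def b_def)
    let ?u = "[True, True, b]" and ?l = "enc_list enc_nat js"
    have u: "foldl next_state 0 ?u = 5" by (simp add: next_state_def)
    have s: "state_at 0 (?u @ z) 0 = 0" "state_at 0 (?u @ z) 1 = 1" "state_at 0 (?u @ z) 2 = 3" for z
      by (simp_all add: state_at_def next_state_def numeral_2_eq_2)
    have s3: "state_at 0 (?u @ z) (3 + r) = state_at 5 z r" for z r
      using state_at_append[of 0 ?u z r] u by (simp add: numeral_3_eq_3)
    have "foldl next_state 0 x = 0" unfolding x foldl_append u by (rule list_code(1))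
    moreover have "state_at 0 x i \<noteq> 0" if "0 < i" "i < length x" for i
    proof -
      have "state_at 5 ?l r \<noteq> 0" if "i = 3 + r" for r
        using list_code(2)[of r js] that \<open>i < length x\<close> by (auto simp: x)
      then show ?thesis using small[of i] that s[of ?l] s3[of ?l] unfolding x by (elim disjE exE) simp_all
    qed
    moreover have "(\<exists>i. 0 < i \<and> i < length x \<and> starts_number 0 x i \<and> number_at (x @ w) i j) \<longleftrightarrow>
        (\<exists>i. 0 < i \<and> i < length ?l \<and> starts_number 5 ?l i \<and> number_at (?l @ w) i j)" (is "?A \<longleftrightarrow> ?B")
    proof
      assume ?A
      then obtain i where i: "0 < i" "i < length x" "starts_number 0 x i" "number_at (x @ w) i j" by blast
      have "\<not> starts_number 0 x 1" "\<not> starts_number 0 x 2"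
        using s[of ?l] unfolding x starts_number_def by auto
      moreover have "\<not> starts_number 0 x 3" using s(3)[of ?l] s3[of ?l 0] unfolding x starts_number_def
        by (auto simp: state_at_def)
      ultimately have "i \<noteq> 1" "i \<noteq> 2" "i \<noteq> 3" using i(3) by metis+
      then obtain r where r: "i = length ?u + r" "0 < r"
        using i(1) le_Suc_ex[of 3 i] by (auto simp: numeral_3_eq_3)
      have "starts_number 5 ?l r" using i(3) unfolding x r(1) starts_number_append[OF r(2)] u .
      moreover have "number_at (?l @ w) r j" using i(4) unfolding x r(1) append_assoc number_at_append .
      moreover have "r < length ?l" using i(2) unfolding x r(1) by simp
      ultimately show ?B using r(2) by blast
    next
      assume ?B
      then obtain i where i: "0 < i" "i < length ?l" "starts_number 5 ?l i" "number_at (?l @ w) i j" by blast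
      have "starts_number 0 x (length ?u + i)" unfolding x starts_number_append[OF i(1)] u by (rule i(3))
      moreover have "number_at (x @ w) (length ?u + i) j" unfolding x append_assoc number_at_append by (rule i(4))
      moreover have "0 < length ?u + i" "length ?u + i < length x" using i unfolding x by auto
      ultimately show ?A by blast
    qed
    ultimately show ?thesis using list_code(3)[of js w j] p by auto
  next
    case False
    then consider (i) "g = Input" | (n) k where "g = Not k" by (cases g) auto
    then show ?thesis
    proof cases
      case i
      have x: "x = [True, False, False]" using i by (simp add: x_def)
      have s: "state_at 0 x 1 = 1" "state_at 0 x 2 = 2" "state_at 0 x 0 = 0" by (simp_all add: x state_at_def next_state_def numeral_2_eq_2)
      have small3: "i = 1 \<or> i = 2" if "0 < i" "i < length x" for i using that by (auto simp: x)
      have ns: "\<not> starts_number 0 x i" "state_at 0 x i \<noteq> 0" if "0 < i" "i < length x" for i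
        using small3[OF that] s by (auto simp: starts_number_def)
      show ?thesis
      proof (intro conjI allI impI iffI)
        show "foldl next_state 0 x = 0" by (simp add: x next_state_def)
        show "state_at 0 x i \<noteq> 0" if "0 < i \<and> i < length x" for i using ns(2)[of i] that by simp
        assume "\<exists>i. 0 < i \<and> i < length x \<and> starts_number 0 x i \<and> number_at (x @ w) i j"
        then obtain i where "0 < i" "i < length x" "starts_number 0 x i" by (elim exE conjE)
        then show "j \<in> set (preds g)" using ns(1)[of i] by simp
      qed (use i in simp)
    next
      case (n k)
      let ?u = "[True, False, True]"
      have x: "x = ?u @ enc_nat k" using n by (simp add: x_def)
      have u: "foldl next_state 0 ?u = 4" by (simp add: next_state_def)
      have s: "state_at 0 (?u @ z) 0 = 0" "state_at 0 (?u @ z) 1 = 1" "state_at 0 (?u @ z) 2 = 2" for z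
        by (simp_all add: state_at_def next_state_def numeral_2_eq_2)
      have s3: "state_at 0 (?u @ z) (3 + r) = state_at 4 z r" for z r
        using state_at_append[of 0 ?u z r] u by (simp add: numeral_3_eq_3)
      have s4: "state_at 0 x (3 + r) = 4" if "r \<le> k" for r
        unfolding x s3 using state_at_enc_nat(2)[of 4 r k] that by simp
      have f0: "foldl next_state 0 x = 0" unfolding x foldl_append u using state_at_enc_nat(1)[of 4 k] by simp
      have fn: "state_at 0 x i \<noteq> 0" if "0 < i" "i < length x" for i
      proof -
        have "r \<le> k" if "i = 3 + r" for r using that \<open>i < length x\<close> by (simp add: x)
        then show ?thesis using small[of i] that s[of "enc_nat k"] s4 unfolding x by (elim disjE exE) simp_all
      qed
      have st: "starts_number 0 x i \<longleftrightarrow> i = 3" if "0 < i" "i < length x" for i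
      proof -
        consider "i = 1" | "i = 2" | "i = 3" | r where "i = 3 + Suc r" "Suc r \<le> k"
        proof -
          have "i \<le> 3 \<or> (\<exists>r. i = 3 + Suc r)" using less_imp_Suc_add[of 3 i] by force
          then show ?thesis using that that(1,2) \<open>0 < i\<close> \<open>i < length x\<close> by (auto simp: x) linarith
        qed
        then show ?thesis
        proof cases
          case 3
          then show ?thesis using s4[of 0] s(3)[of "enc_nat k"] by (simp add: starts_number_def x)
        next
          case 4
          then show ?thesis using s4[of r] s4[of "Suc r"] by (simp add: starts_number_def)
        qed (use s[of "enc_nat k"] in \<open>simp_all add: starts_number_def x\<close>)
      qed
      have "number_at (x @ w) 3 j \<longleftrightarrow> j = k"
        using number_at_append[of ?u "enc_nat k @ w" 0 j] number_at_enc[of k w j] by (simp add: x numeral_3_eq_3)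
      have "3 < length x" by (simp add: x)
      have "(\<exists>i. 0 < i \<and> i < length x \<and> starts_number 0 x i \<and> number_at (x @ w) i j) \<longleftrightarrow> j \<in> set (preds g)"
        (is "?A \<longleftrightarrow> ?B")
      proof
        assume ?A
        then obtain i where "0 < i" "i < length x" "starts_number 0 x i" "number_at (x @ w) i j" by (elim exE conjE)
        then show ?B using st[of i] \<open>number_at (x @ w) 3 j \<longleftrightarrow> j = k\<close> n by simp
      next
        assume ?B
        then show ?A using st[of 3] \<open>3 < length x\<close> \<open>number_at (x @ w) 3 j \<longleftrightarrow> j = k\<close> n
          by (intro exI[of _ 3]) simp
      qed
      then show ?thesis using f0 fn by (intro conjI allI impI) simp_all
    qed
  qed
  then show "foldl next_state 0 x = 0" "0 < i \<Longrightarrow> i < length x \<Longrightarrow> state_at 0 x i \<noteq> 0"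
    "(\<exists>i. 0 < i \<and> i < length x \<and> starts_number 0 x i \<and> number_at (x @ w) i j) \<longleftrightarrow> j \<in> set (preds g)"
    by blast+
qed

lemma gates_before_first:
  assumes "x = (True # enc_gate g) @ w" "0 < i" "i \<le> length (True # enc_gate g)"
  shows "gates_before x i = 1"
proof -
  have "state_at 0 x j = 0 \<and> bit_at x j \<longleftrightarrow> j = 0" if "j < i" for j
  proof (cases "j = 0")
    case True
    then show ?thesis using assms(1) by (simp add: state_at_def bit_at_def)
  next
    case False
    then have "state_at 0 (True # enc_gate g) j \<noteq> 0" using that assms(3) by (intro gate_code(2)) auto
    then show ?thesis using False that assms(1,3) state_at_append1[of j "True # enc_gate g" 0 w] by simp
  qed
  then have "gates_before x i = (\<Sum>j<i. of_bool (j = 0))" unfolding gates_before_def by (intro sum.cong) auto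
  also have "\<dots> = 1" unfolding of_bool_def using assms(2) by (simp only: sum.delta finite_lessThan) simp
  finally show ?thesis .
qed

lemma gates_before_append:
  assumes "x = b @ w" "b = True # enc_gate g"
  shows "gates_before x (length b + i) = Suc (gates_before w i)"
proof -
  have "gates_before x (length b) = 1" using assms by (intro gates_before_first) auto
  moreover have "gates_before x (length b + i) = gates_before x (length b) +
      (\<Sum>j<i. of_bool (state_at 0 x (length b + j) = 0 \<and> bit_at x (length b + j)))"
    unfolding gates_before_def by (induction i) simp_all
  moreover have "foldl next_state 0 b = 0" unfolding assms(2) by (rule gate_code(1))
  then have "state_at 0 x (length b + j) = state_at 0 w j" "bit_at x (length b + j) = bit_at w j" for j
    unfolding assms(1) state_at_append bit_at_append by simp_all
  ultimately show ?thesis by (simp add: gates_before_def)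
qed

lemma circuit_code:
  "size_code (enc_circuit C) = length C"
  "pred_code (enc_circuit C) i j \<longleftrightarrow> i < length C \<and> j \<in> set (preds (C ! i))"
  "i < length C \<Longrightarrow> type_code (enc_circuit C) i b c \<longleftrightarrow> take 2 (enc_gate (C ! i)) = [b, c]"
proof -
  have "size_code (enc_circuit C) = length C \<and>
    (\<forall>i j. pred_code (enc_circuit C) i j \<longleftrightarrow> i < length C \<and> j \<in> set (preds (C ! i))) \<and>
    (\<forall>i < length C. type_code (enc_circuit C) i b c \<longleftrightarrow> take 2 (enc_gate (C ! i)) = [b, c])"
  proof (induction C)
    case Nil
    have x: "enc_circuit [] = [False]" by (simp add: enc_circuit_def enc_list_def)
    have "\<not> bit_at [False] i" for i by (cases i) (simp_all add: bit_at_def)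
    then have "gates_before [False] i = 0" for i by (simp add: gates_before_def)
    then show ?case by (simp add: x size_code_def pred_code_def)
  next
    case (Cons g C)
    let ?b = "True # enc_gate g" and ?w = "enc_circuit C" and ?x = "enc_circuit (g # C)"
    have x: "?x = ?b @ ?w" by (simp add: enc_circuit_def enc_list_def)
    have fb: "foldl next_state 0 ?b = 0" by (rule gate_code(1))
    have gb: "gates_before ?x (length ?b + i) = Suc (gates_before ?w i)" for i
      by (rule gates_before_append[OF x refl])
    have g1: "gates_before ?x i = 1" if "0 < i" "i \<le> length ?b" for i
      by (rule gates_before_first[OF x that])
    have g0: "gates_before ?x 0 = 0" by (simp add: gates_before_def)
    have stb: "state_at 0 ?x (length ?b + i) = state_at 0 ?w i" for i unfolding x state_at_append fb ..
    have size: "size_code ?x = Suc (size_code ?w)"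
      unfolding size_code_def using gb[of "length ?w"] by (simp add: x)
    have pred0: "pred_code ?x 0 j \<longleftrightarrow> j \<in> set (preds g)" for j
    proof -
      have "pred_code ?x 0 j \<longleftrightarrow> (\<exists>i. 0 < i \<and> i < length ?b \<and> starts_number 0 ?b i \<and> number_at (?b @ ?w) i j)"
        (is "?A \<longleftrightarrow> ?B")
      proof
        assume ?A
        then obtain i where i: "i < length ?x" "gates_before ?x i = 1" "starts_number 0 ?x i" "number_at ?x i j"
          unfolding pred_code_def by auto
        have p: "0 < i" using i(3) by (simp add: starts_number_def)
        have lt: "i < length ?b"
        proof (rule ccontr)
          assume "\<not> i < length ?b"
          then obtain r where r: "i = length ?b + r" using le_Suc_ex not_less by blast
          then have z: "gates_before ?w r = 0" using i(2) gb[of r] by simp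
          show False
          proof (cases r)
            case 0
            then have "state_at 0 ?x i = 0" using stb[of 0] r by (simp add: state_at_def)
            then show False using i(3) by (simp add: starts_number_def)
          next
            case (Suc r')
            have "0 < r" using Suc by simp
            have s: "starts_number 0 ?w r" using i(3) unfolding x r starts_number_append[OF \<open>0 < r\<close>] fb .
            have "state_at 0 ?w 0 = 0" by (simp add: state_at_def)
            \<comment> \<open>If no gate has been announced before a later position of the rest, the
              rest starts with the bit that ends the list. It has length 1 then, which leaves no
              place for a number.\<close>
            moreover have "\<not> bit_at ?w 0" using z Suc \<open>state_at 0 ?w 0 = 0\<close>
              by (auto simp: gates_before_def simp del: sum.lessThan_Suc)
            ultimately have w: "C = []" by (cases C) (auto simp: enc_circuit_def enc_list_def bit_at_def)
            have "r < 1" using i(1) unfolding x r w by (simp add: enc_circuit_def enc_list_def)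
            then show False using \<open>0 < r\<close> by simp
          qed
        qed
        have "starts_number 0 ?b i"
          using i(3) starts_number_append1[OF less_imp_le[OF lt], of 0 ?w] unfolding x by (simp only:)
        then show ?B using i(4) p lt unfolding x by (intro exI[of _ i] conjI)
      next
        assume ?B
        then obtain i where i: "0 < i" "i < length ?b" "starts_number 0 ?b i" "number_at (?b @ ?w) i j" by blast
        have "starts_number 0 ?x i"
          using i(3) starts_number_append1[OF less_imp_le[OF i(2)], of 0 ?w] unfolding x by (simp only:)
        moreover have "i < length ?x" using i(2) unfolding x by simp
        moreover have "gates_before ?x i = Suc 0" using g1[OF i(1) less_imp_le[OF i(2)]] by (simp only: One_nat_def)
        moreover have "number_at ?x i j" using i(4) unfolding x .
        ultimately show ?A unfolding pred_code_def by (intro exI[of _ i] conjI)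
      qed
      then show ?thesis using gate_code(3)[of g ?w j] by simp
    qed
    have predS: "pred_code ?x (Suc i) j \<longleftrightarrow> pred_code ?w i j" for i j
    proof
      assume "pred_code ?x (Suc i) j"
      then obtain l where l: "l < length ?x" "gates_before ?x l = Suc (Suc i)" "starts_number 0 ?x l" "number_at ?x l j"
        unfolding pred_code_def by blast
      have "\<not> l \<le> length ?b" using g1[of l] g0 l(2) by (cases "l = 0") auto
      then obtain r where r: "l = length ?b + r" "0 < r" by (metis le_Suc_ex less_add_same_cancel1 linorder_not_le less_imp_le)
      have "gates_before ?w r = Suc i" using l(2) gb[of r] r by simp
      moreover have "starts_number 0 ?w r" using l(3) unfolding x r(1) starts_number_append[OF r(2)] fb .
      moreover have "number_at ?w r j" using l(4) unfolding x r(1) number_at_append .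
      moreover have "r < length ?w" using l(1) unfolding x r(1) by simp
      ultimately show "pred_code ?w i j" unfolding pred_code_def by blast
    next
      assume "pred_code ?w i j"
      then obtain r where r: "r < length ?w" "gates_before ?w r = Suc i" "starts_number 0 ?w r" "number_at ?w r j"
        unfolding pred_code_def by blast
      have p: "0 < r" using r(3) by (simp add: starts_number_def)
      have "gates_before ?x (length ?b + r) = Suc (Suc i)" using gb[of r] r(2) by simp
      moreover have "starts_number 0 ?x (length ?b + r)" unfolding x starts_number_append[OF p] fb by (rule r(3))
      moreover have "number_at ?x (length ?b + r) j" unfolding x number_at_append by (rule r(4))
      moreover have "length ?b + r < length ?x" using r(1) unfolding x by simp
      ultimately show "pred_code ?x (Suc i) j" unfolding pred_code_def by blast
    qed
    have type0: "type_code ?x 0 b c \<longleftrightarrow> take 2 (enc_gate g) = [b, c]"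
    proof -
      have z: "gates_before ?x i = 0 \<longleftrightarrow> i = 0" for i
      proof (cases "i \<le> length ?b")
        case True
        then show ?thesis using g1[of i] g0 by (cases "i = 0") auto
      next
        case False
        then obtain r where "i = length ?b + r" using le_Suc_ex linear by blast
        then show ?thesis using gb[of r] by simp
      qed
      have "type_code ?x 0 b c \<longleftrightarrow> bit_at ?x 1 = b \<and> bit_at ?x 2 = c" (is "?A \<longleftrightarrow> ?B")
      proof
        assume ?A
        then obtain i where i: "gates_before ?x i = 0" "bit_at ?x (i + 1) = b" "bit_at ?x (i + 2) = c"
          unfolding type_code_def by (elim exE conjE)
        have "i = 0" using z[of i] i(1) by (rule iffD1)
        then show ?B using i(2,3) by (simp only: add_0)
      next
        assume B: ?B
        have "bit_at ?x 0" "state_at 0 ?x 0 = 0" "0 < length ?x"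
          by (simp_all add: x bit_at_def state_at_def)
        then show ?A unfolding type_code_def using B g0
          by (intro exI[of _ 0] conjI) (simp_all only: add_0)
      qed
      moreover have "bit_at ?x 1 = enc_gate g ! 0" "bit_at ?x 2 = enc_gate g ! 1"
      proof -
        have l: "1 < length ?b" "2 < length ?b" by (cases g; simp)+
        have "bit_at ?b 1 = enc_gate g ! 0" "bit_at ?b 2 = enc_gate g ! 1"
          using l by (simp_all add: bit_at_def)
        then show "bit_at ?x 1 = enc_gate g ! 0" "bit_at ?x 2 = enc_gate g ! 1"
          unfolding x bit_at_append1[OF l(1)] bit_at_append1[OF l(2)] by (simp_all only:)
      qed
      moreover have "take 2 (enc_gate g) = [enc_gate g ! 0, enc_gate g ! 1]" by (cases g) simp_all
      ultimately show ?thesis by simp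
    qed
    have typeS: "type_code ?x (Suc i) b c \<longleftrightarrow> type_code ?w i b c" for i
    proof
      assume "type_code ?x (Suc i) b c"
      then obtain l where l: "l < length ?x" "gates_before ?x l = Suc i" "state_at 0 ?x l = 0" "bit_at ?x l"
        "bit_at ?x (l + 1) = b" "bit_at ?x (l + 2) = c" unfolding type_code_def by blast
      have "length ?b \<le> l"
      proof (rule ccontr)
        assume "\<not> length ?b \<le> l"
        then have lt: "l < length ?b" by simp
        have "0 < l" using l(2) g0 by (cases l) auto
        then have "state_at 0 ?b l \<noteq> 0" using lt by (rule gate_code(2))
        then show False using l(3) lt state_at_append1[of l ?b 0 ?w] unfolding x by simp
      qed
      then obtain r where r: "l = length ?b + r" using le_Suc_ex by blast
      have "gates_before ?w r = i" using l(2) gb[of r] r by simp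
      moreover have "state_at 0 ?w r = 0" using l(3) stb[of r] r by simp
      moreover have "bit_at ?w r" "bit_at ?w (r + 1) = b" "bit_at ?w (r + 2) = c"
        using l(4-6) unfolding x r add.assoc bit_at_append by auto
      moreover have "r < length ?w" using l(1) unfolding x r by simp
      ultimately show "type_code ?w i b c" unfolding type_code_def by blast
    next
      assume "type_code ?w i b c"
      then obtain r where r: "r < length ?w" "gates_before ?w r = i" "state_at 0 ?w r = 0" "bit_at ?w r"
        "bit_at ?w (r + 1) = b" "bit_at ?w (r + 2) = c" unfolding type_code_def by blast
      have "gates_before ?x (length ?b + r) = Suc i" using gb[of r] r(2) by simp
      moreover have "state_at 0 ?x (length ?b + r) = 0" using stb[of r] r(3) by simp
      moreover have "bit_at ?x (length ?b + r)" "bit_at ?x (length ?b + r + 1) = b" "bit_at ?x (length ?b + r + 2) = c"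
        using r(4-6) unfolding x add.assoc bit_at_append by auto
      moreover have "length ?b + r < length ?x" using r(1) unfolding x by simp
      ultimately show "type_code ?x (Suc i) b c" unfolding type_code_def by blast
    qed
    have "pred_code ?x i j \<longleftrightarrow> i < length (g # C) \<and> j \<in> set (preds ((g # C) ! i))" for i j
      using pred0 predS Cons.IH by (cases i) simp_all
    moreover have "type_code ?x i b c \<longleftrightarrow> take 2 (enc_gate ((g # C) ! i)) = [b, c]" if "i < length (g # C)" for i
      using that type0 typeS Cons.IH by (cases i) simp_all
    ultimately show ?case using size Cons.IH by simp
  qed
  then show "size_code (enc_circuit C) = length C"
    "pred_code (enc_circuit C) i j \<longleftrightarrow> i < length C \<and> j \<in> set (preds (C ! i))"
    "i < length C \<Longrightarrow> type_code (enc_circuit C) i b c \<longleftrightarrow> take 2 (enc_gate (C ! i)) = [b, c]" by blast+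
qed

lemma next_state_le: "next_state q b \<le> 7"
  by (simp add: next_state_def)

text \<open>The run of the automaton fits the truncated recursion: states never exceed 7, and the
  start state 0 is the initial value.\<close>

lemma state_at_rec: "i \<le> length x \<Longrightarrow>
    state_at 0 x i = rec_nat 0 (\<lambda>i a. min 7 (next_state a (bit_at x i))) i"
proof (induction i)
  case (Suc i)
  then have "state_at 0 x (Suc i) = next_state (state_at 0 x i) (bit_at x i)"
    by (simp add: state_at_def take_Suc_conv_app_nth bit_at_def)
  then show ?case using Suc next_state_le by (simp add: min_absorb2)
qed (simp add: state_at_def)

lemma definable_codes:
  "dfn (\<lambda>X e. size_code (fst X))"
  "dfb (\<lambda>X e. pred_code (fst X) (e 0) (e 1))"
  "dfb (\<lambda>X e. type_code (fst X) (e 0) b c)"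
proof -
  define sa where "sa X i = rec_nat 0 (\<lambda>i a. min 7 (next_state a (bit_at (fst X) i))) i" for X :: inp and i
  have sa: "dfn (\<lambda>X e. sa X (e 0))"
    unfolding sa_def next_state_def
    by (rule dfn_rec[where c = "\<lambda>X e. 7" and n = "\<lambda>X e. e 0"]) (intro definable_intros)+
  define gb where "gb X i = (\<Sum>j<i. of_bool (sa X j = 0 \<and> bit_at (fst X) j) :: nat)" for X :: inp and i
  have gb: "dfn (\<lambda>X e. gb X (e 0))"
    unfolding gb_def by (intro dfn_sum definable_intros dfn_app1[OF sa])
  have st: "state_at 0 (fst X) i = sa X i" if "i \<le> length (fst X)" for X i
    using that by (simp add: sa_def state_at_rec)
  have g: "gates_before (fst X) i = gb X i" if "i \<le> length (fst X)" for X i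
    unfolding gates_before_def gb_def using that st by (intro sum.cong) auto
  have "dfn (\<lambda>X e. gb X (length (fst X)))" by (intro dfn_app1[OF gb] definable_intros)
  then show "dfn (\<lambda>X e. size_code (fst X))" unfolding size_code_def by (simp add: g)
  have "dfb (\<lambda>X e. \<exists>i < length (fst X). gb X i = Suc (e 0) \<and>
      (0 < i \<and> (sa X i = 4 \<and> sa X (i - 1) = 2 \<or> sa X i = 6 \<and> sa X (i - 1) = 5)) \<and> number_at (fst X) i (e 1))"
    unfolding number_at_def by (intro definable_intros dfn_app1[OF gb] dfn_app1[OF sa])
  moreover have "pred_code (fst X) g' j \<longleftrightarrow> (\<exists>i < length (fst X). gb X i = Suc g' \<and>
      (0 < i \<and> (sa X i = 4 \<and> sa X (i - 1) = 2 \<or> sa X i = 6 \<and> sa X (i - 1) = 5)) \<and> number_at (fst X) i j)" for X g' j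
    unfolding pred_code_def starts_number_def by (intro ex_cong1 conj_cong refl) (auto simp: g st)
  ultimately show "dfb (\<lambda>X e. pred_code (fst X) (e 0) (e 1))" by simp
  have "dfb (\<lambda>X e. \<exists>i < length (fst X). gb X i = e 0 \<and> sa X i = 0 \<and> bit_at (fst X) i \<and>
      bit_at (fst X) (i + 1) = b \<and> bit_at (fst X) (i + 2) = c)"
    by (intro definable_intros dfn_app1[OF gb] dfn_app1[OF sa])
  moreover have "type_code (fst X) g' b c \<longleftrightarrow> (\<exists>i < length (fst X). gb X i = g' \<and> sa X i = 0 \<and> bit_at (fst X) i \<and>
      bit_at (fst X) (i + 1) = b \<and> bit_at (fst X) (i + 2) = c)" for X g'
    unfolding type_code_def by (intro ex_cong1 conj_cong refl) (auto simp: g st)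
  ultimately show "dfb (\<lambda>X e. type_code (fst X) (e 0) b c)" by simp
qed


section \<open>Evaluating circuits of weft 2\<close>

text \<open>
  A gate that has to take value \<open>b\<close> is universal if all its inputs are constrained, otherwise it is
  existential.  Along a path, at most two gates are large.  In mode \<open>A\<close> existential choices are
  fixed by a strategy \<open>e\<close>, which is guessed in advance; below a large universal gate (mode \<open>C\<close>) the
  universal choices are fixed by a counter-strategy \<open>w\<close>; below a further large existential gate
  (mode \<open>E\<close>) the gate depends on boundedly many inputs, and \<open>\<delta> i b\<close> says that there is evidence for
  input \<open>i\<close> having value \<open>b\<close>.
\<close>

locale gates =
  fixes n :: nat and kind :: "nat \<Rightarrow> nat" and pr :: "nat \<Rightarrow> nat \<Rightarrow> bool"
begin

definition large :: "nat \<Rightarrow> bool" where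
  "large i \<longleftrightarrow> 2 < (\<Sum>j<n. of_bool (pr i j) :: nat)"

definition universal :: "nat \<Rightarrow> bool \<Rightarrow> bool" where
  "universal i b \<longleftrightarrow> kind i = 1 \<or> kind i = (if b then 2 else 3)"

definition polarity :: "nat \<Rightarrow> bool \<Rightarrow> bool" where
  "polarity i b = (if kind i = 1 then \<not> b else b)"

definition later :: "nat \<Rightarrow> nat \<Rightarrow> bool" where
  "later i j \<longleftrightarrow> (\<exists>j' < j. pr i j')"

text \<open>A strategy of height \<open>r + 1\<close> is a pair of numbers below
  \<open>base r\<close>: two substrategies, or a chosen input and a substrategy. Starting with
  \<open>n + 2\<close> makes every gate number fit. For constant \<open>r\<close> the value
  \<open>(n + 2) ^ 2 ^ r\<close> is polynomial.\<close>

primrec base :: "nat \<Rightarrow> nat" where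
  "base 0 = n + 2"
| "base (Suc r) = base r * base r"

text \<open>A gate that is not large has at most two inputs, which \<open>later\<close> tells apart;
  the pair holds one substrategy for each of them.\<close>

definition half :: "nat \<Rightarrow> nat \<Rightarrow> bool \<Rightarrow> nat" where
  "half r e b = (if b then e div base r else e mod base r)"

primrec modeE :: "nat \<Rightarrow> (nat \<Rightarrow> bool \<Rightarrow> bool) \<Rightarrow> nat \<Rightarrow> bool \<Rightarrow> bool" where
  "modeE 0 \<delta> i b = \<delta> i b"
| "modeE (Suc r) \<delta> i b = (if kind i = 0 then \<delta> i b
     else if universal i b then \<forall>j < n. pr i j \<longrightarrow> modeE r \<delta> j (polarity i b)
     else \<exists>j < n. pr i j \<and> modeE r \<delta> j b)"

primrec modeC :: "nat \<Rightarrow> (nat \<Rightarrow> bool \<Rightarrow> bool) \<Rightarrow> nat \<Rightarrow> bool \<Rightarrow> nat \<Rightarrow> bool" where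
  "modeC 0 \<delta> i b w = \<delta> i b"
| "modeC (Suc r) \<delta> i b w = (if kind i = 0 then \<delta> i b
     else if universal i b then pr i (w mod base r) \<longrightarrow> modeC r \<delta> (w mod base r) (polarity i b) (w div base r)
     else if large i then \<exists>j < n. pr i j \<and> modeE r \<delta> j b
     else \<exists>j < n. pr i j \<and> modeC r \<delta> j b (half r w (later i j)))"

text \<open>A strategy needs a reply to every choice of the opponent, and only small gates have few
  enough choices to pack the replies. So \<open>e\<close> is halved at small universal gates and
  given up at a large one, below which the existential choices follow \<open>w\<close>. There
  \<open>w\<close> is halved at small existential gates; below a large one no large gate
  remains.\<close>

primrec modeA :: "nat \<Rightarrow> (nat \<Rightarrow> bool \<Rightarrow> bool) \<Rightarrow> nat \<Rightarrow> bool \<Rightarrow> nat \<Rightarrow> nat \<Rightarrow> bool" where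
  "modeA 0 \<delta> i b e w = \<delta> i b"
| "modeA (Suc r) \<delta> i b e w = (if kind i = 0 then \<delta> i b
     else if universal i b then pr i (w mod base r) \<longrightarrow>
       (if large i then modeC r \<delta> (w mod base r) (polarity i b) (w div base r)
        else modeA r \<delta> (w mod base r) (polarity i b) (half r e (later i (w mod base r))) (w div base r))
     else pr i (e mod base r) \<and> modeA r \<delta> (e mod base r) b (e div base r) (w div base r))"

primrec bounded :: "nat \<Rightarrow> nat \<Rightarrow> nat \<Rightarrow> bool" where
  "bounded 0 t i \<longleftrightarrow> kind i = 0"
| "bounded (Suc r) t i \<longleftrightarrow> kind i = 0 \<or>
     (\<forall>j. pr i j \<longrightarrow> (if large i then 0 < t \<and> bounded r (t - 1) j else bounded r t j))"

lemma base_pos: "n + 2 \<le> base r"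
proof (induction r)
  case (Suc r)
  then have "n + 2 \<le> base r * 1" by simp
  also have "\<dots> \<le> base r * base r" using Suc by (intro mult_le_mono) auto
  finally show ?case by simp
qed simp

lemma base_gt0: "0 < base r"
  using base_pos[of r] by linarith

lemma half_less: "e < base (Suc r) \<Longrightarrow> half r e b < base r"
  by (simp add: half_def base_gt0 less_mult_imp_div_less)

lemma div_less: "e < base (Suc r) \<Longrightarrow> e div base r < base r"
  by (simp add: less_mult_imp_div_less)

lemma pairing:
  assumes "a < base r" "c < base r"
  obtains e where "e < base (Suc r)" "e mod base r = a" "e div base r = c"
proof
  let ?e = "c * base r + a"
  have "?e < Suc c * base r" using assms(1) by simp
  also have "\<dots> \<le> base r * base r" using assms(2) by (intro mult_le_mono1) simp
  finally show "?e < base (Suc r)" by simp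
  show "?e mod base r = a" "?e div base r = c" using assms(1) by auto
qed

end

text \<open>The index \<open>t\<close> stands for a constraint variable, and
  \<open>\<Delta> t\<close> for what its value reveals about the inputs. One \<open>t\<close> may
  have to justify a conjunction, so \<open>evidence_exists\<close> asks for a single
  \<open>t\<close> covering any \<open>s\<close> inputs.\<close>

locale evaluation = gates +
  fixes val :: "nat \<Rightarrow> bool" and \<Delta> :: "'t \<Rightarrow> nat \<Rightarrow> bool \<Rightarrow> bool" and I :: "'t set" and s :: nat
  assumes pr_less: "\<And>i j. i < n \<Longrightarrow> pr i j \<Longrightarrow> j < n"
    and kinds: "\<And>i. i < n \<Longrightarrow> kind i \<le> 3"
    and neg: "\<And>i. i < n \<Longrightarrow> kind i = 1 \<Longrightarrow> \<exists>j. pr i j \<and> (\<forall>j'. pr i j' \<longrightarrow> j' = j) \<and> val i = (\<not> val j)"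
    and conj: "\<And>i. i < n \<Longrightarrow> kind i = 2 \<Longrightarrow> val i = (\<forall>j. pr i j \<longrightarrow> val j)"
    and disj: "\<And>i. i < n \<Longrightarrow> kind i = 3 \<Longrightarrow> val i = (\<exists>j. pr i j \<and> val j)"
    and evidence: "\<And>t i b. t \<in> I \<Longrightarrow> i < n \<Longrightarrow> kind i = 0 \<Longrightarrow> \<Delta> t i b \<Longrightarrow> val i = b"
    and evidence_exists: "\<And>N. N \<subseteq> {i. i < n \<and> kind i = 0} \<Longrightarrow> card N \<le> s \<Longrightarrow> \<exists>t \<in> I. \<forall>i \<in> N. \<Delta> t i (val i)"
begin

lemma val_universal:
  assumes "i < n" "kind i \<noteq> 0" "universal i b"
  shows "val i = b \<longleftrightarrow> (\<forall>j. pr i j \<longrightarrow> val j = polarity i b)"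
proof (cases "kind i = 1")
  case True
  obtain j where j: "pr i j \<and> (\<forall>j'. pr i j' \<longrightarrow> j' = j) \<and> val i = (\<not> val j)"
    using neg[OF assms(1) True] by (elim exE)
  then have "pr i j' \<longleftrightarrow> j' = j" for j' by (cases "j' = j") auto
  moreover have "val i = (\<not> val j)" using j by simp
  ultimately show ?thesis using True by (auto simp: polarity_def)
next
  case False
  show ?thesis
  proof (cases b)
    case True
    then have "kind i = 2" using False assms(3) by (simp add: universal_def)
    then show ?thesis using conj[OF assms(1)] True False by (simp add: polarity_def)
  next
    case F: False
    then have "kind i = 3" using False assms(3) by (simp add: universal_def)
    then show ?thesis using disj[OF assms(1)] F False by (simp add: polarity_def)
  qed
qed

lemma val_existential:
  assumes "i < n" "kind i \<noteq> 0" "\<not> universal i b"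
  shows "val i = b \<longleftrightarrow> (\<exists>j. pr i j \<and> val j = b)"
proof -
  have "kind i = (if b then 3 else 2)" using assms kinds[OF assms(1)] by (auto simp: universal_def split: if_splits)
  then show ?thesis using conj[OF assms(1)] disj[OF assms(1)] by (cases b) simp_all
qed

lemma card_preds: "i < n \<Longrightarrow> card {j. pr i j} = (\<Sum>j<n. of_bool (pr i j))"
proof -
  assume i: "i < n"
  have "{j. pr i j} = {..<n} \<inter> {j. pr i j}" using pr_less[OF i] by auto
  then have c1: "card {j. pr i j} = card ({..<n} \<inter> {j. pr i j})" by (rule arg_cong)
  have c2: "(\<Sum>j<n. of_bool (pr i j)) = card ({..<n} \<inter> {j. pr i j})" by simp
  show ?thesis by (rule trans[OF c1 c2[symmetric]])
qed

lemma finite_preds: "i < n \<Longrightarrow> finite {j. pr i j}"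
proof -
  assume i: "i < n"
  have "{j. pr i j} \<subseteq> {..<n}" using pr_less[OF i] by auto
  then show ?thesis by (rule finite_subset) simp
qed

text \<open>Exactly the smallest input fails to be \<open>later\<close>. Two different later inputs
  would make three inputs together with it.\<close>

lemma later_unique:
  assumes i: "i < n" "\<not> large i" and j: "pr i j" "pr i j'" "later i j = later i j'"
  shows "j = j'"
proof (rule ccontr)
  assume ne: "j \<noteq> j'"
  define l where "l = (LEAST l. pr i l)"
  have l: "pr i l" "\<And>j. pr i j \<Longrightarrow> l \<le> j" unfolding l_def using j(1) by (auto intro: LeastI Least_le)
  have lat: "later i k \<longleftrightarrow> k \<noteq> l" if "pr i k" for k
  proof
    assume "later i k"
    then obtain k' where "k' < k" "pr i k'" unfolding later_def by blast
    then show "k \<noteq> l" using l(2)[of k'] by auto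
  next
    assume "k \<noteq> l"
    then have "l < k" using l(2)[OF that] by simp
    then show "later i k" using l(1) unfolding later_def by blast
  qed
  then have "j \<noteq> l" "j' \<noteq> l" using j ne by auto
  then have "card {l, j, j'} = 3" using ne by auto
  moreover have "{l, j, j'} \<subseteq> {j. pr i j}" using l(1) j by auto
  ultimately have "3 \<le> card {j. pr i j}" using card_mono[OF finite_preds[OF i(1)]] by metis
  then show False using i(2) card_preds[OF i(1)] by (simp add: large_def)
qed

text \<open>Two numbers, one for each input of a small gate, are packed into one.\<close>

lemma pack:
  assumes i: "i < n" "\<not> large i" and ex: "\<And>j. pr i j \<Longrightarrow> \<exists>e < base r. Z j e"
  shows "\<exists>e < base (Suc r). \<forall>j. pr i j \<longrightarrow> Z j (half r e (later i j))"
proof -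
  obtain f where f: "\<And>j. pr i j \<Longrightarrow> f j < base r \<and> Z j (f j)" using ex by metis
  define g where "g b = (if \<exists>j. pr i j \<and> later i j = b then f (SOME j. pr i j \<and> later i j = b) else 0)" for b
  have g: "g (later i j) = f j" if "pr i j" for j
  proof -
    have "pr i (SOME j'. pr i j' \<and> later i j' = later i j) \<and>
        later i (SOME j'. pr i j' \<and> later i j' = later i j) = later i j"
      using that by (intro someI[of "\<lambda>j'. pr i j' \<and> later i j' = later i j" j]) simp
    then have "(SOME j'. pr i j' \<and> later i j' = later i j) = j" using later_unique[OF i] that by blast
    then show ?thesis using that unfolding g_def by auto
  qed
  have "g b < base r" for b
  proof (cases "\<exists>j. pr i j \<and> later i j = b")
    case True
    then show ?thesis using g f by force
  next
    case False
    then show ?thesis unfolding g_def by (simp only: if_False base_gt0)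
  qed
  then obtain e where e: "e < base (Suc r)" "e mod base r = g False" "e div base r = g True"
    using pairing by metis
  have "half r e b = g b" for b using e by (cases b) (simp_all add: half_def)
  then show ?thesis using e(1) g f by auto
qed

lemma modeE_sound:
  "i < n \<Longrightarrow> bounded r t' i \<Longrightarrow> t \<in> I \<Longrightarrow> modeE r (\<Delta> t) i b \<Longrightarrow> val i = b"
proof (induction r arbitrary: i b t')
  case 0
  then show ?case using evidence by simp
next
  case (Suc r)
  show ?case
  proof (cases "kind i = 0")
    case True
    then show ?thesis using Suc.prems evidence by simp
  next
    case False
    have bd: "\<exists>t''. bounded r t'' j" if "pr i j" for j using Suc.prems(2) False that by (auto split: if_splits)
    show ?thesis
    proof (cases "universal i b")
      case True
      have "val j = polarity i b" if j: "pr i j" for j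
      proof -
        have "j < n" using pr_less[OF Suc.prems(1) j] .
        moreover have "modeE r (\<Delta> t) j (polarity i b)" using Suc.prems(4) False True j \<open>j < n\<close> by simp
        ultimately show ?thesis using Suc.IH bd[OF j] Suc.prems(3) by blast
      qed
      then show ?thesis using val_universal[OF Suc.prems(1) False True] by blast
    next
      case F: False
      then obtain j where j: "j < n" "pr i j" "modeE r (\<Delta> t) j b" using Suc.prems(4) False by auto
      then have "val j = b" using Suc.IH bd[OF j(2)] Suc.prems(3) by blast
      then show ?thesis using val_existential[OF Suc.prems(1) False F] j(2) by blast
    qed
  qed
qed

text \<open>Without large gates the in-degrees are at most 2, so at most \<open>2 ^ r\<close> inputs
  have to be inspected. The set \<open>N\<close> is chosen before \<open>\<delta>\<close>, as a
  certificate independent of who provides the evidence.\<close>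

lemma modeE_complete:
  "i < n \<Longrightarrow> bounded r 0 i \<Longrightarrow> val i = b \<Longrightarrow> \<exists>N. N \<subseteq> {i. i < n \<and> kind i = 0} \<and> card N \<le> 2 ^ r \<and>
     (\<forall>\<delta>. (\<forall>l \<in> N. \<delta> l (val l)) \<longrightarrow> modeE r \<delta> i b)"
proof (induction r arbitrary: i b)
  case 0
  then show ?case by (intro exI[of _ "{i}"]) auto
next
  case (Suc r)
  show ?case
  proof (cases "kind i = 0")
    case True
    then show ?thesis using Suc.prems by (intro exI[of _ "{i}"]) auto
  next
    case False
    have bd: "bounded r 0 j" "\<not> large i" if "pr i j" for j using Suc.prems(2) False that by (auto split: if_splits)
    show ?thesis
    proof (cases "universal i b")
      case True
      have "\<exists>N. N \<subseteq> {i. i < n \<and> kind i = 0} \<and> card N \<le> 2 ^ r \<and>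
          (\<forall>\<delta>. (\<forall>l \<in> N. \<delta> l (val l)) \<longrightarrow> modeE r \<delta> j (polarity i b))" if j: "pr i j" for j
        using Suc.IH[OF pr_less[OF Suc.prems(1) j] bd(1)[OF j]] val_universal[OF Suc.prems(1) False True] Suc.prems(3) j
        by blast
      then obtain N where N: "\<And>j. pr i j \<Longrightarrow> N j \<subseteq> {i. i < n \<and> kind i = 0} \<and> card (N j) \<le> 2 ^ r \<and>
          (\<forall>\<delta>. (\<forall>l \<in> N j. \<delta> l (val l)) \<longrightarrow> modeE r \<delta> j (polarity i b))" by metis
      let ?N = "\<Union>j \<in> {j. pr i j}. N j"
      have "card {j. pr i j} \<le> 2"
      proof (cases "\<exists>j. pr i j")
        case True
        then have "\<not> large i" using bd(2) by blast
        then show ?thesis using card_preds[OF Suc.prems(1)] by (simp add: large_def)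
      qed simp
      have "card ?N \<le> (\<Sum>j \<in> {j. pr i j}. card (N j))" by (rule card_UN_le[OF finite_preds[OF Suc.prems(1)]])
      also have "\<dots> \<le> of_nat (card {j. pr i j}) * 2 ^ r"
      proof (rule sum_bounded_above)
        fix j assume "j \<in> {j. pr i j}"
        then show "card (N j) \<le> 2 ^ r" using N[of j] by simp
      qed
      also have "\<dots> \<le> 2 * 2 ^ r" using \<open>card {j. pr i j} \<le> 2\<close> by simp
      finally have "card ?N \<le> 2 ^ Suc r" by simp
      moreover have "?N \<subseteq> {i. i < n \<and> kind i = 0}" using N by blast
      moreover have "modeE (Suc r) \<delta> i b" if d: "\<forall>l \<in> ?N. \<delta> l (val l)" for \<delta>
      proof -
        have "modeE r \<delta> j (polarity i b)" if "pr i j" for j using N[OF that] d that by blast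
        then show ?thesis using True False by simp
      qed
      ultimately show ?thesis by (intro exI[of _ ?N] conjI allI impI)
    next
      case F: False
      then obtain j where j: "pr i j" "val j = b" using val_existential[OF Suc.prems(1) False F] Suc.prems(3) by blast
      obtain N where N: "N \<subseteq> {i. i < n \<and> kind i = 0}" "card N \<le> 2 ^ r"
        "\<And>\<delta>. (\<forall>l \<in> N. \<delta> l (val l)) \<Longrightarrow> modeE r \<delta> j b"
        using Suc.IH[OF pr_less[OF Suc.prems(1) j(1)] bd(1)[OF j(1)] j(2)] by blast
      have "modeE (Suc r) \<delta> i b" if "\<forall>l \<in> N. \<delta> l (val l)" for \<delta>
        using N(3)[of \<delta>, OF that] j(1) pr_less[OF Suc.prems(1) j(1)] False F by auto
      moreover have "card N \<le> 2 ^ Suc r" using N(2) by simp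
      ultimately show ?thesis using N(1) by (intro exI[of _ N] conjI allI impI)
    qed
  qed
qed

lemma I_nonempty: "\<exists>t. t \<in> I"
  using evidence_exists[of "{}"] by auto

lemma input_evidence: "i < n \<Longrightarrow> kind i = 0 \<Longrightarrow> 0 < s \<Longrightarrow> \<exists>t \<in> I. \<Delta> t i (val i)"
  using evidence_exists[of "{i}"] by auto

text \<open>A wrong value is refuted by one \<open>w\<close> against all \<open>t\<close>. At a
  universal gate \<open>w\<close> names an input with the wrong value, and at a small existential
  gate the refutations of both inputs are packed. At a large existential gate every input already
  fails in \<open>modeE\<close>.\<close>

lemma modeC_sound:
  "i < n \<Longrightarrow> bounded r t' i \<Longrightarrow> val i \<noteq> b \<Longrightarrow> \<exists>w < base r. \<forall>t \<in> I. \<not> modeC r (\<Delta> t) i b w"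
proof (induction r arbitrary: i b t')
  case 0
  then show ?case using evidence base_gt0[of 0] by (intro exI[of _ 0]) auto
next
  case (Suc r)
  have pos: "0 < base (Suc r)" by (rule base_gt0)
  show ?case
  proof (cases "kind i = 0")
    case True
    then show ?thesis using Suc.prems evidence pos by (intro exI[of _ 0]) auto
  next
    case False
    have bd: "\<exists>t''. bounded r t'' j" if "pr i j" for j using Suc.prems(2) False that by (auto split: if_splits)
    show ?thesis
    proof (cases "universal i b")
      case True
      then obtain j where j: "pr i j" "val j \<noteq> polarity i b"
        using val_universal[OF Suc.prems(1) False True] Suc.prems(3) by blast
      have jn: "j < n" using pr_less[OF Suc.prems(1) j(1)] .
      obtain w' where w': "w' < base r" "\<And>t. t \<in> I \<Longrightarrow> \<not> modeC r (\<Delta> t) j (polarity i b) w'"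
        using Suc.IH[OF jn _ j(2)] bd[OF j(1)] by blast
      have "j < base r" using jn base_pos[of r] by linarith
      then obtain w where w: "w < base (Suc r)" "w mod base r = j" "w div base r = w'" using pairing w'(1) by blast
      then have "\<not> modeC (Suc r) (\<Delta> t) i b w" if "t \<in> I" for t using False True j(1) w'(2)[OF that] by simp
      then show ?thesis using w(1) by blast
    next
      case F: False
      have bad: "val j \<noteq> b" if "pr i j" for j using val_existential[OF Suc.prems(1) False F] Suc.prems(3) that by blast
      show ?thesis
      proof (cases "large i")
        case True
        have "\<not> modeE r (\<Delta> t) j b" if "t \<in> I" "pr i j" for t j
          using modeE_sound[OF pr_less[OF Suc.prems(1) that(2)] _ that(1)] bd[OF that(2)] bad[OF that(2)] by blast
        then have "\<not> modeC (Suc r) (\<Delta> t) i b 0" if "t \<in> I" for t using False F True that by auto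
        then show ?thesis using pos by blast
      next
        case small: False
        have "\<exists>w < base r. \<forall>t \<in> I. \<not> modeC r (\<Delta> t) j b w" if "pr i j" for j
          using Suc.IH[OF pr_less[OF Suc.prems(1) that] _ bad[OF that]] bd[OF that] by blast
        then obtain w where w: "w < base (Suc r)" "\<And>j. pr i j \<Longrightarrow> \<forall>t \<in> I. \<not> modeC r (\<Delta> t) j b (half r w (later i j))"
          using pack[OF Suc.prems(1) small, where r = r and Z = "\<lambda>j w. \<forall>t \<in> I. \<not> modeC r (\<Delta> t) j b w"] by blast
        then have "\<not> modeC (Suc r) (\<Delta> t) i b w" if "t \<in> I" for t using False F small that by auto
        then show ?thesis using w(1) by blast
      qed
    qed
  qed
qed

text \<open>Here \<open>t\<close> is chosen after \<open>w\<close>, so existential choices merely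
  select a branch. The demand \<open>2 ^ r \<le> s\<close> stems from the large existential gate,
  where one \<open>t\<close> has to certify all inputs of a certificate.\<close>

lemma modeC_complete:
  "i < n \<Longrightarrow> bounded r 1 i \<Longrightarrow> 2 ^ r \<le> s \<Longrightarrow> val i = b \<Longrightarrow> w < base r \<Longrightarrow> \<exists>t \<in> I. modeC r (\<Delta> t) i b w"
proof (induction r arbitrary: i b w)
  case 0
  then show ?case using input_evidence[of i] by auto
next
  case (Suc r)
  have s: "2 ^ r \<le> s" "0 < s"
  proof -
    have "(0::nat) < 2 ^ r" by simp
    then show "2 ^ r \<le> s" "0 < s" using Suc.prems(3) unfolding power_Suc by linarith+
  qed
  show ?case
  proof (cases "kind i = 0")
    case True
    then show ?thesis using Suc.prems input_evidence[of i] s by auto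
  next
    case False
    have bd: "bounded r 0 j \<and> large i \<or> bounded r 1 j \<and> \<not> large i" if "pr i j" for j
      using Suc.prems(2) False that by (auto split: if_splits)
    have mono: "bounded r 0 j \<Longrightarrow> bounded r 1 j" for r j
      by (induction r arbitrary: j) (auto split: if_splits)
    have dl: "w div base r < base r" using Suc.prems(5) by (rule div_less)
    show ?thesis
    proof (cases "universal i b")
      case True
      show ?thesis
      proof (cases "pr i (w mod base r)")
        case T: True
        let ?j = "w mod base r"
        have "val ?j = polarity i b" using val_universal[OF Suc.prems(1) False True] Suc.prems(4) T by blast
        moreover have "bounded r 1 ?j" using bd[OF T] mono by blast
        ultimately obtain t where "t \<in> I" "modeC r (\<Delta> t) ?j (polarity i b) (w div base r)"
          using Suc.IH[OF pr_less[OF Suc.prems(1) T] _ s(1) _ dl] by blast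
        then show ?thesis using False True by auto
      next
        case F: False
        then show ?thesis using False True I_nonempty by auto
      qed
    next
      case F: False
      then obtain j where j: "pr i j" "val j = b" using val_existential[OF Suc.prems(1) False F] Suc.prems(4) by blast
      have jn: "j < n" using pr_less[OF Suc.prems(1) j(1)] .
      show ?thesis
      proof (cases "large i")
        case True
        then have "bounded r 0 j" using bd[OF j(1)] by blast
        then obtain N where N: "N \<subseteq> {i. i < n \<and> kind i = 0}" "card N \<le> 2 ^ r"
          "\<And>\<delta>. (\<forall>l \<in> N. \<delta> l (val l)) \<Longrightarrow> modeE r \<delta> j b" using modeE_complete[OF jn _ j(2)] by blast
        obtain t where t: "t \<in> I" "\<forall>l \<in> N. \<Delta> t l (val l)"
          using evidence_exists[OF N(1)] le_trans[OF N(2) s(1)] by blast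
        then show ?thesis using N(3)[of "\<Delta> t", OF t(2)] False F True j(1) jn by (intro bexI[of _ t]) auto
      next
        case small: False
        then have "bounded r 1 j" using bd[OF j(1)] by blast
        then obtain t where "t \<in> I" "modeC r (\<Delta> t) j b (half r w (later i j))"
          using Suc.IH[OF jn _ s(1) j(2) half_less[OF Suc.prems(5)]] by blast
        then show ?thesis using False F small j(1) jn by (intro bexI[of _ t]) auto
      qed
    qed
  qed
qed

text \<open>As \<open>e\<close> fixes the existential choices, the refutation \<open>w\<close>
  follows a single branch. At a large universal gate it names a wrong input and continues with the
  refutation for \<open>modeC\<close>.\<close>

lemma modeA_sound:
  "i < n \<Longrightarrow> bounded r t' i \<Longrightarrow> val i \<noteq> b \<Longrightarrow> e < base r \<Longrightarrow> \<exists>w < base r. \<forall>t \<in> I. \<not> modeA r (\<Delta> t) i b e w"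
proof (induction r arbitrary: i b t' e)
  case 0
  then show ?case using evidence by (intro exI[of _ 0]) (auto simp: base_gt0)
next
  case (Suc r)
  have pos: "0 < base (Suc r)" by (rule base_gt0)
  show ?case
  proof (cases "kind i = 0")
    case True
    then show ?thesis using Suc.prems evidence pos by (intro exI[of _ 0]) auto
  next
    case False
    have bd: "\<exists>t''. bounded r t'' j" if "pr i j" for j using Suc.prems(2) False that by (auto split: if_splits)
    show ?thesis
    proof (cases "universal i b")
      case True
      then obtain j where j: "pr i j" "val j \<noteq> polarity i b"
        using val_universal[OF Suc.prems(1) False True] Suc.prems(3) by blast
      have jn: "j < n" using pr_less[OF Suc.prems(1) j(1)] .
      have "j < base r" using jn base_pos[of r] by linarith
      show ?thesis
      proof (cases "large i")
        case L: True
        obtain w' where w': "w' < base r" "\<And>t. t \<in> I \<Longrightarrow> \<not> modeC r (\<Delta> t) j (polarity i b) w'"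
          using modeC_sound[OF jn _ j(2)] bd[OF j(1)] by blast
        obtain w where w: "w < base (Suc r)" "w mod base r = j" "w div base r = w'"
          using pairing[OF \<open>j < base r\<close> w'(1)] by blast
        then have "\<not> modeA (Suc r) (\<Delta> t) i b e w" if "t \<in> I" for t using False True L j(1) w'(2)[OF that] by simp
        then show ?thesis using w(1) by blast
      next
        case L: False
        obtain w' where w': "w' < base r" "\<And>t. t \<in> I \<Longrightarrow> \<not> modeA r (\<Delta> t) j (polarity i b) (half r e (later i j)) w'"
          using Suc.IH[OF jn _ j(2) half_less[OF Suc.prems(4)]] bd[OF j(1)] by blast
        obtain w where w: "w < base (Suc r)" "w mod base r = j" "w div base r = w'"
          using pairing[OF \<open>j < base r\<close> w'(1)] by blast
        then have "\<not> modeA (Suc r) (\<Delta> t) i b e w" if "t \<in> I" for t using False True L j(1) w'(2)[OF that] by simp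
        then show ?thesis using w(1) by blast
      qed
    next
      case F: False
      let ?j = "e mod base r"
      show ?thesis
      proof (cases "pr i ?j")
        case True
        have "val ?j \<noteq> b" using val_existential[OF Suc.prems(1) False F] Suc.prems(3) True by blast
        then obtain w' where w': "w' < base r" "\<And>t. t \<in> I \<Longrightarrow> \<not> modeA r (\<Delta> t) ?j b (e div base r) w'"
          using Suc.IH[OF pr_less[OF Suc.prems(1) True] _ _ div_less[OF Suc.prems(4)]] bd[OF True] by blast
        obtain w where w: "w < base (Suc r)" "w mod base r = 0" "w div base r = w'"
          using pairing[OF base_gt0 w'(1)] by blast
        then have "\<not> modeA (Suc r) (\<Delta> t) i b e w" if "t \<in> I" for t using False F w'(2)[OF that] by simp
        then show ?thesis using w(1) by blast
      next
        case Fa: False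
        then have "\<not> modeA (Suc r) (\<Delta> t) i b e 0" for t using False F by simp
        then show ?thesis using pos by blast
      qed
    qed
  qed
qed

text \<open>The strategy \<open>e\<close> precedes \<open>w\<close>. At small universal gates the
  strategies for the inputs are packed; at a large one 0 serves as \<open>e\<close>, because
  \<open>modeC\<close> makes its existential choices with \<open>w\<close> known.\<close>

lemma modeA_complete:
  "i < n \<Longrightarrow> bounded r 2 i \<Longrightarrow> 2 ^ r \<le> s \<Longrightarrow> val i = b \<Longrightarrow>
    \<exists>e < base r. \<forall>w < base r. \<exists>t \<in> I. modeA r (\<Delta> t) i b e w"
proof (induction r arbitrary: i b)
  case 0
  then show ?case using input_evidence[of i] by (intro exI[of _ 0]) auto
next
  case (Suc r)
  have s: "2 ^ r \<le> s" "0 < s"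
  proof -
    have "(0::nat) < 2 ^ r" by simp
    then show "2 ^ r \<le> s" "0 < s" using Suc.prems(3) unfolding power_Suc by linarith+
  qed
  have pos: "0 < base (Suc r)" by (rule base_gt0)
  show ?case
  proof (cases "kind i = 0")
    case True
    then show ?thesis using Suc.prems input_evidence[of i] s pos by (intro exI[of _ 0]) auto
  next
    case False
    have bd: "bounded r 1 j \<and> large i \<or> bounded r 2 j \<and> \<not> large i" if "pr i j" for j
      using Suc.prems(2) False that by (auto split: if_splits simp: numeral_2_eq_2)
    have mono: "bounded r t j \<Longrightarrow> bounded r (Suc t) j" for r t j
      by (induction r arbitrary: j t) (auto split: if_splits, metis Suc_pred)
    have bd2: "bounded r 2 j" if "pr i j" for j using bd[OF that] mono[of r 1 j] by (auto simp: numeral_2_eq_2)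
    show ?thesis
    proof (cases "universal i b")
      case True
      have ok: "val j = polarity i b" if "pr i j" for j
        using val_universal[OF Suc.prems(1) False True] Suc.prems(4) that by blast
      show ?thesis
      proof (cases "large i")
        case L: True
        have "\<exists>t \<in> I. modeA (Suc r) (\<Delta> t) i b 0 w" if w: "w < base (Suc r)" for w
        proof (cases "pr i (w mod base r)")
          case T: True
          have "bounded r 1 (w mod base r)" using bd[OF T] L by blast
          then obtain t where "t \<in> I" "modeC r (\<Delta> t) (w mod base r) (polarity i b) (w div base r)"
            using modeC_complete[OF pr_less[OF Suc.prems(1) T] _ s(1) ok[OF T] div_less[OF w]] by blast
          then show ?thesis using False True L by auto
        next
          case Fa: False
          then show ?thesis using False True I_nonempty by auto
        qed
        then show ?thesis using pos by blast
      next
        case L: False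
        have "\<exists>e < base r. \<forall>w < base r. \<exists>t \<in> I. modeA r (\<Delta> t) j (polarity i b) e w" if "pr i j" for j
          using Suc.IH[OF pr_less[OF Suc.prems(1) that] bd2[OF that] s(1) ok[OF that]] .
        then obtain e where e: "e < base (Suc r)"
          "\<And>j. pr i j \<Longrightarrow> \<forall>w < base r. \<exists>t \<in> I. modeA r (\<Delta> t) j (polarity i b) (half r e (later i j)) w"
          using pack[OF Suc.prems(1) L, where r = r and
              Z = "\<lambda>j e. \<forall>w < base r. \<exists>t \<in> I. modeA r (\<Delta> t) j (polarity i b) e w"] by blast
        have "\<exists>t \<in> I. modeA (Suc r) (\<Delta> t) i b e w" if w: "w < base (Suc r)" for w
        proof (cases "pr i (w mod base r)")
          case T: True
          obtain t where "t \<in> I" "modeA r (\<Delta> t) (w mod base r) (polarity i b) (half r e (later i (w mod base r))) (w div base r)"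
            using e(2)[OF T] div_less[OF w] by blast
          then show ?thesis using False True L by auto
        next
          case Fa: False
          then show ?thesis using False True I_nonempty by auto
        qed
        then show ?thesis using e(1) by blast
      qed
    next
      case F: False
      then obtain j where j: "pr i j" "val j = b" using val_existential[OF Suc.prems(1) False F] Suc.prems(4) by blast
      have jn: "j < n" using pr_less[OF Suc.prems(1) j(1)] .
      have jb: "j < base r" using jn base_pos[of r] by linarith
      obtain e' where e': "e' < base r" "\<And>w. w < base r \<Longrightarrow> \<exists>t \<in> I. modeA r (\<Delta> t) j b e' w"
        using Suc.IH[OF jn bd2[OF j(1)] s(1) j(2)] by blast
      obtain e where e: "e < base (Suc r)" "e mod base r = j" "e div base r = e'" using pairing[OF jb e'(1)] by blast
      have "\<exists>t \<in> I. modeA (Suc r) (\<Delta> t) i b e w" if w: "w < base (Suc r)" for w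
        using e'(2)[OF div_less[OF w]] e j(1) False F by auto
      then show ?thesis using e(1) by blast
    qed
  qed
qed

end


section \<open>Weighted satisfiability as a constraint satisfaction problem\<close>

definition kind_code :: "bool list \<Rightarrow> nat \<Rightarrow> nat" where
  "kind_code x i = (if type_code x i False False then 0 else if type_code x i False True then 1
     else if type_code x i True False then 2 else 3)"

lemma kind_code_circuit:
  "i < length C \<Longrightarrow> kind_code (enc_circuit C) i =
     (case C ! i of Input \<Rightarrow> 0 | Not _ \<Rightarrow> 1 | And _ \<Rightarrow> 2 | Or _ \<Rightarrow> 3)"
  by (cases "C ! i") (simp_all add: kind_code_def circuit_code(3))

section \<open>Paths from inputs to arbitrary gates\<close>

definition input_path :: "circuit \<Rightarrow> nat \<Rightarrow> nat list \<Rightarrow> bool" where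
  "input_path C i p \<longleftrightarrow> p \<noteq> [] \<and> (\<forall>l \<in> set p. l < length C) \<and> C ! hd p = Input \<and> last p = i \<and>
     (\<forall>l. Suc l < length p \<longrightarrow> p ! l \<in> set (preds (C ! (p ! Suc l))))"

lemma input_path_extend:
  assumes "input_path C j p" "i < length C" "j \<in> set (preds (C ! i))"
  shows "input_path C i (p @ [i])"
  unfolding input_path_def
proof (intro conjI allI impI)
  have p: "p \<noteq> []" "last p = j" using assms(1) by (simp_all add: input_path_def)
  show "C ! hd (p @ [i]) = Input" using assms(1) p by (simp add: input_path_def)
  show "\<forall>l \<in> set (p @ [i]). l < length C" using assms(1,2) by (simp add: input_path_def)
  fix l assume l: "Suc l < length (p @ [i])"
  show "(p @ [i]) ! l \<in> set (preds (C ! ((p @ [i]) ! Suc l)))"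
  proof (cases "Suc l < length p")
    case True
    then show ?thesis using assms(1) by (simp add: input_path_def nth_append)
  next
    case False
    then have "l = length p - 1" "Suc l = length p" using l by auto
    then show ?thesis using p assms(3) by (simp add: nth_append last_conv_nth)
  qed
qed simp_all

text \<open>Each gate other than an input has an earlier predecessor. Depth and weft restrict only
  paths that start at an input, so every gate must be known to lie on such a path.\<close>

lemma input_path_exists:
  assumes "circuit C"
  shows "i < length C \<Longrightarrow> \<exists>p. input_path C i p"
proof (induction i rule: less_induct)
  case (less i)
  show ?case
  proof (cases "C ! i = Input")
    case True
    then have "input_path C i [i]" using less.prems by (simp add: input_path_def)
    then show ?thesis by blast
  next
    case False
    then obtain j where j: "j \<in> set (preds (C ! i))"
      using assms less.prems unfolding circuit_def by (metis last_in_set)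
    then have ji: "j < i" using assms less.prems unfolding circuit_def by blast
    then obtain p where "input_path C j p" using less.IH[OF ji] less.prems by auto
    then show ?thesis using input_path_extend[OF _ less.prems j] by blast
  qed
qed

text \<open>Gate \<open>i\<close> is represented by the position \<open>Suc i\<close>. The positions
  up to \<open>Suc n\<close> are cut into \<open>k + 1\<close> intervals, open on the left and
  closed on the right, that end at the true inputs; the last one ends at \<open>Suc n\<close>,
  behind all gates.\<close>

definition pieces :: "nat \<Rightarrow> (nat \<Rightarrow> nat) \<Rightarrow> nat \<Rightarrow> (nat \<Rightarrow> nat) \<Rightarrow> (nat \<Rightarrow> nat) \<Rightarrow> bool" where
  "pieces n kind k lo hi \<longleftrightarrow> lo 0 = 0 \<and> hi k = Suc n \<and> (\<forall>t \<le> k. lo t < hi t) \<and>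
     (\<forall>t < k. hi t = lo (Suc t) \<and> hi t \<le> n \<and> kind (hi t - 1) = 0)"

text \<open>The ends of the pieces, except for the last one, mark the inputs that are true.\<close>

definition marked :: "nat \<Rightarrow> (nat \<Rightarrow> nat) \<Rightarrow> nat set" where
  "marked k hi = (\<lambda>t. hi t - 1) ` {..<k}"

lemma piecesD:
  assumes "pieces n kind k lo hi"
  shows "lo 0 = 0" "hi k = Suc n" "t \<le> k \<Longrightarrow> lo t < hi t" "t < k \<Longrightarrow> hi t = lo (Suc t)"
    "t < k \<Longrightarrow> hi t \<le> n" "t < k \<Longrightarrow> kind (hi t - 1) = 0"
  using assms unfolding pieces_def by blast+

lemma pieces_mono:
  assumes "pieces n kind k lo hi" "t < t'" "t' \<le> k"
  shows "hi t \<le> lo t'"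
  using assms(2,3)
proof (induction t' rule: less_induct)
  case (less t')
  obtain t'' where t': "t' = Suc t''" using less.prems by (cases t') auto
  have "hi t'' = lo t'" using assms(1) less.prems t' by (simp add: pieces_def)
  moreover have "hi t \<le> hi t''"
  proof (cases "t = t''")
    case False
    then have "hi t \<le> lo t''" using less t' by simp
    also have "\<dots> < hi t''" using piecesD(3)[OF assms(1)] less.prems t' by simp
    finally show ?thesis by simp
  qed simp
  ultimately show ?case by simp
qed

lemma pieces_cover:
  assumes p: "pieces n kind k lo hi" and i: "i < n"
  shows "\<exists>t \<le> k. lo t < Suc i \<and> Suc i \<le> hi t"
proof -
  define t where "t = (LEAST t. Suc i \<le> hi t)"
  have k: "Suc i \<le> hi k" using p i by (simp add: pieces_def)
  then have t: "Suc i \<le> hi t" unfolding t_def by (rule LeastI)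
  have tk: "t \<le> k" unfolding t_def using k by (rule Least_le)
  have "lo t < Suc i"
  proof (cases t)
    case 0
    then show ?thesis using p by (simp add: pieces_def)
  next
    case (Suc t')
    then have "\<not> Suc i \<le> hi t'" using not_less_Least[of t' "\<lambda>t. Suc i \<le> hi t"] unfolding t_def by simp
    moreover have "hi t' = lo t" using p Suc tk by (simp add: pieces_def)
    ultimately show ?thesis by simp
  qed
  then show ?thesis using t tk by blast
qed

text \<open>A single piece settles every input inside it: the one at its right end is true and all
  others are false.\<close>

lemma pieces_decide:
  assumes p: "pieces n kind k lo hi" and i: "i < n" and t: "t \<le> k" "lo t < Suc i" "Suc i \<le> hi t"
  shows "i \<in> marked k hi \<longleftrightarrow> Suc i = hi t"
proof
  assume "i \<in> marked k hi"
  then obtain t' where t': "t' < k" "i = hi t' - 1" unfolding marked_def by auto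
  have "lo t' < hi t'" using piecesD(3)[OF p, of t'] t'(1) by simp
  then have e: "Suc i = hi t'" using t'(2) by simp
  have "\<not> t' < t" using pieces_mono[OF p, of t' t] t e by auto
  moreover have "\<not> t < t'" using pieces_mono[OF p, of t t'] t t' e \<open>lo t' < hi t'\<close> by auto
  ultimately show "Suc i = hi t" using e by simp
next
  assume e: "Suc i = hi t"
  then have "t \<noteq> k" using p i by (auto simp: pieces_def)
  then have "t < k" using t(1) by simp
  moreover have "i = hi t - 1" using e by simp
  ultimately show "i \<in> marked k hi" unfolding marked_def by blast
qed

lemma pieces_card:
  assumes p: "pieces n kind k lo hi"
  shows "card (marked k hi) = k" "i \<in> marked k hi \<Longrightarrow> i < n \<and> kind i = 0"
proof -
  have less: "hi t < hi t'" if "t < t'" "t' < k" for t t'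
  proof -
    have "hi t \<le> lo t'" using pieces_mono[OF p that(1)] that(2) by simp
    also have "\<dots> < hi t'" using piecesD(3)[OF p, of t'] that(2) by simp
    finally show ?thesis .
  qed
  have pos: "0 < hi t" if "t < k" for t
  proof -
    have "lo t < hi t" using piecesD(3)[OF p, of t] that by simp
    then show ?thesis by simp
  qed
  have "inj_on (\<lambda>t. hi t - 1) {..<k}"
  proof (rule inj_onI)
    fix t t' assume t: "t \<in> {..<k}" "t' \<in> {..<k}" and e: "hi t - 1 = hi t' - 1"
    have "hi t = hi t'" using e pos[of t] pos[of t'] t by simp
    then show "t = t'" using less[of t t'] less[of t' t] t by (metis lessThan_iff less_irrefl nat_neq_iff)
  qed
  then show "card (marked k hi) = k" unfolding marked_def by (simp add: card_image)
  assume "i \<in> marked k hi"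
  then obtain t where t: "t < k" "i = hi t - 1" unfolding marked_def by auto
  have "hi t \<le> n" "kind (hi t - 1) = 0" using piecesD(5,6)[OF p t(1)] by simp_all
  then show "i < n \<and> kind i = 0" using t pos[OF t(1)] by auto
qed

section \<open>Evidence carried by tuples of gaps\<close>

definition decide :: "nat \<Rightarrow> nat \<Rightarrow> nat \<Rightarrow> nat \<Rightarrow> bool \<Rightarrow> bool" where
  "decide n s v i b \<longleftrightarrow> (\<exists>r < s. dig (n + 2) v (2 * r) < Suc i \<and> Suc i \<le> dig (n + 2) v (2 * r + 1) \<and>
     (b \<longleftrightarrow> Suc i = dig (n + 2) v (2 * r + 1)))"

lemma decide_sound:
  assumes p: "pieces n kind k lo hi" and T: "T < (k + 1) ^ s" "i < n" "decide n s v i b"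
    and v: "\<And>r. r < s \<Longrightarrow> dig (n + 2) v (2 * r) = lo (dig (k + 1) T r) \<and> dig (n + 2) v (2 * r + 1) = hi (dig (k + 1) T r)"
  shows "(i \<in> marked k hi) = b"
proof -
  obtain r where r: "r < s" "dig (n + 2) v (2 * r) < Suc i" "Suc i \<le> dig (n + 2) v (2 * r + 1)"
    "b \<longleftrightarrow> Suc i = dig (n + 2) v (2 * r + 1)" using T(3) unfolding decide_def by (elim exE conjE)
  have "dig (k + 1) T r < k + 1" by (rule dig_less) simp
  then have "i \<in> marked k hi \<longleftrightarrow> Suc i = hi (dig (k + 1) T r)"
    using v[OF r(1)] r by (intro pieces_decide[OF p T(2)]) auto
  then show ?thesis using v[OF r(1)] r(4) by simp
qed

text \<open>The digits of \<open>T\<close> in base \<open>k + 1\<close> list the pieces that contain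
  the members of \<open>N\<close>, padded with piece 0.\<close>

lemma decide_exists:
  assumes p: "pieces n kind k lo hi" and N: "N \<subseteq> {..<n}" "card N \<le> s"
    and v: "\<And>T r. T < (k + 1) ^ s \<Longrightarrow> r < s \<Longrightarrow> dig (n + 2) (v T) (2 * r) = lo (dig (k + 1) T r) \<and>
      dig (n + 2) (v T) (2 * r + 1) = hi (dig (k + 1) T r)"
  shows "\<exists>T < (k + 1) ^ s. \<forall>i \<in> N. decide n s (v T) i (i \<in> marked k hi)"
proof -
  have "finite N" using N(1) by (rule finite_subset) simp
  then obtain l where l: "set l = N" "distinct l" using finite_distinct_list by blast
  have ll: "length l \<le> s" using l N(2) distinct_card[OF l(2)] by simp
  have "\<exists>t. t \<le> k \<and> lo t < Suc i \<and> Suc i \<le> hi t" if "i < n" for i using pieces_cover[OF p that] by blast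
  then obtain f where f: "\<And>i. i < n \<Longrightarrow> f i \<le> k \<and> lo (f i) < Suc i \<and> Suc i \<le> hi (f i)" by metis
  define d where "d r = (if r < length l then f (l ! r) else 0)" for r
  have ln: "l ! r < n" if "r < length l" for r
  proof -
    have "l ! r \<in> N" using nth_mem[OF that] l(1) by simp
    then show ?thesis using N(1) by auto
  qed
  have "d r < k + 1" for r
  proof (cases "r < length l")
    case True
    then show ?thesis using f[OF ln[OF True]] by (simp add: d_def)
  qed (simp add: d_def)
  then obtain T where T: "T < (k + 1) ^ s" "\<And>r. r < s \<Longrightarrow> dig (k + 1) T r = d r"
    using digits_exist[of s d "k + 1"] by blast
  have "decide n s (v T) i (i \<in> marked k hi)" if iN: "i \<in> N" for i
  proof -
    have "i \<in> set l" using iN l(1) by simp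
    then obtain r where r: "r < length l" "l ! r = i" unfolding in_set_conv_nth by blast
    have rs: "r < s" using r(1) ll by simp
    have i: "i < n" using ln[OF r(1)] r(2) by simp
    have dr: "dig (k + 1) T r = f i" using T(2)[OF rs] r by (simp add: d_def)
    have "i \<in> marked k hi \<longleftrightarrow> Suc i = hi (f i)" using f[OF i] by (intro pieces_decide[OF p i]) auto
    then show ?thesis unfolding decide_def using v[OF T(1) rs] dr f[OF i] rs by (intro exI[of _ r]) simp
  qed
  then show ?thesis using T(1) by blast
qed

text \<open>Equal piece numbers must come with equal ends, and consecutive ones must be adjacent,
  also across variables. Thus all variables speak of one family of \<open>pieces\<close>.\<close>

definition piece_ok :: "bool list \<Rightarrow> nat \<Rightarrow> nat \<Rightarrow> nat \<Rightarrow> nat \<Rightarrow> nat \<Rightarrow> nat \<Rightarrow> nat \<Rightarrow> nat \<Rightarrow> bool" where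
  "piece_ok x k T v r T' v' r' n \<longleftrightarrow>
     (dig (k + 1) T r = dig (k + 1) T' r' \<longrightarrow> dig (n + 2) v (2 * r) = dig (n + 2) v' (2 * r') \<and>
        dig (n + 2) v (2 * r + 1) = dig (n + 2) v' (2 * r' + 1)) \<and>
     (Suc (dig (k + 1) T r) = dig (k + 1) T' r' \<longrightarrow> dig (n + 2) v (2 * r + 1) = dig (n + 2) v' (2 * r')) \<and>
     (dig (k + 1) T r = 0 \<longrightarrow> dig (n + 2) v (2 * r) = 0) \<and>
     (dig (k + 1) T r = k \<longrightarrow> dig (n + 2) v (2 * r + 1) = Suc n) \<and>
     dig (n + 2) v (2 * r) < dig (n + 2) v (2 * r + 1) \<and>
     (dig (k + 1) T r < k \<longrightarrow> dig (n + 2) v (2 * r + 1) \<le> n \<and> kind_code x (dig (n + 2) v (2 * r + 1) - 1) = 0)"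

text \<open>The lowest \<open>2 * s\<close> digits of a value are the ends of its \<open>s\<close>
  pieces; the quotient is the strategy for \<open>modeA\<close>, which all variables must
  share.\<close>

definition wsat_ok :: "bool list \<Rightarrow> nat \<Rightarrow> nat \<Rightarrow> nat \<Rightarrow> nat \<Rightarrow> nat \<Rightarrow> nat \<Rightarrow> bool" where
  "wsat_ok x k s T v T' v' \<longleftrightarrow>
     v div (size_code x + 2) ^ (2 * s) = v' div (size_code x + 2) ^ (2 * s) \<and>
     (\<forall>r < s. \<forall>r' < s. piece_ok x k T v r T' v' r' (size_code x))"

definition wsat_clause :: "bool list \<Rightarrow> nat \<Rightarrow> nat \<Rightarrow> nat \<Rightarrow> bool" where
  "wsat_clause x d w v \<longleftrightarrow> gates.modeA (size_code x) (kind_code x) (pred_code x) d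
     (decide (size_code x) (2 ^ d) v) (size_code x - 1) True (v div (size_code x + 2) ^ (2 * 2 ^ d)) w"

text \<open>The number of variables depends on \<open>k\<close> and the constant \<open>d\<close>
  only, while the numbers of values and of clauses are polynomial in the circuit. There is one
  clause for each counter-strategy \<open>w\<close>.\<close>

definition wsat_csp :: "bool list \<Rightarrow> nat \<Rightarrow> nat \<Rightarrow> bool" where
  "wsat_csp x k d \<longleftrightarrow> csp ((k + 1) ^ 2 ^ d) (gates.base (size_code x) d * (size_code x + 2) ^ (2 * 2 ^ d))
     (gates.base (size_code x) d) (wsat_ok x k (2 ^ d)) (wsat_clause x d)"

section \<open>Correctness for circuits of weft 2\<close>

locale weft2 =
  fixes C :: circuit and d :: nat
  assumes circuit: "circuit C" and weft: "weft_le C 2" and depth: "depth_le C d"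
begin

abbreviation "x \<equiv> enc_circuit C"
abbreviation "n \<equiv> length C"

sublocale gates n "kind_code x" "pred_code x" .

lemma preds_less: "i < n \<Longrightarrow> j \<in> set (preds (C ! i)) \<Longrightarrow> j < i"
  using circuit unfolding circuit_def by blast

lemma pr: "i < n \<Longrightarrow> pred_code x i j \<longleftrightarrow> j \<in> set (preds (C ! i))"
  by (simp add: circuit_code(2))

lemma large_iff: "i < n \<Longrightarrow> large i \<longleftrightarrow> 2 < length (preds (C ! i))"
proof -
  assume i: "i < n"
  have "{..<n} \<inter> {j. pred_code x i j} = set (preds (C ! i))"
    by (auto simp: pr[OF i] intro: less_trans[OF preds_less[OF i] i])
  moreover have "(\<Sum>j<n. of_bool (pred_code x i j)) = card ({..<n} \<inter> {j. pred_code x i j})" by simp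
  moreover have "distinct (preds (C ! i))" using circuit i unfolding circuit_def by blast
  ultimately show ?thesis unfolding large_def by (simp add: distinct_card)
qed

lemma kind_0: "i < n \<Longrightarrow> kind_code x i = 0 \<longleftrightarrow> C ! i = Input"
  by (cases "C ! i") (simp_all add: kind_code_circuit)

text \<open>Appending \<open>i\<close> to a path that ends in one of its inputs adds one to the
  length and, if \<open>i\<close> is large, one to the number of large gates. So the bounds at
  \<open>i\<close> yield reduced bounds at its inputs.\<close>

lemma bounded_if_paths:
  "i < n \<Longrightarrow> (\<And>p. input_path C i p \<Longrightarrow> length p - 1 \<le> r \<and> length (filter (\<lambda>i. 2 < length (preds (C ! i))) p) \<le> t) \<Longrightarrow>
   bounded r t i"
proof (induction r arbitrary: i t)
  case 0
  have "C ! i = Input"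
  proof (rule ccontr)
    assume ni: "C ! i \<noteq> Input"
    then obtain j where j: "j \<in> set (preds (C ! i))" using circuit 0(1) unfolding circuit_def by (metis last_in_set)
    have "j < n" using preds_less[OF 0(1) j] 0(1) by simp
    then obtain p where p: "input_path C j p" using input_path_exists[OF circuit] by blast
    then have "p \<noteq> []" by (simp add: input_path_def)
    then show False using 0(2)[OF input_path_extend[OF p 0(1) j]] by simp
  qed
  then show ?case using kind_0[OF 0(1)] by simp
next
  case (Suc r)
  show ?case
  proof (cases "C ! i = Input")
    case True
    then show ?thesis using kind_0[OF Suc.prems(1)] by simp
  next
    case False
    have "if large i then 0 < t \<and> bounded r (t - 1) j else bounded r t j" if pj: "pred_code x i j" for j
    proof -
      have j: "j \<in> set (preds (C ! i))" using pr[OF Suc.prems(1)] pj by simp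
      have jn: "j < n" using preds_less[OF Suc.prems(1) j] Suc.prems(1) by simp
      have ext: "length p \<le> Suc r" "length (filter (\<lambda>i. 2 < length (preds (C ! i))) p) + (if large i then 1 else 0) \<le> t"
        "p \<noteq> []" if "input_path C j p" for p
        using Suc.prems(2)[OF input_path_extend[OF that Suc.prems(1) j]] large_iff[OF Suc.prems(1)] that
        by (auto simp: input_path_def)
      obtain p where p: "input_path C j p" using input_path_exists[OF circuit jn] by blast
      show ?thesis
      proof (cases "large i")
        case True
        have "bounded r (t - 1) j"
        proof (rule Suc.IH[OF jn])
          fix p assume "input_path C j p"
          note ext = ext[OF this]
          show "length p - 1 \<le> r \<and> length (filter (\<lambda>i. 2 < length (preds (C ! i))) p) \<le> t - 1"
            using ext(1,2) True by auto
        qed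
        moreover have "0 < t" using ext(2)[OF p] True by simp
        ultimately show ?thesis using True by simp
      next
        case F: False
        have "bounded r t j"
        proof (rule Suc.IH[OF jn])
          fix p assume "input_path C j p"
          note ext = ext[OF this]
          show "length p - 1 \<le> r \<and> length (filter (\<lambda>i. 2 < length (preds (C ! i))) p) \<le> t"
            using ext(1,2) F by auto
        qed
        then show ?thesis using F by simp
      qed
    qed
    then have "large i \<Longrightarrow> pred_code x i j \<Longrightarrow> 0 < t \<and> bounded r (t - 1) j"
      "\<not> large i \<Longrightarrow> pred_code x i j \<Longrightarrow> bounded r t j" for j
      by (auto split: if_splits)
    then show ?thesis by auto
  qed
qed

lemma n_pos: "0 < n"
  using circuit by (simp add: circuit_def)

lemma bounded_output: "bounded d 2 (n - 1)"
proof (rule bounded_if_paths)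
  show "n - 1 < n" using n_pos by simp
  fix p assume "input_path C (n - 1) p"
  then have "io_path C p" by (simp add: input_path_def io_path_def)
  then show "length p - 1 \<le> d \<and> length (filter (\<lambda>i. 2 < length (preds (C ! i))) p) \<le> 2"
    using weft depth unfolding weft_le_def depth_le_def by blast
qed

lemma evaluationI:
  assumes val: "valuation C val"
    and p: "pieces n (kind_code x) k lo hi"
    and inp: "\<And>i. i < n \<Longrightarrow> C ! i = Input \<Longrightarrow> val i = (i \<in> marked k hi)"
    and v: "\<And>T r. T < (k + 1) ^ s \<Longrightarrow> r < s \<Longrightarrow> dig (n + 2) (v T) (2 * r) = lo (dig (k + 1) T r) \<and>
      dig (n + 2) (v T) (2 * r + 1) = hi (dig (k + 1) T r)"
  shows "evaluation n (kind_code x) (pred_code x) val (\<lambda>T. decide n s (v T)) {..<(k + 1) ^ s} s"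
proof
  fix i assume i: "i < n"
  show "j < n" if "pred_code x i j" for j using preds_less[OF i, of j] that i pr[OF i, of j] by simp
  show "kind_code x i \<le> 3" by (simp add: kind_code_def)
  have eq: "case C ! i of Input \<Rightarrow> True | Not j \<Rightarrow> val i = (\<not> val j)
     | And js \<Rightarrow> val i = (\<forall>j \<in> set js. val j) | Or js \<Rightarrow> val i = (\<exists>j \<in> set js. val j)"
    using val i unfolding valuation_def by blast
  show "\<exists>j. pred_code x i j \<and> (\<forall>j'. pred_code x i j' \<longrightarrow> j' = j) \<and> val i = (\<not> val j)" if "kind_code x i = 1"
    using that eq pr[OF i] by (cases "C ! i") (simp_all add: kind_code_circuit[OF i])
  show "val i = (\<forall>j. pred_code x i j \<longrightarrow> val j)" if "kind_code x i = 2"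
    using that eq pr[OF i] by (cases "C ! i") (auto simp: kind_code_circuit[OF i])
  show "val i = (\<exists>j. pred_code x i j \<and> val j)" if "kind_code x i = 3"
    using that eq pr[OF i] by (cases "C ! i") (auto simp: kind_code_circuit[OF i])
next
  fix T i b assume T: "T \<in> {..<(k + 1) ^ s}" and i: "i < n" "kind_code x i = 0" "decide n s (v T) i b"
  have "(i \<in> marked k hi) = b" using T v by (intro decide_sound[OF p _ i(1,3)]) auto
  then show "val i = b" using inp[OF i(1)] kind_0[OF i(1)] i(2) by simp
next
  fix N assume N: "N \<subseteq> {i. i < n \<and> kind_code x i = 0}" "card N \<le> s"
  have "N \<subseteq> {..<n}" using N(1) by auto
  then obtain T where T: "T < (k + 1) ^ s" "\<And>i. i \<in> N \<Longrightarrow> decide n s (v T) i (i \<in> marked k hi)"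
    using decide_exists[OF p _ N(2) v] by blast
  have "val i = (i \<in> marked k hi)" if "i \<in> N" for i using N(1) that inp[of i] kind_0[of i] by auto
  then show "\<exists>T \<in> {..<(k + 1) ^ s}. \<forall>i \<in> N. decide n s (v T) i (val i)" using T by auto
qed

lemma valuation_exists: "\<exists>val. valuation C val \<and> (\<forall>i < n. C ! i = Input \<longrightarrow> val i = f i)"
proof -
  let ?ok = "\<lambda>val i. case C ! i of Input \<Rightarrow> val i = f i | Not j \<Rightarrow> val i = (\<not> val j)
     | And js \<Rightarrow> val i = (\<forall>j \<in> set js. val j) | Or js \<Rightarrow> val i = (\<exists>j \<in> set js. val j)"
  have "\<exists>val. \<forall>i < l. ?ok val i" if "l \<le> n" for l
    using that
  proof (induction l)
    case (Suc l)
    then obtain val where val: "\<And>i. i < l \<Longrightarrow> ?ok val i" by auto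
    define b where "b = (case C ! l of Input \<Rightarrow> f l | Not j \<Rightarrow> \<not> val j | And js \<Rightarrow> (\<forall>j \<in> set js. val j)
      | Or js \<Rightarrow> (\<exists>j \<in> set js. val j))"
    have same: "(val(l := b)) j = val j" if "i \<le> l" "j \<in> set (preds (C ! i))" for i j
      using preds_less[of i j] that Suc.prems by auto
    have "?ok (val(l := b)) i" if "i < Suc l" for i
    proof (cases "i = l")
      case True
      then show ?thesis using same[of l] by (cases "C ! l") (auto simp: b_def)
    next
      case False
      then have il: "i < l" using that by simp
      have "(val(l := b)) i = val i" using il by simp
      then show ?thesis using val[OF il] same[of i] il by (cases "C ! i") auto
    qed
    then show ?case by blast
  qed simp
  then obtain val where val: "\<And>i. i < n \<Longrightarrow> ?ok val i" by blast
  have "case C ! i of Input \<Rightarrow> True | Not j \<Rightarrow> val i = (\<not> val j)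
     | And js \<Rightarrow> val i = (\<forall>j \<in> set js. val j) | Or js \<Rightarrow> val i = (\<exists>j \<in> set js. val j)" if "i < n" for i
    using val[OF that] by (cases "C ! i") simp_all
  moreover have "val i = f i" if "i < n" "C ! i = Input" for i using val[OF that(1)] that(2) by simp
  ultimately have "valuation C val \<and> (\<forall>i < n. C ! i = Input \<longrightarrow> val i = f i)"
    unfolding valuation_def by blast
  then show ?thesis by blast
qed

lemma wsat_csp_sound:
  assumes "wsat_csp x k d"
  shows "weighted_sat C k"
proof -
  let ?s = "2 ^ d :: nat"
  let ?K = "(k + 1) ^ ?s" and ?R = "(n + 2) ^ (2 * ?s)"
  obtain y where y: "\<And>T. T < ?K \<Longrightarrow> y T < base d * ?R"
    "\<And>T T'. T < ?K \<Longrightarrow> T' < ?K \<Longrightarrow> wsat_ok x k ?s T (y T) T' (y T')"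
    "\<And>w. w < base d \<Longrightarrow> \<exists>T < ?K. wsat_clause x d w (y T)"
    using assms unfolding wsat_csp_def csp_def circuit_code(1) by blast
  \<comment> \<open>The variable with number \<open>t \<le> k\<close> has \<open>t\<close> as its
    lowest digit, so its component 0 is piece \<open>t\<close>.\<close>
  define lo where "lo t = dig (n + 2) (y t) 0" for t
  define hi where "hi t = dig (n + 2) (y t) 1" for t
  have K1: "k + 1 \<le> ?K" using power_increasing[of 1 ?s "k + 1"] by simp
  have d0: "dig (k + 1) t 0 = t" if "t \<le> k" for t using that by (simp add: dig_def)
  have ok: "piece_ok x k T (y T) r T' (y T') r' n" if "T < ?K" "T' < ?K" "r < ?s" "r' < ?s" for T T' r r'
    using y(2)[OF that(1,2)] that(3,4) unfolding wsat_ok_def circuit_code(1) by blast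
  have ok0: "piece_ok x k t (y t) 0 t' (y t') 0 n" if "t \<le> k" "t' \<le> k" for t t'
    using ok[of t t' 0 0] K1 that by simp
  have p: "pieces n (kind_code x) k lo hi"
    unfolding pieces_def
  proof (intro conjI allI impI)
    show "lo 0 = 0" using ok0[of 0 0] d0[of 0] by (simp add: piece_ok_def lo_def)
    show "hi k = Suc n" using ok0[of k k] d0[of k] by (simp add: piece_ok_def hi_def)
    show "lo t < hi t" if "t \<le> k" for t using ok0[OF that that] by (simp add: piece_ok_def lo_def hi_def)
    fix t assume t: "t < k"
    show "hi t = lo (Suc t)" using ok0[of t "Suc t"] d0[of t] d0[of "Suc t"] t by (simp add: piece_ok_def lo_def hi_def)
    show "hi t \<le> n" "kind_code x (hi t - 1) = 0" using ok0[of t t] d0[of t] t by (simp_all add: piece_ok_def hi_def)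
  qed
  obtain val where val: "valuation C val" "\<And>i. i < n \<Longrightarrow> C ! i = Input \<Longrightarrow> val i = (i \<in> marked k hi)"
    using valuation_exists[of "\<lambda>i. i \<in> marked k hi"] by blast
  have dg: "dig (n + 2) (y T) (2 * r) = lo (dig (k + 1) T r) \<and> dig (n + 2) (y T) (2 * r + 1) = hi (dig (k + 1) T r)"
    if "T < ?K" "r < ?s" for T r
  proof -
    let ?t = "dig (k + 1) T r"
    have "?t < k + 1" by (rule dig_less) simp
    then have tk: "?t \<le> k" "?t < ?K" using K1 by auto
    show ?thesis using ok[OF that(1) tk(2) that(2), of 0] d0[OF tk(1)] by (simp add: piece_ok_def lo_def hi_def)
  qed
  interpret evaluation n "kind_code x" "pred_code x" val "\<lambda>T. decide n ?s (y T)" "{..<?K}" ?s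
    by (rule evaluationI[OF val(1) p val(2) dg])
  define e where "e = y 0 div ?R"
  have e: "y T div ?R = e" if "T < ?K" for T
    using y(2)[OF that, of 0] K1 unfolding wsat_ok_def circuit_code(1) e_def by simp
  have "0 < ?K" using K1 by linarith
  then have "e < base d" unfolding e_def using y(1)[of 0] by (intro less_mult_imp_div_less) simp
  have on: "n - 1 < n" using n_pos by simp
  have "val (n - 1)"
  proof (rule ccontr)
    assume "\<not> val (n - 1)"
    then obtain w where w: "w < base d" "\<And>T. T \<in> {..<?K} \<Longrightarrow> \<not> modeA d (decide n ?s (y T)) (n - 1) True e w"
      using modeA_sound[OF on bounded_output _ \<open>e < base d\<close>, of True] by blast
    obtain T where T: "T < ?K" "wsat_clause x d w (y T)" using y(3)[OF w(1)] by blast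
    have "modeA d (decide n ?s (y T)) (n - 1) True e w"
      using T(2) unfolding wsat_clause_def circuit_code(1) e[OF T(1)] .
    then show False using w(2) T(1) by blast
  qed
  moreover have "{i. i < n \<and> C ! i = Input \<and> val i} = marked k hi"
    using val(2) pieces_card(2)[OF p] kind_0 by auto
  ultimately show ?thesis unfolding weighted_sat_def using val(1) pieces_card(1)[OF p] by (intro exI[of _ val]) simp
qed

lemma wsat_csp_complete:
  assumes "weighted_sat C k"
  shows "wsat_csp x k d"
proof -
  let ?s = "2 ^ d :: nat"
  let ?K = "(k + 1) ^ ?s" and ?R = "(n + 2) ^ (2 * ?s)"
  obtain val where val: "valuation C val" "val (n - 1)" "card {i. i < n \<and> C ! i = Input \<and> val i} = k"
    using assms unfolding weighted_sat_def by blast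
  define S where "S = {i. i < n \<and> C ! i = Input \<and> val i}"
  define a where "a = sorted_list_of_set S"
  have fin: "finite S" unfolding S_def by simp
  have la: "length a = k" using val(3) fin unfolding a_def S_def[symmetric] by simp
  have sa: "set a = S" unfolding a_def using fin by simp
  have str: "sorted_wrt (<) a" unfolding a_def by (rule strict_sorted_list_of_set)
  define hi where "hi t = (if t < k then Suc (a ! t) else Suc n)" for t
  define lo where "lo t = (if t = 0 then 0 else hi (t - 1))" for t
  have aS: "a ! t \<in> S" if "t < k" for t using that la sa nth_mem by metis
  have an: "a ! t < n" "C ! (a ! t) = Input" if "t < k" for t using aS[OF that] by (simp_all add: S_def)
  have p: "pieces n (kind_code x) k lo hi"
    unfolding pieces_def
  proof (intro conjI allI impI)
    show "lo 0 = 0" "hi k = Suc n" by (simp_all add: lo_def hi_def)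
    fix t assume t: "t \<le> k"
    show "lo t < hi t"
    proof (cases t)
      case (Suc t')
      have "a ! t' < n" using an[of t'] t Suc by simp
      moreover have "a ! t' < a ! t" if "t < k" using sorted_wrt_nth_less[OF str, of t' t] that Suc la by simp
      ultimately show ?thesis using Suc t by (auto simp: lo_def hi_def)
    qed (simp add: lo_def hi_def)
  next
    fix t assume t: "t < k"
    show "hi t = lo (Suc t)" by (simp add: lo_def)
    show "hi t \<le> n" "kind_code x (hi t - 1) = 0" using an[OF t] t kind_0[of "a ! t"] by (simp_all add: hi_def)
  qed
  have mk: "marked k hi = S"
  proof -
    have "marked k hi = (\<lambda>t. a ! t) ` {..<k}" unfolding marked_def by (rule image_cong) (simp_all add: hi_def)
    also have "\<dots> = set a" using la by (auto simp: set_conv_nth)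
    finally show ?thesis using sa by simp
  qed
  have lh: "hi t < n + 2" "lo t < n + 2" for t
  proof -
    show h: "hi t < n + 2" for t using an[of t] by (auto simp: hi_def)
    show "lo t < n + 2" using h by (simp add: lo_def)
  qed
  have "\<exists>v < ?R. \<forall>i < 2 * ?s. dig (n + 2) v i = (if even i then lo (dig (k + 1) T (i div 2)) else hi (dig (k + 1) T (i div 2)))" for T
    by (rule digits_exist) (split if_split, intro conjI impI lh)
  then obtain v where v: "\<And>T. v T < ?R" "\<And>T i. i < 2 * ?s \<Longrightarrow> dig (n + 2) (v T) i = (if even i then lo (dig (k + 1) T (i div 2)) else hi (dig (k + 1) T (i div 2)))"
    by metis
  have dv: "dig (n + 2) (v T) (2 * r) = lo (dig (k + 1) T r) \<and> dig (n + 2) (v T) (2 * r + 1) = hi (dig (k + 1) T r)"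
    if "r < ?s" for T r
    using v(2)[of "2 * r" T] v(2)[of "2 * r + 1" T] that by simp
  interpret evaluation n "kind_code x" "pred_code x" val "\<lambda>T. decide n ?s (v T)" "{..<?K}" ?s
    by (rule evaluationI[OF val(1) p]) (use mk dv in \<open>auto simp: S_def\<close>)
  have on: "n - 1 < n" using n_pos by simp
  obtain e where e: "e < base d" "\<And>w. w < base d \<Longrightarrow> \<exists>T \<in> {..<?K}. modeA d (decide n ?s (v T)) (n - 1) True e w"
    using modeA_complete[OF on bounded_output, of True] val(2) by auto
  define y where "y T = e * ?R + v T" for T
  have yd: "y T div ?R = e" for T unfolding y_def using v(1)[of T] by simp
  have yg: "dig (n + 2) (y T) i = dig (n + 2) (v T) i" if "i < 2 * ?s" for T i
  proof -
    have R: "?R = (n + 2) ^ i * ((n + 2) * (n + 2) ^ (2 * ?s - Suc i))"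
      using that by (simp flip: power_Suc power_add)
    have "y T = v T + e * ((n + 2) * (n + 2) ^ (2 * ?s - Suc i)) * (n + 2) ^ i"
      unfolding y_def by (subst R) (simp only: ac_simps)
    then have "y T div (n + 2) ^ i = v T div (n + 2) ^ i + e * ((n + 2) * (n + 2) ^ (2 * ?s - Suc i))"
      using div_mult_self1[of "(n + 2) ^ i" "v T" "e * ((n + 2) * (n + 2) ^ (2 * ?s - Suc i))"]
      by (simp only: add.commute) simp
    moreover have "e * ((n + 2) * (n + 2) ^ (2 * ?s - Suc i)) = e * (n + 2) ^ (2 * ?s - Suc i) * (n + 2)"
      by (simp only: ac_simps)
    ultimately show ?thesis unfolding dig_def by (simp only: mod_mult_self1)
  qed
  have dec: "decide n ?s (y T) = decide n ?s (v T)" for T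
    unfolding decide_def fun_eq_iff using yg[of _ T] by (intro allI ex_cong1 conj_cong refl) simp_all
  have dy: "dig (n + 2) (y T) (2 * r) = lo (dig (k + 1) T r)" "dig (n + 2) (y T) (2 * r + 1) = hi (dig (k + 1) T r)"
    if "r < ?s" for T r
    using yg[of "2 * r" T] yg[of "2 * r + 1" T] dv[OF that, of T] that by simp_all
  have "y T < base d * ?R" for T
  proof -
    have "y T < Suc e * ?R" unfolding y_def using v(1)[of T] by simp
    also have "\<dots> \<le> base d * ?R" using e(1) by (intro mult_le_mono1) simp
    finally show ?thesis .
  qed
  moreover have "piece_ok x k T (y T) r T' (y T') r' n" if "r < ?s" "r' < ?s" for T T' r r'
  proof -
    let ?t = "dig (k + 1) T r"
    have "?t < k + 1" by (rule dig_less) simp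
    then have t: "?t \<le> k" by simp
    let ?t' = "dig (k + 1) T' r'"
    have "?t' < k + 1" by (rule dig_less) simp
    then have nx: "hi ?t = lo ?t'" if "Suc ?t = ?t'" using piecesD(4)[OF p, of ?t] that by simp
    show ?thesis unfolding piece_ok_def dy[OF that(1)] dy[OF that(2)] using piecesD[OF p] t nx
      by auto
  qed
  then have "wsat_ok x k ?s T (y T) T' (y T')" for T T' unfolding wsat_ok_def circuit_code(1) yd by blast
  moreover have "\<exists>T < ?K. wsat_clause x d w (y T)" if w: "w < base d" for w
  proof -
    obtain T where "T < ?K" "modeA d (decide n ?s (v T)) (n - 1) True e w" using e(2)[OF w] by blast
    then show ?thesis unfolding wsat_clause_def circuit_code(1) yd dec by blast
  qed
  ultimately show ?thesis unfolding wsat_csp_def csp_def circuit_code(1) by (intro exI[of _ y]) blast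
qed

end

text \<open>The depth \<open>r\<close> is constant, so the modes unfold into terms by induction on
  \<open>r\<close>. The Boolean \<open>b\<close> also belongs to the term; therefore the change of
  polarity at a negation becomes a case distinction on the kind of the gate, and \<open>hf\<close>
  does the same for \<open>half\<close>.\<close>

lemma definable_modes:
  defines "n \<equiv> \<lambda>X :: inp. size_code (fst X)"
  defines "kd \<equiv> \<lambda>X :: inp. kind_code (fst X)"
  defines "pr \<equiv> \<lambda>X :: inp. pred_code (fst X)"
  shows "dfn (\<lambda>X e. n X)" "dfn (\<lambda>X e. kd X (e 0))" "dfn (\<lambda>X e. gates.base (n X) r)"
    "dfb (\<lambda>X e. gates.modeA (n X) (kd X) (pr X) r (decide (n X) s (e 0)) (e 1) b (e 2) (e 3))"
proof -
  show n: "dfn (\<lambda>X e. n X)" unfolding n_def by (rule definable_codes(1))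
  have pr: "dfb (\<lambda>X e. pr X (e 0) (e 1))" unfolding pr_def by (rule definable_codes(2))
  show kd: "dfn (\<lambda>X e. kd X (e 0))" unfolding kd_def kind_code_def
    by (intro definable_intros definable_codes(3))
  show base: "dfn (\<lambda>X e. gates.base (n X) r)" for r
    by (induction r) (simp_all only: gates.base.simps, (intro definable_intros n | assumption)+)
  have dec: "dfb (\<lambda>X e. decide (n X) s (e 0) (e 1) b)" for b
    unfolding decide_def by (intro dfb_ex_const definable_intros dfn_dig n)
  have large: "dfb (\<lambda>X e. gates.large (n X) (pr X) (e 0))"
    unfolding gates.large_def by (intro definable_intros dfn_sum n dfb_app2[OF pr])
  have univ: "dfb (\<lambda>X e. gates.universal (kd X) (e 0) b)" for b
    unfolding gates.universal_def by (intro definable_intros dfn_app1[OF kd])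
  have later: "dfb (\<lambda>X e. gates.later (pr X) (e 0) (e 1))"
    unfolding gates.later_def by (intro definable_intros dfb_app2[OF pr])
  have half: "dfn (\<lambda>X e. if gates.later (pr X) (e 1) (e 2) then e 0 div gates.base (n X) r else e 0 mod gates.base (n X) r)" for r
    by (intro definable_intros base dfb_app2[OF later])
  define hf where "hf r X v i j = (if gates.later (pr X) i j then v div gates.base (n X) r else v mod gates.base (n X) r)" for r and X :: inp and v i j
  have hf: "dfn (\<lambda>X e. hf r X (e 0) (e 1) (e 2))" for r unfolding hf_def by (rule half)
  have hf_eq: "gates.half (n X) r v (gates.later (pr X) i j) = hf r X v i j" for X r v i j
    by (simp add: gates.half_def hf_def)
  define mE where "mE r b X v i = gates.modeE (n X) (kd X) (pr X) r (decide (n X) s v) i b" for r b and X :: inp and v i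
  have mES: "mE (Suc r) b X v i \<longleftrightarrow> (if kd X i = 0 then decide (n X) s v i b
     else if gates.universal (kd X) i b then \<forall>j < n X. pr X i j \<longrightarrow> (if kd X i = 1 then mE r (\<not> b) X v j else mE r b X v j)
     else \<exists>j < n X. pr X i j \<and> mE r b X v j)" for r b X v i
    unfolding mE_def by (simp add: gates.modeE.simps gates.polarity_def)
  have E: "dfb (\<lambda>X e. mE r b X (e 0) (e 1))" for r b
  proof (induction r arbitrary: b)
    case 0
    then show ?case unfolding mE_def gates.modeE.simps by (rule dec)
  next
    case (Suc r)
    show ?case unfolding mES
      by (intro definable_intros dfn_app1[OF kd] n dfb_app2[OF dec] dfb_app1[OF univ] dfb_app2[OF pr] dfb_app2[OF Suc])
  qed
  define mC where "mC r b X v i w = gates.modeC (n X) (kd X) (pr X) r (decide (n X) s v) i b w" for r b and X :: inp and v i w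
  have mCS: "mC (Suc r) b X v i w \<longleftrightarrow> (if kd X i = 0 then decide (n X) s v i b
     else if gates.universal (kd X) i b then pr X i (w mod gates.base (n X) r) \<longrightarrow>
       (if kd X i = 1 then mC r (\<not> b) X v (w mod gates.base (n X) r) (w div gates.base (n X) r)
        else mC r b X v (w mod gates.base (n X) r) (w div gates.base (n X) r))
     else if gates.large (n X) (pr X) i then \<exists>j < n X. pr X i j \<and> mE r b X v j
     else \<exists>j < n X. pr X i j \<and> mC r b X v j (hf r X w i j))" for r b X v i w
    unfolding mC_def mE_def by (simp add: gates.modeC.simps gates.polarity_def hf_eq)
  have C: "dfb (\<lambda>X e. mC r b X (e 0) (e 1) (e 2))" for r b
  proof (induction r arbitrary: b)
    case 0
    then show ?case unfolding mC_def gates.modeC.simps by (rule dec)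
  next
    case (Suc r)
    show ?case unfolding mCS
      by (intro definable_intros dfn_app1[OF kd] n base dfb_app2[OF dec] dfb_app1[OF univ] dfb_app1[OF large]
          dfb_app2[OF pr] dfb_app2[OF E] dfb_app3[OF Suc] dfn_app3[OF hf])
  qed
  define mA where "mA r b X v i e w = gates.modeA (n X) (kd X) (pr X) r (decide (n X) s v) i b e w" for r b and X :: inp and v i e w
  have mAS: "mA (Suc r) b X v i e w \<longleftrightarrow> (if kd X i = 0 then decide (n X) s v i b
     else if gates.universal (kd X) i b then pr X i (w mod gates.base (n X) r) \<longrightarrow>
       (if gates.large (n X) (pr X) i
        then if kd X i = 1 then mC r (\<not> b) X v (w mod gates.base (n X) r) (w div gates.base (n X) r)
          else mC r b X v (w mod gates.base (n X) r) (w div gates.base (n X) r)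
        else if kd X i = 1 then mA r (\<not> b) X v (w mod gates.base (n X) r) (hf r X e i (w mod gates.base (n X) r)) (w div gates.base (n X) r)
          else mA r b X v (w mod gates.base (n X) r) (hf r X e i (w mod gates.base (n X) r)) (w div gates.base (n X) r))
     else pr X i (e mod gates.base (n X) r) \<and> mA r b X v (e mod gates.base (n X) r) (e div gates.base (n X) r) (w div gates.base (n X) r))" for r b X v i e w
    unfolding mA_def mC_def by (simp add: gates.modeA.simps gates.polarity_def hf_eq)
  have "dfb (\<lambda>X e. mA r b X (e 0) (e 1) (e 2) (e 3))" for r b
  proof (induction r arbitrary: b)
    case 0
    then show ?case unfolding mA_def gates.modeA.simps by (rule dec)
  next
    case (Suc r)
    show ?case unfolding mAS
      by (intro definable_intros dfn_app1[OF kd] n base dfb_app2[OF dec] dfb_app1[OF univ] dfb_app1[OF large]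
          dfb_app2[OF pr] dfb_app3[OF C] dfb_app4[OF Suc] dfn_app3[OF hf])
  qed
  then show "dfb (\<lambda>X e. gates.modeA (n X) (kd X) (pr X) r (decide (n X) s (e 0)) (e 1) b (e 2) (e 3))"
    unfolding mA_def .
qed

lemma definable_wsat:
  "dfb (\<lambda>X e. wsat_ok (fst X) (length (snd X)) s (e 0) (e 1) (e 2) (e 3))"
  "dfb (\<lambda>X e. wsat_clause (fst X) d (e 0) (e 1))"
proof -
  have n: "dfn (\<lambda>X e. size_code (fst X))" by (rule definable_modes(1))
  show "dfb (\<lambda>X e. wsat_ok (fst X) (length (snd X)) s (e 0) (e 1) (e 2) (e 3))"
    unfolding wsat_ok_def piece_ok_def
    by (intro dfb_all_const definable_intros dfn_dig n dfn_app1[OF definable_modes(2)])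
  show "dfb (\<lambda>X e. wsat_clause (fst X) d (e 0) (e 1))"
    unfolding wsat_clause_def
    by (intro dfb_app4[OF definable_modes(4)] definable_intros n)
qed

section \<open>Hardness\<close>

theorem coNP_hard_token_sliding: "coNP_hard token_sliding_split"
  unfolding coNP_hard_def
proof
  fix L assume "L \<in> coNP"
  then obtain R and p :: "nat poly" where R: "polytime_relation R"
    and L: "\<And>x. x \<in> - L \<longleftrightarrow> (\<exists>u. length u \<le> poly p (length x) \<and> R x u)"
    unfolding coNP_def NP_def by blast
  obtain M and q :: "nat poly" where M: "wf_tm M"
    "\<And>x u. computes_within M [x, u] [[R x u]] (poly q (length x + length u))"
    using R unfolding polytime_relation_def by blast
  interpret verifier M R p q by unfold_locales (fact M)+
  define G where "G x = csp_graph (T x + 2) (Q x ^ (2 + 2 * m)) 0 (run_ok x) (\<lambda>_ _. True)" for x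
  define F where "F x = enc_nat (Suc (T x + 2)) @ enc_graph (csp_size (T x + 2) (Q x ^ (2 + 2 * m)) 0) (G x)" for x
  have "dfs (\<lambda>X. F (fst X))"
    unfolding F_def G_def
    by (intro dfs_append dfs_enc_nat dfs_enc_csp_graph definable_intros definable_run)
  from polytime_dfs[OF this] have "polytime F" by simp
  moreover have "reduction F L token_sliding_split"
    unfolding reduction_def
  proof (intro allI conjI impI)
    fix x
    have N: "1 < Q x ^ (2 + 2 * m)" by (rule one_less_power) (simp_all add: Q_def)
    have T0: "0 < T x + 2" by simp
    note g = csp_graph[of "T x + 2" "Q x ^ (2 + 2 * m)" 0 "run_ok x" "\<lambda>_ _. True", OF T0 N, folded G_def]
    have "csp (T x + 2) (Q x ^ (2 + 2 * m)) 0 (run_ok x) (\<lambda>_ _. True) \<longleftrightarrow> x \<notin> L"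
      using run_csp_iff[of x] L[of x] unfolding run_csp_def P_def by simp
    then have con: "Digraph_Component.connected (with_proj (TS (Suc (T x + 2)) (G x))) \<longleftrightarrow> x \<in> L" using g(3) by simp
    show "F x \<in> fst token_sliding_split" if "x \<in> L"
      unfolding token_sliding_split_def F_def fst_conv using that con g(1,2) by blast
    show "F x \<in> snd token_sliding_split" if "x \<notin> L"
      unfolding token_sliding_split_def F_def snd_conv using that con g(1,2) by blast
  qed
  ultimately show "poly_reducible L token_sliding_split" unfolding poly_reducible_def by blast
qed

theorem coW2_hard_token_sliding: "coW_hard 2 param_token_sliding_split"
  unfolding coW_hard_def
proof
  fix B assume "B \<in> coW 2"
  then obtain d where "fpt_reducible (- B) (WCS 2 d)" unfolding coW_def W_def by blast
  then obtain f g where f: "fpt_time f" "computable g" "\<And>x k. snd (f (x, k)) \<le> g k" "reduction f (- B) (WCS 2 d)"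
    unfolding fpt_reducible_def by blast
  let ?s = "2 ^ d :: nat"
  define K where "K k = (k + 1) ^ ?s" for k :: nat
  define N where "N x = gates.base (size_code x) d * (size_code x + 2) ^ (2 * ?s)" for x
  define Z where "Z x = gates.base (size_code x) d" for x
  define G where "G x k = csp_graph (K k) (N x) (Z x) (wsat_ok x k ?s) (wsat_clause x d)" for x k
  define F where "F X = enc_graph (csp_size (K (length (snd X))) (N (fst X)) (Z (fst X))) (G (fst X) (length (snd X)))" for X :: inp
  define H where "H X = Suc (K (length (snd X)))" for X :: inp
  define f' where "f' = (\<lambda>(x, k). (F (fst (f (x, k)), unary (snd (f (x, k)))), H (fst (f (x, k)), unary (snd (f (x, k))))))"
  have dK: "dfn (\<lambda>X e. K (length (snd X)))" unfolding K_def by (intro definable_intros)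
  have dN: "dfn (\<lambda>X e. N (fst X))" unfolding N_def by (intro definable_intros definable_modes(1,3))
  have dZ: "dfn (\<lambda>X e. Z (fst X))" unfolding Z_def by (intro definable_modes(3))
  have dF: "dfs F" unfolding F_def G_def by (intro dfs_enc_csp_graph dK dN dZ definable_wsat)
  have dH: "dfn (\<lambda>X e. H X)" unfolding H_def by (intro definable_intros dK)
  have "fpt_time f'" by (rule fpt_time_compose[OF f(1) dF dH]) (simp add: f'_def)
  moreover have "computable (\<lambda>k. Suc (K (g k)))"
    by (rule computable_dfn[OF f(2), of "\<lambda>a b. Suc (K a)"]) (unfold K_def, intro definable_intros)
  moreover have "snd (f' (x, k)) \<le> Suc (K (g k))" for x k
    using f(3)[of x k] by (simp add: f'_def H_def K_def unary_def power_mono)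
  moreover have "reduction f' B param_token_sliding_split"
    unfolding reduction_def
  proof (intro allI conjI impI)
    fix z :: param_instance
    obtain x k where z: "z = (x, k)" by (cases z)
    \<comment> \<open>\<open>f\<close> produces instances of a problem posed on circuits only. Hence
      in both cases the image encodes a circuit of weft 2 and depth \<open>d\<close>, and its
      satisfiability means \<open>z \<notin> B\<close>.\<close>
    obtain C k' where C: "f z = (enc_circuit C, k')" "circuit C" "weft_le C 2" "depth_le C d"
      and sat: "weighted_sat C k' \<longleftrightarrow> z \<notin> B"
    proof (cases "z \<in> B")
      case True
      then have "f z \<in> snd (WCS 2 d)" using f(4) unfolding reduction_def by blast
      then show ?thesis using that True unfolding WCS_def by auto
    next
      case False
      then have "f z \<in> fst (WCS 2 d)" using f(4) unfolding reduction_def by blast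
      then show ?thesis using that False unfolding WCS_def by auto
    qed
    interpret weft2 C d by unfold_locales (fact C)+
    have f'z: "f' z = (enc_graph (csp_size (K k') (N (enc_circuit C)) (Z (enc_circuit C))) (G (enc_circuit C) k'), Suc (K k'))"
      using C(1) z by (simp add: f'_def F_def H_def unary_def)
    have K0: "0 < K k'" by (simp add: K_def)
    have N1: "1 < N (enc_circuit C)"
    proof -
      have "1 < (n + 2) ^ (2 * ?s)" by (rule one_less_power) simp_all
      then show ?thesis unfolding N_def circuit_code(1) using base_gt0[of d]
        by (metis less_le_trans mult_le_mono1 mult_1 Suc_leI One_nat_def)
    qed
    note gr = csp_graph[OF K0 N1, of "Z (enc_circuit C)" "wsat_ok (enc_circuit C) k' ?s" "wsat_clause (enc_circuit C) d", folded G_def]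
    have "csp (K k') (N (enc_circuit C)) (Z (enc_circuit C)) (wsat_ok (enc_circuit C) k' ?s) (wsat_clause (enc_circuit C) d) \<longleftrightarrow> z \<notin> B"
      using wsat_csp_sound[of k'] wsat_csp_complete[of k'] sat unfolding wsat_csp_def K_def N_def Z_def by blast
    then have con: "Digraph_Component.connected (with_proj (TS (Suc (K k')) (G (enc_circuit C) k'))) \<longleftrightarrow> z \<in> B" using gr(3) by simp
    show "f' z \<in> fst param_token_sliding_split" if "z \<in> B"
      unfolding param_token_sliding_split_def f'z fst_conv using that con gr(1,2) by blast
    show "f' z \<in> snd param_token_sliding_split" if "z \<notin> B"
      unfolding param_token_sliding_split_def f'z snd_conv using that con gr(1,2) by blast
  qed
  ultimately show "fpt_reducible B param_token_sliding_split" unfolding fpt_reducible_def by blast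
qed

theorem theorem1:
  shows "coNP_hard token_sliding_split \<and> coW_hard 2 param_token_sliding_split"
  using coNP_hard_token_sliding coW2_hard_token_sliding by (rule conjI)

end
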